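(* Let assumptions (A) and (B) of the context hold. Consider the variance-reduced SGD algorithm $$x_{k+1}=x_k-\alpha\,(\nabla f(x_k)+w_{k,N_k}),\qquad k\ge 0,$$ where $\alpha\in(0,\tfrac{2}{\eta+L}]$ and $N_k=\lceil \rho_1^{-(k+1)}\rceil$ with $\rho_1\in(q,1)$, $q=1-\tfrac{2\alpha\eta L}{\eta+L}$. Let $\mathbf P_1=\rho_1^{-1/2}(\mathbf I_m-\alpha\mathbf H)$ and $\boldsymbol\Sigma_1=\sum_{t=0}^\infty\mathbf P_1^t\mathbf S_0\mathbf P_1^t$. Let $n\ge m+1$, let $x_{1k},\dots,x_{nk}$ be the $k$-th iterates of $n$ independent replications of the algorithm, and set $$\bar{\mathbf x}_k=\frac1n\sum_{i=1}^nx_{ik},\qquad \mathbf S_k=\frac1{n-1}\sum_{i=1}^n(x_{ik}-\bar{\mathbf x}_k)(x_{ik}-\bar{\mathbf x}_k)^T.$$ Then: (i) $\sqrt n\,\alpha^{-1}\rho_1^{-k/2}(\bar{\mathbf x}_k-x^* )\xrightarrow[k\to\infty]{d}N(0,\boldsymbol\Sigma_1)$; (ii) $n(\bar{\mathbf x}_k-x^* )^T\mathbf S_k^{-1}(\bar{\mathbf x}_k-x^* )\xrightarrow[k\to\infty]{d}\frac{m(n-1)}{n-m}F(m,n-m)$, where $F(m,n-m)$ denotes the $F$-distribution with $(m,n-m)$ degrees of freedom.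
   Context: Problem: minimize $f(x)=\mathbb E[F(x,\boldsymbol\xi)]$ over $x\in\mathbb R^m$, where $\boldsymbol\xi$ is an $\mathbb R^d$-valued random vector and $F:\mathbb R^m\times\mathbb R^d\to\mathbb R$. Sampled gradients $\nabla F(x,\xi)$ (gradient in $x$) are available. Given $x_0\in\mathbb R^m$ and positive integers $N_k$ (batch sizes), $\xi_{j,k}$ ($1\le j\le N_k$, $k\ge 0$) are i.i.d. copies of $\boldsymbol\xi$; $w_{k,N_k}=\frac1{N_k}\sum_{j=1}^{N_k}\nabla F(x_k,\xi_{j,k})-\nabla f(x_k)$; and $\mathcal F_k=\sigma\{x_0,\xi_{j,t}:1\le j\le N_t,\,0\le t\le k-1\}$, so $x_k$ is $\mathcal F_k$-measurable. Assumption (A): (i) $f$ is continuously differentiable on $\mathbb R^m$ and $\|\nabla f(x)-\nabla f(x')\|\le L\|x-x'\|$ for all $x,x'$, with $L>0$; (ii) $f$ is $\eta$-strongly convex, $\eta>0$: $(\nabla f(x)-\nabla f(x'))^T(x-x')\ge\eta\|x-x'\|^2$ for all $x,x'$; (iii) there is $\nu>0$ such that for all $k\ge0$ and $1\le j\le N_k$, almost surely $\mathbb E[\nabla F(x_k,\xi_{j,k})\mid\mathcal F_k]=\nabla f(x_k)$ and $\mathbb E[\|\nabla F(x_k,\xi_{j,k})-\nabla f(x_k)\|^2\mid\mathcal F_k]\le\nu^2$. The unique minimizer of $f$ is denoted $x^*$. Assumption (B): (i) $\nabla f$ is differentiable at $x^*$ with Hessian matrix $\mathbf H\in\mathbb R^{m\times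 m}$, and $\nabla f(x)=\mathbf H(x-x^* )+\mathbf D(x)(x-x^* )$ with $\|\mathbf D(x)\|\le R_D\|x-x^*\|$ for some $R_D>0$; (ii) for a matrix $\mathbf S_0$, $\lim_{k\to\infty}N_k\mathbb E[w_{k,N_k}w_{k,N_k}^T\mid\mathcal F_k]=\lim_{k\to\infty} N_k\mathbb E[w_{k,N_k}w_{k,N_k}^T]=\mathbf S_0$ almost surely, and $\lim_{r\to\infty}\sup_k\mathbb E\big[\|\sqrt{N_k}w_{k,N_k}\|^2 I_{[\|\sqrt{N_k}w_{k,N_k}\|>r]}\big]=0$, where $I_{[a>b]}=1$ if $a>b$ and $0$ otherwise. $\mathbf I_m$ is the $m\times m$ identity matrix, $\|\cdot\|$ is the Euclidean norm / matrix two-norm, and $\xrightarrow{d}$ is convergence in distribution.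
   Formalization: Two conditions are added since the claim fails without them: a Lindeberg condition on the single-sample errors ∇F(x_k,ξ_{j,k})−∇f(x_k), as (B) does not make w_{k,N_k} asymptotically normal; and, in (ii) only, invertibility of Σ_1, as S_k may be singular (e.g. S_0=0). *)

theory Defs
  imports "HOL-Probability.Probability"
begin

section \<open>Matrices\<close>

definition outer :: "real^'m \<Rightarrow> real^'m \<Rightarrow> real^'m^'m" where
  "outer u v = (\<chi> a b. u $ a * v $ b)"

(* The power operation ^ on real^'m^'m is taken componentwise in the library, so matrix powers
   need a definition of their own. *)
primrec mat_pow :: "real^'m^'m \<Rightarrow> nat \<Rightarrow> real^'m^'m" where
  "mat_pow A 0 = mat 1"
| "mat_pow A (Suc t) = A ** mat_pow A t"

section \<open>Conditional expectation of random vectors and matrices\<close>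

(* Both operate entrywise, as real_cond_exp is available for real-valued functions only.
   real_cond_exp is meaningful for integrable functions; below it is applied to the sampled
   gradients and to products of entries of their averaged errors, which are integrable by the
   conditional second moment bound (stated with nn_cond_exp, where infinite values count). *)

definition cond_exp_vec :: "'a measure \<Rightarrow> 'a measure \<Rightarrow> ('a \<Rightarrow> real^'m) \<Rightarrow> 'a \<Rightarrow> real^'m" where
  "cond_exp_vec M G X \<omega> = (\<chi> a. real_cond_exp M G (\<lambda>\<omega>'. X \<omega>' $ a) \<omega>)"

definition cond_exp_mat :: "'a measure \<Rightarrow> 'a measure \<Rightarrow> ('a \<Rightarrow> real^'m^'m) \<Rightarrow> 'a \<Rightarrow> real^'m^'m" where
  "cond_exp_mat M G X \<omega> = (\<chi> a b. real_cond_exp M G (\<lambda>\<omega>'. X \<omega>' $ a $ b) \<omega>)"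

(* The sigma-algebra generated by all samples s t j with t < k and 1 <= j <= N t. The initial point
   of the algorithm is deterministic and contributes nothing to it. *)
definition history :: "'a measure \<Rightarrow> (nat \<Rightarrow> nat) \<Rightarrow> (nat \<Rightarrow> nat \<Rightarrow> 'a \<Rightarrow> real^'d) \<Rightarrow> nat \<Rightarrow> 'a measure"
  where
  "history M N s k =
     sigma (space M) {s t j -` B \<inter> space M | t j B. t < k \<and> j \<in> {1..N t} \<and> B \<in> sets borel}"

section \<open>Limit laws\<close>

(* weak_conv_m of the library covers laws on the real line only. *)
definition weak_conv_vec :: "(nat \<Rightarrow> (real^'m) measure) \<Rightarrow> (real^'m) measure \<Rightarrow> bool" where
  "weak_conv_vec \<mu> \<nu> \<longleftrightarrow>
     (\<forall>g :: real^'m \<Rightarrow> real. continuous_on UNIV g \<and> bounded (range g) \<longrightarrow>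
        (\<lambda>k. \<integral>x. g x \<partial>\<mu> k) \<longlonglongrightarrow> (\<integral>x. g x \<partial>\<nu>))"

definition std_normal_vec :: "(real^'m) measure" where
  "std_normal_vec = density lborel (\<lambda>z. ennreal (\<Prod>a\<in>UNIV. std_normal_density (z $ a)))"

(* \<nu> is the law N(c, C), i.e. the law of c + A Z with Z standard normal and A A^T = C.
   C may be singular. *)
definition multivariate_normal :: "(real^'m) measure \<Rightarrow> real^'m \<Rightarrow> real^'m^'m \<Rightarrow> bool" where
  "multivariate_normal \<nu> c C \<longleftrightarrow>
     (\<exists>A :: real^'m^'m. A ** transpose A = C \<and> \<nu> = distr std_normal_vec borel (\<lambda>z. c + A *v z))"

definition chi_square :: "nat \<Rightarrow> real measure" where
  "chi_square r = distr (PiM {..<r} (\<lambda>_. density lborel (\<lambda>z. ennreal (std_normal_density z)))) borel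
     (\<lambda>z. \<Sum>i<r. (z i)\<^sup>2)"

definition F_distribution :: "nat \<Rightarrow> nat \<Rightarrow> real measure" where
  "F_distribution a b =
     distr (chi_square a \<Otimes>\<^sub>M chi_square b) borel (\<lambda>(u, v). (u / real a) / (v / real b))"

end

theory Submission
  imports Defs
begin

text \<open>
  The rescaled iterates \<open>z\<^sub>k = \<alpha>\<inverse> \<rho>\<^bsup>-k/2\<^esup> (x\<^sub>k - x\<^sup>*)\<close> satisfy
  \<open>z\<^sub>k\<^sub>+\<^sub>1 = P z\<^sub>k - \<surd>N\<^sub>k w\<^sub>k + o(1)\<close> in mean: cocoercivity of the gradient gives
  \<open>E \<parallel>x\<^sub>k - x\<^sup>*\<parallel>\<^sup>2 = O(\<rho>\<^sup>k)\<close>, so that the quadratic remainder of the gradient at \<open>x\<^sup>*\<close> and the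
  rounding of \<open>N\<^sub>k\<close> are negligible, and \<open>P\<close> is a contraction because \<open>q < \<rho>\<close>. Given the past, the batch
  is an i.i.d. sample, so a conditional Lindeberg argument multiplies the characteristic function by
  \<open>exp (- u \<bullet> S\<^sub>0 u / 2)\<close> in each step; the recursion then converges to the product of
  \<open>exp (- P\<^sup>tu \<bullet> S\<^sub>0 P\<^sup>tu / 2)\<close> over \<open>t\<close>, which is the characteristic function of \<open>N(0, \<Sigma>)\<close>.

  For the statistic, the \<open>n\<close> independent limits are jointly \<open>A Z\<^sub>i\<close> with \<open>A A\<^sup>T = \<Sigma>\<close> and \<open>Z\<^sub>i\<close> standard
  normal. Hotelling's statistic is invariant under \<open>A\<close> and continuous where its matrix is regular, which
  holds almost surely. Its law comes from an invariance: reflections of the sample index preserve the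
  Gaussian law, so the vector of ones may be replaced by an independent Gaussian weight vector \<open>c\<close> and the
  sample then be brought to triangular form, where the statistic is a quotient of sums of the \<open>c\<^sub>i\<^sup>2\<close>.

  Convergence of characteristic functions is turned into weak convergence by Stone-Weierstrass on a
  cube: folding a coordinate by \<open>x \<mapsto> R arcsin (sin (x/R))\<close> makes bounded continuous functions uniform
  limits of trigonometric sums, at a cost controlled by tightness.
\<close>

subsection \<open>Gradient steps\<close>

text \<open>The samples of step \<open>k\<close> are independent of \<open>hist k\<close>, so
  conditioning on the past means integrating over the batch with \<open>x k\<close> frozen. The
  hypotheses on conditional moments thereby become plain moments of one sample at almost every
  iterate (\<open>good\<close>). The law of the summands still moves with \<open>x k\<close>, so a
  limit theorem for one fixed law does not apply: every step needs a bound with explicit error,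
  which is then averaged over the iterates. Such errors are summed over a fixed number
  \<open>r\<close> of steps only. What lies more than \<open>r\<close> steps back is disposed of by
  the contraction \<open>P\<close> and a first moment bound that is uniform in \<open>k\<close>.

  Families are indexed by countable types, so that one theorem on characteristic functions serves
  vectors, Gaussian sequences and the joint law of the replications. In (ii) the normalisation
  cancels, because the statistic is invariant under regular matrices, in particular scalar ones.
  Inversion is discontinuous at singular matrices; a cut-off in terms of the determinant keeps all
  test functions continuous.\<close>

lemma gderiv_line:
  fixes g :: "'e::real_inner \<Rightarrow> real"
  assumes "\<And>y. GDERIV g y :> p y"
  shows "((\<lambda>t. g (x + t *\<^sub>R d)) has_real_derivative (p (x + t *\<^sub>R d) \<bullet> d)) (at t within T)"
proof -
  have g: "(g has_derivative (\<lambda>h. h \<bullet> p (x + t *\<^sub>R d))) (at (x + t *\<^sub>R d))"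
    using assms[of "x + t *\<^sub>R d"] by (simp add: gderiv_def)
  have "((\<lambda>t. x + t *\<^sub>R d) has_derivative (\<lambda>h. h *\<^sub>R d)) (at t within T)"
    by (auto intro!: derivative_eq_intros)
  from has_derivative_compose[OF this g]
  show ?thesis
    by (simp add: has_field_derivative_def inner_commute mult_commute_abs)
qed

text \<open>Along the segment, \<open>g\<close> minus its linearisation at \<open>x\<close> has a
  derivative between 0 and \<open>\<beta> * t * (norm v)\<^sup>2\<close>. Comparing monotone
  functions at 0 and 1 takes the place of integrating these bounds.\<close>

lemma quadratic_bounds:
  fixes g :: "'e::real_inner \<Rightarrow> real"
  assumes d: "\<And>y. GDERIV g y :> p y"
    and mono: "\<And>y y'. 0 \<le> (p y - p y') \<bullet> (y - y')"
    and ub: "\<And>y y'. (p y - p y') \<bullet> (y - y') \<le> \<beta> * (norm (y - y'))\<^sup>2"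
  shows "p x \<bullet> (y - x) \<le> g y - g x"
    and "g y - g x \<le> p x \<bullet> (y - x) + \<beta> / 2 * (norm (y - x))\<^sup>2"
proof -
  define v where "v = y - x"
  let ?h = "\<lambda>t. g (x + t *\<^sub>R v) - t * (p x \<bullet> v)"
  have dh: "(?h has_real_derivative ((p (x + t *\<^sub>R v) - p x) \<bullet> v)) (at t)" for t
    using gderiv_line[OF d, where x=x and d=v and t=t and T=UNIV]
    by (auto intro!: derivative_eq_intros simp: inner_diff_left)
  have lo: "0 \<le> (p (x + t *\<^sub>R v) - p x) \<bullet> v" if "0 < t" for t
    using mono[of "x + t *\<^sub>R v" x] that by (simp add: zero_le_mult_iff)
  have hi: "(p (x + t *\<^sub>R v) - p x) \<bullet> v \<le> \<beta> * t * (norm v)\<^sup>2" if "0 < t" for t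
    using ub[of "x + t *\<^sub>R v" x] that by (simp add: power_mult_distrib power2_eq_square mult.assoc mult.left_commute)
  have "?h 0 \<le> ?h 1"
    by (rule DERIV_nonneg_imp_increasing_open[of 0 1 ?h])
       (use dh lo in \<open>auto intro!: continuous_at_imp_continuous_on DERIV_isCont\<close>)
  then show "p x \<bullet> (y - x) \<le> g y - g x" by (simp add: v_def)
  let ?k = "\<lambda>t. \<beta> * t\<^sup>2 / 2 * (norm v)\<^sup>2 - ?h t"
  have dk: "(?k has_real_derivative (\<beta> * t * (norm v)\<^sup>2 - (p (x + t *\<^sub>R v) - p x) \<bullet> v)) (at t)" for t
    by (rule derivative_eq_intros dh refl | simp)+
  have "?k 0 \<le> ?k 1"
  proof (rule DERIV_nonneg_imp_increasing_open[of 0 1 ?k])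
    fix t :: real assume "0 < t" "t < 1"
    then show "\<exists>y. (?k has_real_derivative y) (at t) \<and> 0 \<le> y"
      using dk[of t] hi[of t] by (intro exI conjI) auto
  next
    show "continuous_on {0..1} ?k"
      by (intro continuous_at_imp_continuous_on ballI DERIV_isCont[OF dk])
  qed simp
  then show "g y - g x \<le> p x \<bullet> (y - x) + \<beta> / 2 * (norm (y - x))\<^sup>2" by (simp add: v_def)
qed

(* the Baillon-Haddad argument: minimise z -> g z - p x . z *)
lemma baillon_haddad:
  fixes g :: "'e::real_inner \<Rightarrow> real"
  assumes d: "\<And>y. GDERIV g y :> p y"
    and mono: "\<And>y y'. 0 \<le> (p y - p y') \<bullet> (y - y')"
    and ub: "\<And>y y'. (p y - p y') \<bullet> (y - y') \<le> \<beta> * (norm (y - y'))\<^sup>2"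
    and b: "0 < \<beta>"
  shows "(norm (p y - p x))\<^sup>2 \<le> \<beta> * ((p y - p x) \<bullet> (y - x))"
proof -
  have half: "1 / (2 * \<beta>) * (norm (p y - p x))\<^sup>2 \<le> g y - g x - p x \<bullet> (y - x)" for x y
  proof -
    define D where "D = p y - p x"
    \<comment> \<open>A gradient step of length \<open>1/\<beta>\<close> for the function tilted by
      \<open>p x\<close>, that is, the minimiser of its quadratic upper bound around
      \<open>y\<close>.\<close>
    define z where "z = y - (1/\<beta>) *\<^sub>R D"
    have 1: "p x \<bullet> (z - x) \<le> g z - g x" by (rule quadratic_bounds(1)[OF d mono ub])
    have 2: "g z - g y \<le> p y \<bullet> (z - y) + \<beta> / 2 * (norm (z - y))\<^sup>2"
      by (rule quadratic_bounds(2)[OF d mono ub])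
    have zy: "z - y = - ((1/\<beta>) *\<^sub>R D)" by (simp add: z_def)
    define E where "E = (norm D)\<^sup>2 / \<beta>"
    have n: "\<beta> / 2 * (norm (z - y))\<^sup>2 = E / 2"
      using b unfolding zy by (simp add: power2_eq_square E_def)
    have e: "p x \<bullet> (z - x) = p x \<bullet> (z - y) + p x \<bullet> (y - x)" by (simp add: inner_diff_right)
    have "(p y - p x) \<bullet> (z - y) = - E"
      unfolding zy D_def[symmetric] by (simp add: power2_norm_eq_inner E_def)
    then have "p y \<bullet> (z - y) - p x \<bullet> (z - y) = - E" by (simp add: inner_diff_left)
    then have "E / 2 \<le> g y - g x - p x \<bullet> (y - x)"
      using 1 2 n e by linarith
    then show ?thesis by (simp add: E_def D_def)
  qed
  \<comment> \<open>Adding \<open>half\<close> in both orders cancels the function values and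
    doubles the constant.\<close>
  have "1 / \<beta> * (norm (p y - p x))\<^sup>2 \<le> (p y - p x) \<bullet> (y - x)"
    using half[of y x] half[of x y]
    by (simp add: inner_diff_left inner_diff_right norm_minus_commute inner_commute field_simps)
  then show ?thesis using b by (simp add: field_simps)
qed

text \<open>Subtracting \<open>\<eta> / 2 * (z \<bullet> z)\<close> leaves a convex function whose
  gradient varies with constant \<open>L - \<eta>\<close>. Baillon-Haddad for that function, written
  out in terms of \<open>gf\<close>, is the claim.\<close>

lemma cocoercive_strongly_convex:
  fixes gf :: "'e::real_inner \<Rightarrow> 'e"
  assumes d: "\<And>y. GDERIV f y :> gf y"
    and lip: "\<And>y y'. norm (gf y - gf y') \<le> L * norm (y - y')"
    and sc: "\<And>y y'. \<eta> * (norm (y - y'))\<^sup>2 \<le> (gf y - gf y') \<bullet> (y - y')"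
    and pos: "0 < \<eta>" and le: "\<eta> \<le> L"
  shows "\<eta> * L * (norm (y - x))\<^sup>2 + (norm (gf y - gf x))\<^sup>2 \<le> (\<eta> + L) * ((gf y - gf x) \<bullet> (y - x))"
proof -
  have cs: "(gf y - gf y') \<bullet> (y - y') \<le> L * (norm (y - y'))\<^sup>2" for y y'
  proof -
    have "(gf y - gf y') \<bullet> (y - y') \<le> norm (gf y - gf y') * norm (y - y')" by (rule norm_cauchy_schwarz)
    also have "\<dots> \<le> L * norm (y - y') * norm (y - y')" by (intro mult_right_mono lip) simp
    finally show ?thesis by (simp add: power2_eq_square)
  qed
  show ?thesis
  proof (cases "\<eta> = L")
    \<comment> \<open>The reduced gradient has constant 0 here, out of reach of
      \<open>baillon_haddad\<close>; the Lipschitz bound and strong monotonicity combine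
      directly.\<close>
    case True
    have "(norm (gf y - gf x))\<^sup>2 \<le> (L * norm (y - x))\<^sup>2" by (intro power_mono lip) simp
    moreover have "L * (L * (norm (y - x))\<^sup>2) \<le> L * ((gf y - gf x) \<bullet> (y - x))"
      using mult_left_mono[OF sc[of y x], of L] True pos by simp
    ultimately show ?thesis
      using True by (simp add: power_mult_distrib power2_eq_square algebra_simps)
  next
    case False
    then have b: "0 < L - \<eta>" using le by simp
    define g where "g = (\<lambda>z. f z - \<eta> / 2 * (z \<bullet> z))"
    define p where "p = (\<lambda>z. gf z - \<eta> *\<^sub>R z)"
    have dg: "GDERIV g z :> p z" for z
      using d[of z] unfolding gderiv_def g_def p_def
      by (auto intro!: derivative_eq_intros simp: inner_diff_right inner_commute algebra_simps)
    have pd: "p u - p v = (gf u - gf v) - \<eta> *\<^sub>R (u - v)" for u v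
      by (simp add: p_def algebra_simps)
    have pp: "(p u - p v) \<bullet> (u - v) = (gf u - gf v) \<bullet> (u - v) - \<eta> * (norm (u - v))\<^sup>2" for u v
      unfolding pd by (simp only: inner_diff_left[of "gf u - gf v"] inner_scaleR_left power2_norm_eq_inner)
    have "(norm (p y - p x))\<^sup>2 \<le> (L - \<eta>) * ((p y - p x) \<bullet> (y - x))"
    proof (rule baillon_haddad[OF dg _ _ b])
      fix u v
      show "0 \<le> (p u - p v) \<bullet> (u - v)" unfolding pp using sc[of u v] by simp
      show "(p u - p v) \<bullet> (u - v) \<le> (L - \<eta>) * (norm (u - v))\<^sup>2"
        unfolding pp using cs[of u v] by (simp add: left_diff_distrib)
    qed
    moreover have "(norm (p y - p x))\<^sup>2 = (norm (gf y - gf x))\<^sup>2 - 2 * \<eta> * ((gf y - gf x) \<bullet> (y - x))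
        + \<eta>\<^sup>2 * (norm (y - x))\<^sup>2"
      unfolding pd by (simp only: power2_norm_eq_inner)
        (simp add: inner_diff_left inner_diff_right inner_commute algebra_simps power2_eq_square)
    ultimately show ?thesis unfolding pp by (simp add: algebra_simps power2_eq_square)
  qed
qed

text \<open>Cocoercivity gains \<open>\<alpha> * 2 / (\<eta> + L)\<close> times the squared gradient
  difference. The bound on the step size is what lets this absorb the
  \<open>\<alpha>\<^sup>2\<close> term of the expanded square.\<close>

lemma gradient_step_contraction:
  fixes gf :: "'e::real_inner \<Rightarrow> 'e"
  assumes d: "\<And>y. GDERIV f y :> gf y"
    and lip: "\<And>y y'. norm (gf y - gf y') \<le> L * norm (y - y')"
    and sc: "\<And>y y'. \<eta> * (norm (y - y'))\<^sup>2 \<le> (gf y - gf y') \<bullet> (y - y')"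
    and pos: "0 < \<eta>" and le: "\<eta> \<le> L" and \<alpha>: "0 < \<alpha>" "\<alpha> \<le> 2 / (\<eta> + L)"
  shows "(norm ((y - x) - \<alpha> *\<^sub>R (gf y - gf x)))\<^sup>2 \<le> (1 - 2 * \<alpha> * \<eta> * L / (\<eta> + L)) * (norm (y - x))\<^sup>2"
proof -
  let ?D = "gf y - gf x" and ?d = "y - x"
  have s: "0 < \<eta> + L" using le pos by simp
  have c: "\<eta> * L / (\<eta> + L) * (norm ?d)\<^sup>2 + (norm ?D)\<^sup>2 / (\<eta> + L) \<le> ?D \<bullet> ?d"
  proof -
    have "\<eta> * L / (\<eta> + L) * (norm ?d)\<^sup>2 + (norm ?D)\<^sup>2 / (\<eta> + L)
        = (\<eta> * L * (norm ?d)\<^sup>2 + (norm ?D)\<^sup>2) / (\<eta> + L)"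
      by (simp add: add_divide_distrib)
    also have "\<dots> \<le> ?D \<bullet> ?d"
      using cocoercive_strongly_convex[OF d lip sc pos le, of y x] s
      by (simp add: pos_divide_le_eq mult.commute)
    finally show ?thesis .
  qed
  have "\<alpha> * \<alpha> \<le> \<alpha> * (2 / (\<eta> + L))" using \<alpha> by (intro mult_left_mono) auto
  then have a: "\<alpha>\<^sup>2 * (norm ?D)\<^sup>2 \<le> \<alpha> * (2 / (\<eta> + L)) * (norm ?D)\<^sup>2"
    by (intro mult_right_mono) (auto simp: power2_eq_square)
  have "(norm (?d - \<alpha> *\<^sub>R ?D))\<^sup>2 = (norm ?d)\<^sup>2 - 2 * \<alpha> * (?D \<bullet> ?d) + \<alpha>\<^sup>2 * (norm ?D)\<^sup>2"
    by (simp only: power2_norm_eq_inner)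
       (simp add: inner_diff_left inner_diff_right inner_commute algebra_simps power2_eq_square)
  also have "\<dots> \<le> (norm ?d)\<^sup>2 - 2 * \<alpha> * (\<eta> * L / (\<eta> + L) * (norm ?d)\<^sup>2 + (norm ?D)\<^sup>2 / (\<eta> + L))
      + \<alpha> * (2 / (\<eta> + L)) * (norm ?D)\<^sup>2"
  proof -
    have "2 * \<alpha> * (\<eta> * L / (\<eta> + L) * (norm ?d)\<^sup>2 + (norm ?D)\<^sup>2 / (\<eta> + L)) \<le> 2 * \<alpha> * (?D \<bullet> ?d)"
      using c \<alpha>(1) by (intro mult_left_mono) auto
    then show ?thesis by (intro add_mono diff_mono order_refl a)
  qed
  also have "\<dots> = (1 - 2 * \<alpha> * \<eta> * L / (\<eta> + L)) * (norm ?d)\<^sup>2"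
    by (simp add: algebra_simps)
  finally show ?thesis .
qed

text \<open>The contraction between \<open>xs + t *\<^sub>R h\<close> and \<open>xs\<close>, divided
  by \<open>t\<^sup>2\<close>, survives the limit of \<open>t\<close> to 0 from the right. The
  linearisation thus inherits the factor \<open>q\<close> without any use of eigenvalues of
  \<open>H\<close>.\<close>

lemma linearised_step_contraction:
  fixes gf :: "real^'m \<Rightarrow> real^'m"
  assumes step: "\<And>y x. (norm ((y - x) - \<alpha> *\<^sub>R (gf y - gf x)))\<^sup>2 \<le> q * (norm (y - x))\<^sup>2"
    and der: "(gf has_derivative (\<lambda>h. H *v h)) (at xs)"
  shows "(norm (h - \<alpha> *\<^sub>R (H *v h)))\<^sup>2 \<le> q * (norm h)\<^sup>2"
proof -
  have "((\<lambda>t. gf (xs + t *\<^sub>R h)) has_derivative (\<lambda>t. t *\<^sub>R (H *v h))) (at 0)"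
  proof -
    have "((\<lambda>t. xs + t *\<^sub>R h) has_derivative (\<lambda>t. t *\<^sub>R h)) (at (0::real))"
      by (auto intro!: derivative_eq_intros)
    from has_derivative_compose[OF this, of gf "\<lambda>h. H *v h"] der
    show ?thesis by (simp add: matrix_vector_mult_scaleR)
  qed
  then have "((\<lambda>t. norm (gf (xs + t *\<^sub>R h) - gf xs - t *\<^sub>R (H *v h)) / norm t) \<longlongrightarrow> 0) (at 0)"
    unfolding has_derivative_at by simp
  then have "((\<lambda>t. norm ((gf (xs + t *\<^sub>R h) - gf xs - t *\<^sub>R (H *v h)) /\<^sub>R norm t)) \<longlongrightarrow> 0) (at 0)"
    by (rule back_subst[where P="\<lambda>f. (f \<longlongrightarrow> 0) (at 0)"]) (rule ext, simp add: divide_inverse)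
  then have "((\<lambda>t. (gf (xs + t *\<^sub>R h) - gf xs - t *\<^sub>R (H *v h)) /\<^sub>R norm t) \<longlongrightarrow> 0) (at 0)"
    by (rule tendsto_norm_zero_cancel)
  then have "((\<lambda>t. (gf (xs + t *\<^sub>R h) - gf xs - t *\<^sub>R (H *v h)) /\<^sub>R norm t) \<longlongrightarrow> 0) (at_right 0)"
    by (rule tendsto_within_subset) simp
  then have "((\<lambda>t. (gf (xs + t *\<^sub>R h) - gf xs) /\<^sub>R t - H *v h) \<longlongrightarrow> 0) (at_right 0)"
    by (rule Lim_transform_eventually)
       (auto simp: eventually_at_right_field scaleR_diff_right intro!: exI[of _ 1])
  then have l: "((\<lambda>t. (gf (xs + t *\<^sub>R h) - gf xs) /\<^sub>R t) \<longlongrightarrow> H *v h) (at_right 0)"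
    by (rule LIM_zero_cancel)
  have "((\<lambda>t. (norm (h - \<alpha> *\<^sub>R ((gf (xs + t *\<^sub>R h) - gf xs) /\<^sub>R t)))\<^sup>2)
      \<longlongrightarrow> (norm (h - \<alpha> *\<^sub>R (H *v h)))\<^sup>2) (at_right 0)"
    by (intro tendsto_intros l)
  moreover have "\<forall>\<^sub>F t in at_right 0.
      (norm (h - \<alpha> *\<^sub>R ((gf (xs + t *\<^sub>R h) - gf xs) /\<^sub>R t)))\<^sup>2 \<le> q * (norm h)\<^sup>2"
  proof -
    have "(norm (h - \<alpha> *\<^sub>R ((gf (xs + t *\<^sub>R h) - gf xs) /\<^sub>R t)))\<^sup>2 \<le> q * (norm h)\<^sup>2" if t: "0 < t" for t
    proof -
      have "t *\<^sub>R h - \<alpha> *\<^sub>R (gf (xs + t *\<^sub>R h) - gf xs)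
          = t *\<^sub>R (h - \<alpha> *\<^sub>R ((gf (xs + t *\<^sub>R h) - gf xs) /\<^sub>R t))"
        using t by (simp add: scaleR_diff_right mult.left_commute[of t \<alpha>])
      then have "t\<^sup>2 * (norm (h - \<alpha> *\<^sub>R ((gf (xs + t *\<^sub>R h) - gf xs) /\<^sub>R t)))\<^sup>2 \<le> t\<^sup>2 * (q * (norm h)\<^sup>2)"
        using step[of "xs + t *\<^sub>R h" xs] by (simp add: power_mult_distrib mult.left_commute)
      then show ?thesis using t by (auto simp: mult_le_cancel_left)
    qed
    then show ?thesis by (auto simp: eventually_at_right_field intro!: exI[of _ 1])
  qed
  ultimately show ?thesis
    by (intro tendsto_upperbound[where F="at_right (0::real)"]) auto
qed

(* Young's theorem, from the second difference of f over the parallelogram spanned by t u and t v. *)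
lemma derivative_of_gradient_symmetric:
  fixes gf :: "real^'m \<Rightarrow> real^'m"
  assumes d: "\<And>y. GDERIV f y :> gf y"
    and der: "(gf has_derivative (\<lambda>h. H *v h)) (at xs)"
  shows "u \<bullet> (H *v v) = v \<bullet> (H *v u)"
proof -
  define \<Delta> where "\<Delta> = (\<lambda>t u v. f (xs + t *\<^sub>R u + t *\<^sub>R v) - f (xs + t *\<^sub>R u) - f (xs + t *\<^sub>R v) + f xs)"
  have sym: "\<Delta> t u v = \<Delta> t v u" for t u v by (simp add: \<Delta>_def algebra_simps)
  have close: "\<exists>\<delta>>0. \<forall>t. 0 < t \<and> t < \<delta> \<longrightarrow> \<bar>\<Delta> t u v - t\<^sup>2 * (u \<bullet> (H *v v))\<bar> \<le> e * t\<^sup>2 * (norm u * (2 * norm u + norm v))"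
    if e: "0 < e" for e u v
  proof -
    obtain r where r: "0 < r" "\<And>y. norm (y - xs) < r \<Longrightarrow>
        norm (gf y - gf xs - H *v (y - xs)) \<le> e * norm (y - xs)"
      using der e unfolding has_derivative_at_alt by blast
    define \<delta> where "\<delta> = r / (norm u + norm v + 1)"
    have \<delta>: "0 < \<delta>" using r by (simp add: \<delta>_def add_nonneg_pos)
    have "\<bar>\<Delta> t u v - t\<^sup>2 * (u \<bullet> (H *v v))\<bar> \<le> e * t\<^sup>2 * (norm u * (2 * norm u + norm v))"
      if t: "0 < t" "t < \<delta>" for t
    proof -
      \<comment> \<open>The mean value theorem in the direction \<open>u\<close> alone leaves two
        gradient values, both compared with \<open>gf xs\<close>. Differentiability of
        \<open>gf\<close> at the single point \<open>xs\<close> then controls the second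
        difference.\<close>
      let ?g = "\<lambda>s. f ((xs + t *\<^sub>R v) + s *\<^sub>R u) - f (xs + s *\<^sub>R u)"
      have "\<exists>z>0. z < t \<and> ?g t - ?g 0 = (t - 0) * (gf ((xs + t *\<^sub>R v) + z *\<^sub>R u) \<bullet> u - gf (xs + z *\<^sub>R u) \<bullet> u)"
        by (rule MVT2) (use t in \<open>auto intro!: derivative_eq_intros gderiv_line[OF d]\<close>)
      then obtain z where z: "0 < z" "z < t"
        and g: "?g t - ?g 0 = t * ((gf ((xs + t *\<^sub>R v) + z *\<^sub>R u) - gf (xs + z *\<^sub>R u)) \<bullet> u)"
        by (auto simp: inner_diff_left)
      have D: "\<Delta> t u v = ?g t - ?g 0" by (simp add: \<Delta>_def algebra_simps)
      let ?p = "t *\<^sub>R v + z *\<^sub>R u" and ?q = "z *\<^sub>R u"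
      have np: "norm ?p \<le> t * (norm u + norm v)" "norm ?q \<le> t * norm u"
        using norm_triangle_ineq[of "t *\<^sub>R v" "z *\<^sub>R u"] z t
          mult_right_mono[of z t "norm u"] by (auto simp: algebra_simps)
      have "t * (norm u + norm v + 1) < r"
        using t(2) unfolding \<delta>_def
        by (subst (asm) pos_less_divide_eq) (auto intro: add_nonneg_pos)
      then have r': "t * (norm u + norm v) < r" "t * norm u < r"
        using t(1) mult_nonneg_nonneg[OF less_imp_le[OF t(1)] norm_ge_zero[of v]]
        unfolding distrib_left mult_1_right by linarith+
      have "norm ?p < r" by (rule le_less_trans[OF np(1) r'(1)])
      moreover have "norm ?q < r" by (rule le_less_trans[OF np(2) r'(2)])
      ultimately have "norm (gf (xs + ?p) - gf xs - H *v ?p) \<le> e * norm ?p"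
          "norm (gf (xs + ?q) - gf xs - H *v ?q) \<le> e * norm ?q"
        using r(2)[of "xs + ?p"] r(2)[of "xs + ?q"] by auto
      moreover have "e * norm ?p \<le> e * (t * (norm u + norm v))" "e * norm ?q \<le> e * (t * norm u)"
        using np e by (auto intro!: mult_left_mono simp del: norm_scaleR)
      ultimately have "norm (gf (xs + ?p) - gf xs - H *v ?p) \<le> e * (t * (norm u + norm v))"
          "norm (gf (xs + ?q) - gf xs - H *v ?q) \<le> e * (t * norm u)"
        by linarith+
      then have "norm ((gf (xs + ?p) - gf xs - H *v ?p) - (gf (xs + ?q) - gf xs - H *v ?q))
          \<le> e * t * (2 * norm u + norm v)"
        by (intro order_trans[OF norm_triangle_ineq4]) (simp add: algebra_simps)
      moreover have "H *v ?p - H *v ?q = t *\<^sub>R (H *v v)"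
        by (simp add: matrix_vector_right_distrib matrix_vector_mult_scaleR)
      then have "(gf (xs + ?p) - gf xs - H *v ?p) - (gf (xs + ?q) - gf xs - H *v ?q)
         = gf (xs + ?p) - gf (xs + ?q) - t *\<^sub>R (H *v v)"
        by (simp add: algebra_simps)
      ultimately have n: "norm (gf ((xs + t *\<^sub>R v) + z *\<^sub>R u) - gf (xs + z *\<^sub>R u) - t *\<^sub>R (H *v v))
          \<le> e * t * (2 * norm u + norm v)" by (simp add: add.assoc)
      define w where "w = gf ((xs + t *\<^sub>R v) + z *\<^sub>R u) - gf (xs + z *\<^sub>R u) - t *\<^sub>R (H *v v)"
      have "\<Delta> t u v - t\<^sup>2 * (u \<bullet> (H *v v)) = t * (w \<bullet> u)"
        unfolding D g w_def
        by (simp add: inner_diff_left inner_diff_right inner_commute right_diff_distrib power2_eq_square)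
      moreover have "\<bar>w \<bullet> u\<bar> \<le> e * t * (2 * norm u + norm v) * norm u"
        by (rule order_trans[OF Cauchy_Schwarz_ineq2 mult_right_mono]) (use n in \<open>simp_all add: w_def\<close>)
      ultimately have "\<bar>\<Delta> t u v - t\<^sup>2 * (u \<bullet> (H *v v))\<bar> \<le> t * (e * t * (2 * norm u + norm v) * norm u)"
        using t(1) by (simp add: abs_mult mult_le_cancel_left)
      then show ?thesis by (simp add: power2_eq_square mult_ac)
    qed
    then show ?thesis using \<delta> by (intro exI[of _ \<delta>]) simp
  qed
  define C where "C = norm u * (2 * norm u + norm v) + norm v * (2 * norm v + norm u)"
  have C: "0 \<le> C" by (simp add: C_def)
  have "\<bar>u \<bullet> (H *v v) - v \<bullet> (H *v u)\<bar> \<le> e * C" if e: "0 < e" for e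
  proof -
    obtain \<delta>1 where 1: "\<delta>1 > 0" "\<And>t. 0 < t \<and> t < \<delta>1 \<longrightarrow> \<bar>\<Delta> t u v - t\<^sup>2 * (u \<bullet> (H *v v))\<bar> \<le> e * t\<^sup>2 * (norm u * (2 * norm u + norm v))"
      using close[OF e] by blast
    obtain \<delta>2 where 2: "\<delta>2 > 0" "\<And>t. 0 < t \<and> t < \<delta>2 \<longrightarrow> \<bar>\<Delta> t v u - t\<^sup>2 * (v \<bullet> (H *v u))\<bar> \<le> e * t\<^sup>2 * (norm v * (2 * norm v + norm u))"
      using close[OF e] by blast
    define t where "t = min \<delta>1 \<delta>2 / 2"
    have t: "0 < t" "t < \<delta>1" "t < \<delta>2" using 1(1) 2(1) by (auto simp: t_def min_def)
    have "\<bar>t\<^sup>2 * (u \<bullet> (H *v v)) - t\<^sup>2 * (v \<bullet> (H *v u))\<bar> \<le> e * t\<^sup>2 * C"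
    proof -
      have "\<bar>\<Delta> t u v - t\<^sup>2 * (u \<bullet> (H *v v))\<bar> \<le> e * t\<^sup>2 * (norm u * (2 * norm u + norm v))"
        using 1(2)[of t] t by blast
      moreover have "\<bar>\<Delta> t u v - t\<^sup>2 * (v \<bullet> (H *v u))\<bar> \<le> e * t\<^sup>2 * (norm v * (2 * norm v + norm u))"
        using 2(2)[of t] t unfolding sym[of t u v] by blast
      ultimately show ?thesis unfolding C_def distrib_left[of "e * t\<^sup>2"] by linarith
    qed
    then have "t\<^sup>2 * \<bar>u \<bullet> (H *v v) - v \<bullet> (H *v u)\<bar> \<le> t\<^sup>2 * (e * C)"
      unfolding right_diff_distrib[symmetric] abs_mult by (simp add: mult_ac)
    then show ?thesis using t by (simp add: mult_le_cancel_left)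
  qed note le = this
  have "\<bar>u \<bullet> (H *v v) - v \<bullet> (H *v u)\<bar> \<le> 0"
  proof (rule field_le_epsilon)
    fix e :: real assume e: "0 < e"
    have "e / (C + 1) * C \<le> e" using C e by (simp add: field_simps)
    then show "\<bar>u \<bullet> (H *v v) - v \<bullet> (H *v u)\<bar> \<le> 0 + e"
      using le[of "e / (C + 1)"] e C by (auto simp: add_nonneg_pos)
  qed
  then show ?thesis by simp
qed

text \<open>The entries of \<open>gF\<close> are pointwise limits of difference quotients of
  \<open>F\<close> with steps \<open>1 / Suc k\<close>, so joint measurability is inherited from
  \<open>F\<close>.\<close>

lemma gradient_measurable:
  fixes F :: "real^'m \<Rightarrow> real^'d \<Rightarrow> real"
  assumes F: "(\<lambda>(y, z). F y z) \<in> borel_measurable borel"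
    and d: "\<And>y z. GDERIV (\<lambda>y'. F y' z) y :> gF y z"
  shows "(\<lambda>p. gF (fst p) (snd p)) \<in> borel_measurable (borel \<Otimes>\<^sub>M borel)"
proof -
  let ?B = "borel \<Otimes>\<^sub>M borel :: ((real^'m) \<times> (real^'d)) measure"
  have F': "(\<lambda>p. F (fst p) (snd p)) \<in> borel_measurable ?B"
    using F by (simp add: case_prod_beta' borel_prod)
  let ?h = "\<lambda>k. 1 / real (Suc k)"
  have comp: "(\<lambda>p. gF (fst p) (snd p) $ a) \<in> borel_measurable ?B" for a
  proof (rule borel_measurable_LIMSEQ_real)
    fix p :: "(real^'m) \<times> (real^'d)"
    have "((\<lambda>t. F (fst p + t *\<^sub>R axis a 1) (snd p)) has_real_derivative
        (gF (fst p + 0 *\<^sub>R axis a 1) (snd p) \<bullet> axis a 1)) (at 0)"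
      by (rule gderiv_line[OF d])
    then have "((\<lambda>t. (F (fst p + t *\<^sub>R axis a 1) (snd p) - F (fst p) (snd p)) / t)
        \<longlongrightarrow> gF (fst p) (snd p) $ a) (at 0)"
      by (simp add: DERIV_def inner_axis)
    moreover have "filterlim ?h (at 0) sequentially"
      by (intro filterlim_atI LIMSEQ_Suc[OF lim_1_over_n]) auto
    ultimately show "(\<lambda>k. (F (fst p + ?h k *\<^sub>R axis a 1) (snd p) - F (fst p) (snd p)) / ?h k)
        \<longlonglongrightarrow> gF (fst p) (snd p) $ a"
      by (rule filterlim_compose)
  next
    fix k
    have "(\<lambda>p. (fst p + ?h k *\<^sub>R axis a 1, snd p)) \<in> measurable ?B ?B"
      by (intro measurable_Pair borel_measurable_add measurable_fst measurable_snd borel_measurable_const)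
    from measurable_compose[OF this F']
    show "(\<lambda>p. (F (fst p + ?h k *\<^sub>R axis a 1) (snd p) - F (fst p) (snd p)) / ?h k) \<in> borel_measurable ?B"
      by (intro borel_measurable_divide borel_measurable_diff F' borel_measurable_const) simp
  qed
  show ?thesis
    by (rule borel_measurable_euclidean_space[THEN iffD2]) (use comp in \<open>auto simp: Basis_vec_def inner_axis\<close>)
qed

text \<open>Both bounds are tested on one unit vector, which exists because index types are
  nonempty.\<close>

lemma strong_convexity_le_Lipschitz:
  fixes gf :: "real^'m \<Rightarrow> real^'m"
  assumes lip: "\<And>y y'. norm (gf y - gf y') \<le> L * norm (y - y')"
    and sc: "\<And>y y'. \<eta> * (norm (y - y'))\<^sup>2 \<le> (gf y - gf y') \<bullet> (y - y')"
  shows "\<eta> \<le> L"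
proof -
  let ?v = "axis undefined 1 :: real^'m"
  have "\<eta> \<le> (gf ?v - gf 0) \<bullet> ?v" using sc[of ?v 0] by (simp add: norm_axis_1)
  also have "\<dots> \<le> norm (gf ?v - gf 0) * norm ?v" by (rule norm_cauchy_schwarz)
  also have "\<dots> \<le> L" using lip[of ?v 0] by (simp add: norm_axis_1)
  finally show ?thesis .
qed

lemma quadratic_remainder:
  fixes D :: "real^'m^'m"
  assumes "onorm (\<lambda>h. D *v h) \<le> R * norm v"
  shows "norm (D *v v) \<le> R * (norm v)\<^sup>2"
proof -
  have "norm (D *v v) \<le> onorm (\<lambda>h. D *v h) * norm v"
    by (rule onorm[OF matrix_vector_mul_bounded_linear])
  also have "\<dots> \<le> R * norm v * norm v" by (rule mult_right_mono[OF assms]) simp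
  finally show ?thesis by (simp add: power2_eq_square)
qed

subsection \<open>Weak convergence in countable products\<close>

lemma cis_borel [measurable]: "cis \<in> borel_measurable borel"
  by (intro borel_measurable_continuous_onI continuous_intros)

text \<open>Trigonometric polynomials with arbitrary real frequencies in finitely many coordinates.
  The free phase \<open>d\<close> makes sines and constants instances of a cosine, so one generator
  is enough for an algebra.\<close>

inductive_set trig_sums :: "(('k \<Rightarrow> real) \<Rightarrow> real) set" where
  cosine: "finite J \<Longrightarrow> (\<lambda>x. c * cos ((\<Sum>i\<in>J. t i * x i) + d)) \<in> trig_sums"
| plus: "f \<in> trig_sums \<Longrightarrow> g \<in> trig_sums \<Longrightarrow> (\<lambda>x. f x + g x) \<in> trig_sums"

lemma trig_sums_const: "(\<lambda>x. c) \<in> trig_sums"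
  using cosine[of "{}" c _ 0] by simp

lemma trig_sums_sin: "(\<lambda>x. sin (x i * r)) \<in> trig_sums"
  using cosine[of "{i}" 1 "\<lambda>_. r" "- pi/2"] by (simp add: cos_diff mult.commute)

lemma trig_sums_mult_cosine:
  assumes "f \<in> trig_sums" "finite J"
  shows "(\<lambda>x. f x * (c * cos ((\<Sum>i\<in>J. t i * x i) + d))) \<in> trig_sums"
  using assms
proof (induction f rule: trig_sums.induct)
  case (cosine J' c' t' d')
  \<comment> \<open>Extending the coefficients by 0 puts both frequencies over the common index set
    \<open>J \<union> J'\<close>, where the product-to-sum formula applies.\<close>
  define T where "T = (\<lambda>i. if i \<in> J then t i else 0)"
  define T' where "T' = (\<lambda>i. if i \<in> J' then t' i else 0)"
  have e: "(\<Sum>i\<in>J. t i * x i) = (\<Sum>i\<in>J \<union> J'. T i * x i)"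
       "(\<Sum>i\<in>J'. t' i * x i) = (\<Sum>i\<in>J \<union> J'. T' i * x i)" for x
    unfolding T_def T'_def using cosine by (auto intro!: sum.mono_neutral_cong_left)
  have "(\<lambda>x. (c * c' / 2) * cos ((\<Sum>i\<in>J \<union> J'. (T' i - T i) * x i) + (d' - d)) +
         (c * c' / 2) * cos ((\<Sum>i\<in>J \<union> J'. (T' i + T i) * x i) + (d' + d))) \<in> trig_sums"
    using cosine by (intro trig_sums.intros) auto
  moreover have "c' * cos ((\<Sum>i\<in>J'. t' i * x i) + d') * (c * cos ((\<Sum>i\<in>J. t i * x i) + d)) =
     (c * c' / 2) * cos ((\<Sum>i\<in>J \<union> J'. (T' i - T i) * x i) + (d' - d)) +
         (c * c' / 2) * cos ((\<Sum>i\<in>J \<union> J'. (T' i + T i) * x i) + (d' + d))" for x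
  proof -
    have "c' * cos ((\<Sum>i\<in>J'. t' i * x i) + d') * (c * cos ((\<Sum>i\<in>J. t i * x i) + d)) =
        c * c' * (cos ((\<Sum>i\<in>J \<union> J'. T' i * x i) + d') * cos ((\<Sum>i\<in>J \<union> J'. T i * x i) + d))"
      unfolding e by simp
    then show ?thesis
      unfolding cos_times_cos
      by (simp add: sum.distrib sum_subtractf algebra_simps distrib_left)
  qed
  ultimately show ?case by simp
next
  case (plus f g)
  then show ?case by (simp add: distrib_right trig_sums.plus)
qed

lemma trig_sums_mult:
  assumes "g \<in> trig_sums" "f \<in> trig_sums"
  shows "(\<lambda>x. f x * g x) \<in> trig_sums"
  using assms
proof (induction g rule: trig_sums.induct)
  case (cosine J c t d)
  then show ?case by (intro trig_sums_mult_cosine)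
next
  case (plus f g)
  then show ?case by (simp add: distrib_left trig_sums.plus)
qed

lemma trig_sums_measurable:
  fixes f :: "('k::countable \<Rightarrow> real) \<Rightarrow> real"
  assumes "f \<in> trig_sums"
  shows "f \<in> borel_measurable borel" and "\<exists>B. \<forall>x. \<bar>f x\<bar> \<le> B"
proof -
  have [measurable]: "(\<lambda>x::'k\<Rightarrow>real. x i) \<in> borel_measurable borel" for i
    by (intro borel_measurable_continuous_onI continuous_on_product_coordinates)
  show "f \<in> borel_measurable borel"
    using assms
  proof (induction f rule: trig_sums.induct)
    case (plus f g)
    then show ?case by (intro borel_measurable_add)
  qed measurable
  show "\<exists>B. \<forall>x. \<bar>f x\<bar> \<le> B"
    using assms
  proof (induction f rule: trig_sums.induct)
    case (cosine J c t d)
    show ?case by (rule exI[of _ "\<bar>c\<bar>"]) (auto simp: abs_mult intro: mult_left_le)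
  next
    case (plus f g)
    then obtain B B' where "\<forall>x. \<bar>f x\<bar> \<le> B" "\<forall>x. \<bar>g x\<bar> \<le> B'" by blast
    then show ?case by (intro exI[of _ "B + B'"] allI order_trans[OF abs_triangle_ineq] add_mono) auto
  qed
qed

text \<open>In the variables \<open>sin (x i / R i)\<close> the folded function lives on the compact
  cube \<open>C\<close> (Tychonoff for a countable product), and polynomials in these variables are
  trigonometric sums in \<open>x\<close>.\<close>

lemma trig_sums_Stone_Weierstrass:
  fixes h :: "('k::countable \<Rightarrow> real) \<Rightarrow> real"
  assumes h: "continuous_on UNIV h" and e: "0 < e" and R: "\<And>i. 0 < R i"
  shows "\<exists>p\<in>trig_sums. \<forall>x. \<bar>h (\<lambda>i. R i * arcsin (sin (x i / R i))) - p x\<bar> < e"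
proof -
  define C :: "('k \<Rightarrow> real) set" where "C = (\<Pi>\<^sub>E i\<in>UNIV. {-1..1})"
  \<comment> \<open>The second conjunct speaks of the function after substitution, so an
    approximation found in this ring is itself the trigonometric sum that is wanted.\<close>
  define ring where "ring = {p. continuous_on C p \<and> (\<lambda>x. p (\<lambda>i. sin (x i / R i))) \<in> trig_sums}"
  have "compactin (product_topology (\<lambda>i. euclidean) UNIV) C"
    unfolding C_def compactin_PiE by (auto simp: compactin_euclidean_iff)
  then have cC: "compact C" by (simp add: euclidean_product_topology)
  interpret function_ring_on ring C
  proof
    fix x y :: "'k \<Rightarrow> real" assume "x \<in> C" "y \<in> C" "x \<noteq> y"
    then obtain i where i: "x i \<noteq> y i" by auto
    have "continuous_on C (\<lambda>z. z i)"
      by (rule continuous_on_subset[OF continuous_on_product_coordinates]) simp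
    then have "(\<lambda>z. z i) \<in> ring"
      using trig_sums_sin[of i "1 / R i"] by (simp add: ring_def)
    with i show "\<exists>f\<in>ring. f x \<noteq> f y" by (intro bexI[where x="\<lambda>z. z i"])
  next
    fix f g assume "f \<in> ring" "g \<in> ring"
    then show "(\<lambda>x. f x + g x) \<in> ring" "(\<lambda>x. f x * g x) \<in> ring"
      by (simp_all add: ring_def continuous_on_add continuous_on_mult trig_sums.plus trig_sums_mult)
  next
    show "(\<lambda>_. c) \<in> ring" for c by (simp add: ring_def trig_sums_const)
  qed (use cC in \<open>simp_all add: ring_def\<close>)
  have "continuous_on C (h \<circ> (\<lambda>y i. R i * arcsin (y i)))"
  proof (rule continuous_on_compose)
    have ci: "continuous_on C (\<lambda>y. y i)" for i
      by (rule continuous_on_subset[OF continuous_on_product_coordinates]) simp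
    have "continuous_on C (\<lambda>y. R i * arcsin (y i))" for i
      by (intro continuous_intros ci) (auto simp: C_def PiE_def Pi_def)
    then show "continuous_on C (\<lambda>y i. R i * arcsin (y i))"
      by (rule continuous_on_coordinatewise_then_product)
    show "continuous_on ((\<lambda>y i. R i * arcsin (y i)) ` C) h"
      by (rule continuous_on_subset[OF h]) simp
  qed
  from Stone_Weierstrass_basic[OF this e] obtain g where g: "g \<in> ring"
    "\<And>y. y \<in> C \<Longrightarrow> \<bar>h (\<lambda>i. R i * arcsin (y i)) - g y\<bar> < e" by auto
  show ?thesis
  proof (rule bexI[of _ "\<lambda>x. g (\<lambda>i. sin (x i / R i))"])
    show "\<forall>x. \<bar>h (\<lambda>i. R i * arcsin (sin (x i / R i))) - g (\<lambda>i. sin (x i / R i))\<bar> < e"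
      by (intro allI g(2)) (auto simp: C_def)
  qed (use g in \<open>auto simp: ring_def\<close>)
qed

text \<open>\<open>cos (s + d)\<close> is the real part of \<open>cis d * cis s\<close>, so
  convergence of characteristic functions settles the generators, and linearity does the
  rest.\<close>

lemma trig_sums_tendsto:
  fixes \<mu> :: "nat \<Rightarrow> ('k::countable \<Rightarrow> real) measure"
  assumes [simp]: "\<And>j. prob_space (\<mu> j)" "prob_space \<nu>"
    and [measurable_cong]: "\<And>j. sets (\<mu> j) = sets borel" "sets \<nu> = sets borel"
    and conv: "\<And>J t. finite J \<Longrightarrow>
      (\<lambda>j. \<integral>x. cis (\<Sum>i\<in>J. t i * x i) \<partial>\<mu> j) \<longlonglongrightarrow> (\<integral>x. cis (\<Sum>i\<in>J. t i * x i) \<partial>\<nu>)"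
    and p: "p \<in> trig_sums"
  shows "(\<lambda>j. \<integral>x. p x \<partial>\<mu> j) \<longlonglongrightarrow> (\<integral>x. p x \<partial>\<nu>)"
  using p
proof (induction p rule: trig_sums.induct)
  case (cosine J c t d)
  have [measurable]: "(\<lambda>x::'k\<Rightarrow>real. x i) \<in> borel_measurable borel" for i
    by (intro borel_measurable_continuous_onI continuous_on_product_coordinates)
  have cis: "(\<lambda>x. cis (\<Sum>i\<in>J. t i * x i)) \<in> borel_measurable borel"
    unfolding cis_conv_exp by measurable
  have "(\<integral>x. c * cos ((\<Sum>i\<in>J. t i * x i) + d) \<partial>\<mu>) = Re (c * cis d * (\<integral>x. cis (\<Sum>i\<in>J. t i * x i) \<partial>\<mu>))"
    if P: "prob_space \<mu>" and S[measurable_cong]: "sets \<mu> = sets borel" for \<mu> :: "('k \<Rightarrow> real) measure"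
  proof -
    interpret prob_space \<mu> by (rule P)
    have i: "integrable \<mu> (\<lambda>x. cis (\<Sum>i\<in>J. t i * x i))"
      using cis by (intro integrable_const_bound[of _ 1]) (auto simp: measurable_cong_sets[OF S refl])
    have "Re (c * cis d * (\<integral>x. cis (\<Sum>i\<in>J. t i * x i) \<partial>\<mu>)) = (\<integral>x. Re (c * cis d * cis (\<Sum>i\<in>J. t i * x i)) \<partial>\<mu>)"
      using i by (subst integral_Re) (auto simp: mult.assoc)
    also have "\<dots> = (\<integral>x. c * cos ((\<Sum>i\<in>J. t i * x i) + d) \<partial>\<mu>)"
      by (intro Bochner_Integration.integral_cong refl) (simp add: cos_add algebra_simps)
    finally show ?thesis by simp
  qed
  then show ?case
    using assms cosine by (auto intro!: tendsto_intros)
next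
  case (plus f g)
  have "integrable \<mu> q" if P: "prob_space \<mu>" and S: "sets \<mu> = sets borel" and q: "q \<in> trig_sums"
    for \<mu> :: "('k \<Rightarrow> real) measure" and q
  proof -
    interpret prob_space \<mu> by (rule P)
    obtain B where "\<forall>x. \<bar>q x\<bar> \<le> B" using trig_sums_measurable(2)[OF q] by blast
    then show ?thesis
      using trig_sums_measurable(1)[OF q]
      by (intro integrable_const_bound[of _ B]) (auto simp: measurable_cong_sets[OF S refl])
  qed
  then show ?case
    using plus assms by (subst (1 2) Bochner_Integration.integral_add) (auto intro: tendsto_add)
qed

lemma tight_coordinate:
  fixes \<mu> :: "('k::countable \<Rightarrow> real) measure"
  assumes "prob_space \<mu>" and S[measurable_cong]: "sets \<mu> = sets borel" and e: "0 < e"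
  shows "\<exists>R>0. measure \<mu> {x. \<bar>x i\<bar> > R} \<le> e"
proof -
  interpret prob_space \<mu> by fact
  have sp: "space \<mu> = UNIV" using sets_eq_imp_space_eq[OF S] by simp
  have [measurable]: "(\<lambda>x::'k\<Rightarrow>real. x i) \<in> borel_measurable borel"
    by (intro borel_measurable_continuous_onI continuous_on_product_coordinates)
  have "(\<lambda>n. measure \<mu> {x\<in>space \<mu>. \<bar>x i\<bar> > real n}) \<longlonglongrightarrow> measure \<mu> (\<Inter>n. {x\<in>space \<mu>. \<bar>x i\<bar> > real n})"
    by (rule finite_Lim_measure_decseq) (auto simp: decseq_def)
  moreover have "(\<Inter>n. {x\<in>space \<mu>. \<bar>x i\<bar> > real n}) = {}"
  proof -
    have "\<exists>n. \<not> real n < \<bar>x i\<bar>" for x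
      using reals_Archimedean2[of "\<bar>x i\<bar>"] by (auto simp: not_less intro: less_imp_le)
    then show ?thesis by blast
  qed
  ultimately have "\<forall>\<^sub>F n in sequentially. measure \<mu> {x\<in>space \<mu>. \<bar>x i\<bar> > real n} < e"
    using e by (simp add: order_tendstoD(2))
  then obtain n where n: "measure \<mu> {x\<in>space \<mu>. \<bar>x i\<bar> > real n} < e"
    by (auto simp: eventually_sequentially)
  have "measure \<mu> {x. \<bar>x i\<bar> > real n + 1} \<le> measure \<mu> {x\<in>space \<mu>. \<bar>x i\<bar> > real n}"
    using sp by (intro finite_measure_mono) auto
  then show ?thesis using n by (intro exI[of _ "real n + 1"]) auto
qed

text \<open>If \<open>\<bar>x i\<bar> \<le> R i\<close> for all \<open>i\<close>, folding changes
  nothing, since \<open>1 \<le> pi / 2\<close>. The exceptional events have total probability at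
  most \<open>e\<close> by the geometric weights. There the error is at most
  \<open>2 * B + e\<close>, elsewhere \<open>e\<close>.\<close>

lemma folding_error:
  fixes \<mu> :: "('k::countable \<Rightarrow> real) measure" and h :: "('k \<Rightarrow> real) \<Rightarrow> real"
  assumes "prob_space \<mu>" and S[measurable_cong]: "sets \<mu> = sets borel" and e: "0 < e"
    and R: "\<And>i. 0 < R i" "\<And>i. measure \<mu> {x. \<bar>x i\<bar> > R i} \<le> e * (1/2) ^ Suc (to_nat i)"
    and h: "continuous_on UNIV h" "\<And>x. \<bar>h x\<bar> \<le> B"
    and p: "p \<in> trig_sums" "\<And>x. \<bar>h (\<lambda>i. R i * arcsin (sin (x i / R i))) - p x\<bar> < e"
  shows "\<bar>(\<integral>x. h x \<partial>\<mu>) - (\<integral>x. p x \<partial>\<mu>)\<bar> \<le> (2 * B + 1) * e"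
proof -
  interpret prob_space \<mu> by fact
  have sp: "space \<mu> = UNIV" using sets_eq_imp_space_eq[OF S] by simp
  have B: "0 \<le> B" using h(2)[of undefined] by linarith
  have c[measurable]: "(\<lambda>x::'k\<Rightarrow>real. x i) \<in> borel_measurable borel" for i
    by (intro borel_measurable_continuous_onI continuous_on_product_coordinates)
  \<comment> \<open>The exceptional events are enumerated by \<open>to_nat\<close>; numbers outside
    its range contribute the empty set, so that finite index types are covered too.\<close>
  define A where "A = (\<lambda>n. if n \<in> range (to_nat :: 'k \<Rightarrow> nat)
      then {x. \<bar>x (from_nat n :: 'k)\<bar> > R (from_nat n :: 'k)} else {})"
  have A: "A n \<in> sets \<mu>" for n
  proof -
    have "{x\<in>space \<mu>. \<bar>x i\<bar> > R i} \<in> sets \<mu>" for i by measurable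
    then show ?thesis by (simp add: A_def sp)
  qed
  have An: "measure \<mu> (A n) \<le> e * (1/2) ^ Suc n" for n
    using R(2) e by (auto simp: A_def)
  have ss: "(\<lambda>n. e * (1/2) ^ Suc n) sums e"
    using sums_mult[OF power_half_series, of e] by simp
  have sA: "summable (\<lambda>n. measure \<mu> (A n))"
    by (rule summable_comparison_test'[OF sums_summable[OF ss], of 0]) (use An in auto)
  have bad: "measure \<mu> (\<Union>n. A n) \<le> e"
  proof -
    have "measure \<mu> (\<Union>n. A n) \<le> (\<Sum>n. measure \<mu> (A n))"
      by (rule finite_measure_subadditive_countably) (use A sA in auto)
    also have "\<dots> \<le> (\<Sum>n. e * (1/2) ^ Suc n)"
      using An sA ss by (intro suminf_le) (auto simp: sums_iff)
    finally show ?thesis using ss by (simp add: sums_iff)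
  qed
  have hm[measurable]: "h \<in> borel_measurable borel" by (rule borel_measurable_continuous_onI[OF h(1)])
  note pm[measurable] = trig_sums_measurable(1)[OF p(1)]
  obtain C where C: "\<forall>x. \<bar>p x\<bar> \<le> C" using trig_sums_measurable(2)[OF p(1)] by blast
  have i: "integrable \<mu> h" "integrable \<mu> p"
    using h(2) C by (auto intro: integrable_const_bound[of _ B] integrable_const_bound[of _ C])
  have pt: "\<bar>h x - p x\<bar> \<le> 2 * B * indicator (\<Union>n. A n) x + e" for x
  proof (cases "x \<in> (\<Union>n. A n)")
    case True
    then show ?thesis using h(2)[of x] h(2)[of "\<lambda>i. R i * arcsin (sin (x i / R i))"] p(2)[of x] by simp
  next
    case False
    have "\<bar>x i\<bar> \<le> R i" for i
    proof -
      have "x \<notin> A (to_nat i)" using False by blast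
      then show ?thesis by (simp add: A_def)
    qed
    then have le1: "\<bar>x i / R i\<bar> \<le> 1" for i
      using R(1)[of i] by (simp add: abs_divide)
    have "arcsin (sin (x i / R i)) = x i / R i" for i
    proof (intro arcsin_sin)
      have "\<bar>x i / R i\<bar> \<le> pi / 2" using le1[of i] pi_ge_two by linarith
      then show "- (pi / 2) \<le> x i / R i" "x i / R i \<le> pi / 2" by linarith+
    qed
    then have "(\<lambda>i. R i * arcsin (sin (x i / R i))) = x"
      using R(1) by (auto simp: less_imp_neq[THEN not_sym] intro!: ext)
    then show ?thesis using p(2)[of x] False by simp
  qed
  have "\<bar>(\<integral>x. h x \<partial>\<mu>) - (\<integral>x. p x \<partial>\<mu>)\<bar> \<le> (\<integral>x. \<bar>h x - p x\<bar> \<partial>\<mu>)"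
    using integral_abs_bound[of \<mu> "\<lambda>x. h x - p x"] i by simp
  also have "\<dots> \<le> (\<integral>x. 2 * B * indicator (\<Union>n. A n) x + e \<partial>\<mu>)"
    using A i pt by (intro integral_mono) (auto intro!: integrable_abs simp: emeasure_eq_measure)
  also have "\<dots> = 2 * B * measure \<mu> (\<Union>n. A n) + e"
    using A by (subst Bochner_Integration.integral_add) (auto simp: prob_space emeasure_eq_measure)
  also have "\<dots> \<le> 2 * B * e + e"
    using bad B by (intro add_right_mono mult_left_mono) auto
  finally show ?thesis by (simp add: algebra_simps)
qed

text \<open>Tightness is a premise, supplied later by second moments. It gives cut-offs
  \<open>R i\<close> common to all \<open>\<mu> j\<close> and to \<open>\<nu>\<close>, so a single
  trigonometric sum approximates the test function for all of them at once.\<close>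

theorem weak_conv_of_characteristic_functions:
  fixes \<mu> :: "nat \<Rightarrow> ('k::countable \<Rightarrow> real) measure" and h :: "('k \<Rightarrow> real) \<Rightarrow> real"
  assumes \<mu>: "\<And>j. prob_space (\<mu> j)" "\<And>j. sets (\<mu> j) = sets borel"
    and \<nu>: "prob_space \<nu>" "sets \<nu> = sets borel"
    and tight: "\<And>i e. 0 < e \<Longrightarrow> \<exists>R. \<forall>j. measure (\<mu> j) {x. \<bar>x i\<bar> > R} \<le> e"
    and conv: "\<And>J t. finite J \<Longrightarrow>
      (\<lambda>j. \<integral>x. cis (\<Sum>i\<in>J. t i * x i) \<partial>\<mu> j) \<longlonglongrightarrow> (\<integral>x. cis (\<Sum>i\<in>J. t i * x i) \<partial>\<nu>)"
    and h: "continuous_on UNIV h" "\<And>x. \<bar>h x\<bar> \<le> B"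
  shows "(\<lambda>j. \<integral>x. h x \<partial>\<mu> j) \<longlonglongrightarrow> (\<integral>x. h x \<partial>\<nu>)"
proof (rule LIMSEQ_I)
  fix r :: real assume r: "0 < r"
  have B: "0 \<le> B" using h(2)[of undefined] by linarith
  \<comment> \<open>Two folding errors of \<open>(2 * B + 1) * e\<close> and one error
    \<open>e\<close> for the trigonometric sum.\<close>
  define e where "e = r / (4 * B + 3)"
  have e: "0 < e" using r B by (simp add: e_def)
  have "\<exists>R>0. (\<forall>j. measure (\<mu> j) {x. \<bar>x i\<bar> > R} \<le> e * (1/2) ^ Suc (to_nat i)) \<and>
      measure \<nu> {x. \<bar>x i\<bar> > R} \<le> e * (1/2) ^ Suc (to_nat i)" for i
  proof -
    have ei: "0 < e * (1/2) ^ Suc (to_nat i)" using e by simp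
    obtain R1 where 1: "\<And>j. measure (\<mu> j) {x. \<bar>x i\<bar> > R1} \<le> e * (1/2) ^ Suc (to_nat i)"
      using tight[OF ei] by blast
    obtain R2 where 2: "0 < R2" "measure \<nu> {x. \<bar>x i\<bar> > R2} \<le> e * (1/2) ^ Suc (to_nat i)"
      using tight_coordinate[OF \<nu> ei] by blast
    have mono: "measure \<mu> {x. \<bar>x i\<bar> > max R1 R2} \<le> measure \<mu> {x. \<bar>x i\<bar> > R}"
      if "prob_space \<mu>" and S[measurable_cong]: "sets \<mu> = sets borel" and "R \<in> {R1, R2}" for \<mu> :: "('k \<Rightarrow> real) measure" and R
    proof -
      interpret prob_space \<mu> by fact
      have sp: "space \<mu> = UNIV" using sets_eq_imp_space_eq[OF S] by simp
      have [measurable]: "(\<lambda>x::'k\<Rightarrow>real. x i) \<in> borel_measurable borel"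
        by (intro borel_measurable_continuous_onI continuous_on_product_coordinates)
      have "{x\<in>space \<mu>. \<bar>x i\<bar> > R} \<in> sets \<mu>" by measurable
      then show ?thesis using that(3) by (intro finite_measure_mono) (auto simp: sp)
    qed
    show ?thesis
    proof (intro exI[of _ "max R1 R2"] conjI allI)
      show "0 < max R1 R2" using 2(1) by simp
      show "measure (\<mu> j) {x. max R1 R2 < \<bar>x i\<bar>} \<le> e * (1/2) ^ Suc (to_nat i)" for j
        by (rule order_trans[OF mono[OF \<mu>, of R1] 1]) simp
      show "measure \<nu> {x. max R1 R2 < \<bar>x i\<bar>} \<le> e * (1/2) ^ Suc (to_nat i)"
        by (rule order_trans[OF mono[OF \<nu>, of R2] 2(2)]) simp
    qed
  qed
  then obtain R where R: "\<And>i. 0 < R i"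
      "\<And>i j. measure (\<mu> j) {x. \<bar>x i\<bar> > R i} \<le> e * (1/2) ^ Suc (to_nat i)"
      "\<And>i. measure \<nu> {x. \<bar>x i\<bar> > R i} \<le> e * (1/2) ^ Suc (to_nat i)"
    by metis
  obtain p where p: "p \<in> trig_sums" "\<And>x. \<bar>h (\<lambda>i. R i * arcsin (sin (x i / R i))) - p x\<bar> < e"
    using trig_sums_Stone_Weierstrass[OF h(1) e, of R] R(1) by blast
  have "(\<lambda>j. \<integral>x. p x \<partial>\<mu> j) \<longlonglongrightarrow> (\<integral>x. p x \<partial>\<nu>)"
    by (rule trig_sums_tendsto[OF \<mu>(1) \<nu>(1) \<mu>(2) \<nu>(2) conv p(1)])
  then obtain n where n: "\<And>j. n \<le> j \<Longrightarrow> \<bar>(\<integral>x. p x \<partial>\<mu> j) - (\<integral>x. p x \<partial>\<nu>)\<bar> < e"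
    using LIMSEQ_D[OF _ e] by (metis real_norm_def)
  have "\<bar>(\<integral>x. h x \<partial>\<mu> j) - (\<integral>x. h x \<partial>\<nu>)\<bar> < r" if "n \<le> j" for j
  proof -
    have "\<bar>(\<integral>x. h x \<partial>\<mu> j) - (\<integral>x. h x \<partial>\<nu>)\<bar> < (2 * B + 1) * e + (2 * B + 1) * e + e"
      using folding_error[OF \<mu> e R(1) R(2) h p, of j] folding_error[OF \<nu> e R(1) R(3) h p] n[OF that]
      by linarith
    also have "\<dots> = e * (4 * B + 3)" by (simp add: algebra_simps)
    also have "\<dots> = r" using B by (simp add: e_def)
    finally show ?thesis .
  qed
  then show "\<exists>n. \<forall>j\<ge>n. norm ((\<integral>x. h x \<partial>\<mu> j) - (\<integral>x. h x \<partial>\<nu>)) < r"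
    by auto
qed

text \<open>The constant sequence \<open>\<mu>\<close> converges weakly to \<open>\<nu>\<close>, so
  bounded continuous functions have equal integrals. These determine the measure on closed sets, an
  intersection-stable generator.\<close>

corollary characteristic_function_unique:
  fixes \<mu> \<nu> :: "('k::countable \<Rightarrow> real) measure"
  assumes \<mu>: "prob_space \<mu>" "sets \<mu> = sets borel"
    and \<nu>: "prob_space \<nu>" "sets \<nu> = sets borel"
    and eq: "\<And>J t. finite J \<Longrightarrow>
      (\<integral>x. cis (\<Sum>i\<in>J. t i * x i) \<partial>\<mu>) = (\<integral>x. cis (\<Sum>i\<in>J. t i * x i) \<partial>\<nu>)"
  shows "\<mu> = \<nu>"
proof -
  have ints: "(\<integral>x. h x \<partial>\<mu>) = (\<integral>x. h x \<partial>\<nu>)"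
    if "continuous_on UNIV h" "\<And>x. \<bar>h x\<bar> \<le> B" for h :: "('k \<Rightarrow> real) \<Rightarrow> real" and B
  proof -
    have "(\<lambda>j::nat. \<integral>x. h x \<partial>\<mu>) \<longlonglongrightarrow> (\<integral>x. h x \<partial>\<nu>)"
    proof (rule weak_conv_of_characteristic_functions[where \<mu>="\<lambda>_. \<mu>", OF \<mu> \<nu> _ _ that])
      show "\<exists>R. \<forall>j::nat. measure \<mu> {x. R < \<bar>x i\<bar>} \<le> e" if "0 < e" for i e
        using tight_coordinate[OF \<mu> that] by auto
    qed (auto simp: eq)
    then show ?thesis by (simp add: LIMSEQ_const_iff)
  qed
  interpret \<mu>: prob_space \<mu> by fact
  interpret \<nu>: prob_space \<nu> by fact
  have closed: "emeasure \<mu> F = emeasure \<nu> F" if F: "closed F" for F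
  proof (cases "F = {}")
    case False
    \<comment> \<open>Tent functions decreasing to the indicator of \<open>F\<close>. The empty set
      is treated apart because \<open>infdist x {}\<close> is 0 by convention.\<close>
    define h where "h = (\<lambda>(n::nat) x. max 0 (1 - real n * infdist x F))"
    have hc: "continuous_on UNIV (h n)" for n unfolding h_def by (intro continuous_intros)
    have hb: "\<bar>h n x\<bar> \<le> 1" for n x by (simp add: h_def infdist_nonneg)
    have lim: "(\<lambda>n. h n x) \<longlonglongrightarrow> indicat_real F x" for x
    proof (cases "x \<in> F")
      case True
      then show ?thesis by (simp add: h_def)
    next
      case False
      then have pos: "infdist x F > 0"
        using F \<open>F \<noteq> {}\<close> in_closed_iff_infdist_zero[OF F, of x] infdist_nonneg[of x F] by fastforce
      obtain N where N: "1 < real N * infdist x F" using ex_less_of_nat_mult[OF pos] by blast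
      have "h n x = 0" if "N \<le> n" for n
      proof -
        have "real N * infdist x F \<le> real n * infdist x F"
          using that pos by (intro mult_right_mono) auto
        then show ?thesis using N unfolding h_def by linarith
      qed
      then show ?thesis
        using False by (intro tendsto_eventually) (auto simp: eventually_sequentially intro!: exI[of _ N])
    qed
    have conv: "(\<lambda>n. \<integral>x. h n x \<partial>M) \<longlonglongrightarrow> measure M F"
      if "prob_space M" and S: "sets M = sets borel" for M :: "('k \<Rightarrow> real) measure"
    proof -
      interpret prob_space M by fact
      have sp: "space M = UNIV" using sets_eq_imp_space_eq[OF S] by simp
      have "(\<lambda>n. \<integral>x. h n x \<partial>M) \<longlonglongrightarrow> (\<integral>x. indicat_real F x \<partial>M)"
      proof (rule integral_dominated_convergence[where w="\<lambda>_. 1"])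
        show "h n \<in> borel_measurable M" for n
          using borel_measurable_continuous_onI[OF hc] by (simp add: measurable_cong_sets[OF S refl])
        show "indicat_real F \<in> borel_measurable M"
          using F S by (intro borel_measurable_indicator) (simp add: borel_closed)
      qed (use lim hb in auto)
      then show ?thesis using F S sp by simp
    qed
    have "measure \<mu> F = measure \<nu> F"
      using conv[OF \<mu>] conv[OF \<nu>] ints[OF hc hb] by (simp add: LIMSEQ_unique)
    then show ?thesis by (simp add: \<mu>.emeasure_eq_measure \<nu>.emeasure_eq_measure)
  qed simp
  show ?thesis
  proof (rule measure_eqI_generator_eq[where E="Collect closed" and \<Omega>=UNIV and A="\<lambda>_::nat. UNIV"])
    show "sets \<mu> = sigma_sets UNIV (Collect closed)" "sets \<nu> = sigma_sets UNIV (Collect closed)"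
      using \<mu>(2) \<nu>(2) by (simp_all add: borel_eq_closed)
    show "Int_stable (Collect closed)" by (auto simp: Int_stable_def)
    show "emeasure \<mu> UNIV \<noteq> \<infinity>" using \<mu>.emeasure_finite by simp
  qed (use closed in auto)
qed

subsection \<open>Gaussian sequences\<close>

text \<open>The product runs over a whole index type such as \<open>nat \<times> 'm\<close>,
  although statistics look only at coordinates in a finite set \<open>K\<close>. This keeps the
  sample size out of the types.\<close>

definition gauss :: "('k \<Rightarrow> real) measure" where
  "gauss = PiM UNIV (\<lambda>_. std_normal_distribution)"

lemma prob_space_std_normal: "prob_space std_normal_distribution"
  using real_dist_normal_dist by (simp add: real_distribution_def)

interpretation std_normal: product_prob_space "\<lambda>_. std_normal_distribution" UNIV
  by (intro product_prob_spaceI prob_space_std_normal)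

interpretation gauss: prob_space "gauss :: ('k \<Rightarrow> real) measure"
  unfolding gauss_def by (intro prob_space_PiM prob_space_std_normal)

lemma sets_gauss [measurable_cong]: "sets (gauss :: ('k::countable \<Rightarrow> real) measure) = sets borel"
proof -
  have "sets (gauss :: ('k \<Rightarrow> real) measure) = sets (PiM UNIV (\<lambda>_. borel))"
    unfolding gauss_def by (intro sets_PiM_cong) auto
  then show ?thesis by (simp add: sets_PiM_equal_borel)
qed

lemma space_gauss [simp]: "space (gauss :: ('k \<Rightarrow> real) measure) = UNIV"
  by (simp add: gauss_def space_PiM)

lemma cis_sum: "finite J \<Longrightarrow> cis (\<Sum>i\<in>J. f i) = (\<Prod>i\<in>J. cis (f i))"
  by (induction J rule: finite_induct) (auto simp: cis_mult[symmetric])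

lemma std_normal_cis: "(\<integral>x. cis (t * x) \<partial>std_normal_distribution) = of_real (exp (- t\<^sup>2 / 2))"
  using fun_cong[OF char_std_normal_distribution, of t] by (simp add: char_def cis_conv_exp)

lemma gauss_cis:
  fixes t :: "'k::countable \<Rightarrow> real"
  assumes J: "finite J"
  shows "(\<integral>x. cis (\<Sum>i\<in>J. t i * x i) \<partial>gauss) = of_real (exp (- (\<Sum>i\<in>J. (t i)\<^sup>2) / 2))"
proof -
  have "(\<integral>x. cis (\<Sum>i\<in>J. t i * x i) \<partial>gauss)
      = (\<integral>x. cis (\<Sum>i\<in>J. t i * restrict x J i) \<partial>gauss)"
    by (intro Bochner_Integration.integral_cong refl arg_cong[where f=cis] sum.cong) auto
  also have "\<dots> = (\<integral>x. cis (\<Sum>i\<in>J. t i * x i) \<partial>distr gauss (PiM J (\<lambda>_. std_normal_distribution)) (\<lambda>x. restrict x J))"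
    unfolding gauss_def
    by (subst integral_distr) (auto intro!: measurable_restrict_subset measurable_compose[OF _ cis_borel])
  also have "\<dots> = (\<integral>x. (\<Prod>i\<in>J. cis (t i * x i)) \<partial>PiM J (\<lambda>_. std_normal_distribution))"
    unfolding gauss_def using J
    by (subst std_normal.distr_PiM_restrict_finite) (auto simp: cis_sum)
  also have "\<dots> = (\<Prod>i\<in>J. \<integral>x. cis (t i * x) \<partial>std_normal_distribution)"
    using J by (intro std_normal.product_integral_prod std_normal.M.integrable_const_bound[of _ 1])
      (auto intro!: measurable_compose[OF _ cis_borel])
  also have "\<dots> = of_real (exp (- (\<Sum>i\<in>J. (t i)\<^sup>2) / 2))"
    unfolding std_normal_cis of_real_prod[symmetric] exp_sum[OF J, symmetric]
    by (simp add: sum_negf sum_divide_distrib)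
  finally show ?thesis .
qed

text \<open>The characteristic function of \<open>gauss\<close> depends only on the sum of squared
  coefficients. A map preserves the law once it pulls finite linear forms back to linear forms with
  the same sum.\<close>

lemma distr_gauss_eq:
  fixes q :: "('l::countable \<Rightarrow> real) \<Rightarrow> ('k::countable \<Rightarrow> real)"
  assumes q[measurable]: "q \<in> borel_measurable borel"
    and lin: "\<And>J t. finite J \<Longrightarrow> \<exists>J' s. finite J' \<and> (\<forall>x. (\<Sum>i\<in>J. t i * q x i) = (\<Sum>i\<in>J'. s i * x i)) \<and>
        (\<Sum>i\<in>J. (t i)\<^sup>2) = (\<Sum>i\<in>J'. (s i)\<^sup>2)"
  shows "distr gauss borel q = gauss"
proof (rule characteristic_function_unique)
  show "prob_space (distr gauss borel q)" by (rule gauss.prob_space_distr) simp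
  fix J :: "'k set" and t assume J: "finite J"
  obtain J' s where J': "finite J'" "\<And>x. (\<Sum>i\<in>J. t i * q x i) = (\<Sum>i\<in>J'. s i * x i)"
      "(\<Sum>i\<in>J. (t i)\<^sup>2) = (\<Sum>i\<in>J'. (s i)\<^sup>2)"
    using lin[OF J] by blast
  have "(\<integral>x. cis (\<Sum>i\<in>J. t i * x i) \<partial>distr gauss borel q) = (\<integral>x. cis (\<Sum>i\<in>J. t i * q x i) \<partial>gauss)"
    by (rule integral_distr) (auto intro!: measurable_compose[OF _ cis_borel])
  also have "\<dots> = of_real (exp (- (\<Sum>i\<in>J'. (s i)\<^sup>2) / 2))"
    unfolding J'(2) by (rule gauss_cis[OF J'(1)])
  also have "\<dots> = (\<integral>x. cis (\<Sum>i\<in>J. t i * x i) \<partial>gauss)"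
    unfolding gauss_cis[OF J] J'(3) ..
  finally show "(\<integral>x. cis (\<Sum>i\<in>J. t i * x i) \<partial>distr gauss borel q) = (\<integral>x. cis (\<Sum>i\<in>J. t i * x i) \<partial>gauss)" .
qed (auto simp: sets_gauss gauss.prob_space_axioms)

text \<open>Pulling back a linear form transforms its coefficients on \<open>K\<close> by the
  transpose of \<open>Q\<close>; orthonormal rows of \<open>Q\<close> preserve the sum of their
  squares. Off \<open>K\<close> nothing moves.\<close>

lemma gauss_orthogonal:
  fixes Q :: "'k::countable \<Rightarrow> 'k \<Rightarrow> real"
  assumes K: "finite K"
    and orth: "\<And>p r. p \<in> K \<Longrightarrow> r \<in> K \<Longrightarrow> (\<Sum>l\<in>K. Q p l * Q r l) = (if p = r then 1 else 0)"
  shows "distr gauss borel (\<lambda>x p. if p \<in> K then \<Sum>l\<in>K. Q p l * x l else x p) = gauss" (is "distr _ _ ?q = _")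
proof (rule distr_gauss_eq)
  have "(\<lambda>x. ?q x p) \<in> borel_measurable borel" for p
    by (cases "p \<in> K") simp_all
  then show "?q \<in> borel_measurable borel"
    by (rule measurable_coordinatewise_then_product)
next
  fix J :: "'k set" and t :: "'k \<Rightarrow> real" assume J: "finite J"
  define T where "T = (\<lambda>i. if i \<in> J then t i else 0)"
  define s where "s = (\<lambda>l. if l \<in> K then \<Sum>p\<in>K. T p * Q p l else T l)"
  have split: "(\<Sum>i\<in>J \<union> K. f i) = (\<Sum>i\<in>J - K. f i) + (\<Sum>i\<in>K. f i)" for f :: "'k \<Rightarrow> real"
    using J K by (subst sum.union_disjoint[symmetric]) (auto intro: sum.cong)
  have "(\<Sum>i\<in>J. t i * ?q x i) = (\<Sum>i\<in>J \<union> K. s i * x i)" for x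
  proof -
    have "(\<Sum>i\<in>J. t i * ?q x i) = (\<Sum>i\<in>J \<union> K. T i * ?q x i)"
      unfolding T_def using J K by (intro sum.mono_neutral_cong_left) auto
    also have "\<dots> = (\<Sum>i\<in>J - K. T i * x i) + (\<Sum>p\<in>K. T p * (\<Sum>l\<in>K. Q p l * x l))"
      unfolding split by (intro arg_cong2[where f="(+)"] sum.cong) auto
    also have "(\<Sum>p\<in>K. T p * (\<Sum>l\<in>K. Q p l * x l)) = (\<Sum>l\<in>K. (\<Sum>p\<in>K. T p * Q p l) * x l)"
      unfolding sum_distrib_left sum_distrib_right by (subst sum.swap) (simp add: mult.assoc)
    also have "(\<Sum>i\<in>J - K. T i * x i) + \<dots> = (\<Sum>i\<in>J \<union> K. s i * x i)"
      unfolding split by (intro arg_cong2[where f="(+)"] sum.cong) (auto simp: s_def)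
    finally show ?thesis .
  qed
  moreover have "(\<Sum>i\<in>J. (t i)\<^sup>2) = (\<Sum>i\<in>J \<union> K. (s i)\<^sup>2)"
  proof -
    have "(\<Sum>l\<in>K. (\<Sum>p\<in>K. T p * Q p l)\<^sup>2) = (\<Sum>l\<in>K. \<Sum>p\<in>K. \<Sum>r\<in>K. T p * T r * (Q p l * Q r l))"
      by (simp add: power2_eq_square sum_product mult_ac)
    also have "\<dots> = (\<Sum>p\<in>K. \<Sum>r\<in>K. T p * T r * (\<Sum>l\<in>K. Q p l * Q r l))"
      unfolding sum_distrib_left
      by (rule trans[OF sum.swap], rule sum.cong[OF refl], rule sum.swap)
    also have "\<dots> = (\<Sum>p\<in>K. \<Sum>r\<in>K. if p = r then T p * T r else 0)"
      using orth by (intro sum.cong refl) auto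
    also have "\<dots> = (\<Sum>p\<in>K. (T p)\<^sup>2)" using K by (simp add: power2_eq_square)
    finally have "(\<Sum>i\<in>J \<union> K. (s i)\<^sup>2) = (\<Sum>i\<in>J - K. (T i)\<^sup>2) + (\<Sum>p\<in>K. (T p)\<^sup>2)"
      unfolding split by (intro arg_cong2[where f="(+)"]) (auto simp: s_def intro: sum.cong)
    also have "\<dots> = (\<Sum>i\<in>J \<union> K. (T i)\<^sup>2)" by (simp add: split)
    also have "\<dots> = (\<Sum>i\<in>J. (t i)\<^sup>2)"
      unfolding T_def using J K by (intro sum.mono_neutral_cong_right) auto
    finally show ?thesis by simp
  qed
  ultimately show "\<exists>J' s. finite J' \<and> (\<forall>x. (\<Sum>i\<in>J. t i * ?q x i) = (\<Sum>i\<in>J'. s i * x i)) \<and>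
        (\<Sum>i\<in>J. (t i)\<^sup>2) = (\<Sum>i\<in>J'. (s i)\<^sup>2)"
    using J K by (intro exI[of _ "J \<union> K"] exI[of _ s]) auto
qed

section \<open>Householder reflections of the sample index\<close>

definition ip :: "'i set \<Rightarrow> ('i \<Rightarrow> real) \<Rightarrow> ('i \<Rightarrow> real) \<Rightarrow> real" where
  "ip K u v = (\<Sum>i\<in>K. u i * v i)"

lemma ip_commute: "ip K u v = ip K v u" by (simp add: ip_def mult.commute)

lemma ip_diff: "ip K (\<lambda>i. u i - v i) w = ip K u w - ip K v w"
  by (simp add: ip_def left_diff_distrib sum_subtractf)

lemma ip_cong: "(\<And>i. i \<in> K \<Longrightarrow> u i = u' i) \<Longrightarrow> (\<And>i. i \<in> K \<Longrightarrow> v i = v' i) \<Longrightarrow> ip K u v = ip K u' v'"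
  unfolding ip_def by (rule sum.cong) auto

lemma ip_self_nonneg: "0 \<le> ip K v v" by (simp add: ip_def sum_nonneg)

lemma ip_self_zero: "finite K \<Longrightarrow> ip K v v = 0 \<Longrightarrow> i \<in> K \<Longrightarrow> v i = 0"
  by (auto simp: ip_def sum_nonneg_eq_0_iff)

(* For v = 0 on K the coefficient is 2 / 0 = 0, and reflect K v is the identity. *)
definition reflect_mat :: "'i set \<Rightarrow> ('i \<Rightarrow> real) \<Rightarrow> 'i \<Rightarrow> 'i \<Rightarrow> real" where
  "reflect_mat K v i j = (if i = j then 1 else 0) - 2 / ip K v v * v i * v j"

definition reflect :: "'i set \<Rightarrow> ('i \<Rightarrow> real) \<Rightarrow> ('i \<Rightarrow> real) \<Rightarrow> 'i \<Rightarrow> real" where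
  "reflect K v c i = (if i \<in> K then \<Sum>j\<in>K. reflect_mat K v i j * c j else c i)"

text \<open>One and the same reflection acts on the sample index in every component
  \<open>a\<close>; hence all inner products between columns of the data are preserved.\<close>

definition reflect2 :: "'i set \<Rightarrow> ('i \<Rightarrow> real) \<Rightarrow> ('i \<times> 'b \<Rightarrow> real) \<Rightarrow> 'i \<times> 'b \<Rightarrow> real" where
  "reflect2 K v z = (\<lambda>(i, a). reflect K v (\<lambda>i. z (i, a)) i)"

lemma reflect_eq:
  assumes "finite K" "i \<in> K"
  shows "reflect K v c i = c i - 2 / ip K v v * ip K v c * v i"
proof -
  have "(\<Sum>j\<in>K. reflect_mat K v i j * c j) =
      (\<Sum>j\<in>K. (if i = j then c j else 0)) - (\<Sum>j\<in>K. 2 / ip K v v * v i * (v j * c j))"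
    unfolding sum_subtractf[symmetric]
    by (intro sum.cong refl) (simp add: reflect_mat_def left_diff_distrib)
  also have "(\<Sum>j\<in>K. 2 / ip K v v * v i * (v j * c j)) = 2 / ip K v v * v i * ip K v c"
    by (simp only: ip_def[of K v c] sum_distrib_left)
  finally show ?thesis using assms by (simp add: reflect_def mult_ac)
qed

lemma reflect_mat_orthogonal:
  assumes K: "finite K" "i \<in> K" "j \<in> K"
  shows "(\<Sum>l\<in>K. reflect_mat K v i l * reflect_mat K v j l) = (if i = j then 1 else 0)"
proof -
  let ?\<beta> = "2 / ip K v v"
  have "(\<Sum>l\<in>K. reflect_mat K v i l * reflect_mat K v j l) = reflect K v (reflect_mat K v j) i"
    using K by (simp add: reflect_def)
  also have "\<dots> = reflect_mat K v j i - ?\<beta> * ip K v (reflect_mat K v j) * v i"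
    using K by (simp add: reflect_eq)
  also have "ip K v (reflect_mat K v j) = reflect K v v j"
    using K by (simp add: reflect_def ip_def mult.commute)
  also have "\<dots> = v j - ?\<beta> * ip K v v * v j" using K by (simp add: reflect_eq)
  finally show ?thesis
    using ip_self_zero[OF K(1) _ K(2), of v]
    by (cases "ip K v v = 0") (auto simp: reflect_mat_def)
qed

lemma ip_reflect:
  assumes K: "finite K"
  shows "ip K (reflect K v u) (reflect K v w) = ip K u w"
proof -
  have "ip K (reflect K v u) (reflect K v w) = (\<Sum>i\<in>K. (u i - 2 / ip K v v * ip K v u * v i) * (w i - 2 / ip K v v * ip K v w * v i))"
    using K by (auto simp: ip_def[of K "reflect K v u"] reflect_eq intro!: sum.cong)
  also have "\<dots> = ip K u w - 2 / ip K v v * ip K v w * ip K v u - 2 / ip K v v * ip K v u * ip K v w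
      + (2 / ip K v v * ip K v u) * (2 / ip K v v * ip K v w) * ip K v v"
  proof -
    have "(\<Sum>i\<in>K. (u i - \<beta> * v i) * (w i - \<gamma> * v i))
        = ip K u w - \<gamma> * ip K v u - \<beta> * ip K v w + \<beta> * \<gamma> * ip K v v" for \<beta> \<gamma>
      by (simp add: ip_def algebra_simps sum.distrib sum_subtractf sum_distrib_left)
    then show ?thesis by blast
  qed
  finally show ?thesis by (cases "ip K v v = 0") auto
qed

lemma reflect_fixes:
  assumes "finite K" "ip K v w = 0"
  shows "reflect K v w = w"
proof
  fix i show "reflect K v w i = w i"
    using assms by (cases "i \<in> K") (simp add: reflect_eq, simp add: reflect_def)
qed

text \<open>The hypothesis says that \<open>w\<close> and \<open>w + v\<close> have equal norm on
  \<open>K\<close>; reflection along their difference exchanges them.\<close>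

lemma reflect_moves:
  assumes K: "finite K" and v: "ip K v v = - 2 * ip K v w" and i: "i \<in> K"
  shows "reflect K v w i = w i + v i"
proof (cases "ip K v v = 0")
  case True
  then show ?thesis using ip_self_zero[OF K True i] K i by (simp add: reflect_eq)
next
  case False
  then have "2 / ip K v v * ip K v w = - 1" using v by (simp add: field_simps)
  then show ?thesis using K i by (simp add: reflect_eq)
qed

lemma gauss_reflect:
  fixes v :: "'k::countable \<Rightarrow> real"
  assumes K: "finite K"
  shows "distr gauss borel (reflect K v) = gauss"
proof -
  have "reflect K v = (\<lambda>x p. if p \<in> K then \<Sum>l\<in>K. reflect_mat K v p l * x l else x p)"
    by (simp add: fun_eq_iff reflect_def)
  then show ?thesis using gauss_orthogonal[OF K reflect_mat_orthogonal[OF K, of _ _ v]] by simp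
qed

text \<open>On pairs the map is block diagonal with one copy of \<open>reflect_mat\<close> for each
  component, so orthogonality carries over.\<close>

lemma gauss_reflect2:
  fixes v :: "'k::countable \<Rightarrow> real"
  assumes K: "finite K"
  shows "distr gauss borel (reflect2 K v :: ('k \<times> 'b::finite \<Rightarrow> real) \<Rightarrow> _) = gauss"
proof -
  let ?K = "K \<times> (UNIV :: 'b set)"
  let ?Q = "\<lambda>(p :: 'k \<times> 'b) (l :: 'k \<times> 'b). if snd p = snd l then reflect_mat K v (fst p) (fst l) else 0"
  have "(\<Sum>l\<in>?K. ?Q p l * ?Q r l) = (if p = r then 1 else 0)" if "p \<in> ?K" "r \<in> ?K" for p r :: "'k \<times> 'b"
  proof -
    have "(\<Sum>l\<in>?K. ?Q p l * ?Q r l) = (\<Sum>i\<in>K. \<Sum>b\<in>UNIV. if snd p = b \<and> snd r = b then reflect_mat K v (fst p) i * reflect_mat K v (fst r) i else 0)"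
      by (subst sum.cartesian_product) (auto intro!: sum.cong)
    also have "\<dots> = (\<Sum>i\<in>K. if snd p = snd r then reflect_mat K v (fst p) i * reflect_mat K v (fst r) i else 0)"
      by (intro sum.cong refl, cases "snd p = snd r") (auto simp: sum.delta intro!: sum.neutral)
    also have "\<dots> = (if p = r then 1 else 0)"
      using that reflect_mat_orthogonal[OF K, of "fst p" "fst r" v] prod_eq_iff[of p r]
      by (cases "snd p = snd r") auto
    finally show ?thesis .
  qed
  then have "distr gauss borel (\<lambda>x p. if p \<in> ?K then \<Sum>l\<in>?K. ?Q p l * x l else x p) = gauss"
    using K by (intro gauss_orthogonal) auto
  moreover have "reflect2 K v = (\<lambda>x p. if p \<in> ?K then \<Sum>l\<in>?K. ?Q p l * x l else x p)"
  proof (intro ext)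
    fix x :: "'k \<times> 'b \<Rightarrow> real" and p :: "'k \<times> 'b"
    obtain i a where p: "p = (i, a)" by force
    have "(\<Sum>l\<in>?K. ?Q p l * x l) = (\<Sum>j\<in>K. \<Sum>b\<in>UNIV. if a = b then reflect_mat K v i j * x (j, b) else 0)"
      by (subst sum.cartesian_product) (auto intro!: sum.cong simp: p)
    then show "reflect2 K v x p = (if p \<in> ?K then \<Sum>l\<in>?K. ?Q p l * x l else x p)"
      by (simp add: p reflect2_def reflect_def)
  qed
  ultimately show ?thesis by simp
qed

subsection \<open>Hotelling's statistic\<close>

lemma borel_measurable_det:
  fixes A :: "'a \<Rightarrow> real^'m^'m"
  assumes "\<And>i j. (\<lambda>x. A x $ i $ j) \<in> borel_measurable M"
  shows "(\<lambda>x. det (A x)) \<in> borel_measurable M"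
  unfolding det_def using assms by measurable

lemma continuous_on_det:
  fixes A :: "'a::topological_space \<Rightarrow> real^'m^'m"
  assumes "\<And>i j. continuous_on S (\<lambda>x. A x $ i $ j)"
  shows "continuous_on S (\<lambda>x. det (A x))"
  unfolding det_def by (intro continuous_intros assms)

lemma matrix_inv_inverse:
  fixes W :: "real^'m^'m"
  assumes "det W \<noteq> 0"
  shows "W ** matrix_inv W = mat 1" "matrix_inv W ** W = mat 1"
proof -
  have "\<exists>A'. W ** A' = mat 1 \<and> A' ** W = mat 1"
    using assms by (simp add: invertible_det_nz[symmetric] invertible_def)
  from someI_ex[OF this] show "W ** matrix_inv W = mat 1" "matrix_inv W ** W = mat 1"
    unfolding matrix_inv_def by auto
qed

lemma matrix_inv_solves:
  fixes W :: "real^'m^'m"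
  assumes "det W \<noteq> 0"
  shows "W *v (matrix_inv W *v b) = b"
  by (simp add: matrix_vector_mul_assoc matrix_inv_inverse[OF assms])

lemma matrix_inv_mult_eq:
  fixes W :: "real^'m^'m"
  assumes "det W \<noteq> 0" "W *v y = b"
  shows "matrix_inv W *v b = y"
  by (simp add: assms(2)[symmetric] matrix_vector_mul_assoc matrix_inv_inverse[OF assms(1)])

lemma matrix_inv_cramer:
  fixes W :: "real^'m^'m"
  assumes "det W \<noteq> 0"
  shows "matrix_inv W *v b = (\<chi> k. det (\<chi> i j. if j = k then b $ i else W $ i $ j) / det W)"
  using cramer[OF assms, of "matrix_inv W *v b" b] matrix_inv_solves[OF assms, of b] by simp

lemma det_zero_iff_kernel:
  fixes W :: "real^'m^'m"
  shows "det W = 0 \<longleftrightarrow> (\<exists>y. y \<noteq> 0 \<and> W *v y = 0)"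
proof -
  have "det W \<noteq> 0 \<longleftrightarrow> (\<forall>y. W *v y = 0 \<longrightarrow> y = 0)"
    by (simp only: invertible_det_nz[symmetric] invertible_left_inverse matrix_left_invertible_ker)
  then show ?thesis by blast
qed

lemma inner_transpose_mult:
  fixes R :: "real^'m^'n"
  shows "(transpose R *v x) \<bullet> y = x \<bullet> (R *v y)"
  by (simp add: transpose_matrix_vector dot_lmul_matrix)

definition colv :: "('i \<times> 'm \<Rightarrow> real) \<Rightarrow> 'm \<Rightarrow> 'i \<Rightarrow> real" where
  "colv z a i = z (i, a)"

definition gram :: "'i set \<Rightarrow> ('i \<times> 'm::finite \<Rightarrow> real) \<Rightarrow> real^'m^'m" where
  "gram K z = (\<chi> a b. ip K (colv z a) (colv z b))"

definition hotW :: "'i set \<Rightarrow> ('i \<times> 'm::finite \<Rightarrow> real) \<Rightarrow> ('i \<Rightarrow> real) \<Rightarrow> real^'m^'m" where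
  "hotW K z c = (\<chi> a b. ip K c c * ip K (colv z a) (colv z b) - ip K c (colv z a) * ip K c (colv z b))"

definition hotb :: "'i set \<Rightarrow> ('i \<times> 'm::finite \<Rightarrow> real) \<Rightarrow> ('i \<Rightarrow> real) \<Rightarrow> real^'m" where
  "hotb K z c = (\<chi> a. ip K c (colv z a))"

(* The value -1 marks a singular matrix; the quadratic form is never negative. *)
definition hotelling :: "'i set \<Rightarrow> ('i \<times> 'm::finite \<Rightarrow> real) \<Rightarrow> ('i \<Rightarrow> real) \<Rightarrow> real" where
  "hotelling K z c = (if det (hotW K z c) = 0 then -1
     else hotb K z c \<bullet> (matrix_inv (hotW K z c) *v hotb K z c))"

lemma hotelling_eq:
  assumes "det (hotW K z c) \<noteq> 0" "hotW K z c *v y = hotb K z c"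
  shows "hotelling K z c = hotb K z c \<bullet> y"
  using assms matrix_inv_mult_eq by (auto simp: hotelling_def)

lemma hotelling_cong:
  assumes "\<And>i. i \<in> K \<Longrightarrow> c i = c' i" "\<And>i a. i \<in> K \<Longrightarrow> z (i, a) = z' (i, a)"
  shows "hotelling K z c = hotelling K z' c'"
proof -
  have "ip K c c = ip K c' c'" "\<And>a. ip K c (colv z a) = ip K c' (colv z' a)"
     "\<And>a b. ip K (colv z a) (colv z b) = ip K (colv z' a) (colv z' b)"
    using assms by (auto intro!: ip_cong simp: colv_def)
  then show ?thesis by (simp add: hotelling_def hotW_def hotb_def)
qed

lemma colv_reflect2: "colv (reflect2 K v z) a = reflect K v (colv z a)"
  by (simp add: fun_eq_iff colv_def reflect2_def) (simp add: colv_def[abs_def])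

lemma hotelling_reflect:
  "finite K \<Longrightarrow> hotelling K (reflect2 K v z) (reflect K v c) = hotelling K z c"
  by (simp add: hotelling_def hotW_def hotb_def colv_reflect2 ip_reflect)

lemma gram_reflect: "finite K \<Longrightarrow> gram K (reflect2 K v z) = gram K z"
  by (simp add: gram_def colv_reflect2 ip_reflect)

text \<open>\<open>hotb\<close> scales by \<open>r\<close> and \<open>hotW\<close> by
  \<open>r\<^sup>2\<close>, which cancels in the quadratic form of the inverse.\<close>

lemma hotelling_scale:
  assumes r: "r \<noteq> 0"
  shows "hotelling K z (\<lambda>i. r * c i) = hotelling K z c"
proof -
  have 1: "ip K (\<lambda>i. r * c i) u = r * ip K c u" for u by (simp add: ip_def sum_distrib_left mult_ac)
  have 2: "ip K (\<lambda>i. r * c i) (\<lambda>i. r * c i) = r\<^sup>2 * ip K c c"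
    by (simp add: ip_def sum_distrib_left power2_eq_square mult_ac)
  have W: "hotW K z (\<lambda>i. r * c i) = r\<^sup>2 *\<^sub>R hotW K z c"
    by (simp add: vec_eq_iff hotW_def 1[of "colv z _"] 2 power2_eq_square right_diff_distrib mult_ac)
  have b: "hotb K z (\<lambda>i. r * c i) = r *\<^sub>R hotb K z c"
    by (simp add: vec_eq_iff hotb_def 1)
  have d: "det (hotW K z (\<lambda>i. r * c i)) = 0 \<longleftrightarrow> det (hotW K z c) = 0"
    unfolding W det_zero_iff_kernel using r by (simp add: scaleR_matrix_vector_assoc[symmetric])
  show ?thesis
  proof (cases "det (hotW K z c) = 0")
    case True
    then show ?thesis using d by (simp add: hotelling_def)
  next
    case False
    let ?y = "matrix_inv (hotW K z c) *v hotb K z c"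
    have y: "hotW K z c *v ?y = hotb K z c"
      by (rule matrix_inv_solves[OF False])
    have "hotelling K z (\<lambda>i. r * c i) = hotb K z (\<lambda>i. r * c i) \<bullet> ((1/r) *\<^sub>R ?y)"
      using r False d y unfolding W
      by (intro hotelling_eq) (simp_all add: W b matrix_vector_mult_scaleR scaleR_matrix_vector_assoc[symmetric] power2_eq_square)
    then show ?thesis using r False by (simp add: b hotelling_def)
  qed
qed

lemma ip_measurable [measurable (raw)]:
  assumes "\<And>i. i \<in> K \<Longrightarrow> (\<lambda>x. u x i) \<in> borel_measurable M" "\<And>i. i \<in> K \<Longrightarrow> (\<lambda>x. v x i) \<in> borel_measurable M"
  shows "(\<lambda>x. ip K (u x) (v x)) \<in> borel_measurable M"
  unfolding ip_def using assms by (intro borel_measurable_sum borel_measurable_times)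

text \<open>Cramer's rule turns the quadratic form into a quotient of determinants, so
  \<open>matrix_inv\<close> itself need not be shown measurable.\<close>

lemma hotelling_measurable:
  assumes z: "\<And>i a. (\<lambda>x. z x (i, a)) \<in> borel_measurable M"
    and c: "\<And>i. (\<lambda>x. c x i) \<in> borel_measurable M"
  shows "(\<lambda>x. hotelling K (z x) (c x)) \<in> borel_measurable M"
proof -
  have zc[measurable]: "(\<lambda>x. colv (z x) a i) \<in> borel_measurable M" for a i
    unfolding colv_def by (rule z)
  note c[measurable]
  have W[measurable]: "(\<lambda>x. hotW K (z x) (c x) $ a $ b) \<in> borel_measurable M" for a b
    unfolding hotW_def by simp measurable
  have b[measurable]: "(\<lambda>x. hotb K (z x) (c x) $ a) \<in> borel_measurable M" for a
    unfolding hotb_def by simp measurable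
  have [measurable]: "(\<lambda>x. det (hotW K (z x) (c x))) \<in> borel_measurable M"
    by (rule borel_measurable_det) measurable
  have [measurable]: "(\<lambda>x. det (\<chi> i j. if j = k then hotb K (z x) (c x) $ i else hotW K (z x) (c x) $ i $ j)) \<in> borel_measurable M" for k
    by (rule borel_measurable_det) simp
  have "hotelling K (z x) (c x) = (if det (hotW K (z x) (c x)) = 0 then -1 else
      \<Sum>k\<in>UNIV. hotb K (z x) (c x) $ k * (det (\<chi> i j. if j = k then hotb K (z x) (c x) $ i else hotW K (z x) (c x) $ i $ j) / det (hotW K (z x) (c x))))" for x
    by (simp add: hotelling_def inner_vec_def matrix_inv_cramer)
  then show ?thesis by simp
qed

text \<open>A reflection carries \<open>c\<close> to a constant vector of the same length. Applied
  to data and weights together it leaves the statistic alone, and applied to the data it preserves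
  the Gaussian law; the constant is then scaled to 1.\<close>

lemma hotelling_law_indep_of_weights:
  fixes K :: "'i::countable set"
  assumes K: "finite K" and c: "ip K c c > 0" and ne: "K \<noteq> {}"
  shows "distr gauss borel (\<lambda>z :: 'i \<times> 'm::finite \<Rightarrow> real. hotelling K z c) = distr gauss borel (\<lambda>z :: 'i \<times> 'm \<Rightarrow> real. hotelling K z (\<lambda>_. 1))"
proof -
  \<comment> \<open>The constant vector with entries \<open>r\<close> has the same norm on
    \<open>K\<close> as \<open>c\<close>.\<close>
  define r where "r = sqrt (ip K c c / real (card K))"
  have n: "0 < real (card K)" using K ne by (simp add: card_gt_0_iff)
  have r: "0 < r" "r\<^sup>2 * real (card K) = ip K c c" using c n by (simp_all add: r_def)
  define v where "v = (\<lambda>i. r - c i)"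
  have vd: "ip K v w = ip K (\<lambda>_. r) w - ip K c w" for w unfolding v_def by (rule ip_diff)
  have rr: "ip K (\<lambda>_. r) (\<lambda>_. r) = ip K c c" using r(2) by (simp add: ip_def power2_eq_square mult_ac)
  have "ip K v v = - 2 * ip K v c"
    using vd[of c] vd[of v] vd[of "\<lambda>_. r"] rr ip_commute[of K "\<lambda>_. r" v] ip_commute[of K c v]
      ip_commute[of K c "\<lambda>_. r"] by linarith
  then have moved: "reflect K v c i = r" if "i \<in> K" for i
    using reflect_moves[OF K _ that, of v c] by (simp add: v_def)
  have "hotelling K z c = hotelling K (reflect2 K v z) (\<lambda>_. 1)" for z :: "'i \<times> 'm \<Rightarrow> real"
  proof -
    have "hotelling K z c = hotelling K (reflect2 K v z) (reflect K v c)" using K by (simp add: hotelling_reflect)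
    also have "\<dots> = hotelling K (reflect2 K v z) (\<lambda>i. r * 1)" by (intro hotelling_cong) (auto simp: moved)
    also have "\<dots> = hotelling K (reflect2 K v z) (\<lambda>_. 1)" using r by (intro hotelling_scale) simp
    finally show ?thesis .
  qed
  then have "distr gauss borel (\<lambda>z :: 'i \<times> 'm \<Rightarrow> real. hotelling K z c)
      = distr (distr gauss borel (reflect2 K v)) borel (\<lambda>z :: 'i \<times> 'm \<Rightarrow> real. hotelling K z (\<lambda>_. 1))"
  proof (subst distr_distr)
    show "(\<lambda>z :: 'i \<times> 'm \<Rightarrow> real. hotelling K z (\<lambda>_. 1)) \<in> borel_measurable borel"
      by (rule hotelling_measurable) auto
    show "reflect2 K v \<in> measurable (gauss :: ('i \<times> 'm \<Rightarrow> real) measure) borel"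
      unfolding measurable_cong_sets[OF sets_gauss refl]
    proof (rule measurable_coordinatewise_then_product)
      fix p :: "'i \<times> 'm"
      show "(\<lambda>x. reflect2 K v x p) \<in> borel_measurable borel"
        by (cases p, cases "fst p \<in> K") (simp_all add: reflect2_def reflect_def)
    qed
  qed (simp add: comp_def)
  then show ?thesis by (simp add: gauss_reflect2[OF K])
qed

(* Triangular samples: all rows off J vanish, so that the statistic only sees the weights. *)
lemma hotelling_triangular:
  fixes J :: "'m::finite \<Rightarrow> 'i" and z :: "'i \<times> 'm \<Rightarrow> real"
  assumes K: "finite K" and J: "inj J" "range J \<subseteq> K"
    and z: "\<And>i a. i \<in> K - range J \<Longrightarrow> z (i, a) = 0"
    and A: "det (gram K z) \<noteq> 0" and r: "0 < (\<Sum>i\<in>K - range J. (c i)\<^sup>2)"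
  shows "hotelling K z c = (\<Sum>i\<in>range J. (c i)\<^sup>2) / (\<Sum>i\<in>K - range J. (c i)\<^sup>2)"
proof -
  define R :: "real^'m^'m" where "R = (\<chi> k a. z (J k, a))"
  define x :: "real^'m" where "x = (\<chi> k. c (J k))"
  let ?r = "\<Sum>i\<in>K - range J. (c i)\<^sup>2"
  have red: "ip K u (colv z a) = (\<Sum>k\<in>UNIV. u (J k) * R $ k $ a)" for u a
  proof -
    have "ip K u (colv z a) = (\<Sum>i\<in>range J. u i * z (i, a))"
      unfolding ip_def colv_def using K J z by (intro sum.mono_neutral_right) auto
    also have "\<dots> = (\<Sum>k\<in>UNIV. u (J k) * R $ k $ a)"
      using J(1) by (simp add: sum.reindex R_def)
    finally show ?thesis .
  qed
  have xx: "(\<Sum>i\<in>range J. (c i)\<^sup>2) = x \<bullet> x"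
    using J(1) by (simp add: sum.reindex x_def inner_vec_def power2_eq_square)
  have s: "ip K c c = x \<bullet> x + ?r"
    unfolding xx[symmetric] ip_def using K J(2)
    by (subst sum.subset_diff[OF J(2) K]) (simp add: power2_eq_square)
  have G: "gram K z = transpose R ** R"
    by (simp add: vec_eq_iff gram_def red matrix_matrix_mult_def transpose_def)
       (simp add: colv_def R_def)
  have b: "hotb K z c = transpose R *v x"
    by (simp add: vec_eq_iff hotb_def red matrix_vector_mult_def transpose_def x_def mult.commute)
  have dR: "det R \<noteq> 0" using A by (simp add: G det_mul)
  \<comment> \<open>As a matrix, \<open>hotW K z c\<close> is \<open>transpose R ** B ** R\<close>,
    where \<open>B\<close> is \<open>ip K c c\<close> times the identity minus the outer square of
    \<open>x\<close>.\<close>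
  have W: "hotW K z c *v y = transpose R *v (ip K c c *\<^sub>R (R *v y) - (x \<bullet> (R *v y)) *\<^sub>R x)" for y
  proof -
    have "hotW K z c = ip K c c *\<^sub>R gram K z - (\<chi> a b. hotb K z c $ a * hotb K z c $ b)"
      by (simp add: vec_eq_iff hotW_def gram_def hotb_def)
    moreover have "(\<chi> a b. hotb K z c $ a * hotb K z c $ b) *v y = (hotb K z c \<bullet> y) *\<^sub>R hotb K z c"
      by (simp add: vec_eq_iff matrix_vector_mult_def inner_vec_def sum_distrib_right sum_distrib_left mult_ac)
    moreover have "hotb K z c \<bullet> y = x \<bullet> (R *v y)"
      unfolding b by (rule inner_transpose_mult)
    ultimately show ?thesis
      by (simp add: matrix_vector_mult_diff_rdistrib scaleR_matrix_vector_assoc[symmetric] G b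
          matrix_vector_mul_assoc[symmetric] matrix_vector_mult_diff_distrib matrix_vector_mult_scaleR)
  qed
  have dTR: "det (transpose R) \<noteq> 0" using dR by simp
  have dW: "det (hotW K z c) \<noteq> 0"
  proof
    assume "det (hotW K z c) = 0"
    then obtain y where y: "y \<noteq> 0" "hotW K z c *v y = 0" unfolding det_zero_iff_kernel by blast
    define u where "u = R *v y"
    have "ip K c c *\<^sub>R u - (x \<bullet> u) *\<^sub>R x = 0"
      using y(2) dTR unfolding W u_def det_zero_iff_kernel by blast
    then have e: "ip K c c *\<^sub>R u = (x \<bullet> u) *\<^sub>R x" by simp
    have "ip K c c * (x \<bullet> u) = (x \<bullet> u) * (x \<bullet> x)"
      using arg_cong[OF e, of "\<lambda>w. x \<bullet> w"] by simp
    then have "?r * (x \<bullet> u) = 0" by (simp add: s algebra_simps)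
    then have "x \<bullet> u = 0" using r by simp
    moreover have "0 < ip K c c" using s r by (simp add: add_nonneg_pos)
    ultimately have "u = 0" using e by simp
    then show False using y(1) dR unfolding u_def det_zero_iff_kernel by blast
  qed
  \<comment> \<open>On the line through \<open>x\<close> the middle factor acts as multiplication by
    \<open>ip K c c - x \<bullet> x = ?r\<close>, so \<open>R *v y = x / ?r\<close> solves the
    system.\<close>
  define y where "y = matrix_inv R *v ((1 / ?r) *\<^sub>R x)"
  have y: "R *v y = (1 / ?r) *\<^sub>R x" unfolding y_def by (rule matrix_inv_solves[OF dR])
  have "hotW K z c *v y = transpose R *v (((x \<bullet> x + ?r) * (1 / ?r) - (x \<bullet> x) * (1 / ?r)) *\<^sub>R x)"
    unfolding W y s by (simp add: scaleR_diff_left mult.commute)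
  also have "(x \<bullet> x + ?r) * (1 / ?r) - (x \<bullet> x) * (1 / ?r) = 1"
    using r by (simp add: field_simps)
  finally have "hotW K z c *v y = hotb K z c" by (simp add: b)
  then have "hotelling K z c = hotb K z c \<bullet> y" by (rule hotelling_eq[OF dW])
  also have "\<dots> = x \<bullet> (R *v y)" unfolding b by (rule inner_transpose_mult)
  also have "\<dots> = (x \<bullet> x) / ?r" by (simp add: y)
  finally show ?thesis by (simp add: xx)
qed

lemma AE_std_normal_neq: "AE x in std_normal_distribution. x \<noteq> a"
proof -
  have "AE x in lborel. x \<noteq> a" by (rule AE_lborel_singleton)
  then show ?thesis by (subst AE_density) auto
qed

lemma AE_gauss_sum_squares_pos:
  assumes I: "finite I" "I \<noteq> {}"
  shows "AE c in gauss. 0 < (\<Sum>i\<in>I. (c i)\<^sup>2)"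
proof -
  obtain i where i: "i \<in> I" using I by blast
  have "AE c in gauss. c i \<noteq> 0"
    unfolding gauss_def by (rule AE_PiM_component) (auto intro: prob_space_std_normal AE_std_normal_neq)
  then show ?thesis
  proof (rule AE_mp, intro AE_I2 impI)
    fix c :: "'a \<Rightarrow> real" assume "c i \<noteq> 0"
    then show "0 < (\<Sum>i\<in>I. (c i)\<^sup>2)" using I i by (intro sum_pos2[of I i]) auto
  qed
qed

lemma reflect_measurable: 
  fixes v :: "'k::countable \<Rightarrow> real"
  shows "reflect K v \<in> borel_measurable borel"
proof (rule measurable_coordinatewise_then_product)
  fix p show "(\<lambda>x. reflect K v x p) \<in> borel_measurable borel"
    by (cases "p \<in> K") (simp_all add: reflect_def)
qed

text \<open>Here the data are frozen and the weights are Gaussian. Reflections clear the columns one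
  after another, as in a QR decomposition; each preserves the law of the weights and the Gram
  matrix. \<open>D\<close> is the set of finished columns, and the induction is on the number of the
  others.\<close>

lemma hotelling_law_of_weights:
  fixes J :: "'m::finite \<Rightarrow> 'i::countable" and z :: "'i \<times> 'm \<Rightarrow> real"
  assumes K: "finite K" and J: "inj J" "range J \<subseteq> K" "K - range J \<noteq> {}"
    and det: "det (gram K z) \<noteq> 0"
  shows "distr gauss borel (hotelling K z)
    = distr gauss borel (\<lambda>c. (\<Sum>i\<in>range J. (c i)\<^sup>2) / (\<Sum>i\<in>K - range J. (c i)\<^sup>2))"
proof -
  have hm: "hotelling K z \<in> borel_measurable borel" for z :: "'i \<times> 'm \<Rightarrow> real"
    by (rule hotelling_measurable) auto
  have "distr gauss borel (hotelling K z)
    = distr gauss borel (\<lambda>c. (\<Sum>i\<in>range J. (c i)\<^sup>2) / (\<Sum>i\<in>K - range J. (c i)\<^sup>2))"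
    if "\<And>a i. a \<in> D \<Longrightarrow> i \<in> K - J ` D \<Longrightarrow> z (i, a) = 0" and "det (gram K z) \<noteq> 0"
    for D and z :: "'i \<times> 'm \<Rightarrow> real"
    using that
  proof (induction "card (- D)" arbitrary: D z)
    case 0
    then have D: "D = UNIV" by (metis Compl_empty_eq card_0_eq double_complement finite)
    have "AE c in gauss. 0 < (\<Sum>i\<in>K - range J. (c i)\<^sup>2)"
      using K J by (intro AE_gauss_sum_squares_pos) auto
    then have "AE c in gauss. hotelling K z c = (\<Sum>i\<in>range J. (c i)\<^sup>2) / (\<Sum>i\<in>K - range J. (c i)\<^sup>2)"
    proof (rule AE_mp, intro AE_I2 impI)
      fix c :: "'i \<Rightarrow> real" assume "0 < (\<Sum>i\<in>K - range J. (c i)\<^sup>2)"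
      then show "hotelling K z c = (\<Sum>i\<in>range J. (c i)\<^sup>2) / (\<Sum>i\<in>K - range J. (c i)\<^sup>2)"
        using K J 0 D by (intro hotelling_triangular) auto
    qed
    then show ?case
      by (intro distr_cong_AE refl) (auto simp: measurable_cong_sets[OF sets_gauss refl] hm)
  next
    case (Suc n)
    then have "- D \<noteq> {}" by force
    then obtain b where b: "b \<notin> D" by blast
    \<comment> \<open>The rows that are not pivots of finished columns.\<close>
    define E where "E = K - J ` D"
    have Jb: "J b \<in> E" using b J by (auto simp: E_def inj_eq)
    \<comment> \<open>The part of column \<open>b\<close> on these rows is to be moved onto its
      pivot \<open>J b\<close>. Since \<open>v = u' - u\<close> vanishes off \<open>E\<close> and
      finished columns vanish on \<open>E\<close>, the reflection along \<open>v\<close> leaves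
      finished columns fixed.\<close>
    define u where "u = (\<lambda>i. if i \<in> E then z (i, b) else 0)"
    define r where "r = sqrt (ip K u u)"
    define u' where "u' = (\<lambda>i. if i = J b then r else 0)"
    define v where "v = (\<lambda>i. u' i - u i)"
    have v0: "v i = 0" if "i \<notin> E" for i using that Jb by (auto simp: v_def u_def u'_def)
    have u'u': "ip K u' u' = ip K u u"
    proof -
      have "ip K u' u' = (\<Sum>i\<in>K. if i = J b then r\<^sup>2 else 0)"
        unfolding ip_def u'_def by (intro sum.cong) (auto simp: power2_eq_square)
      then show ?thesis using K Jb ip_self_nonneg[of K u] by (simp add: E_def r_def)
    qed
    have vw: "ip K v w = ip K v w'" if "\<And>i. i \<in> E \<Longrightarrow> w i = w' i" for w w'
      unfolding ip_def using v0 that by (intro sum.cong refl) (metis mult_zero_left)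
    have vd: "ip K v w = ip K u' w - ip K u w" for w unfolding v_def by (rule ip_diff)
    have "ip K v (colv z b) = ip K v u" by (rule vw) (simp add: colv_def u_def)
    then have vv: "ip K v v = - 2 * ip K v (colv z b)"
      using vd[of v] vd[of u] vd[of u'] u'u' ip_commute[of K u v] ip_commute[of K u' v] ip_commute[of K u u']
      by linarith
    have va: "ip K v (colv z a) = 0" if "a \<in> D" for a
      using vw[of "colv z a" "\<lambda>_. 0"] Suc.prems(1)[OF that] by (simp add: colv_def E_def ip_def)
    define z' where "z' = reflect2 K v z"
    have z'_zero: "z' (i, a) = 0" if "a \<in> insert b D" "i \<in> K - J ` insert b D" for i a
    proof (cases "a = b")
      case True
      then have "z' (i, a) = z (i, b) + v i"
        using reflect_moves[OF K vv, of i] that by (simp add: z'_def reflect2_def colv_def[abs_def])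
      then show ?thesis using that by (auto simp: v_def u_def u'_def E_def)
    next
      case False
      then have "a \<in> D" using that by simp
      then have "z' (i, a) = z (i, a)"
        using reflect_fixes[OF K va[of a]] by (simp add: z'_def reflect2_def colv_def[abs_def])
      then show ?thesis using Suc.prems(1)[OF \<open>a \<in> D\<close>, of i] that by simp
    qed
    have "- D = insert b (- insert b D)" using b by auto
    then have cn: "n = card (- insert b D)" using Suc.hyps(2) by simp
    have "hotelling K z = (\<lambda>c. hotelling K z' (reflect K v c))"
      by (simp add: z'_def hotelling_reflect[OF K] fun_eq_iff)
    then have "distr gauss borel (hotelling K z) = distr (distr gauss borel (reflect K v)) borel (hotelling K z')"
      by (subst distr_distr) (auto simp: comp_def measurable_cong_sets[OF sets_gauss refl] hm reflect_measurable)
    also have "\<dots> = distr gauss borel (hotelling K z')" by (simp add: gauss_reflect[OF K])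
    also have "\<dots> = distr gauss borel (\<lambda>c. (\<Sum>i\<in>range J. (c i)\<^sup>2) / (\<Sum>i\<in>K - range J. (c i)\<^sup>2))"
      using Suc.prems(2) by (intro Suc.hyps(1)[OF cn] z'_zero) (auto simp: z'_def gram_reflect[OF K])
    finally show ?case .
  qed
  from this[of "{}"] det show ?thesis by simp
qed

text \<open>Given all other coordinates, the affine expression vanishes for one value of
  \<open>z k\<close> only, which a normal variable avoids almost surely. Fubini on the splitting
  into coordinate \<open>k\<close> and the rest concludes.\<close>

lemma AE_gauss_affine_neq_0:
  fixes C r :: "('k::countable \<Rightarrow> real) \<Rightarrow> real"
  assumes [measurable]: "C \<in> borel_measurable borel" "r \<in> borel_measurable borel"
    and C: "\<And>z t. C (z(k := t)) = C z" and r: "\<And>z t. r (z(k := t)) = r z"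
    and AE: "AE z in gauss. C z \<noteq> 0"
  shows "AE z in gauss. z k * C z + r z \<noteq> 0"
proof -
  let ?N = "std_normal_distribution"
  let ?M = "PiM (UNIV - {k}) (\<lambda>_. ?N)"
  interpret N: prob_space ?N by (rule prob_space_std_normal)
  interpret M: prob_space ?M by (intro prob_space_PiM prob_space_std_normal)
  interpret NM: pair_sigma_finite ?N ?M ..
  have g: "distr (?N \<Otimes>\<^sub>M ?M) gauss (\<lambda>(x, X). X(k := x)) = gauss"
    using distr_pair_PiM_eq_PiM[of "UNIV - {k}" "\<lambda>_. ?N" k] prob_space_std_normal
    by (simp add: gauss_def insert_Diff_single)
  have upd: "(\<lambda>(x, X). X(k := x)) \<in> measurable (?N \<Otimes>\<^sub>M ?M) gauss"
    unfolding gauss_def using measurable_add_dim[of k "UNIV - {k}" "\<lambda>_. ?N"]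
    by (simp add: insert_Diff_single)
  let ?Q = "\<lambda>z. z k * C z + r z \<noteq> 0"
  have [measurable]: "C \<in> borel_measurable gauss" "r \<in> borel_measurable gauss"
     "(\<lambda>z. z k) \<in> borel_measurable gauss"
    by (simp_all add: measurable_cong_sets[OF sets_gauss refl])
  note upd[measurable]
  have Qm[measurable]: "{z \<in> space gauss. ?Q z} \<in> sets gauss" by measurable
  have meas: "{p \<in> space (?N \<Otimes>\<^sub>M ?M). ?Q ((snd p)(k := fst p))} \<in> sets (?N \<Otimes>\<^sub>M ?M)"
    using measurable_sets[OF upd Qm] by (simp add: vimage_def Int_def case_prod_beta conj_commute)
  have "AE p in ?N \<Otimes>\<^sub>M ?M. C ((snd p)(k := fst p)) \<noteq> 0"
    using AE by (subst (asm) g[symmetric], subst (asm) AE_distr_iff[OF upd]) (auto simp: case_prod_beta)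
  then have "AE x in ?N. AE X in ?M. C (X(k := x)) \<noteq> 0"
    using NM.AE_pair by fastforce
  then have "AE x in ?N. AE X in ?M. C X \<noteq> 0" by (simp add: C)
  then have "AE X in ?M. C X \<noteq> 0" by simp
  then have "AE X in ?M. AE x in ?N. x * C X + r X \<noteq> 0"
  proof (rule eventually_mono)
    fix X :: "'k \<Rightarrow> real" assume "C X \<noteq> 0"
    then have "x * C X + r X \<noteq> 0 \<longleftrightarrow> x \<noteq> - r X / C X" for x by (auto simp: field_simps)
    then show "AE x in ?N. x * C X + r X \<noteq> 0" using AE_std_normal_neq[of "- r X / C X"] by simp
  qed
  then have "AE X in ?M. AE x in ?N. (X(k := x)) k * C (X(k := x)) + r (X(k := x)) \<noteq> 0"
    by (simp add: C r)
  then have "AE x in ?N. AE X in ?M. (X(k := x)) k * C (X(k := x)) + r (X(k := x)) \<noteq> 0"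
    using NM.AE_commute[of "\<lambda>x X. ?Q (X(k := x))"] meas by blast
  then have "AE p in ?N \<Otimes>\<^sub>M ?M. ?Q (case p of (x, X) \<Rightarrow> X(k := x))"
    by (intro NM.AE_pair_measure) (use meas in \<open>simp_all add: case_prod_beta\<close>)
  then have "AE z in distr (?N \<Otimes>\<^sub>M ?M) gauss (\<lambda>(x, X). X(k := x)). ?Q z"
    by (subst AE_distr_iff[OF upd]) auto
  then show ?thesis unfolding g .
qed

text \<open>The rows of the identity matrix are replaced by Gaussian rows one at a time. The new
  determinant is affine in the fresh diagonal entry, with the old determinant as
  coefficient.\<close>

lemma AE_gauss_det:
  fixes J :: "'m::finite \<Rightarrow> 'i::countable"
  assumes J: "inj J"
  shows "AE z in gauss. det (\<chi> k a. z (J k, a :: 'm)) \<noteq> 0"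
proof -
  define RB where "RB = (\<lambda>B z. (\<chi> k a. if k \<in> B then z (J k, a) else if k = a then 1 else 0) :: real^'m^'m)"
  have m: "(\<lambda>z. det (f z)) \<in> borel_measurable borel"
    if "\<And>i j. (\<lambda>z. f z $ i $ j) \<in> borel_measurable borel" for f :: "('i \<times> 'm \<Rightarrow> real) \<Rightarrow> real^'m^'m"
    by (rule borel_measurable_det[OF that])
  have "AE z in gauss. det (RB B z) \<noteq> 0" for B
  proof (induction B rule: finite_induct[OF finite])
    case 1
    have "RB {} z = mat 1" for z by (simp add: RB_def mat_def)
    then show ?case by simp
  next
    case (2 b B)
    \<comment> \<open>The contribution of row \<open>b\<close> with its diagonal entry set to 0; it
      does not involve the coordinate \<open>(J b, b)\<close>.\<close>
    define rest where "rest = (\<lambda>z. det (\<chi> k. if k = b then (\<chi> a. if a = b then 0 else z (J b, a)) else RB B z $ k))"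
    have cell: "(\<lambda>z :: 'i \<times> 'm \<Rightarrow> real. RB B z $ k $ a) \<in> borel_measurable borel" for k a
      by (cases "k \<in> B"; cases "k = a") (simp_all add: RB_def)
    have rm: "rest \<in> borel_measurable borel"
      unfolding rest_def
    proof (rule m)
      fix i j show "(\<lambda>z. (\<chi> k. if k = b then (\<chi> a. if a = b then 0 else z (J b, a)) else RB B z $ k) $ i $ j) \<in> borel_measurable borel"
        by (cases "i = b"; cases "j = b") (simp_all add: cell)
    qed
    have upd: "RB B (z((J b, b) := t)) = RB B z" for z t
      using 2 J by (auto simp: RB_def vec_eq_iff inj_eq)
    have ru: "rest (z((J b, b) := t)) = rest z" for z t
      unfolding rest_def upd by (intro arg_cong[where f=det]) (auto simp: vec_eq_iff)
    have dec: "det (RB (insert b B) z) = z (J b, b) * det (RB B z) + rest z" for z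
    proof -
      have "RB (insert b B) z = (\<chi> k. if k = b then z (J b, b) *s axis b 1 + (\<chi> a. if a = b then 0 else z (J b, a)) else RB B z $ k)"
        using 2 by (auto simp: RB_def vec_eq_iff axis_def)
      then have "det (RB (insert b B) z) = z (J b, b) * det (\<chi> k. if k = b then axis b 1 else RB B z $ k) + rest z"
        by (simp add: det_row_add det_row_mul rest_def)
      moreover have "(\<chi> k. if k = b then axis b 1 else RB B z $ k) = RB B z"
        using 2 by (auto simp: RB_def vec_eq_iff axis_def)
      ultimately show ?thesis by simp
    qed
    show ?case
      unfolding dec by (rule AE_gauss_affine_neq_0[OF m[OF cell] rm]) (use upd ru 2 in simp_all)
  qed
  from this[of UNIV] show ?thesis by (simp add: RB_def)
qed

text \<open>For a kernel vector \<open>y\<close> of the Gram matrix,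
  \<open>y \<bullet> (gram K z *v y)\<close> is a vanishing sum of squares, so \<open>y\<close> also
  lies in the kernel of the square block of rows picked by \<open>J\<close>.\<close>

lemma AE_gauss_gram:
  fixes J :: "'m::finite \<Rightarrow> 'i::countable"
  assumes K: "finite K" and J: "inj J" "range J \<subseteq> K"
  shows "AE z in gauss. det (gram K z :: real^'m^'m) \<noteq> 0"
  using AE_gauss_det[OF J(1)]
proof (rule AE_mp, intro AE_I2 impI notI)
  fix z :: "'i \<times> 'm \<Rightarrow> real"
  assume R: "det (\<chi> k a. z (J k, a)) \<noteq> 0" and "det (gram K z) = 0"
  then obtain y where y: "y \<noteq> 0" "gram K z *v y = 0" by (auto simp: det_zero_iff_kernel)
  have "(\<Sum>i\<in>K. (\<Sum>a\<in>UNIV. z (i, a) * y $ a)\<^sup>2) = y \<bullet> (gram K z *v y)"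
    by (simp add: inner_vec_def matrix_vector_mult_def gram_def ip_def colv_def power2_eq_square
        sum_product sum_distrib_left sum_distrib_right)
       (subst sum.swap, intro sum.cong refl, subst sum.swap, simp add: mult_ac)
  then have "(\<Sum>i\<in>K. (\<Sum>a\<in>UNIV. z (i, a) * y $ a)\<^sup>2) = 0" by (simp add: y)
  then have "(\<Sum>a\<in>UNIV. z (i, a) * y $ a) = 0" if "i \<in> K" for i
    using K that by (simp add: sum_nonneg_eq_0_iff)
  then have "(\<chi> k a. z (J k, a)) *v y = 0"
    using J(2) by (auto simp: vec_eq_iff matrix_vector_mult_def)
  then show False using R y(1) by (auto simp: det_zero_iff_kernel)
qed

theorem hotelling_law:
  fixes J :: "'m::finite \<Rightarrow> 'i::countable"
  assumes K: "finite K" and J: "inj J" "range J \<subseteq> K" "K - range J \<noteq> {}"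
  shows "distr gauss borel (\<lambda>z :: 'i \<times> 'm \<Rightarrow> real. hotelling K z (\<lambda>_. 1))
    = distr gauss borel (\<lambda>c. (\<Sum>i\<in>range J. (c i)\<^sup>2) / (\<Sum>i\<in>K - range J. (c i)\<^sup>2))" (is "?L = ?R")
proof (rule measure_eqI)
  show "sets ?L = sets ?R" by simp
  fix B assume "B \<in> sets ?L"
  then have B[measurable]: "B \<in> sets borel" by simp
  let ?Z = "gauss :: ('i \<times> 'm \<Rightarrow> real) measure" and ?C = "gauss :: ('i \<Rightarrow> real) measure"
  interpret CZ: pair_sigma_finite ?C ?Z ..
  have mZ: "(\<lambda>z. z p) \<in> borel_measurable ?Z" for p by (simp add: measurable_cong_sets[OF sets_gauss refl])
  have mC: "(\<lambda>c. c i) \<in> borel_measurable ?C" for i by (simp add: measurable_cong_sets[OF sets_gauss refl])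
  have joint: "(\<lambda>p. hotelling K (snd p) (fst p)) \<in> borel_measurable (?C \<Otimes>\<^sub>M ?Z)"
    by (rule hotelling_measurable) (use mZ mC in measurable)
  have mz: "(\<lambda>z. hotelling K z c) \<in> borel_measurable ?Z" for c
    by (rule hotelling_measurable) (use mZ in auto)
  have mc: "hotelling K z \<in> borel_measurable ?C" for z :: "'i \<times> 'm \<Rightarrow> real"
    by (rule hotelling_measurable) (use mC in auto)
  have "AE c in ?C. 0 < (\<Sum>i\<in>K. (c i)\<^sup>2)"
    using K J by (intro AE_gauss_sum_squares_pos) auto
  then have "AE c in ?C. emeasure ?L B = (\<integral>\<^sup>+z. indicator B (hotelling K z c) \<partial>?Z)"
  proof (rule AE_mp, intro AE_I2 impI)
    fix c :: "'i \<Rightarrow> real" assume "0 < (\<Sum>i\<in>K. (c i)\<^sup>2)"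
    then have "distr ?Z borel (\<lambda>z. hotelling K z c) = ?L"
      using K J by (intro hotelling_law_indep_of_weights) (auto simp: ip_def power2_eq_square)
    then have "emeasure ?L B = (\<integral>\<^sup>+y. indicator B y \<partial>distr ?Z borel (\<lambda>z. hotelling K z c))" by simp
    also have "\<dots> = (\<integral>\<^sup>+z. indicator B (hotelling K z c) \<partial>?Z)"
      by (rule nn_integral_distr) (use mz in auto)
    finally show "emeasure ?L B = (\<integral>\<^sup>+z. indicator B (hotelling K z c) \<partial>?Z)" .
  qed
  then have "(\<integral>\<^sup>+c. emeasure ?L B \<partial>?C) = (\<integral>\<^sup>+c. \<integral>\<^sup>+z. indicator B (hotelling K z c) \<partial>?Z \<partial>?C)"
    by (rule nn_integral_cong_AE)
  also have "\<dots> = (\<integral>\<^sup>+z. \<integral>\<^sup>+c. indicator B (hotelling K z c) \<partial>?C \<partial>?Z)"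
    using CZ.Fubini[of "\<lambda>p. indicator B (hotelling K (snd p) (fst p))"] joint by simp
  also have "\<dots> = (\<integral>\<^sup>+z. emeasure ?R B \<partial>?Z)"
  proof (rule nn_integral_cong_AE, rule AE_mp[OF AE_gauss_gram[OF K J(1,2)]], intro AE_I2 impI)
    fix z :: "'i \<times> 'm \<Rightarrow> real" assume "det (gram K z) \<noteq> 0"
    then have "distr ?C borel (hotelling K z) = ?R" by (rule hotelling_law_of_weights[OF K J])
    then have "emeasure ?R B = (\<integral>\<^sup>+y. indicator B y \<partial>distr ?C borel (hotelling K z))" by simp
    also have "\<dots> = (\<integral>\<^sup>+c. indicator B (hotelling K z c) \<partial>?C)"
      by (rule nn_integral_distr) (use mc in auto)
    finally show "(\<integral>\<^sup>+c. indicator B (hotelling K z c) \<partial>?C) = emeasure ?R B" by simp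
  qed
  finally show "emeasure ?L B = emeasure ?R B"
    by (simp add: gauss.emeasure_space_1[unfolded space_gauss])
qed

section \<open>Gaussian sums of squares and the F-distribution\<close>

lemma chi_square_eq:
  assumes I: "finite I"
  shows "distr (PiM I (\<lambda>_. std_normal_distribution)) borel (\<lambda>z. \<Sum>i\<in>I. (z i)\<^sup>2) = chi_square (card I)"
proof -
  let ?N = "\<lambda>_. std_normal_distribution"
  obtain h where h: "bij_betw h {..<card I} I"
    using ex_bij_betw_nat_finite[OF I] by (auto simp: atLeast0LessThan)
  have r: "distr (PiM I ?N) (PiM {..<card I} ?N) (\<lambda>\<omega>. \<lambda>n\<in>{..<card I}. \<omega> (h n)) = PiM {..<card I} ?N"
    using distr_PiM_reindex[of I ?N h "{..<card I}"] h prob_space_std_normal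
    by (auto simp: bij_betw_def)
  have "chi_square (card I) = distr (PiM {..<card I} ?N) borel (\<lambda>z. \<Sum>i<card I. (z i)\<^sup>2)"
    by (simp add: chi_square_def)
  also have "\<dots> = distr (PiM I ?N) borel (\<lambda>z. \<Sum>i<card I. (z (h i))\<^sup>2)"
    using h by (subst r[symmetric], subst distr_distr)
      (auto simp: comp_def bij_betw_def intro!: measurable_restrict measurable_component_singleton distr_cong)
  also have "(\<lambda>z :: 'a \<Rightarrow> real. \<Sum>i<card I. (z (h i))\<^sup>2) = (\<lambda>z. \<Sum>i\<in>I. (z i)\<^sup>2)"
    using sum.reindex_bij_betw[OF h, of "\<lambda>i. (z i)\<^sup>2" for z :: "'a \<Rightarrow> real"] by auto
  finally show ?thesis ..
qed

lemma prob_space_chi_square: "prob_space (chi_square r)"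
  unfolding chi_square_def
  by (intro prob_space.prob_space_distr prob_space_PiM prob_space_std_normal) auto

text \<open>Sums over disjoint coordinate sets are functions of independent blocks, so their joint
  law is the product of two chi-square laws.\<close>

lemma gauss_ratio_law:
  fixes A B :: "'i::countable set" and g :: "real \<Rightarrow> real \<Rightarrow> real"
  assumes fin: "finite A" "finite B" and dis: "A \<inter> B = {}"
    and g: "(\<lambda>(u, v). g u v) \<in> borel_measurable (borel \<Otimes>\<^sub>M borel)"
  shows "distr gauss borel (\<lambda>c. g (\<Sum>i\<in>A. (c i)\<^sup>2) (\<Sum>i\<in>B. (c i)\<^sup>2))
    = distr (chi_square (card A) \<Otimes>\<^sub>M chi_square (card B)) borel (\<lambda>(u, v). g u v)"
proof -
  let ?N = "\<lambda>_::'i. std_normal_distribution"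
  let ?q = "\<lambda>I z. \<Sum>i\<in>I. (z i)\<^sup>2"
  have qm: "?q I \<in> borel_measurable (PiM I ?N)" if "finite I" for I
    by (intro borel_measurable_sum borel_measurable_power) (auto intro: measurable_component_singleton)
  have gm: "(\<lambda>c. g (?q A c) (?q B c)) \<in> borel_measurable (PiM (A \<union> B) ?N)"
    by (rule measurable_compose[where g="\<lambda>(u, v). g u v", OF _ g, of "\<lambda>c. (?q A c, ?q B c)", simplified])
       (auto intro!: measurable_Pair borel_measurable_sum borel_measurable_power measurable_component_singleton)
  have 1: "distr gauss borel (\<lambda>c. g (?q A c) (?q B c))
      = distr (PiM (A \<union> B) ?N) borel (\<lambda>c. g (?q A c) (?q B c))"
  proof -
    have "(\<lambda>c. g (?q A c) (?q B c)) = (\<lambda>c. g (?q A c) (?q B c)) \<circ> (\<lambda>x. restrict x (A \<union> B))"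
      by (simp add: fun_eq_iff)
    then have "distr gauss borel (\<lambda>c. g (?q A c) (?q B c))
      = distr (distr gauss (PiM (A \<union> B) ?N) (\<lambda>x. restrict x (A \<union> B))) borel (\<lambda>c. g (?q A c) (?q B c))"
      unfolding gauss_def by (subst distr_distr) (auto intro!: gm measurable_restrict_subset)
    then show ?thesis
      using fin std_normal.distr_PiM_restrict_finite[of "A \<union> B"] by (simp add: gauss_def)
  qed
  also have "\<dots> = distr (PiM A ?N \<Otimes>\<^sub>M PiM B ?N) borel (\<lambda>p. g (?q A (fst p)) (?q B (snd p)))"
  proof -
    have m: "?q A (merge A B p) = ?q A (fst p)" "?q B (merge A B p) = ?q B (snd p)" for p :: "('i \<Rightarrow> real) \<times> ('i \<Rightarrow> real)"
      using dis by (cases p, auto intro!: sum.cong simp: merge_def)+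
    show ?thesis
      by (subst std_normal.distr_merge[OF dis fin, symmetric], subst distr_distr) (auto intro!: gm measurable_merge simp: comp_def m)
  qed
  also have "\<dots> = distr (distr (PiM A ?N) borel (?q A) \<Otimes>\<^sub>M distr (PiM B ?N) borel (?q B)) borel (\<lambda>(u, v). g u v)"
  proof -
    have sf: "sigma_finite_measure (distr (PiM B ?N) borel (?q B))"
      unfolding chi_square_eq[OF fin(2)]
      by (intro finite_measure.axioms(1) prob_space.finite_measure prob_space_chi_square)
    have qq: "(\<lambda>(x, y). (?q A x, ?q B y)) \<in> measurable (PiM A ?N \<Otimes>\<^sub>M PiM B ?N) (borel \<Otimes>\<^sub>M borel)"
      using qm[OF fin(1)] qm[OF fin(2)] by measurable
    have "(\<lambda>p. g (?q A (fst p)) (?q B (snd p))) = (\<lambda>(u, v). g u v) \<circ> (\<lambda>(x, y). (?q A x, ?q B y))"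
      by (simp add: fun_eq_iff case_prod_beta)
    then have "distr (PiM A ?N \<Otimes>\<^sub>M PiM B ?N) borel (\<lambda>p. g (?q A (fst p)) (?q B (snd p)))
        = distr (distr (PiM A ?N \<Otimes>\<^sub>M PiM B ?N) (borel \<Otimes>\<^sub>M borel) (\<lambda>(x, y). (?q A x, ?q B y))) borel (\<lambda>(u, v). g u v)"
      by (simp only: distr_distr[OF g qq])
    then show ?thesis
      by (simp only: pair_measure_distr[OF qm[OF fin(1)] qm[OF fin(2)] sf])
  qed
  finally show ?thesis by (simp add: chi_square_eq fin)
qed

corollary hotelling_F_law:
  fixes J :: "'m::finite \<Rightarrow> 'i::countable"
  assumes K: "finite K" and J: "inj J" "range J \<subseteq> K" "K - range J \<noteq> {}"
  defines "n \<equiv> card K"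
  shows "distr gauss borel (\<lambda>z :: 'i \<times> 'm \<Rightarrow> real. (real n - 1) * hotelling K z (\<lambda>_. 1))
    = distr (F_distribution CARD('m) (n - CARD('m))) borel
        (\<lambda>y. real CARD('m) * (real n - 1) / (real n - real CARD('m)) * y)"
proof -
  have cJ: "card (range J) = CARD('m)" using J(1) by (simp add: card_image)
  have cK: "card (K - range J) = n - CARD('m)" using K J cJ by (simp add: n_def card_Diff_subset finite_subset)
  have lt: "CARD('m) < n"
    using K J cJ psubset_card_mono[of K "range J"] by (auto simp: n_def)
  have m0: "0 < CARD('m)" by simp
  let ?P = "chi_square CARD('m) \<Otimes>\<^sub>M chi_square (n - CARD('m))"
  have sets: "sets ?P = sets (borel \<Otimes>\<^sub>M borel)"
    by (intro sets_pair_measure_cong) (simp_all add: chi_square_def)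
  have m1: "(\<lambda>(u, v). u / v) \<in> borel_measurable (borel \<Otimes>\<^sub>M borel :: (real \<times> real) measure)"
    by measurable
  have m2: "(\<lambda>(u, v). (u / real CARD('m)) / (v / real (n - CARD('m)))) \<in> borel_measurable (borel \<Otimes>\<^sub>M borel :: (real \<times> real) measure)"
    by measurable
  have hm: "(\<lambda>z :: 'i \<times> 'm \<Rightarrow> real. hotelling K z (\<lambda>_. 1)) \<in> borel_measurable gauss"
    by (rule hotelling_measurable) (auto simp: measurable_cong_sets[OF sets_gauss refl])
  have "distr gauss borel (\<lambda>z :: 'i \<times> 'm \<Rightarrow> real. (real n - 1) * hotelling K z (\<lambda>_. 1))
     = distr (distr gauss borel (\<lambda>z :: 'i \<times> 'm \<Rightarrow> real. hotelling K z (\<lambda>_. 1))) borel (\<lambda>t. (real n - 1) * t)"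
    using hm by (subst distr_distr) (auto simp: comp_def)
  also have "\<dots> = distr (distr ?P borel (\<lambda>(u, v). u / v)) borel (\<lambda>t. (real n - 1) * t)"
    unfolding hotelling_law[OF K J]
    using gauss_ratio_law[of "range J" "K - range J" "(/)"] K m1 by (simp add: cJ cK)
  also have "\<dots> = distr ?P borel (\<lambda>p. (real n - 1) * (fst p / snd p))"
    using m1 by (subst distr_distr) (auto simp: comp_def case_prod_beta' measurable_cong_sets[OF sets refl])
  \<comment> \<open>Dividing numerator and denominator by their degrees of freedom brings in the
    factor \<open>m / (n - m)\<close>.\<close>
  also have "(\<lambda>p :: real \<times> real. (real n - 1) * (fst p / snd p)) = (\<lambda>p. real CARD('m) * (real n - 1) / (real n - real CARD('m)) * ((fst p / real CARD('m)) / (snd p / real (n - CARD('m)))))"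
  proof -
    have "N * (a / b) = m * N / k * ((a / m) / (b / k))" if "m \<noteq> 0" "k \<noteq> 0" for N a b m k :: real
      using that by simp
    then show ?thesis using lt m0 by (simp add: fun_eq_iff of_nat_diff)
  qed
  also have "distr ?P borel \<dots> = distr (F_distribution CARD('m) (n - CARD('m))) borel
        (\<lambda>y. real CARD('m) * (real n - 1) / (real n - real CARD('m)) * y)"
    unfolding F_distribution_def
    using m2 by (subst distr_distr) (auto simp: comp_def case_prod_beta' measurable_cong_sets[OF sets refl])
  finally show ?thesis .
qed

subsection \<open>Square roots of covariance matrices\<close>

(* Eliminates one nonzero row at a time: subtract v v^T with v the normalised column at a positive
   diagonal entry. *)
lemma psd_square_root:
  fixes C :: "real^'m^'m"
  assumes sym: "\<And>a b. C $ a $ b = C $ b $ a" and psd: "\<And>u. 0 \<le> u \<bullet> (C *v u)"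
  shows "\<exists>A :: real^'m^'m. A ** transpose A = C"
proof -
  have quad: "(x *\<^sub>R axis a 1 + y *\<^sub>R axis b 1) \<bullet> (C *v (x *\<^sub>R axis a 1 + y *\<^sub>R axis b 1))
      = x\<^sup>2 * C $ a $ a + x * y * C $ a $ b + x * y * C $ b $ a + y\<^sup>2 * C $ b $ b"
    for C :: "real^'m^'m" and x y a b
    by (simp add: matrix_vector_right_distrib matrix_vector_mult_scaleR inner_add_left inner_add_right
        inner_axis' matrix_vector_mul_component column_def power2_eq_square algebra_simps
        matrix_vector_mult_basis)
  have zero: "C $ a $ b = 0"
    if s: "\<And>a b. C $ a $ b = C $ b $ a" and p: "\<And>u. 0 \<le> u \<bullet> (C *v u)" and d: "C $ a $ a = 0"
    for C :: "real^'m^'m" and a b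
  proof (rule ccontr)
    assume n: "C $ a $ b \<noteq> 0"
    \<comment> \<open>This choice makes the quadratic form at
      \<open>x *\<^sub>R axis a 1 + axis b 1\<close> equal to -1.\<close>
    define x where "x = - (C $ b $ b + 1) / (2 * C $ a $ b)"
    have "0 \<le> x\<^sup>2 * C $ a $ a + x * 1 * C $ a $ b + x * 1 * C $ b $ a + 1\<^sup>2 * C $ b $ b"
      using p unfolding quad[symmetric] .
    then have "0 \<le> 2 * (x * C $ a $ b) + C $ b $ b" using d s[of a b] by simp
    moreover have "2 * (x * C $ a $ b) = - (C $ b $ b + 1)" using n by (simp add: x_def field_simps)
    ultimately show False by simp
  qed
  have "\<exists>A :: real^'m^'m. A ** transpose A = C"
    if "\<And>a b. C $ a $ b = C $ b $ a" "\<And>u. 0 \<le> u \<bullet> (C *v u)"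
      and "\<And>a b. a \<notin> D \<Longrightarrow> C $ a $ b = 0" and "finite D"
    for C :: "real^'m^'m" and D
  proof -
    \<comment> \<open>The claim is strengthened: columns of the factor outside \<open>D\<close>
      vanish, so that in the induction step column \<open>d\<close> is free to hold
      \<open>v\<close>.\<close>
    have "\<exists>A :: real^'m^'m. A ** transpose A = C \<and> (\<forall>a b. b \<notin> D \<longrightarrow> A $ a $ b = 0)"
      using that(4,1,2,3)
    proof (induction D arbitrary: C rule: finite_induct)
      case empty
      then have "C = 0" by (simp add: vec_eq_iff)
      then show ?case by (intro exI[of _ 0]) simp
    next
      case (insert d D)
      note s = insert.prems(1) and p = insert.prems(2)
      show ?case
      proof (cases "C $ d $ d = 0")
        case True
        have "C $ a $ b = 0" if "a \<notin> D" for a b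
          using zero[OF s p True, of b] insert.prems(3)[of a b] that by (cases "a = d") auto
        from insert.IH[OF s p this] show ?thesis by blast
      next
        case False
        have "0 \<le> 1\<^sup>2 * C $ d $ d + 1 * 0 * C $ d $ d + 1 * 0 * C $ d $ d + 0\<^sup>2 * C $ d $ d"
          using p unfolding quad[symmetric] .
        then have pos: "0 < C $ d $ d" using False by simp
        define v where "v = (\<lambda>a. C $ a $ d / sqrt (C $ d $ d))"
        define C' :: "real^'m^'m" where "C' = (\<chi> a b. C $ a $ b - v a * v b)"
        have v': "v a = C $ d $ a / sqrt (C $ d $ d)" for a using s[of a d] by (simp add: v_def)
        have vd: "v d * v b = C $ d $ b" for b using pos s[of d b] by (simp add: v_def)
        have s': "C' $ a $ b = C' $ b $ a" for a b using s by (simp add: C'_def mult.commute)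
        have p': "0 \<le> u \<bullet> (C' *v u)" for u
        proof -
          \<comment> \<open>Moving by \<open>t\<close> along \<open>axis d 1\<close> minimises the
            quadratic form of \<open>C\<close>; the minimal value is the form of the Schur
            complement \<open>C'\<close> at \<open>u\<close>.\<close>
          define t where "t = (\<Sum>a\<in>UNIV. C $ d $ a * u $ a) / C $ d $ d"
          let ?w = "u - t *\<^sub>R axis d 1"
          have Cd: "(C *v u) $ d = t * C $ d $ d" using pos by (simp add: t_def matrix_vector_mult_def)
          have ud: "u \<bullet> (C *v axis d 1) = t * C $ d $ d"
          proof -
            have "C *v axis d 1 = (\<chi> i. C $ i $ d)" by (simp add: matrix_vector_mult_basis column_def)
            then show ?thesis
              unfolding Cd[symmetric] by (simp add: inner_vec_def matrix_vector_mult_def s[of _ d] mult.commute)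
          qed
          have "0 \<le> ?w \<bullet> (C *v ?w)" by (rule p)
          also have "\<dots> = u \<bullet> (C *v u) - t * (t * C $ d $ d)"
            by (simp add: matrix_vector_mult_diff_distrib matrix_vector_mult_scaleR inner_diff_left inner_diff_right
                inner_axis' ud[unfolded matrix_vector_mult_basis column_def] Cd matrix_vector_mult_basis column_def)
          also have "\<dots> = u \<bullet> (C' *v u)"
          proof -
            have "(\<Sum>a\<in>UNIV. v a * u $ a) = t * sqrt (C $ d $ d)"
            proof -
              have "(\<Sum>a\<in>UNIV. v a * u $ a) = (\<Sum>a\<in>UNIV. C $ d $ a * u $ a) / sqrt (C $ d $ d)"
                unfolding sum_divide_distrib v' by (intro sum.cong refl) simp
              also have "\<dots> = t * (C $ d $ d / sqrt (C $ d $ d))" using pos by (simp add: t_def)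
              also have "C $ d $ d / sqrt (C $ d $ d) = sqrt (C $ d $ d)" using pos by (simp add: real_div_sqrt)
              finally show ?thesis .
            qed
            then have "(\<Sum>a\<in>UNIV. v a * u $ a) * (\<Sum>a\<in>UNIV. v a * u $ a) = t * (t * C $ d $ d)"
              using pos by (simp add: mult_ac)
            moreover have "u \<bullet> (C' *v u) = u \<bullet> (C *v u) - (\<Sum>a\<in>UNIV. v a * u $ a) * (\<Sum>a\<in>UNIV. v a * u $ a)"
              by (simp add: C'_def inner_vec_def matrix_vector_mult_def left_diff_distrib right_diff_distrib
                  sum_subtractf sum_product sum_distrib_left mult_ac)
            ultimately show ?thesis by simp
          qed
          finally show ?thesis .
        qed
        have z': "C' $ a $ b = 0" if "a \<notin> D" for a b
        proof (cases "a = d")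
          case True
          then show ?thesis using vd by (simp add: C'_def)
        next
          case False
          then have "C $ a $ b = 0" "C $ a $ d = 0" using insert.prems(3) that by auto
          then show ?thesis by (simp add: C'_def v_def)
        qed
        obtain A where A: "A ** transpose A = C'" "\<And>a b. b \<notin> D \<Longrightarrow> A $ a $ b = 0"
          using insert.IH[OF s' p' z'] by blast
        define A' :: "real^'m^'m" where "A' = (\<chi> a b. if b = d then v a else A $ a $ b)"
        have "(\<Sum>k\<in>UNIV. A' $ a $ k * A' $ b $ k) = C $ a $ b" for a b
        proof -
          have "(\<Sum>k\<in>UNIV. A' $ a $ k * A' $ b $ k) = v a * v b + (\<Sum>k\<in>UNIV - {d}. A $ a $ k * A $ b $ k)"
            by (subst sum.remove[of UNIV d]) (auto simp: A'_def intro!: sum.cong)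
          also have "(\<Sum>k\<in>UNIV - {d}. A $ a $ k * A $ b $ k) = (\<Sum>k\<in>UNIV. A $ a $ k * A $ b $ k)"
            using A(2)[OF insert.hyps(2)] by (intro sum.mono_neutral_left) auto
          also have "\<dots> = C' $ a $ b"
            unfolding A(1)[symmetric] by (simp add: matrix_matrix_mult_def transpose_def)
          finally show ?thesis by (simp add: C'_def)
        qed
        then have "A' ** transpose A' = C" by (simp add: vec_eq_iff matrix_matrix_mult_def transpose_def)
        moreover have "\<forall>a b. b \<notin> insert d D \<longrightarrow> A' $ a $ b = 0" using A(2) by (simp add: A'_def)
        ultimately show ?thesis by blast
      qed
    qed
    then show ?thesis by blast
  qed
  from this[OF sym psd, of UNIV] show ?thesis by simp
qed

subsection \<open>Convergence in law of random families and vectors\<close>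

text \<open>Chebyshev's inequality with the uniform second moment bound yields the tightness of
  every coordinate.\<close>

lemma (in prob_space) family_weak_conv:
  fixes X :: "nat \<Rightarrow> 'a \<Rightarrow> 'k::countable \<Rightarrow> real" and h :: "('k \<Rightarrow> real) \<Rightarrow> real"
  assumes Xm: "\<And>k i. (\<lambda>\<omega>. X k \<omega> i) \<in> borel_measurable M"
    and \<nu>: "prob_space \<nu>" "sets \<nu> = sets borel"
    and bound: "\<And>k i. (\<integral>\<^sup>+\<omega>. ennreal ((X k \<omega> i)\<^sup>2) \<partial>M) \<le> ennreal C"
    and conv: "\<And>J t. finite J \<Longrightarrow> (\<lambda>k. \<integral>\<omega>. cis (\<Sum>i\<in>J. t i * X k \<omega> i) \<partial>M) \<longlonglongrightarrow> (\<integral>x. cis (\<Sum>i\<in>J. t i * x i) \<partial>\<nu>)"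
    and h: "continuous_on UNIV h" "\<And>x. \<bar>h x\<bar> \<le> B"
  shows "(\<lambda>k. \<integral>\<omega>. h (X k \<omega>) \<partial>M) \<longlonglongrightarrow> (\<integral>x. h x \<partial>\<nu>)"
proof -
  have m[measurable]: "X k \<in> borel_measurable M" for k
    by (rule measurable_coordinatewise_then_product[OF Xm])
  have hm: "h \<in> borel_measurable borel" by (rule borel_measurable_continuous_onI[OF h(1)])
  have "(\<lambda>k. \<integral>x. h x \<partial>distr M borel (X k)) \<longlonglongrightarrow> (\<integral>x. h x \<partial>\<nu>)"
  proof (rule weak_conv_of_characteristic_functions[OF _ _ \<nu> _ _ h])
    show "prob_space (distr M borel (X k))" for k by (rule prob_space_distr) simp
    show "sets (distr M borel (X k)) = sets borel" for k by simp
    have "(\<integral>x. cis (\<Sum>i\<in>J. t i * x i) \<partial>distr M borel (X k)) = (\<integral>\<omega>. cis (\<Sum>i\<in>J. t i * X k \<omega> i) \<partial>M)" for J t k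
      by (rule integral_distr) (auto intro!: measurable_compose[OF _ cis_borel])
    then show "(\<lambda>k. \<integral>x. cis (\<Sum>i\<in>J. t i * x i) \<partial>distr M borel (X k)) \<longlonglongrightarrow> (\<integral>x. cis (\<Sum>i\<in>J. t i * x i) \<partial>\<nu>)"
      if "finite J" for J t using conv[OF that] by simp
    fix i and e :: real assume e: "0 < e"
    define r where "r = sqrt ((\<bar>C\<bar> + 1) / e)"
    have r: "0 < r" "(\<bar>C\<bar> + 1) / r\<^sup>2 = e" using e by (simp_all add: r_def)
    have "measure (distr M borel (X k)) {x. \<bar>x i\<bar> > r} \<le> e" for k
    proof -
      have s: "{x :: 'k \<Rightarrow> real. \<bar>x i\<bar> > r} \<in> sets borel" by measurable
      have s': "{\<omega>\<in>space M. \<bar>X k \<omega> i\<bar> > r} \<in> sets M" using Xm[of k i] by measurable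
      have "emeasure M {\<omega>\<in>space M. \<bar>X k \<omega> i\<bar> > r} = (\<integral>\<^sup>+\<omega>. indicator {\<omega>\<in>space M. \<bar>X k \<omega> i\<bar> > r} \<omega> \<partial>M)"
        using s' by simp
      also have "\<dots> \<le> (\<integral>\<^sup>+\<omega>. ennreal (1 / r\<^sup>2) * ennreal ((X k \<omega> i)\<^sup>2) \<partial>M)"
      proof (rule nn_integral_mono)
        fix \<omega>
        show "indicator {\<omega>\<in>space M. \<bar>X k \<omega> i\<bar> > r} \<omega> \<le> ennreal (1 / r\<^sup>2) * ennreal ((X k \<omega> i)\<^sup>2)"
        proof (cases "\<bar>X k \<omega> i\<bar> > r")
          case True
          have "r\<^sup>2 \<le> \<bar>X k \<omega> i\<bar>\<^sup>2" using True r by (intro power_mono) auto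
          then have "1 \<le> 1 / r\<^sup>2 * (X k \<omega> i)\<^sup>2" using r(1) by (simp add: field_simps)
          then have "ennreal 1 \<le> ennreal (1 / r\<^sup>2 * (X k \<omega> i)\<^sup>2)" by (rule ennreal_leI)
          moreover have "ennreal (1 / r\<^sup>2 * (X k \<omega> i)\<^sup>2) = ennreal (1 / r\<^sup>2) * ennreal ((X k \<omega> i)\<^sup>2)"
            by (rule ennreal_mult') simp
          ultimately show ?thesis by (simp only: indicator_def ennreal_1) simp
        qed (simp add: indicator_def)
      qed
      also have "\<dots> = ennreal (1 / r\<^sup>2) * (\<integral>\<^sup>+\<omega>. ennreal ((X k \<omega> i)\<^sup>2) \<partial>M)"
        using Xm[of k i] by (intro nn_integral_cmult) measurable
      also have "\<dots> \<le> ennreal (1 / r\<^sup>2) * ennreal (\<bar>C\<bar> + 1)"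
        by (intro mult_left_mono order_trans[OF bound] ennreal_leI) auto
      also have "\<dots> = ennreal (1 / r\<^sup>2 * (\<bar>C\<bar> + 1))" by (rule ennreal_mult'[symmetric]) simp
      also have "1 / r\<^sup>2 * (\<bar>C\<bar> + 1) = e" using r(2) by simp
      finally have "emeasure M {\<omega>\<in>space M. \<bar>X k \<omega> i\<bar> > r} \<le> ennreal e" .
      moreover have "measure (distr M borel (X k)) {x. \<bar>x i\<bar> > r} = measure M {\<omega>\<in>space M. \<bar>X k \<omega> i\<bar> > r}"
        using s by (subst measure_distr) (auto intro!: arg_cong[where f="measure M"])
      ultimately show ?thesis using e by (simp add: emeasure_eq_measure ennreal_le_iff)
    qed
    then show "\<exists>R. \<forall>k. measure (distr M borel (X k)) {x. \<bar>x i\<bar> > R} \<le> e" by blast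
  qed
  moreover have "(\<integral>x. h x \<partial>distr M borel (X k)) = (\<integral>\<omega>. h (X k \<omega>) \<partial>M)" for k
    by (rule integral_distr) (use hm in auto)
  ultimately show ?thesis by simp
qed

lemma continuous_on_vec_lambda: "continuous_on UNIV (\<lambda>x :: 'm::finite \<Rightarrow> real. \<chi> a. x a)"
  by (intro continuous_on_vec_lambda continuous_on_product_coordinates)

lemma vec_nth_measurable_fun: "(\<lambda>v :: real^'m. (\<lambda>a. v $ a)) \<in> borel_measurable borel"
  by (rule measurable_coordinatewise_then_product)
     (intro borel_measurable_continuous_onI continuous_intros)

text \<open>A vector is read as a family over its finite index type; a linear form supported on
  \<open>J\<close> becomes the inner product with a vector that vanishes off
  \<open>J\<close>.\<close>

lemma (in prob_space) weak_conv_vecI: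
  fixes X :: "nat \<Rightarrow> 'a \<Rightarrow> real^'m"
  assumes Xm [measurable]: "\<And>k. X k \<in> borel_measurable M"
    and \<nu>: "prob_space \<nu>" "sets \<nu> = sets borel"
    and bound: "\<And>k. (\<integral>\<^sup>+\<omega>. ennreal ((norm (X k \<omega>))\<^sup>2) \<partial>M) \<le> ennreal C"
    and conv: "\<And>u. (\<lambda>k. \<integral>\<omega>. cis (u \<bullet> X k \<omega>) \<partial>M) \<longlonglongrightarrow> (\<integral>x. cis (u \<bullet> x) \<partial>\<nu>)"
  shows "weak_conv_vec (\<lambda>k. distr M borel (X k)) \<nu>"
  unfolding weak_conv_vec_def
proof (intro allI impI, elim conjE)
  fix g :: "real^'m \<Rightarrow> real" assume g: "continuous_on UNIV g" "bounded (range g)"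
  obtain B where B: "\<And>x. \<bar>g x\<bar> \<le> B" using g(2) by (auto simp: bounded_iff)
  have fm: "(\<lambda>v a. v $ a) \<in> measurable \<nu> (borel :: ('m \<Rightarrow> real) measure)"
    using vec_nth_measurable_fun by (simp add: measurable_cong_sets[OF \<nu>(2) refl])
  have gm: "g \<in> borel_measurable borel" by (rule borel_measurable_continuous_onI[OF g(1)])
  have hc: "continuous_on UNIV (\<lambda>x :: 'm \<Rightarrow> real. g (\<chi> a. x a))"
    using continuous_on_compose[OF continuous_on_vec_lambda continuous_on_subset[OF g(1)]] by (simp add: comp_def)
  have "(\<lambda>k. \<integral>\<omega>. g (\<chi> a. X k \<omega> $ a) \<partial>M) \<longlonglongrightarrow> (\<integral>x. g (\<chi> a. x a) \<partial>distr \<nu> borel (\<lambda>v a. v $ a))"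
  proof (rule family_weak_conv[where X="\<lambda>k \<omega> a. X k \<omega> $ a" and h="\<lambda>x. g (\<chi> a. x a)", OF _ _ _ _ _ hc B])
    show "(\<lambda>\<omega>. X k \<omega> $ i) \<in> borel_measurable M" for k i
      using measurable_product_then_coordinatewise[OF measurable_compose[OF Xm vec_nth_measurable_fun]] .
    show "prob_space (distr \<nu> borel (\<lambda>v a. v $ a))" by (rule prob_space.prob_space_distr[OF \<nu>(1) fm])
    show "(\<integral>\<^sup>+\<omega>. ennreal ((X k \<omega> $ i)\<^sup>2) \<partial>M) \<le> ennreal C" for k i
    proof (rule order_trans[OF nn_integral_mono bound[of k]])
      fix \<omega>
      show "ennreal ((X k \<omega> $ i)\<^sup>2) \<le> ennreal ((norm (X k \<omega>))\<^sup>2)"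
        using component_le_norm_cart[of "X k \<omega>" i] by (intro ennreal_leI) (simp add: power2_le_iff_abs_le)
    qed
    fix J :: "'m set" and t :: "'m \<Rightarrow> real" assume "finite J"
    define u :: "real^'m" where "u = (\<chi> a. if a \<in> J then t a else 0)"
    have s: "(\<Sum>i\<in>J. t i * v $ i) = u \<bullet> v" for v :: "real^'m"
      by (simp add: inner_vec_def u_def if_distrib[of "\<lambda>c. c * _"] sum.If_cases)
    have "(\<integral>x. cis (\<Sum>i\<in>J. t i * x i) \<partial>distr \<nu> borel (\<lambda>v a. v $ a)) = (\<integral>v. cis (\<Sum>i\<in>J. t i * v $ i) \<partial>\<nu>)"
      by (rule integral_distr[OF fm]) (auto intro!: measurable_compose[OF _ cis_borel])
    then show "(\<lambda>k. \<integral>\<omega>. cis (\<Sum>i\<in>J. t i * X k \<omega> $ i) \<partial>M) \<longlonglongrightarrow> (\<integral>x. cis (\<Sum>i\<in>J. t i * x i) \<partial>distr \<nu> borel (\<lambda>v a. v $ a))"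
      using conv[of u] by (simp add: s)
  qed simp
  moreover have "(\<integral>x. g (\<chi> a. x a) \<partial>distr \<nu> borel (\<lambda>v a. v $ a)) = (\<integral>v. g (\<chi> a. v $ a) \<partial>\<nu>)"
    by (rule integral_distr[OF fm]) (use borel_measurable_continuous_onI[OF hc] in simp)
  moreover have "(\<integral>x. g x \<partial>distr M borel (X k)) = (\<integral>\<omega>. g (X k \<omega>) \<partial>M)" for k
    by (rule integral_distr) (use gm in auto)
  ultimately show "(\<lambda>k. \<integral>x. g x \<partial>distr M borel (X k)) \<longlonglongrightarrow> (\<integral>x. g x \<partial>\<nu>)" by simp
qed

text \<open>The definition by a Lebesgue density is turned into independent coordinates, from which
  the characteristic function factorises. Agreement of the two measures is checked on boxes.\<close>

lemma std_normal_vec_PiM: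
  "std_normal_vec = distr (PiM (Basis :: (real^'m) set) (\<lambda>_. std_normal_distribution)) borel (\<lambda>x. \<Sum>b\<in>Basis. x b *\<^sub>R b)"
proof -
  let ?B = "Basis :: (real^'m) set"
  let ?S = "\<lambda>x. \<Sum>b\<in>?B. x b *\<^sub>R b"
  let ?d = "\<lambda>x. \<Prod>b\<in>?B. ennreal (std_normal_density (x b))"
  interpret L: product_sigma_finite "\<lambda>_ :: real^'m. lborel :: real measure" ..
  have Sm: "?S \<in> measurable (PiM ?B (\<lambda>_. lborel)) borel" by measurable
  have den: "ennreal (\<Prod>a\<in>UNIV. std_normal_density (z $ a)) = (\<Prod>b\<in>?B. ennreal (std_normal_density (z \<bullet> b)))" for z :: "real^'m"
  proof -
    have "(\<Prod>b\<in>?B. ennreal (std_normal_density (z \<bullet> b))) = (\<Prod>a\<in>UNIV. ennreal (std_normal_density (z \<bullet> axis a 1)))"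
    proof -
      have B: "?B = range (\<lambda>a. axis a 1)" by (auto simp: Basis_vec_def)
      have I: "inj (\<lambda>a :: 'm. axis a (1 :: real))" by (auto simp: inj_def axis_eq_axis)
      show ?thesis unfolding B prod.reindex[OF I] by simp
    qed
    then show ?thesis by (simp add: inner_axis prod_ennreal)
  qed
  have Sb: "?S x \<bullet> b = x b" if "b \<in> ?B" for x b using that by (simp add: inner_sum_left_Basis)
  have "std_normal_vec = density (distr (PiM ?B (\<lambda>_. lborel)) borel ?S) (\<lambda>z. \<Prod>b\<in>?B. ennreal (std_normal_density (z \<bullet> b)))"
    unfolding std_normal_vec_def den by (subst lborel_eq) (rule refl)
  also have "\<dots> = distr (density (PiM ?B (\<lambda>_. lborel)) (\<lambda>x. \<Prod>b\<in>?B. ennreal (std_normal_density (?S x \<bullet> b)))) borel ?S"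
    by (rule density_distr) (use Sm in measurable)
  also have "density (PiM ?B (\<lambda>_. lborel)) (\<lambda>x. \<Prod>b\<in>?B. ennreal (std_normal_density (?S x \<bullet> b))) = density (PiM ?B (\<lambda>_. lborel)) ?d"
    by (simp add: Sb cong: prod.cong)
  also have "\<dots> = PiM ?B (\<lambda>_. std_normal_distribution)"
  proof (rule measure_eqI_PiM_finite[symmetric, where M="\<lambda>_. std_normal_distribution" and A="\<lambda>_. \<Pi>\<^sub>E b\<in>?B. UNIV"])
    show "sets (density (PiM ?B (\<lambda>_. lborel)) ?d) = sets (PiM ?B (\<lambda>_. std_normal_distribution))"
      by (simp, intro sets_PiM_cong) auto
    fix A :: "real^'m \<Rightarrow> real set" assume A: "\<And>b. b \<in> ?B \<Longrightarrow> A b \<in> sets std_normal_distribution"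
    have "emeasure (density (PiM ?B (\<lambda>_. lborel)) ?d) (Pi\<^sub>E ?B A) = (\<integral>\<^sup>+x. ?d x * indicator (Pi\<^sub>E ?B A) x \<partial>PiM ?B (\<lambda>_. lborel))"
      using A by (intro emeasure_density) (auto intro!: sets_PiM_I_finite)
    also have "\<dots> = (\<integral>\<^sup>+x. (\<Prod>b\<in>?B. ennreal (std_normal_density (x b)) * indicator (A b) (x b)) \<partial>PiM ?B (\<lambda>_. lborel))"
    proof (rule nn_integral_cong)
      fix x assume "x \<in> space (PiM ?B (\<lambda>_. lborel :: real measure))"
      then have "indicator (Pi\<^sub>E ?B A) x = (\<Prod>b\<in>?B. indicator (A b) (x b) :: ennreal)"
        by (auto simp: space_PiM PiE_def indicator_def Pi_def prod_zero_iff)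
      then show "?d x * indicator (Pi\<^sub>E ?B A) x = (\<Prod>b\<in>?B. ennreal (std_normal_density (x b)) * indicator (A b) (x b))"
        by (simp add: prod.distrib)
    qed
    also have "\<dots> = (\<Prod>b\<in>?B. \<integral>\<^sup>+t. ennreal (std_normal_density t) * indicator (A b) t \<partial>lborel)"
      using A by (intro L.product_nn_integral_prod) auto
    also have "\<dots> = (\<Prod>b\<in>?B. emeasure std_normal_distribution (A b))"
      using A by (intro prod.cong refl emeasure_density[symmetric]) auto
    also have "\<dots> = emeasure (PiM ?B (\<lambda>_. std_normal_distribution)) (Pi\<^sub>E ?B A)"
      using A by (intro std_normal.emeasure_PiM[symmetric]) auto
    finally show "emeasure (PiM ?B (\<lambda>_. std_normal_distribution)) (Pi\<^sub>E ?B A) = emeasure (density (PiM ?B (\<lambda>_. lborel)) ?d) (Pi\<^sub>E ?B A)" ..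
  qed (auto intro!: prod_algebraI_finite simp: prob_space.emeasure_space_1 space_PiM
      std_normal.emeasure_PiM prob_space.emeasure_space_1[OF prob_space_std_normal, simplified])
  finally show ?thesis .
qed

lemma std_normal_vec_prob: "prob_space (std_normal_vec :: (real^'m) measure)"
  unfolding std_normal_vec_PiM
  by (intro prob_space.prob_space_distr prob_space_PiM prob_space_std_normal) measurable

lemma sets_std_normal_vec: "sets (std_normal_vec :: (real^'m) measure) = sets borel"
  by (simp add: std_normal_vec_def)

lemma std_normal_vec_cis:
  fixes u :: "real^'m"
  shows "(\<integral>z. cis (u \<bullet> z) \<partial>std_normal_vec) = of_real (exp (- (norm u)\<^sup>2 / 2))"
proof -
  let ?B = "Basis :: (real^'m) set"
  let ?N = "PiM ?B (\<lambda>_. std_normal_distribution)"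
  have "(\<integral>z. cis (u \<bullet> z) \<partial>std_normal_vec) = (\<integral>x. cis (u \<bullet> (\<Sum>b\<in>?B. x b *\<^sub>R b)) \<partial>?N)"
    unfolding std_normal_vec_PiM
  proof (rule integral_distr)
    show "(\<lambda>x. \<Sum>b\<in>?B. x b *\<^sub>R b) \<in> borel_measurable ?N" by measurable
    show "(\<lambda>z. cis (u \<bullet> z)) \<in> borel_measurable borel" by (rule measurable_compose[OF _ cis_borel]) measurable
  qed
  also have "\<dots> = (\<integral>x. (\<Prod>b\<in>?B. cis ((u \<bullet> b) * x b)) \<partial>?N)"
    by (simp add: inner_sum_right cis_sum mult.commute)
  also have "\<dots> = (\<Prod>b\<in>?B. \<integral>t. cis ((u \<bullet> b) * t) \<partial>std_normal_distribution)"
    by (intro std_normal.product_integral_prod std_normal.M.integrable_const_bound[of _ 1])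
      (auto intro!: measurable_compose[OF _ cis_borel])
  also have "\<dots> = of_real (exp (- (\<Sum>b\<in>?B. (u \<bullet> b)\<^sup>2) / 2))"
    unfolding std_normal_cis of_real_prod[symmetric] exp_sum[OF finite_Basis, symmetric]
    by (simp add: sum_negf sum_divide_distrib)
  also have "(\<Sum>b\<in>?B. (u \<bullet> b)\<^sup>2) = (norm u)\<^sup>2"
    unfolding power2_norm_eq_inner by (subst euclidean_inner) (simp add: power2_eq_square)
  finally show ?thesis .
qed

section \<open>Invariance, continuity and regularity of the statistic\<close>

definition lin :: "real^'m^'m \<Rightarrow> ('i \<times> 'm \<Rightarrow> real) \<Rightarrow> 'i \<times> 'm \<Rightarrow> real" where
  "lin A z = (\<lambda>(i, a). \<Sum>b\<in>UNIV. A $ a $ b * z (i, b))"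

lemma ip_lin: "ip K u (colv (lin A z) a) = (\<Sum>b\<in>UNIV. A $ a $ b * ip K u (colv z b))"
  unfolding ip_def colv_def lin_def
  by (simp add: sum_distrib_left, subst sum.swap) (simp add: mult_ac)

lemma hotb_lin: "hotb K (lin A z) c = A *v hotb K z c"
  by (simp add: vec_eq_iff hotb_def ip_lin matrix_vector_mult_def)

lemma hotW_lin: "hotW K (lin A z) c = A ** hotW K z c ** transpose A"
proof -
  have ip2: "ip K (colv (lin A z) a) (colv (lin A z) d) = (\<Sum>e\<in>UNIV. (\<Sum>b\<in>UNIV. A $ a $ b * ip K (colv z b) (colv z e)) * A $ d $ e)" for a d
  proof -
    have l: "ip K (colv (lin A z) a) (colv z e) = (\<Sum>b\<in>UNIV. A $ a $ b * ip K (colv z b) (colv z e))" for e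
      unfolding ip_commute[of K "colv (lin A z) a" "colv z e"] ip_lin
      by (intro sum.cong refl arg_cong2[where f="(*)"] ip_commute)
    show ?thesis
      unfolding ip_lin[of K "colv (lin A z) a"] l by (intro sum.cong refl mult.commute)
  qed
  have "hotW K (lin A z) c $ a $ d = (\<Sum>e\<in>UNIV. (\<Sum>b\<in>UNIV. A $ a $ b * hotW K z c $ b $ e) * A $ d $ e)" for a d
  proof -
    have "(\<Sum>e\<in>UNIV. (\<Sum>b\<in>UNIV. A $ a $ b * hotW K z c $ b $ e) * A $ d $ e)
        = (\<Sum>e\<in>UNIV. (ip K c c * (\<Sum>b\<in>UNIV. A $ a $ b * ip K (colv z b) (colv z e))
            - (\<Sum>b\<in>UNIV. A $ a $ b * ip K c (colv z b)) * ip K c (colv z e)) * A $ d $ e)"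
      by (intro sum.cong refl) (simp add: hotW_def right_diff_distrib sum_subtractf sum_distrib_left sum_distrib_right mult_ac)
    also have "\<dots> = ip K c c * (\<Sum>e\<in>UNIV. (\<Sum>b\<in>UNIV. A $ a $ b * ip K (colv z b) (colv z e)) * A $ d $ e)
        - (\<Sum>b\<in>UNIV. A $ a $ b * ip K c (colv z b)) * (\<Sum>e\<in>UNIV. A $ d $ e * ip K c (colv z e))"
      unfolding left_diff_distrib sum_subtractf sum_distrib_left[of "ip K c c"] sum_distrib_left[of "\<Sum>b\<in>UNIV. A $ a $ b * ip K c (colv z b)"]
      by (intro arg_cong2[where f="(-)"] sum.cong refl) (simp_all add: sum_distrib_left sum_distrib_right mult_ac)
    finally show ?thesis unfolding ip2[symmetric] by (simp add: hotW_def ip_lin)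
  qed
  then show ?thesis by (simp add: vec_eq_iff matrix_matrix_mult_def transpose_def)
qed

text \<open>\<open>hotb\<close> becomes \<open>A *v hotb\<close> and \<open>hotW\<close> becomes
  \<open>A ** hotW ** transpose A\<close>, so a regular \<open>A\<close> cancels. This removes the
  covariance of the limit as well as the normalisation of the iterates.\<close>

lemma hotelling_lin:
  assumes A: "det A \<noteq> 0"
  shows "hotelling K (lin A z) c = hotelling K z c" "det (hotW K (lin A z) c) = 0 \<longleftrightarrow> det (hotW K z c) = 0"
proof -
  show d: "det (hotW K (lin A z) c) = 0 \<longleftrightarrow> det (hotW K z c) = 0"
    using A by (simp add: hotW_lin det_mul)
  show "hotelling K (lin A z) c = hotelling K z c"
  proof (cases "det (hotW K z c) = 0")
    case True
    then show ?thesis using d by (simp add: hotelling_def)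
  next
    case False
    let ?y = "matrix_inv (hotW K z c) *v hotb K z c"
    have dT: "det (transpose A) \<noteq> 0" using A by simp
    define y where "y = matrix_inv (transpose A) *v ?y"
    have y: "transpose A *v y = ?y" unfolding y_def by (rule matrix_inv_solves[OF dT])
    have "hotW K (lin A z) c *v y = A *v (hotW K z c *v (transpose A *v y))"
      by (simp only: hotW_lin matrix_vector_mul_assoc matrix_mul_assoc)
    also have "\<dots> = hotb K (lin A z) c" unfolding y hotb_lin matrix_inv_solves[OF False] ..
    finally have "hotelling K (lin A z) c = hotb K (lin A z) c \<bullet> y"
      using False d by (intro hotelling_eq) auto
    also have "\<dots> = hotb K z c \<bullet> (transpose A *v y)"
      unfolding hotb_lin using inner_transpose_mult[of A y "hotb K z c"] by (simp add: inner_commute)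
    also have "\<dots> = hotelling K z c" unfolding y using False by (simp add: hotelling_def)
    finally show ?thesis .
  qed
qed

lemma continuous_on_hotW: "continuous_on S (\<lambda>y :: 'i \<times> 'm::finite \<Rightarrow> real. hotW K y c $ a $ b)"
  unfolding hotW_def ip_def colv_def
  by (simp, intro continuous_intros continuous_on_subset[OF continuous_on_product_coordinates]) auto

lemma continuous_on_hotelling:
  "continuous_on {y :: 'i \<times> 'm::finite \<Rightarrow> real. det (hotW K y c) \<noteq> 0} (\<lambda>y. hotelling K y c)"
proof -
  let ?S = "{y :: 'i \<times> 'm \<Rightarrow> real. det (hotW K y c) \<noteq> 0}"
  have b: "continuous_on ?S (\<lambda>y. hotb K y c $ a)" for a
    unfolding hotb_def ip_def colv_def
    by (simp, intro continuous_intros continuous_on_subset[OF continuous_on_product_coordinates]) auto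
  have W: "continuous_on ?S (\<lambda>y. det (hotW K y c))" by (rule continuous_on_det[OF continuous_on_hotW])
  have k: "continuous_on ?S (\<lambda>y. det (\<chi> i j. if j = k then hotb K y c $ i else hotW K y c $ i $ j))" for k
  proof (rule continuous_on_det)
    fix i j show "continuous_on ?S (\<lambda>y. (\<chi> i j. if j = k then hotb K y c $ i else hotW K y c $ i $ j) $ i $ j)"
      by (cases "j = k") (simp_all add: b continuous_on_hotW)
  qed
  have "continuous_on ?S (\<lambda>y. \<Sum>k\<in>UNIV. hotb K y c $ k * (det (\<chi> i j. if j = k then hotb K y c $ i else hotW K y c $ i $ j) / det (hotW K y c)))"
    by (intro continuous_intros b W k) auto
  then show ?thesis
    by (rule continuous_on_eq) (simp add: hotelling_def inner_vec_def matrix_inv_cramer)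
qed

text \<open>The law of the statistic is already known to be that of a nonnegative quotient, whereas
  a singular matrix is marked by -1; hence singularity has probability 0.\<close>

lemma AE_gauss_hotW:
  fixes J :: "'m::finite \<Rightarrow> 'i::countable"
  assumes K: "finite K" and J: "inj J" "range J \<subseteq> K" "K - range J \<noteq> {}"
  shows "AE z in gauss. det (hotW K z (\<lambda>_. 1) :: real^'m^'m) \<noteq> 0"
proof -
  have m: "(\<lambda>z :: 'i \<times> 'm \<Rightarrow> real. hotelling K z (\<lambda>_. 1)) \<in> borel_measurable gauss"
    by (rule hotelling_measurable) (auto simp: measurable_cong_sets[OF sets_gauss refl])
  have m': "(\<lambda>c :: 'i \<Rightarrow> real. (\<Sum>i\<in>range J. (c i)\<^sup>2) / (\<Sum>i\<in>K - range J. (c i)\<^sup>2)) \<in> borel_measurable gauss"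
    by (simp add: measurable_cong_sets[OF sets_gauss refl])
  have "AE t in distr gauss borel (\<lambda>c :: 'i \<Rightarrow> real. (\<Sum>i\<in>range J. (c i)\<^sup>2) / (\<Sum>i\<in>K - range J. (c i)\<^sup>2)). 0 \<le> t"
    by (subst AE_distr_iff[OF m']) (auto intro!: AE_I2 divide_nonneg_nonneg sum_nonneg)
  then have "AE t in distr gauss borel (\<lambda>z :: 'i \<times> 'm \<Rightarrow> real. hotelling K z (\<lambda>_. 1)). 0 \<le> t"
    by (simp only: hotelling_law[OF K J])
  then have "AE z in gauss. 0 \<le> hotelling K (z :: 'i \<times> 'm \<Rightarrow> real) (\<lambda>_. 1)"
    by (subst (asm) AE_distr_iff[OF m]) auto
  then show ?thesis by (rule eventually_mono) (auto simp: hotelling_def split: if_splits)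
qed

text \<open>With weights 1, \<open>hotb\<close> is \<open>n\<close> times the deviation of the mean
  from \<open>xs\<close>, and \<open>hotW\<close> is \<open>n * (n - 1)\<close> times
  \<open>S\<close>, since centring at \<open>xs\<close> or at the mean gives the same scatter. The
  powers of \<open>n\<close> leave the factor \<open>n - 1\<close>.\<close>

lemma hotelling_T2:
  fixes X :: "nat \<Rightarrow> real^'m" and xs xbar :: "real^'m"
  assumes n: "2 \<le> n" and xbar: "xbar = (1 / real n) *\<^sub>R (\<Sum>i=1..n. X i)"
    and S: "S = (1 / (real n - 1)) *\<^sub>R (\<Sum>i=1..n. outer (X i - xbar) (X i - xbar))"
    and y: "y = (\<lambda>(i, a). (X i - xs) $ a)"
    and det: "det (hotW {1..n} y (\<lambda>_. 1)) \<noteq> 0"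
  shows "real n * ((xbar - xs) \<bullet> (matrix_inv S *v (xbar - xs))) = (real n - 1) * hotelling {1..n} y (\<lambda>_. 1)"
proof -
  let ?W = "hotW {1..n} y (\<lambda>_. 1)" and ?b = "hotb {1..n} y (\<lambda>_. 1)"
  have n': "real n > 0" "real n - 1 > 0" using n by auto
  have ys: "y (i, a) = X i $ a - xs $ a" for i a by (simp add: y)
  have b: "?b = real n *\<^sub>R (xbar - xs)"
    using n' by (simp add: vec_eq_iff hotb_def ip_def colv_def ys xbar sum_subtractf right_diff_distrib)
  have W: "?W = (real n * (real n - 1)) *\<^sub>R S"
  proof -
    have "(\<Sum>i=1..n. (X i - xbar) $ a * (X i - xbar) $ c) = (\<Sum>i=1..n. y (i, a) * y (i, c)) - ?b $ a * ?b $ c / real n" for a c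
    proof -
      define \<beta> where "\<beta> = (\<lambda>a. ?b $ a / real n)"
      have e: "(X i - xbar) $ a = y (i, a) - \<beta> a" for i a unfolding \<beta>_def b using n' by (simp add: ys)
      have sb: "(\<Sum>i=1..n. y (i, a)) = real n * \<beta> a" for a using n' by (simp add: \<beta>_def hotb_def ip_def colv_def)
      have "(\<Sum>i=1..n. (X i - xbar) $ a * (X i - xbar) $ c)
          = (\<Sum>i=1..n. y (i, a) * y (i, c)) - \<beta> c * (\<Sum>i=1..n. y (i, a)) - \<beta> a * (\<Sum>i=1..n. y (i, c)) + real n * (\<beta> a * \<beta> c)"
        unfolding e by (simp add: left_diff_distrib right_diff_distrib sum_subtractf sum.distrib sum_distrib_left mult_ac)
      then show ?thesis unfolding sb using n' by (simp add: \<beta>_def power2_eq_square)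
    qed
    note cross = this
    have gen: "(p * r) * ((1 / r) * (Y - B / p)) = p * Y - B" if "0 < p" "0 < r" for p r Y B :: real
      using that by (simp add: field_simps)
    have "S $ a $ c = (1 / (real n - 1)) * (\<Sum>i=1..n. (X i - xbar) $ a * (X i - xbar) $ c)" for a c
      by (simp add: S outer_def)
    then have "(real n * (real n - 1)) * S $ a $ c = real n * (\<Sum>i=1..n. y (i, a) * y (i, c)) - ?b $ a * ?b $ c" for a c
      unfolding cross by (simp only: gen[OF n'])
    then show ?thesis by (simp add: vec_eq_iff hotW_def hotb_def) (simp add: ip_def colv_def)
  qed
  let ?w = "matrix_inv ?W *v ?b"
  have "det S \<noteq> 0"
  proof
    assume "det S = 0"
    then obtain u where "u \<noteq> 0" "S *v u = 0" unfolding det_zero_iff_kernel by blast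
    then have "?W *v u = 0" unfolding W by (simp add: scaleR_matrix_vector_assoc[symmetric])
    then show False using det \<open>u \<noteq> 0\<close> unfolding det_zero_iff_kernel by blast
  qed
  moreover have "S *v ((real n - 1) *\<^sub>R ?w) = xbar - xs"
  proof -
    have "(real n * (real n - 1)) *\<^sub>R (S *v ?w) = real n *\<^sub>R (xbar - xs)"
      using matrix_inv_solves[OF det, of ?b] unfolding W b[unfolded W] scaleR_matrix_vector_assoc by (simp add: W[symmetric] b)
    then have "real n *\<^sub>R ((real n - 1) *\<^sub>R (S *v ?w)) = real n *\<^sub>R (xbar - xs)" by simp
    then show ?thesis using n' by (simp only: scaleR_cancel_left matrix_vector_mult_scaleR) simp
  qed
  ultimately have "matrix_inv S *v (xbar - xs) = (real n - 1) *\<^sub>R ?w" by (rule matrix_inv_mult_eq)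
  then have "real n * ((xbar - xs) \<bullet> (matrix_inv S *v (xbar - xs))) = (real n - 1) * ((real n *\<^sub>R (xbar - xs)) \<bullet> ?w)"
    by simp
  then show ?thesis using det by (simp only: b[symmetric] hotelling_def if_False)
qed

text \<open>A continuous mapping theorem for a map continuous off the null set where
  \<open>D\<close> vanishes. \<open>T k\<close> is tied to \<open>Q\<close> only where
  \<open>D\<close> is nonzero, so the value of \<open>matrix_inv\<close> at singular matrices is
  immaterial. The mass lost to the cut-off is the integral of a continuous function of
  \<open>D\<close> and therefore converges as well.\<close>

lemma (in prob_space) weak_conv_m_off_null_set:
  fixes X :: "nat \<Rightarrow> 'a \<Rightarrow> 'k::countable \<Rightarrow> real" and D Q :: "('k \<Rightarrow> real) \<Rightarrow> real"
  assumes Xm [measurable]: "\<And>k. X k \<in> borel_measurable M"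
    and \<nu>: "prob_space \<nu>" "sets \<nu> = sets borel"
    and conv: "\<And>h B. continuous_on UNIV h \<Longrightarrow> (\<And>x. \<bar>h x\<bar> \<le> (B :: real)) \<Longrightarrow>
      (\<lambda>k. \<integral>\<omega>. h (X k \<omega>) \<partial>M) \<longlonglongrightarrow> (\<integral>x. h x \<partial>\<nu>)"
    and D: "continuous_on UNIV D" and Q: "continuous_on {y. D y \<noteq> 0} Q"
    and Qm [measurable]: "Q \<in> borel_measurable borel" and null: "AE y in \<nu>. D y \<noteq> 0"
    and Tm [measurable]: "\<And>k. T k \<in> borel_measurable M"
    and T: "\<And>k \<omega>. D (X k \<omega>) \<noteq> 0 \<Longrightarrow> T k \<omega> = Q (X k \<omega>)"
  shows "weak_conv_m (\<lambda>k. distr M borel (T k)) (distr \<nu> borel Q)"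
proof -
  interpret \<nu>: prob_space \<nu> by (rule \<nu>(1))
  have Dm[measurable]: "D \<in> borel_measurable borel" by (rule borel_measurable_continuous_onI[OF D])
  note mn = measurable_cong_sets[OF \<nu>(2) refl]
  have Q\<nu>: "Q \<in> measurable \<nu> borel" "D \<in> measurable \<nu> borel" using Qm Dm by (simp_all add: mn)
  have rd: "real_distribution (distr M borel (T k))" for k by (rule real_distribution_distr) simp
  have rd': "real_distribution (distr \<nu> borel Q)" by (rule \<nu>.real_distribution_distr) (rule Q\<nu>)
  show ?thesis
  proof (rule integral_bdd_continuous_conv_imp_weak_conv[OF rd rd'])
    fix g :: "real \<Rightarrow> real" assume gc: "\<And>x. isCont g x" and gb: "\<And>x. \<bar>g x\<bar> \<le> 1"
    have g: "continuous_on UNIV g" using gc by (simp add: continuous_at_imp_continuous_on)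
    have gm[measurable]: "g \<in> borel_measurable borel" by (rule borel_measurable_continuous_onI[OF g])
    \<comment> \<open>\<open>th m s\<close> is 0 for \<open>\<bar>s\<bar> \<le> 1 / m\<close> and 1
      for \<open>\<bar>s\<bar> \<ge> 2 / m\<close>.\<close>
    define th where "th = (\<lambda>(m::nat) s :: real. max 0 (min 1 (real m * \<bar>s\<bar> - 1)))"
    have th: "0 \<le> th m s" "th m s \<le> 1" "th m 0 = 0" for m s by (auto simp: th_def)
    have thc: "continuous_on UNIV (th m)" for m unfolding th_def by (intro continuous_intros)
    define h where "h = (\<lambda>m y. th m (D y) * g (Q y))"
    have hc: "continuous_on UNIV (h m)" for m
    proof -
      \<comment> \<open>Two open sets cover the space: on the first \<open>Q\<close> is continuous,
        on the second the cut-off makes the product identically 0.\<close>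
      have o1: "open {y. D y \<noteq> 0}" by (rule open_Collect_neq[OF D continuous_on_const])
      have o2: "open {y. real m * \<bar>D y\<bar> < 1}"
        by (intro open_Collect_less continuous_intros D)
      have c1: "continuous_on {y. D y \<noteq> 0} (h m)"
        unfolding h_def
        by (intro continuous_on_mult continuous_on_compose2[OF thc continuous_on_subset[OF D]] continuous_on_compose2[OF g Q]) auto
      have c2: "continuous_on {y. real m * \<bar>D y\<bar> < 1} (h m)"
        by (rule continuous_on_eq[OF continuous_on_const[of _ 0]]) (auto simp: h_def th_def)
      have "{y. D y \<noteq> 0} \<union> {y. real m * \<bar>D y\<bar> < 1} = UNIV" by auto
      then show ?thesis using continuous_on_open_Un[OF o1 o2 c1 c2] by simp
    qed
    have hb: "\<bar>h m y\<bar> \<le> 1" for m y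
      unfolding h_def abs_mult using th gb[of "Q y"] by (intro mult_le_one) auto
    have tc: "continuous_on UNIV (\<lambda>y. th m (D y))" for m by (rule continuous_on_compose2[OF thc D]) auto
    have hm[measurable]: "h m \<in> borel_measurable borel" for m by (rule borel_measurable_continuous_onI[OF hc])
    have tm[measurable]: "(\<lambda>y. th m (D y)) \<in> borel_measurable borel" for m by (rule borel_measurable_continuous_onI[OF tc])
    define e where "e = (\<lambda>m. 1 - (\<integral>y. th m (D y) \<partial>\<nu>))"
    have e0: "e \<longlonglongrightarrow> 0"
    proof -
      have "(\<lambda>m. \<integral>y. th m (D y) \<partial>\<nu>) \<longlonglongrightarrow> (\<integral>y. 1 \<partial>\<nu>)"
      proof (rule integral_dominated_convergence[where w="\<lambda>_. 1"])
        show "AE y in \<nu>. (\<lambda>m. th m (D y)) \<longlonglongrightarrow> 1"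
        proof (rule eventually_mono[OF null])
          fix y assume "D y \<noteq> 0"
          then have "0 < \<bar>D y\<bar>" by simp
          then obtain N where N: "2 < real N * \<bar>D y\<bar>" using ex_less_of_nat_mult by blast
          have "th m (D y) = 1" if "N \<le> m" for m
          proof -
            have "real N * \<bar>D y\<bar> \<le> real m * \<bar>D y\<bar>" using that by (intro mult_right_mono) auto
            then show ?thesis using N by (simp add: th_def)
          qed
          then show "(\<lambda>m. th m (D y)) \<longlonglongrightarrow> 1"
            by (intro tendsto_eventually) (auto simp: eventually_sequentially intro!: exI[of _ N])
        qed
      qed (use th in \<open>auto simp: mn\<close>)
      from tendsto_diff[OF tendsto_const[of 1] this] show ?thesis by (simp add: e_def \<nu>.prob_space)
    qed
    have lim1: "\<bar>(\<integral>y. h m y \<partial>\<nu>) - (\<integral>y. g (Q y) \<partial>\<nu>)\<bar> \<le> e m" for m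
    proof -
      have i: "integrable \<nu> (h m)" "integrable \<nu> (\<lambda>y. g (Q y))" "integrable \<nu> (\<lambda>y. th m (D y))"
        using hb gb th by (auto intro!: \<nu>.integrable_const_bound[of _ 1] simp: mn)
      have "\<bar>(\<integral>y. h m y \<partial>\<nu>) - (\<integral>y. g (Q y) \<partial>\<nu>)\<bar> \<le> (\<integral>y. \<bar>h m y - g (Q y)\<bar> \<partial>\<nu>)"
        using integral_abs_bound[of \<nu> "\<lambda>y. h m y - g (Q y)"] i by simp
      also have "\<dots> \<le> (\<integral>y. 1 - th m (D y) \<partial>\<nu>)"
      proof (rule integral_mono)
        fix y
        have "h m y - g (Q y) = - ((1 - th m (D y)) * g (Q y))" by (simp add: h_def algebra_simps)
        then have "\<bar>h m y - g (Q y)\<bar> = (1 - th m (D y)) * \<bar>g (Q y)\<bar>" using th by (simp add: abs_mult)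
        also have "\<dots> \<le> (1 - th m (D y)) * 1" using th gb by (intro mult_left_mono) auto
        finally show "\<bar>h m y - g (Q y)\<bar> \<le> 1 - th m (D y)" by simp
      qed (use i in auto)
      also have "\<dots> = e m" using i by (simp add: e_def \<nu>.prob_space)
      finally show ?thesis .
    qed
    have lim2: "\<bar>(\<integral>\<omega>. g (T k \<omega>) \<partial>M) - (\<integral>\<omega>. h m (X k \<omega>) \<partial>M)\<bar> \<le> 1 - (\<integral>\<omega>. th m (D (X k \<omega>)) \<partial>M)" for m k
    proof -
      have i: "integrable M (\<lambda>\<omega>. h m (X k \<omega>))" "integrable M (\<lambda>\<omega>. g (T k \<omega>))" "integrable M (\<lambda>\<omega>. th m (D (X k \<omega>)))"
        using hb gb th by (auto intro!: integrable_const_bound[of _ 1])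
      have "\<bar>(\<integral>\<omega>. g (T k \<omega>) \<partial>M) - (\<integral>\<omega>. h m (X k \<omega>) \<partial>M)\<bar> \<le> (\<integral>\<omega>. \<bar>g (T k \<omega>) - h m (X k \<omega>)\<bar> \<partial>M)"
        using integral_abs_bound[of M "\<lambda>\<omega>. g (T k \<omega>) - h m (X k \<omega>)"] i by simp
      also have "\<dots> \<le> (\<integral>\<omega>. 1 - th m (D (X k \<omega>)) \<partial>M)"
      proof (rule integral_mono)
        fix \<omega>
        have "g (T k \<omega>) - h m (X k \<omega>) = (1 - th m (D (X k \<omega>))) * g (T k \<omega>)"
        proof (cases "D (X k \<omega>) = 0")
          case True
          then show ?thesis using th by (simp add: h_def)
        next
          case False
          then show ?thesis by (simp add: h_def T algebra_simps)
        qed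
        then have "\<bar>g (T k \<omega>) - h m (X k \<omega>)\<bar> = (1 - th m (D (X k \<omega>))) * \<bar>g (T k \<omega>)\<bar>" using th by (simp add: abs_mult)
        also have "\<dots> \<le> (1 - th m (D (X k \<omega>))) * 1" using th gb by (intro mult_left_mono) auto
        finally show "\<bar>g (T k \<omega>) - h m (X k \<omega>)\<bar> \<le> 1 - th m (D (X k \<omega>))" by simp
      qed (use i in auto)
      also have "\<dots> = 1 - (\<integral>\<omega>. th m (D (X k \<omega>)) \<partial>M)" using i by (simp add: prob_space)
      finally show ?thesis .
    qed
    have "(\<lambda>k. \<integral>\<omega>. g (T k \<omega>) \<partial>M) \<longlonglongrightarrow> (\<integral>y. g (Q y) \<partial>\<nu>)"
    proof (rule LIMSEQ_I)
      fix r :: real assume r: "0 < r"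
      have "\<forall>\<^sub>F m in sequentially. e m < r / 5" using order_tendstoD(2)[OF e0, of "r / 5"] r by simp
      then obtain m where m: "e m < r / 5" by (auto simp: eventually_sequentially)
      have c1: "(\<lambda>k. \<integral>\<omega>. h m (X k \<omega>) \<partial>M) \<longlonglongrightarrow> (\<integral>y. h m y \<partial>\<nu>)" by (rule conv[OF hc hb])
      have c2: "(\<lambda>k. \<integral>\<omega>. th m (D (X k \<omega>)) \<partial>M) \<longlonglongrightarrow> (\<integral>y. th m (D y) \<partial>\<nu>)"
        by (rule conv[OF tc, of _ 1]) (use th in simp)
      obtain k1 where k1: "\<And>k. k1 \<le> k \<Longrightarrow> \<bar>(\<integral>\<omega>. h m (X k \<omega>) \<partial>M) - (\<integral>y. h m y \<partial>\<nu>)\<bar> < r / 5"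
        using LIMSEQ_D[OF c1, of "r / 5"] r by auto
      obtain k2 where k2: "\<And>k. k2 \<le> k \<Longrightarrow> \<bar>(\<integral>\<omega>. th m (D (X k \<omega>)) \<partial>M) - (\<integral>y. th m (D y) \<partial>\<nu>)\<bar> < r / 5"
        using LIMSEQ_D[OF c2, of "r / 5"] r by auto
      \<comment> \<open>\<open>lim2\<close> costs \<open>e m\<close> plus the error of
        \<open>c2\<close>; together with \<open>lim1\<close> and the error of \<open>c1\<close>,
        four of the five parts of \<open>r\<close> are spent.\<close>
      have "\<bar>(\<integral>\<omega>. g (T k \<omega>) \<partial>M) - (\<integral>y. g (Q y) \<partial>\<nu>)\<bar> < r" if "max k1 k2 \<le> k" for k
        using k1[of k] k2[of k] that lim1[of m] lim2[of k m] m r unfolding e_def by linarith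
      then show "\<exists>no. \<forall>k\<ge>no. norm ((\<integral>\<omega>. g (T k \<omega>) \<partial>M) - (\<integral>y. g (Q y) \<partial>\<nu>)) < r"
        by (intro exI[of _ "max k1 k2"] allI impI) simp
    qed
    moreover have "(\<integral>x. g x \<partial>distr M borel (T k)) = (\<integral>\<omega>. g (T k \<omega>) \<partial>M)" for k by (rule integral_distr) auto
    moreover have "(\<integral>x. g x \<partial>distr \<nu> borel Q) = (\<integral>y. g (Q y) \<partial>\<nu>)" by (rule integral_distr[OF Q\<nu>(1)]) simp
    ultimately show "(\<lambda>k. \<integral>x. g x \<partial>distr M borel (T k)) \<longlonglongrightarrow> (\<integral>x. g x \<partial>distr \<nu> borel Q)" by simp
  qed
qed

subsection \<open>Conditioning on an independent sample\<close>

text \<open>\<open>G\<close> is the past and \<open>B\<close> a fresh sample. The locale makes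
  precise that conditioning on \<open>G\<close> is integration over the law of \<open>B\<close> with
  everything \<open>G\<close>-measurable frozen.\<close>

locale indep_sample = prob_space M for M :: "'a measure" +
  fixes G :: "'a measure" and S :: "'b measure" and B :: "'a \<Rightarrow> 'b"
  assumes sub: "subalgebra M G" and B [measurable]: "B \<in> measurable M S"
    and ind: "\<And>A C. A \<in> sets G \<Longrightarrow> C \<in> sets S \<Longrightarrow>
      prob (A \<inter> (B -` C \<inter> space M)) = prob A * prob (B -` C \<inter> space M)"
begin

abbreviation "law \<equiv> distr M S B"

sublocale law: prob_space law by (rule prob_space_distr) simp

sublocale G: prob_space "restr_to_subalg M G"
  by (rule prob_space_restr_to_subalg[OF sub prob_space_axioms])

sublocale sigma_finite_subalgebra M G
  by (intro finite_measure_subalgebra_is_sigma_finite finite_measure_subalgebra.intro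
      finite_measure_subalgebra_axioms.intro sub) unfold_locales

lemma sets_G_law [measurable_cong]: "sets (restr_to_subalg M G \<Otimes>\<^sub>M law) = sets (G \<Otimes>\<^sub>M S)"
  by (intro sets_pair_measure_cong) (simp_all add: sets_restr_to_subalg[OF sub])

lemma Pair_measurable: "(\<lambda>\<omega>. (\<omega>, B \<omega>)) \<in> measurable M (restr_to_subalg M G \<Otimes>\<^sub>M law)"
proof -
  have "(\<lambda>\<omega>. \<omega>) \<in> measurable M G" by (rule measurable_from_subalg[OF sub]) simp
  then show ?thesis unfolding measurable_cong_sets[OF refl sets_G_law] by simp
qed

text \<open>The identity map into the smaller sigma-algebra \<open>G\<close> is independent of
  \<open>B\<close>, so the pair has a product law. All Fubini statements below rest on this.\<close>

lemma distr_Pair: "distr M (restr_to_subalg M G \<Otimes>\<^sub>M law) (\<lambda>\<omega>. (\<omega>, B \<omega>)) = restr_to_subalg M G \<Otimes>\<^sub>M law"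
proof (rule pair_measure_eqI[symmetric])
  fix A C assume A: "A \<in> sets (restr_to_subalg M G)" and C: "C \<in> sets law"
  have A': "A \<in> sets G" using A by (simp add: sets_restr_to_subalg[OF sub])
  have AM: "A \<in> sets M" using A' sub by (auto simp: subalgebra_def)
  have "(\<lambda>\<omega>. (\<omega>, B \<omega>)) -` (A \<times> C) \<inter> space M = A \<inter> (B -` C \<inter> space M)"
    using sets.sets_into_space[OF AM] by auto
  then show "emeasure (restr_to_subalg M G) A * emeasure law C
      = emeasure (distr M (restr_to_subalg M G \<Otimes>\<^sub>M law) (\<lambda>\<omega>. (\<omega>, B \<omega>))) (A \<times> C)"
    using A C A' ind[OF A', of C]
    by (simp add: emeasure_distr[OF Pair_measurable] emeasure_distr emeasure_restr_to_subalg[OF sub]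
        emeasure_eq_measure ennreal_mult'')
qed (auto intro: G.sigma_finite_measure law.sigma_finite_measure)

lemma nn_fubini:
  assumes k: "k \<in> borel_measurable (G \<Otimes>\<^sub>M S)"
  shows "(\<integral>\<^sup>+\<omega>. k (\<omega>, B \<omega>) \<partial>M) = (\<integral>\<^sup>+\<omega>. \<integral>\<^sup>+b. k (\<omega>, b) \<partial>law \<partial>M)"
    and "(\<lambda>\<omega>. \<integral>\<^sup>+b. k (\<omega>, b) \<partial>law) \<in> borel_measurable G"
proof -
  have k': "k \<in> borel_measurable (restr_to_subalg M G \<Otimes>\<^sub>M law)"
    using k by (simp add: measurable_cong_sets[OF sets_G_law refl])
  have m: "(\<lambda>\<omega>. \<integral>\<^sup>+b. k (\<omega>, b) \<partial>law) \<in> borel_measurable (restr_to_subalg M G)"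
    using k' by (rule law.borel_measurable_nn_integral_fst)
  then show m': "(\<lambda>\<omega>. \<integral>\<^sup>+b. k (\<omega>, b) \<partial>law) \<in> borel_measurable G"
    by (rule measurable_in_subalg'[OF sub])
  have "(\<integral>\<^sup>+\<omega>. k (\<omega>, B \<omega>) \<partial>M) = (\<integral>\<^sup>+p. k p \<partial>distr M (restr_to_subalg M G \<Otimes>\<^sub>M law) (\<lambda>\<omega>. (\<omega>, B \<omega>)))"
    by (rule nn_integral_distr[OF Pair_measurable, symmetric]) (simp add: k')
  also have "\<dots> = (\<integral>\<^sup>+p. k p \<partial>(restr_to_subalg M G \<Otimes>\<^sub>M law))" by (simp only: distr_Pair)
  also have "\<dots> = (\<integral>\<^sup>+\<omega>. \<integral>\<^sup>+b. k (\<omega>, b) \<partial>law \<partial>restr_to_subalg M G)"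
    using k' by (rule law.nn_integral_fst[symmetric])
  also have "\<dots> = (\<integral>\<^sup>+\<omega>. \<integral>\<^sup>+b. k (\<omega>, b) \<partial>law \<partial>M)"
    by (rule nn_integral_subalgebra2[OF sub m'])
  finally show "(\<integral>\<^sup>+\<omega>. k (\<omega>, B \<omega>) \<partial>M) = (\<integral>\<^sup>+\<omega>. \<integral>\<^sup>+b. k (\<omega>, b) \<partial>law \<partial>M)" .
qed

lemma fubini:
  fixes k :: "'a \<times> 'b \<Rightarrow> 'c::{banach, second_countable_topology}"
  assumes k: "k \<in> borel_measurable (G \<Otimes>\<^sub>M S)" and i: "integrable M (\<lambda>\<omega>. k (\<omega>, B \<omega>))"
  shows "(\<integral>\<omega>. k (\<omega>, B \<omega>) \<partial>M) = (\<integral>\<omega>. \<integral>b. k (\<omega>, b) \<partial>law \<partial>M)"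
proof -
  have k': "k \<in> borel_measurable (restr_to_subalg M G \<Otimes>\<^sub>M law)"
    using k by (simp add: measurable_cong_sets[OF sets_G_law refl])
  interpret P: pair_sigma_finite "restr_to_subalg M G" law ..
  have i': "integrable (restr_to_subalg M G \<Otimes>\<^sub>M law) k"
    using i integrable_distr_eq[OF Pair_measurable k'] by (simp add: distr_Pair)
  have m: "(\<lambda>\<omega>. \<integral>b. k (\<omega>, b) \<partial>law) \<in> borel_measurable G"
    by (rule measurable_in_subalg'[OF sub]) (rule law.borel_measurable_lebesgue_integral, use k' in simp)
  have "(\<integral>\<omega>. k (\<omega>, B \<omega>) \<partial>M) = (\<integral>p. k p \<partial>distr M (restr_to_subalg M G \<Otimes>\<^sub>M law) (\<lambda>\<omega>. (\<omega>, B \<omega>)))"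
    by (rule integral_distr[OF Pair_measurable k', symmetric])
  also have "\<dots> = (\<integral>p. k p \<partial>(restr_to_subalg M G \<Otimes>\<^sub>M law))" by (simp only: distr_Pair)
  also have "\<dots> = (\<integral>\<omega>. \<integral>b. k (\<omega>, b) \<partial>law \<partial>restr_to_subalg M G)"
    by (rule P.integral_fst'[OF i', symmetric])
  also have "\<dots> = (\<integral>\<omega>. \<integral>b. k (\<omega>, b) \<partial>law \<partial>M)"
    by (rule integral_subalgebra2[OF sub m])
  finally show ?thesis .
qed

lemma nn_cond_exp_freeze:
  assumes k: "k \<in> borel_measurable (G \<Otimes>\<^sub>M S)"
  shows "AE \<omega> in M. nn_cond_exp M G (\<lambda>\<omega>. k (\<omega>, B \<omega>)) \<omega> = (\<integral>\<^sup>+b. k (\<omega>, b) \<partial>law)"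
proof -
  have km: "(\<lambda>\<omega>. k (\<omega>, B \<omega>)) \<in> borel_measurable M"
    by (rule measurable_compose[OF Pair_measurable]) (use k in \<open>simp add: measurable_cong_sets[OF sets_G_law refl]\<close>)
  have "AE \<omega> in M. (\<integral>\<^sup>+b. k (\<omega>, b) \<partial>law) = nn_cond_exp M G (\<lambda>\<omega>. k (\<omega>, B \<omega>)) \<omega>"
  proof (rule nn_cond_exp_charact[OF _ km nn_fubini(2)[OF k]])
    fix A assume A[measurable]: "A \<in> sets G"
    note k[measurable]
    have "(\<integral>\<^sup>+\<omega>. k (\<omega>, B \<omega>) * indicator A \<omega> \<partial>M) = (\<integral>\<^sup>+\<omega>. \<integral>\<^sup>+b. k (\<omega>, b) * indicator A \<omega> \<partial>law \<partial>M)"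
      using nn_fubini(1)[of "\<lambda>p. k p * indicator A (fst p)"] by simp
    also have "\<dots> = (\<integral>\<^sup>+\<omega>. (\<integral>\<^sup>+b. k (\<omega>, b) \<partial>law) * indicator A \<omega> \<partial>M)"
    proof (rule nn_integral_cong)
      fix \<omega> assume "\<omega> \<in> space M"
      then have "\<omega> \<in> space G" using sub by (simp add: subalgebra_def)
      then have "(\<lambda>b. k (\<omega>, b)) \<in> borel_measurable S" by measurable
      then show "(\<integral>\<^sup>+b. k (\<omega>, b) * indicator A \<omega> \<partial>law) = (\<integral>\<^sup>+b. k (\<omega>, b) \<partial>law) * indicator A \<omega>"
        by (intro nn_integral_multc) simp
    qed
    finally show "(\<integral>\<^sup>+\<omega>. k (\<omega>, B \<omega>) * indicator A \<omega> \<partial>M) = (\<integral>\<^sup>+\<omega>. (\<integral>\<^sup>+b. k (\<omega>, b) \<partial>law) * indicator A \<omega> \<partial>M)" .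
  qed
  then show ?thesis by auto
qed

text \<open>Positive and negative parts are frozen separately. Integrability is asked of almost
  every frozen section, which is what the conditional moment bound delivers.\<close>

lemma real_cond_exp_freeze:
  assumes k: "k \<in> borel_measurable (G \<Otimes>\<^sub>M S)"
    and i: "AE \<omega> in M. integrable law (\<lambda>b. k (\<omega>, b))"
  shows "AE \<omega> in M. real_cond_exp M G (\<lambda>\<omega>. k (\<omega>, B \<omega>)) \<omega> = (\<integral>b. k (\<omega>, b) \<partial>law)"
proof -
  have "AE \<omega> in M. nn_cond_exp M G (\<lambda>\<omega>. ennreal (k (\<omega>, B \<omega>))) \<omega> = (\<integral>\<^sup>+b. ennreal (k (\<omega>, b)) \<partial>law)"
      "AE \<omega> in M. nn_cond_exp M G (\<lambda>\<omega>. ennreal (- k (\<omega>, B \<omega>))) \<omega> = (\<integral>\<^sup>+b. ennreal (- k (\<omega>, b)) \<partial>law)"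
    using k by (auto intro!: nn_cond_exp_freeze[of "\<lambda>p. ennreal (k p)"] nn_cond_exp_freeze[of "\<lambda>p. ennreal (- k p)"])
  then show ?thesis
    using i
  proof eventually_elim
    case (elim \<omega>)
    then show ?case by (simp add: real_cond_exp_def real_lebesgue_integral_def)
  qed
qed

end

subsection \<open>Averages of a finite i.i.d. sample\<close>

locale iid = prob_space \<mu> for \<mu> :: "'z measure" +
  fixes n :: nat
  assumes n: "0 < n"
begin

abbreviation "\<beta> \<equiv> PiM {1..n} (\<lambda>_. \<mu>)"

sublocale \<beta>: product_prob_space "\<lambda>_. \<mu>" "{1..n}"
  by (intro product_prob_spaceI) (rule prob_space_axioms)

lemma component_distr: "j \<in> {1..n} \<Longrightarrow> distr \<beta> \<mu> (\<lambda>b. b j) = \<mu>"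
  by (rule distr_PiM_component) (auto intro: prob_space_axioms)

lemma component_integral:
  fixes f :: "'z \<Rightarrow> 'b::{banach, second_countable_topology}"
  assumes j: "j \<in> {1..n}" and f: "f \<in> borel_measurable \<mu>"
  shows "(\<integral>b. f (b j) \<partial>\<beta>) = (\<integral>z. f z \<partial>\<mu>)" "integrable \<beta> (\<lambda>b. f (b j)) \<longleftrightarrow> integrable \<mu> f"
proof -
  have m: "(\<lambda>b. b j) \<in> measurable \<beta> \<mu>" using j by (rule measurable_component_singleton)
  show "(\<integral>b. f (b j) \<partial>\<beta>) = (\<integral>z. f z \<partial>\<mu>)"
    using integral_distr[OF m f] unfolding component_distr[OF j] by (rule sym)
  show "integrable \<beta> (\<lambda>b. f (b j)) \<longleftrightarrow> integrable \<mu> f"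
    using integrable_distr_eq[OF m f] unfolding component_distr[OF j] by (rule sym)
qed

lemma component_nn_integral:
  assumes j: "j \<in> {1..n}" and f: "f \<in> borel_measurable \<mu>"
  shows "(\<integral>\<^sup>+b. f (b j) \<partial>\<beta>) = (\<integral>\<^sup>+z. f z \<partial>\<mu>)"
proof -
  have "(\<lambda>b. b j) \<in> measurable \<beta> \<mu>" using j by (rule measurable_component_singleton)
  from nn_integral_distr[OF this, of f] f show ?thesis unfolding component_distr[OF j] by simp
qed

lemma square_integrable_imp_integrable_mult:
  fixes g h :: "'z \<Rightarrow> real"
  assumes [measurable]: "g \<in> borel_measurable \<mu>" "h \<in> borel_measurable \<mu>"
    and "integrable \<mu> (\<lambda>z. (g z)\<^sup>2)" "integrable \<mu> (\<lambda>z. (h z)\<^sup>2)"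
  shows "integrable \<mu> (\<lambda>z. g z * h z)"
proof (rule Bochner_Integration.integrable_bound)
  show "integrable \<mu> (\<lambda>z. (g z)\<^sup>2 + (h z)\<^sup>2)" using assms by simp
  have "\<bar>g z * h z\<bar> \<le> (g z)\<^sup>2 + (h z)\<^sup>2" for z
  proof -
    have "2 * \<bar>g z\<bar> * \<bar>h z\<bar> \<le> (g z)\<^sup>2 + (h z)\<^sup>2"
      using sum_squares_bound[of "\<bar>g z\<bar>" "\<bar>h z\<bar>"] by simp
    moreover have "0 \<le> \<bar>g z\<bar> * \<bar>h z\<bar>" by simp
    ultimately show ?thesis unfolding abs_mult by linarith
  qed
  then show "AE z in \<mu>. norm (g z * h z) \<le> norm ((g z)\<^sup>2 + (h z)\<^sup>2)" by simp
qed simp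

text \<open>Products over different sample indices factorise and contain the mean of
  \<open>g\<close>, so only the \<open>n\<close> diagonal terms remain.\<close>

lemma covariance:
  fixes g h :: "'z \<Rightarrow> real"
  assumes m[measurable]: "g \<in> borel_measurable \<mu>" "h \<in> borel_measurable \<mu>"
    and sq: "integrable \<mu> (\<lambda>z. (g z)\<^sup>2)" "integrable \<mu> (\<lambda>z. (h z)\<^sup>2)"
    and i: "integrable \<mu> g" "integrable \<mu> h" and 0: "(\<integral>z. g z \<partial>\<mu>) = 0"
  shows "integrable \<beta> (\<lambda>b. (\<Sum>j=1..n. g (b j)) * (\<Sum>j=1..n. h (b j)))"
    and "(\<integral>b. (\<Sum>j=1..n. g (b j)) * (\<Sum>j=1..n. h (b j)) \<partial>\<beta>) = real n * (\<integral>z. g z * h z \<partial>\<mu>)"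
proof -
  have gh: "integrable \<mu> (\<lambda>z. g z * h z)"
    by (rule square_integrable_imp_integrable_mult[OF m sq])
  have one: "integrable \<beta> (\<lambda>b. g (b j) * h (b l)) \<and>
      (\<integral>b. g (b j) * h (b l) \<partial>\<beta>) = (if j = l then \<integral>z. g z * h z \<partial>\<mu> else 0)"
    if j: "j \<in> {1..n}" and l: "l \<in> {1..n}" for j l
  proof (cases "j = l")
    case True
    then show ?thesis using component_integral[OF j, of "\<lambda>z. g z * h z"] gh by simp
  next
    case False
    \<comment> \<open>Padding with the constant 1 writes the product of two coordinates as a product
      over the whole sample.\<close>
    define f where "f = (\<lambda>i z. if i = j then g z else if i = l then h z else 1)"
    have fi: "integrable \<mu> (f i)" for i
      using i unfolding f_def by (cases "i = j"; cases "i = l") simp_all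
    have "(\<Prod>i\<in>{1..n}. f i (b i)) = g (b j) * h (b l)" for b
    proof -
      have "(\<Prod>i\<in>{1..n}. f i (b i)) = f j (b j) * (f l (b l) * (\<Prod>i\<in>{1..n} - {j} - {l}. f i (b i)))"
        using j l False prod.remove[of "{1..n}" j "\<lambda>i. f i (b i)"] prod.remove[of "{1..n} - {j}" l "\<lambda>i. f i (b i)"]
        by (simp del: One_nat_def)
      also have "(\<Prod>i\<in>{1..n} - {j} - {l}. f i (b i)) = 1" by (rule prod.neutral) (auto simp: f_def)
      finally show ?thesis using False by (simp add: f_def)
    qed
    moreover have "(\<Prod>i\<in>{1..n}. \<integral>z. f i z \<partial>\<mu>) = 0"
      using j 0 by (intro prod_zero bexI[of _ j]) (auto simp: f_def)
    ultimately show ?thesis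
      using \<beta>.product_integral_prod[of "{1..n}" f] \<beta>.product_integrable_prod[of "{1..n}" f] fi False by simp
  qed
  have e: "(\<Sum>j=1..n. g (b j)) * (\<Sum>j=1..n. h (b j)) = (\<Sum>j=1..n. \<Sum>l=1..n. g (b j) * h (b l))" for b
    by (rule sum_product)
  show "integrable \<beta> (\<lambda>b. (\<Sum>j=1..n. g (b j)) * (\<Sum>j=1..n. h (b j)))"
    unfolding e using one by (intro Bochner_Integration.integrable_sum) auto
  have "(\<integral>b. (\<Sum>j=1..n. g (b j)) * (\<Sum>j=1..n. h (b j)) \<partial>\<beta>)
      = (\<Sum>j=1..n. \<Sum>l=1..n. if j = l then \<integral>z. g z * h z \<partial>\<mu> else 0)"
  proof -
    have "(\<integral>b. (\<Sum>j=1..n. g (b j)) * (\<Sum>j=1..n. h (b j)) \<partial>\<beta>)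
        = (\<Sum>j=1..n. \<integral>b. (\<Sum>l=1..n. g (b j) * h (b l)) \<partial>\<beta>)"
      unfolding e by (rule Bochner_Integration.integral_sum, rule Bochner_Integration.integrable_sum) (use one in blast)
    also have "\<dots> = (\<Sum>j=1..n. \<Sum>l=1..n. \<integral>b. g (b j) * h (b l) \<partial>\<beta>)"
      by (rule sum.cong[OF refl], rule Bochner_Integration.integral_sum) (use one in blast)
    also have "\<dots> = (\<Sum>j=1..n. \<Sum>l=1..n. if j = l then \<integral>z. g z * h z \<partial>\<mu> else 0)"
      by (intro sum.cong refl) (use one in blast)
    finally show ?thesis .
  qed
  also have "\<dots> = real n * (\<integral>z. g z * h z \<partial>\<mu>)" by simp
  finally show "(\<integral>b. (\<Sum>j=1..n. g (b j)) * (\<Sum>j=1..n. h (b j)) \<partial>\<beta>) = real n * (\<integral>z. g z * h z \<partial>\<mu>)" .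
qed

lemma cis_average:
  fixes h :: "'z \<Rightarrow> real"
  assumes [measurable]: "h \<in> borel_measurable \<mu>"
  shows "(\<integral>b. cis (\<Sum>j=1..n. c * h (b j)) \<partial>\<beta>) = (char (distr \<mu> borel h) c) ^ n"
proof -
  have i: "integrable \<mu> (\<lambda>z. cis (c * h z))"
    by (intro integrable_const_bound[of _ 1]) (auto intro!: measurable_compose[OF _ cis_borel])
  have "cis (\<Sum>j=1..n. c * h (b j)) = (\<Prod>j=1..n. cis (c * h (b j)))" for b
    by (induction n) (auto simp: cis_mult[symmetric])
  then have "(\<integral>b. cis (\<Sum>j=1..n. c * h (b j)) \<partial>\<beta>) = (\<Prod>j=1..n. \<integral>z. cis (c * h z) \<partial>\<mu>)"
    using \<beta>.product_integral_prod[of "{1..n}" "\<lambda>_ z. cis (c * h z)"] i by simp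
  also have "(\<integral>z. cis (c * h z) \<partial>\<mu>) = char (distr \<mu> borel h) c"
    unfolding char_def by (subst integral_distr) (auto simp: cis_conv_exp)
  finally show ?thesis by simp
qed

(* The quantitative step of the Lindeberg central limit theorem. *)
lemma lindeberg_bound:
  fixes h :: "'z \<Rightarrow> real"
  assumes hm[measurable]: "h \<in> borel_measurable \<mu>" and i: "integrable \<mu> h"
    and 0: "(\<integral>z. h z \<partial>\<mu>) = 0" and sq: "integrable \<mu> (\<lambda>z. (h z)\<^sup>2)"
    and le: "(\<integral>z. (h z)\<^sup>2 \<partial>\<mu>) \<le> 4 * real n" and \<epsilon>: "0 < \<epsilon>"
  defines "v \<equiv> \<integral>z. (h z)\<^sup>2 \<partial>\<mu>"
  shows "cmod ((\<integral>b. cis (\<Sum>j=1..n. (1 / sqrt (real n)) * h (b j)) \<partial>\<beta>) - of_real (exp (- v / 2)))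
    \<le> \<epsilon> * v + (\<integral>z. (h z)\<^sup>2 * indicator {z. \<bar>h z\<bar> > \<epsilon> * sqrt (real n)} z \<partial>\<mu>) + v\<^sup>2 / (8 * real n)"
proof -
  let ?t = "1 / sqrt (real n)"
  let ?I = "\<lambda>z. indicator {z. \<bar>h z\<bar> > \<epsilon> * sqrt (real n)} z :: real"
  have n': "0 < real n" using n by simp
  have v0: "0 \<le> v" unfolding v_def by (rule Bochner_Integration.integral_nonneg) simp
  define \<psi> where "\<psi> = char (distr \<mu> borel h) ?t"
  have t2: "?t\<^sup>2 = 1 / real n" using n' by (simp add: power_divide)
  have ind_m: "(\<lambda>z. ?I z) \<in> borel_measurable \<mu>"
    by (rule borel_measurable_indicator') simp
  have iI: "integrable \<mu> (\<lambda>z. (h z)\<^sup>2 * ?I z)"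
    by (rule Bochner_Integration.integrable_bound[OF sq]) (auto simp: indicator_def ind_m intro!: borel_measurable_times)
  \<comment> \<open>Beyond \<open>\<epsilon> * sqrt (real n)\<close> the quadratic bound is used,
    below it the cubic one, where one factor is at most \<open>\<epsilon>\<close>.\<close>
  have min_le: "min (6 * (h z)\<^sup>2) (\<bar>?t\<bar> * \<bar>h z\<bar> ^ 3) \<le> \<epsilon> * (h z)\<^sup>2 + 6 * ((h z)\<^sup>2 * ?I z)" for z
  proof (cases "\<bar>h z\<bar> > \<epsilon> * sqrt (real n)")
    case True
    then have "6 * (h z)\<^sup>2 \<le> \<epsilon> * (h z)\<^sup>2 + 6 * ((h z)\<^sup>2 * ?I z)" using \<epsilon> by simp
    then show ?thesis by (rule order_trans[OF min.cobounded1])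
  next
    case False
    then have "?t * \<bar>h z\<bar> \<le> \<epsilon>" using n' by (simp add: pos_divide_le_eq)
    then have "?t * \<bar>h z\<bar> * (h z)\<^sup>2 \<le> \<epsilon> * (h z)\<^sup>2" by (intro mult_right_mono) auto
    moreover have "\<bar>?t\<bar> * \<bar>h z\<bar> ^ 3 = ?t * \<bar>h z\<bar> * (h z)\<^sup>2" using n' by (simp add: power3_eq_cube power2_eq_square)
    ultimately have "\<bar>?t\<bar> * \<bar>h z\<bar> ^ 3 \<le> \<epsilon> * (h z)\<^sup>2 + 6 * ((h z)\<^sup>2 * ?I z)"
      using False by (simp only:) simp
    then show ?thesis by (rule order_trans[OF min.cobounded2])
  qed
  have mini: "integrable \<mu> (\<lambda>z. min (6 * (h z)\<^sup>2) (\<bar>?t\<bar> * \<bar>h z\<bar> ^ 3))"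
    by (rule Bochner_Integration.integrable_bound[where f="\<lambda>z. 6 * (h z)\<^sup>2"]) (use sq in \<open>auto simp: min_def\<close>)
  have "cmod (\<psi> - (1 - ?t\<^sup>2 * v / 2)) \<le> (?t\<^sup>2 / 6) * (\<integral>z. min (6 * (h z)\<^sup>2) (\<bar>?t\<bar> * \<bar>h z\<bar> ^ 3) \<partial>\<mu>)"
    unfolding \<psi>_def by (rule char_approx3'[OF _ _ _ _ _ refl]) (use i 0 sq in \<open>simp_all add: v_def\<close>)
  also have "(\<integral>z. min (6 * (h z)\<^sup>2) (\<bar>?t\<bar> * \<bar>h z\<bar> ^ 3) \<partial>\<mu>) \<le> (\<integral>z. \<epsilon> * (h z)\<^sup>2 + 6 * ((h z)\<^sup>2 * ?I z) \<partial>\<mu>)"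
    by (rule integral_mono[OF mini _ min_le]) (use sq iI in auto)
  also have "\<dots> = \<epsilon> * v + 6 * (\<integral>z. (h z)\<^sup>2 * ?I z \<partial>\<mu>)"
    unfolding v_def by (subst Bochner_Integration.integral_add) (use sq iI in auto)
  finally have "cmod (\<psi> - (1 - ?t\<^sup>2 * v / 2)) \<le> (?t\<^sup>2 / 6) * (\<epsilon> * v + 6 * (\<integral>z. (h z)\<^sup>2 * ?I z \<partial>\<mu>))"
    by (simp add: mult_left_mono)
  then have "real n * cmod (\<psi> - (1 - ?t\<^sup>2 * v / 2)) \<le> real n * ((?t\<^sup>2 / 6) * (\<epsilon> * v + 6 * (\<integral>z. (h z)\<^sup>2 * ?I z \<partial>\<mu>)))"
    by (intro mult_left_mono) auto
  also have "\<dots> = (\<epsilon> * v) / 6 + (\<integral>z. (h z)\<^sup>2 * ?I z \<partial>\<mu>)"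
    unfolding t2 using n' by (simp add: field_simps)
  finally have A: "real n * cmod (\<psi> - (1 - ?t\<^sup>2 * v / 2)) \<le> \<epsilon> * v / 6 + (\<integral>z. (h z)\<^sup>2 * ?I z \<partial>\<mu>)" .
  define s where "s = v / (2 * real n)"
  \<comment> \<open>\<open>v \<le> 4 * real n\<close> gives \<open>s \<le> 2\<close>, hence
    \<open>\<bar>1 - s\<bar> \<le> 1\<close>; only then may the \<open>n\<close>-th powers be
    compared at cost \<open>n\<close> times the difference of the bases.\<close>
  have s: "0 \<le> s" "s \<le> 2" using v0 le n' by (auto simp: s_def v_def[symmetric] pos_divide_le_eq)
  have ts: "?t\<^sup>2 * v / 2 = s" by (simp add: t2 s_def)
  have "cmod (\<psi> ^ n - (of_real (1 - s)) ^ n) \<le> real n * cmod (\<psi> - of_real (1 - s))"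
  proof (rule norm_power_diff)
    interpret rd: real_distribution "distr \<mu> borel h" by (rule real_distribution_distr) simp
    show "cmod \<psi> \<le> 1" unfolding \<psi>_def by (rule rd.cmod_char_le_1)
    show "cmod (of_real (1 - s)) \<le> 1" using s by (simp del: of_real_diff)
  qed
  moreover have "cmod ((of_real (1 - s)) ^ n - (of_real (exp (- s))) ^ n) \<le> real n * cmod (of_real (1 - s) - of_real (exp (- s)))"
    using s by (intro norm_power_diff) (simp_all del: of_real_diff)
  moreover have "cmod (of_real (1 - s) - of_real (exp (- s))) \<le> s\<^sup>2 / 2"
  proof -
    have "1 - s \<le> exp (- s)" using exp_ge_add_one_self[of "- s"] by simp
    moreover have "exp (- s) \<le> 1 - s + s\<^sup>2 / 2"
    proof -
      let ?f = "\<lambda>x. 1 - x + x\<^sup>2 / 2 - exp (- x)"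
      have "?f 0 \<le> ?f s"
      proof (rule DERIV_nonneg_imp_nondecreasing[OF s(1)])
        fix x :: real assume "0 \<le> x" "x \<le> s"
        have "(?f has_real_derivative (- 1 + x + exp (- x))) (at x)"
          by (auto intro!: derivative_eq_intros)
        moreover have "0 \<le> - 1 + x + exp (- x)" using exp_ge_add_one_self[of "- x"] by simp
        ultimately show "\<exists>y. (?f has_real_derivative y) (at x) \<and> 0 \<le> y" by blast
      qed
      then show ?thesis by simp
    qed
    ultimately have "\<bar>(1 - s) - exp (- s)\<bar> \<le> s\<^sup>2 / 2" by linarith
    then show ?thesis by (metis norm_of_real of_real_diff)
  qed
  then have "real n * cmod (of_real (1 - s) - of_real (exp (- s))) \<le> real n * (s\<^sup>2 / 2)" using n' by (intro mult_left_mono) auto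
  moreover have "real n * (s\<^sup>2 / 2) = v\<^sup>2 / (8 * real n)"
    using n' by (simp add: s_def power2_eq_square field_simps)
  moreover have "(of_real (exp (- s))) ^ n = (of_real (exp (- v / 2)) :: complex)"
    using n' by (simp add: of_real_power[symmetric] exp_of_nat_mult[symmetric] s_def del: of_real_power)
  moreover have "\<psi> ^ n = (\<integral>b. cis (\<Sum>j=1..n. ?t * h (b j)) \<partial>\<beta>)"
    unfolding \<psi>_def by (rule cis_average[symmetric]) simp
  moreover have "cmod (\<psi> ^ n - of_real (exp (- v / 2))) \<le> cmod (\<psi> ^ n - (of_real (1 - s)) ^ n) + cmod ((of_real (1 - s)) ^ n - of_real (exp (- v / 2)))"
    using norm_triangle_ineq[of "\<psi> ^ n - (of_real (1 - s)) ^ n" "(of_real (1 - s)) ^ n - of_real (exp (- v / 2))"] by simp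
  moreover have "\<epsilon> * v / 6 \<le> \<epsilon> * v" using v0 \<epsilon> by simp
  ultimately show ?thesis using A unfolding ts by (simp only: of_real_diff of_real_1)
qed

end

subsection \<open>One replication of the algorithm\<close>

text \<open>The generator is regrouped as a union over index pairs, the form in which independent
  families are merged into sigma-algebras.\<close>

lemma sets_history: "sets (history M N s k) = sigma_sets (space M)
    (\<Union>(t, j)\<in>{(t, j). t < k \<and> j \<in> {1..N t}}. {s t j -` B \<inter> space M | B. B \<in> sets borel})"
proof -
  have e: "(\<Union>(t, j)\<in>{(t, j). t < k \<and> j \<in> {1..N t}}. {s t j -` B \<inter> space M | B. B \<in> sets borel})
     = {s t j -` B \<inter> space M | t j B. t < k \<and> j \<in> {1..N t} \<and> B \<in> sets borel}" by blast
  show ?thesis unfolding e history_def by (rule sets_measure_of) auto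
qed

lemma space_history [simp]: "space (history M N s k) = space M"
  unfolding history_def by (rule space_measure_of) auto

text \<open>A single replication. The objective has disappeared: what convexity and smoothness
  contribute is reduced to \<open>step\<close>, \<open>lin\<close>, \<open>symH\<close> and
  \<open>rem\<close>.\<close>

locale sgd_chain = prob_space M for M :: "'a measure" +
  fixes \<mu>0 :: "(real^'d) measure" and gF :: "real^'m \<Rightarrow> real^'d \<Rightarrow> real^'m" and gf :: "real^'m \<Rightarrow> real^'m"
    and \<xi> :: "nat \<Rightarrow> nat \<Rightarrow> 'a \<Rightarrow> real^'d" and x w :: "nat \<Rightarrow> 'a \<Rightarrow> real^'m"
    and x0 xs :: "real^'m" and H S0 P :: "real^'m^'m" and \<alpha> \<rho> q R \<nu> :: real and N :: "nat \<Rightarrow> nat"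
  assumes gF_m: "(\<lambda>p. gF (fst p) (snd p)) \<in> borel_measurable (borel \<Otimes>\<^sub>M borel)"
    and gf_m [measurable]: "gf \<in> borel_measurable borel"
    and indep: "indep_vars (\<lambda>_. borel) (\<lambda>(k, j). \<xi> k j) {(k, j). j \<in> {1..N k}}"
    and law: "\<And>k j. j \<in> {1..N k} \<Longrightarrow> distr M borel (\<xi> k j) = \<mu>0"
    and x_0: "\<And>\<omega>. x 0 \<omega> = x0"
    and w_eq: "\<And>k \<omega>. w k \<omega> = (1 / real (N k)) *\<^sub>R (\<Sum>j=1..N k. gF (x k \<omega>) (\<xi> k j \<omega>)) - gf (x k \<omega>)"
    and x_Suc: "\<And>k \<omega>. x (Suc k) \<omega> = x k \<omega> - \<alpha> *\<^sub>R (gf (x k \<omega>) + w k \<omega>)"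
    and \<alpha>: "0 < \<alpha>" and q: "0 \<le> q" "q < \<rho>" and \<rho>: "\<rho> < 1"
    and N: "\<And>k. N k = nat \<lceil>1 / \<rho> ^ (k + 1)\<rceil>"
    and step: "\<And>y. (norm (y - xs - \<alpha> *\<^sub>R gf y))\<^sup>2 \<le> q * (norm (y - xs))\<^sup>2"
    and lin: "\<And>h. (norm (h - \<alpha> *\<^sub>R (H *v h)))\<^sup>2 \<le> q * (norm h)\<^sup>2"
    and symH: "\<And>u v. u \<bullet> (H *v v) = v \<bullet> (H *v u)"
    and R: "0 < R" and rem: "\<And>y. norm (gf y - H *v (y - xs)) \<le> R * (norm (y - xs))\<^sup>2"
    and \<nu>: "0 < \<nu>"
    and mean: "\<And>k j. j \<in> {1..N k} \<Longrightarrow> AE \<omega> in M. cond_exp_vec M (history M N \<xi> k)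
              (\<lambda>\<omega>'. gF (x k \<omega>') (\<xi> k j \<omega>')) \<omega> = gf (x k \<omega>)"
    and second: "\<And>k j. j \<in> {1..N k} \<Longrightarrow> AE \<omega> in M. nn_cond_exp M (history M N \<xi> k)
              (\<lambda>\<omega>'. ennreal ((norm (gF (x k \<omega>') (\<xi> k j \<omega>') - gf (x k \<omega>')))\<^sup>2)) \<omega>
              \<le> ennreal (\<nu>\<^sup>2)"
    and cov: "AE \<omega> in M. (\<lambda>k. real (N k) *\<^sub>R cond_exp_mat M (history M N \<xi> k)
              (\<lambda>\<omega>'. outer (w k \<omega>') (w k \<omega>')) \<omega>) \<longlonglongrightarrow> S0"
    and lindeberg: "\<And>\<epsilon>. 0 < \<epsilon> \<Longrightarrow> (\<lambda>k. (1 / ennreal (real (N k))) * (\<Sum>j=1..N k. \<integral>\<^sup>+\<omega>.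
              ennreal ((norm (gF (x k \<omega>) (\<xi> k j \<omega>) - gf (x k \<omega>)))\<^sup>2) *
              indicator {\<omega>. norm (gF (x k \<omega>) (\<xi> k j \<omega>) - gf (x k \<omega>))
                              > \<epsilon> * sqrt (real (N k))} \<omega> \<partial>M)) \<longlonglongrightarrow> 0"
    and P: "P = (\<rho> powr (-1/2)) *\<^sub>R (mat 1 - \<alpha> *\<^sub>R H)"
begin

lemma rho_pos: "0 < \<rho>" using q by simp

lemma N_ge: "1 / \<rho> ^ (k + 1) \<le> real (N k)"
  unfolding N by (rule real_nat_ceiling_ge)

lemma N_le: "real (N k) \<le> 1 / \<rho> ^ (k + 1) + 1"
proof -
  have "0 < 1 / \<rho> ^ (k + 1)" using rho_pos by simp
  then have "0 \<le> \<lceil>1 / \<rho> ^ (k + 1)\<rceil>" unfolding zero_le_ceiling by linarith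
  then show ?thesis unfolding N using ceiling_correct[of "1 / \<rho> ^ (k + 1)"] by simp
qed

lemma N_pos: "0 < N k"
proof -
  have "0 < 1 / \<rho> ^ (k + 1)" using rho_pos by simp
  also note N_ge[of k]
  finally show ?thesis by simp
qed

section \<open>Batches and their independence of the past\<close>

abbreviation "hist k \<equiv> history M N \<xi> k"
abbreviation "E k \<equiv> PiM {1..N k} (\<lambda>_. borel :: (real^'d) measure)"
abbreviation "\<beta> k \<equiv> PiM {1..N k} (\<lambda>_. \<mu>0)"

definition batch :: "nat \<Rightarrow> 'a \<Rightarrow> nat \<Rightarrow> real^'d" where
  "batch k \<omega> = (\<lambda>j\<in>{1..N k}. \<xi> k j \<omega>)"

text \<open>The averaged error as a deterministic function of the point and the batch, so that the
  point can be frozen.\<close>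

definition Wf :: "nat \<Rightarrow> real^'m \<Rightarrow> (nat \<Rightarrow> real^'d) \<Rightarrow> real^'m" where
  "Wf k y b = (1 / real (N k)) *\<^sub>R (\<Sum>j=1..N k. gF y (b j)) - gf y"

definition dev :: "real^'m \<Rightarrow> real^'d \<Rightarrow> real^'m" where
  "dev y z = gF y z - gf y"

lemma w_batch: "w k \<omega> = Wf k (x k \<omega>) (batch k \<omega>)"
proof -
  have "(\<Sum>j=1..N k. gF (x k \<omega>) (\<xi> k j \<omega>)) = (\<Sum>j=1..N k. gF (x k \<omega>) (batch k \<omega> j))"
    unfolding batch_def by (rule sum.cong) auto
  then show ?thesis by (simp only: w_eq Wf_def)
qed

lemma Wf_dev: "Wf k y b = (1 / real (N k)) *\<^sub>R (\<Sum>j=1..N k. dev y (b j))"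
proof -
  have "(\<Sum>j=1..N k. gf y) = real (N k) *\<^sub>R gf y" by (simp only: sum_constant_scaleR) simp
  then show ?thesis
    using N_pos[of k] by (simp only: Wf_def dev_def sum_subtractf scaleR_diff_right) simp
qed

lemma xi_measurable: "j \<in> {1..N k} \<Longrightarrow> \<xi> k j \<in> borel_measurable M"
  using indep unfolding indep_vars_def by auto

lemma prob_mu0: "prob_space \<mu>0"
proof -
  have "1 \<in> {1..N 0}" using N_pos[of 0] by simp
  then show ?thesis using law[of 1 0] xi_measurable[of 1 0] prob_space_distr by metis
qed

lemma sets_mu0 [measurable_cong]: "sets \<mu>0 = sets borel"
proof -
  have "1 \<in> {1..N 0}" using N_pos[of 0] by simp
  then show ?thesis using law[of 1 0] by (metis sets_distr)
qed

lemma hist_sub: "subalgebra M (hist k)"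
  unfolding subalgebra_def sets_history
  by (auto intro!: sets.sigma_sets_subset measurable_sets[OF xi_measurable])

lemma hist_mono: "k \<le> l \<Longrightarrow> subalgebra (hist l) (hist k)"
  unfolding subalgebra_def sets_history space_history
  by (intro conjI refl sigma_sets_mono' UN_mono) auto

lemma xi_hist: "t < k \<Longrightarrow> j \<in> {1..N t} \<Longrightarrow> \<xi> t j \<in> measurable (hist k) borel"
  by (rule measurableI) (auto simp: sets_history intro!: sigma_sets.Basic)

lemma batch_measurable: "batch k \<in> measurable M (E k)"
  unfolding batch_def by (intro measurable_restrict xi_measurable)

lemma batch_hist: "t < k \<Longrightarrow> batch t \<in> measurable (hist k) (E t)"
  unfolding batch_def by (intro measurable_restrict xi_hist)

text \<open>The samples with \<open>t < k\<close> and those with \<open>t = k\<close> have disjoint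
  indices, so the sigma-algebras they generate are independent; \<open>batch k\<close> is measurable
  with respect to the second one.\<close>

lemma batch_indep: "indep_sample M (hist k) (E k) (batch k)"
proof
  show "subalgebra M (hist k)" by (rule hist_sub)
  show "batch k \<in> measurable M (E k)" by (rule batch_measurable)
  let ?F = "\<lambda>(t, j). {\<xi> t j -` B \<inter> space M | B. B \<in> sets borel}"
  let ?I = "case_bool {(t, j). t < k \<and> j \<in> {1..N t}} {(t, j). t = k \<and> j \<in> {1..N t}}"
  have "indep_sets ?F {(t, j). j \<in> {1..N t}}"
    using indep unfolding indep_vars_def2 by (simp add: case_prod_beta')
  then have "indep_sets ?F (\<Union>b\<in>UNIV. ?I b)"
    by (rule indep_sets_mono_index[rotated]) (auto simp: UNIV_bool)
  then have "indep_sets (\<lambda>b. sigma_sets (space M) (\<Union>i\<in>?I b. ?F i)) UNIV"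
  proof (rule indep_sets_collect_sigma)
    fix i b assume "i \<in> ?I b"
    show "Int_stable (?F i)"
    proof (cases i)
      case (Pair t j)
      show ?thesis unfolding Pair
      proof (safe intro!: Int_stableI, simp)
        fix B B' :: "(real^'d) set" assume "B \<in> sets borel" "B' \<in> sets borel"
        then show "\<exists>B''. \<xi> t j -` B \<inter> space M \<inter> (\<xi> t j -` B' \<inter> space M) = \<xi> t j -` B'' \<inter> space M \<and> B'' \<in> sets borel"
          by (intro exI[of _ "B \<inter> B'"]) auto
      qed
    qed
  qed (auto simp: disjoint_family_on_def UNIV_bool)
  then have "indep_set (sets (hist k)) (sigma_sets (space M) (\<Union>i\<in>?I False. ?F i))"
    unfolding indep_set_def sets_history by (rule indep_sets_mono_sets) (auto split: bool.split)
  then have pr: "prob (A \<inter> C) = prob A * prob C"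
    if "A \<in> sets (hist k)" "C \<in> sigma_sets (space M) (\<Union>i\<in>?I False. ?F i)" for A C
    using that unfolding indep_sets2_eq by blast
  define U0 where "U0 = (\<Union>i\<in>?I False. ?F i)"
  let ?G = "sigma (space M) U0"
  have "U0 \<subseteq> Pow (space M)" by (auto simp: U0_def)
  then have G: "sets ?G = sigma_sets (space M) U0" "space ?G = space M"
    by (rule sets_measure_of, rule space_measure_of)
  have "batch k \<in> measurable ?G (E k)"
    unfolding batch_def
  proof (rule measurable_restrict)
    fix j assume "j \<in> {1..N k}"
    then have "\<xi> k j -` A \<inter> space M \<in> U0" if "A \<in> sets borel" for A
      using that by (auto simp: U0_def)
    then show "\<xi> k j \<in> measurable ?G borel"
      by (intro measurableI) (simp_all only: G sigma_sets.Basic space_borel UNIV_I)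
  qed
  then have "batch k -` C \<inter> space M \<in> sigma_sets (space M) U0" if "C \<in> sets (E k)" for C
    using measurable_sets[OF _ that, of "batch k" ?G] unfolding G by blast
  then show "prob (A \<inter> (batch k -` C \<inter> space M)) = prob A * prob (batch k -` C \<inter> space M)"
    if "A \<in> sets (hist k)" "C \<in> sets (E k)" for A C
    using pr[folded U0_def] that by blast
qed

lemma batch_law: "distr M (E k) (batch k) = \<beta> k"
proof -
  have "indep_vars (\<lambda>_. borel) (\<xi> k) {1..N k}"
    unfolding indep_vars_def2
  proof
    have ind: "indep_sets (\<lambda>(t, j). {\<xi> t j -` B \<inter> space M | B. B \<in> sets borel}) {(t, j). j \<in> {1..N t}}"
      using indep unfolding indep_vars_def2 by (simp add: case_prod_beta')
    show "indep_sets (\<lambda>j. {\<xi> k j -` B \<inter> space M | B. B \<in> sets borel}) {1..N k}"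
    proof (rule indep_setsI)
      fix A J assume J: "J \<noteq> {}" "J \<subseteq> {1..N k}" "finite J"
        and A: "\<forall>j\<in>J. A j \<in> {\<xi> k j -` B \<inter> space M | B. B \<in> sets borel}"
      have "prob (\<Inter>p\<in>Pair k ` J. A (snd p)) = (\<Prod>p\<in>Pair k ` J. prob (A (snd p)))"
        by (rule indep_setsD[OF ind]) (use J A in auto)
      then show "prob (\<Inter>j\<in>J. A j) = (\<Prod>j\<in>J. prob (A j))"
        by (simp add: image_image prod.reindex inj_on_def)
    qed (auto intro!: measurable_sets[OF xi_measurable])
  qed (use xi_measurable in auto)
  then have "distr M (E k) (\<lambda>\<omega>. \<lambda>j\<in>{1..N k}. \<xi> k j \<omega>) = (\<Pi>\<^sub>M j\<in>{1..N k}. distr M borel (\<xi> k j))"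
    using xi_measurable N_pos[of k] by (subst (asm) indep_vars_iff_distr_eq_PiM') auto
  also have "\<dots> = \<beta> k" by (intro PiM_cong) (auto simp: law)
  finally show ?thesis unfolding batch_def[abs_def] .
qed

lemma sets_beta: "sets (\<beta> k) = sets (E k)"
  by (intro sets_PiM_cong) (simp_all add: sets_mu0)

lemma iid_batch: "iid \<mu>0 (N k)"
  by (intro iid.intro iid_axioms.intro prob_mu0 N_pos)

lemma prob_beta: "prob_space (\<beta> k)"
  by (intro prob_space_PiM prob_mu0)

lemma Wf_measurable: "(\<lambda>p. Wf k (fst p) (snd p)) \<in> borel_measurable (borel \<Otimes>\<^sub>M E k)"
proof -
  have "(\<lambda>p. gF (fst p) (snd p j)) \<in> borel_measurable (borel \<Otimes>\<^sub>M E k)" if j: "j \<in> {1..N k}" for j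
  proof -
    have "(\<lambda>p. (fst p, snd p j)) \<in> measurable (borel \<Otimes>\<^sub>M E k) (borel \<Otimes>\<^sub>M borel)"
      by (intro measurable_Pair measurable_fst measurable_compose[OF measurable_snd measurable_component_singleton[OF j]])
    from measurable_compose[OF this gF_m] show ?thesis by simp
  qed
  then show ?thesis unfolding Wf_def
    by (intro borel_measurable_diff borel_measurable_scaleR borel_measurable_sum borel_measurable_const
        measurable_compose[OF measurable_fst gf_m]) auto
qed

lemma dev_measurable: "(\<lambda>p. dev (fst p) (snd p)) \<in> borel_measurable (borel \<Otimes>\<^sub>M borel)"
  unfolding dev_def by (intro borel_measurable_diff gF_m measurable_compose[OF measurable_fst gf_m])

lemma dev_measurable2 [measurable]: "dev y \<in> borel_measurable borel"
  using measurable_compose[OF measurable_Pair1' dev_measurable, of y] by simp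

lemma x_hist: "x k \<in> measurable (hist k) borel"
proof (induction k)
  case 0
  have "x 0 = (\<lambda>_. x0)" by (simp add: fun_eq_iff x_0)
  then show ?case by simp
next
  case (Suc k)
  have xm: "x k \<in> measurable (hist (Suc k)) borel"
    by (rule measurable_from_subalg[OF hist_mono Suc]) simp
  have "(\<lambda>\<omega>. (x k \<omega>, batch k \<omega>)) \<in> measurable (hist (Suc k)) (borel \<Otimes>\<^sub>M E k)"
    by (intro measurable_Pair xm batch_hist) simp
  from measurable_compose[OF this Wf_measurable]
  have "(\<lambda>\<omega>. w k \<omega>) \<in> measurable (hist (Suc k)) borel" by (simp add: w_batch)
  then show ?case
    unfolding x_Suc[abs_def]
    by (intro borel_measurable_diff borel_measurable_scaleR borel_measurable_add borel_measurable_const xm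
        measurable_compose[OF xm gf_m])
qed

lemma x_measurable [measurable]: "x k \<in> borel_measurable M"
  by (rule measurable_from_subalg[OF hist_sub x_hist])

lemma w_hist: "w k \<in> measurable (hist (Suc k)) borel"
proof -
  have xm: "x k \<in> measurable (hist (Suc k)) borel"
    by (rule measurable_from_subalg[OF hist_mono x_hist]) simp
  have "(\<lambda>\<omega>. (x k \<omega>, batch k \<omega>)) \<in> measurable (hist (Suc k)) (borel \<Otimes>\<^sub>M E k)"
    by (intro measurable_Pair xm batch_hist) simp
  from measurable_compose[OF this Wf_measurable] show ?thesis by (simp add: w_batch[abs_def])
qed

lemma w_measurable [measurable]: "w k \<in> borel_measurable M"
  by (rule measurable_from_subalg[OF hist_sub w_hist])

section \<open>Moments of the noise at a frozen point and mean square rate\<close>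

definition good :: "real^'m \<Rightarrow> bool" where
  "good y \<longleftrightarrow> integrable \<mu>0 (\<lambda>z. (norm (dev y z))\<^sup>2) \<and> (\<integral>z. (norm (dev y z))\<^sup>2 \<partial>\<mu>0) \<le> \<nu>\<^sup>2 \<and>
     (\<forall>a. (\<integral>z. dev y z $ a \<partial>\<mu>0) = 0)"

definition covm :: "real^'m \<Rightarrow> 'm \<Rightarrow> 'm \<Rightarrow> real" where
  "covm y a b = (\<integral>z. dev y z $ a * dev y z $ b \<partial>\<mu>0)"

lemma dev_mu0 [measurable]: "dev y \<in> borel_measurable \<mu>0"
  by (simp add: measurable_cong_sets[OF sets_mu0 refl])

lemma vec_nth_borel [measurable]: "(\<lambda>v :: real^'n. v $ a) \<in> borel_measurable borel"
  by (intro borel_measurable_continuous_onI continuous_intros)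

lemma norm_power2_eq_sum: "(norm (v :: real^'n))\<^sup>2 = (\<Sum>a\<in>UNIV. (v $ a)\<^sup>2)"
  by (simp only: power2_norm_eq_inner inner_vec_def inner_real_def) (simp add: power2_eq_square)

lemma dev_component [measurable]: "(\<lambda>z. dev y z $ a) \<in> borel_measurable \<mu>0"
  by (rule measurable_compose[OF dev_mu0 vec_nth_borel])

lemma square_integrable_components:
  assumes "integrable \<mu>0 (\<lambda>z. (norm (dev y z))\<^sup>2)"
  shows "integrable \<mu>0 (\<lambda>z. (dev y z $ a)\<^sup>2)" "integrable \<mu>0 (\<lambda>z. dev y z $ a)"
proof -
  interpret mu0: prob_space \<mu>0 by (rule prob_mu0)
  have le: "(dev y z $ a)\<^sup>2 \<le> (norm (dev y z))\<^sup>2" for z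
    using component_le_norm_cart[of "dev y z" a] by (simp add: power2_le_iff_abs_le)
  show i: "integrable \<mu>0 (\<lambda>z. (dev y z $ a)\<^sup>2)"
    by (rule Bochner_Integration.integrable_bound[OF assms]) (use le in auto)
  show "integrable \<mu>0 (\<lambda>z. dev y z $ a)"
    by (rule mu0.square_integrable_imp_integrable[OF _ i]) measurable
qed

text \<open>Freezing \<open>x k\<close> turns the conditional moments of the first sample into
  moments under \<open>\<mu>0\<close>. The second moment comes first, because it provides the
  integrability needed to identify the conditional mean.\<close>

lemma AE_good: "AE \<omega> in M. good (x k \<omega>)"
proof -
  interpret S: indep_sample M "hist k" "E k" "batch k" by (rule batch_indep)
  interpret I: iid \<mu>0 "N k" by (rule iid_batch)
  have one: "1 \<in> {1..N k}" using N_pos[of k] by simp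
  have x': "x k \<in> measurable (hist k) borel" by (rule x_hist)
  have pm: "(\<lambda>p. (x k (fst p), snd p 1)) \<in> measurable (hist k \<Otimes>\<^sub>M E k) (borel \<Otimes>\<^sub>M borel)"
    by (intro measurable_Pair measurable_compose[OF measurable_fst x']
        measurable_compose[OF measurable_snd measurable_component_singleton[OF one]])
  have bx: "batch k \<omega> 1 = \<xi> k 1 \<omega>" for \<omega> using one by (simp add: batch_def)
  have dm: "(\<lambda>p. dev (x k (fst p)) (snd p 1)) \<in> borel_measurable (hist k \<Otimes>\<^sub>M E k)"
    using measurable_compose[OF pm dev_measurable] by simp
  have gm: "(\<lambda>p. gF (x k (fst p)) (snd p 1)) \<in> borel_measurable (hist k \<Otimes>\<^sub>M E k)"
    using measurable_compose[OF pm gF_m] by simp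
  have "AE \<omega> in M. nn_cond_exp M (hist k) (\<lambda>\<omega>. ennreal ((norm (dev (x k \<omega>) (batch k \<omega> 1)))\<^sup>2)) \<omega>
      = (\<integral>\<^sup>+b. ennreal ((norm (dev (x k \<omega>) (b 1)))\<^sup>2) \<partial>S.law)"
    using S.nn_cond_exp_freeze[of "\<lambda>p. ennreal ((norm (dev (x k (fst p)) (snd p 1)))\<^sup>2)"] dm by simp
  then have sq: "AE \<omega> in M. (\<integral>\<^sup>+z. ennreal ((norm (dev (x k \<omega>) z))\<^sup>2) \<partial>\<mu>0) \<le> ennreal (\<nu>\<^sup>2)"
    using second[OF one]
  proof eventually_elim
    case (elim \<omega>)
    have "(\<integral>\<^sup>+z. ennreal ((norm (dev (x k \<omega>) z))\<^sup>2) \<partial>\<mu>0) = (\<integral>\<^sup>+b. ennreal ((norm (dev (x k \<omega>) (b 1)))\<^sup>2) \<partial>S.law)"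
      unfolding batch_law by (rule I.component_nn_integral[OF one, symmetric]) measurable
    then show ?case using elim unfolding bx dev_def by (simp only:)
  qed
  have int: "integrable \<mu>0 (\<lambda>z. (norm (dev y z))\<^sup>2)"
    if "(\<integral>\<^sup>+z. ennreal ((norm (dev y z))\<^sup>2) \<partial>\<mu>0) \<le> ennreal (\<nu>\<^sup>2)" for y
    using that by (intro integrableI_bounded) (auto intro: le_less_trans)
  have gfi: "integrable \<mu>0 (\<lambda>z. gF y z $ a) \<and> (\<integral>z. gF y z $ a \<partial>\<mu>0) = (\<integral>z. dev y z $ a \<partial>\<mu>0) + gf y $ a"
    if "(\<integral>\<^sup>+z. ennreal ((norm (dev y z))\<^sup>2) \<partial>\<mu>0) \<le> ennreal (\<nu>\<^sup>2)" for y a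
  proof -
    have i: "integrable \<mu>0 (\<lambda>z. dev y z $ a)" by (rule square_integrable_components(2)[OF int[OF that]])
    have "gF y z $ a = dev y z $ a + gf y $ a" for z by (simp add: dev_def)
    then show ?thesis using i by (simp add: I.prob_space)
  qed
  have gF1: "gF y \<in> borel_measurable \<mu>0" for y
    using measurable_compose[OF measurable_Pair1' gF_m, of y] by (simp add: measurable_cong_sets[OF sets_mu0 refl])
  have mn: "AE \<omega> in M. \<forall>a. real_cond_exp M (hist k) (\<lambda>\<omega>. gF (x k \<omega>) (batch k \<omega> 1) $ a) \<omega>
      = (\<integral>b. gF (x k \<omega>) (b 1) $ a \<partial>S.law)"
    unfolding AE_all_countable
  proof
    fix a
    have "AE \<omega> in M. integrable S.law (\<lambda>b. gF (x k \<omega>) (b 1) $ a)"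
      using sq
    proof eventually_elim
      case (elim \<omega>)
      have "(\<lambda>z. gF (x k \<omega>) z $ a) \<in> borel_measurable \<mu>0" using gF1 by measurable
      from I.component_integral(2)[OF one this] gfi[OF elim, of a] show ?case unfolding batch_law by blast
    qed
    then show "AE \<omega> in M. real_cond_exp M (hist k) (\<lambda>\<omega>. gF (x k \<omega>) (batch k \<omega> 1) $ a) \<omega>
      = (\<integral>b. gF (x k \<omega>) (b 1) $ a \<partial>S.law)"
      using S.real_cond_exp_freeze[of "\<lambda>p. gF (x k (fst p)) (snd p 1) $ a"] gm by simp
  qed
  show ?thesis
    using sq mn mean[OF one]
  proof eventually_elim
    case (elim \<omega>)
    note le = elim(1)
    have "(\<integral>z. dev (x k \<omega>) z $ a \<partial>\<mu>0) = 0" for a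
    proof -
      have m: "(\<lambda>z. gF (x k \<omega>) z $ a) \<in> borel_measurable \<mu>0" using gF1 by measurable
      have "gf (x k \<omega>) $ a = real_cond_exp M (hist k) (\<lambda>\<omega>. gF (x k \<omega>) (batch k \<omega> 1) $ a) \<omega>"
        using arg_cong[OF elim(3), of "\<lambda>v. v $ a"] unfolding bx by (simp add: cond_exp_vec_def)
      also have "\<dots> = (\<integral>b. gF (x k \<omega>) (b 1) $ a \<partial>\<beta> k)" using elim(2) batch_law by simp
      also have "\<dots> = (\<integral>z. gF (x k \<omega>) z $ a \<partial>\<mu>0)" by (rule I.component_integral(1)[OF one m])
      finally show ?thesis using gfi[OF le, of a] by simp
    qed
    moreover have "(\<integral>z. (norm (dev (x k \<omega>) z))\<^sup>2 \<partial>\<mu>0) \<le> \<nu>\<^sup>2"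
      using le int[OF le] by (subst (asm) nn_integral_eq_integral) (auto simp: ennreal_le_iff)
    ultimately show ?case using int[OF le] by (simp add: good_def)
  qed
qed

lemma good_mean:
  assumes "good y"
  shows "integrable (\<beta> k) (\<lambda>b. Wf k y b $ a)" "(\<integral>b. Wf k y b $ a \<partial>\<beta> k) = 0"
proof -
  interpret I: iid \<mu>0 "N k" by (rule iid_batch)
  have i: "integrable \<mu>0 (\<lambda>z. dev y z $ a)" using square_integrable_components assms by (simp add: good_def)
  have ij: "integrable (\<beta> k) (\<lambda>b. dev y (b j) $ a)" "(\<integral>b. dev y (b j) $ a \<partial>\<beta> k) = 0" if "j \<in> {1..N k}" for j
    using I.component_integral[OF that dev_component[of y a]] i assms by (simp_all add: good_def)
  have e: "Wf k y b $ a = (1 / real (N k)) * (\<Sum>j=1..N k. dev y (b j) $ a)" for b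
    by (simp add: Wf_dev)
  show "integrable (\<beta> k) (\<lambda>b. Wf k y b $ a)"
    unfolding e by (intro integrable_mult_right Bochner_Integration.integrable_sum ij(1))
  have "(\<integral>b. (\<Sum>j=1..N k. dev y (b j) $ a) \<partial>\<beta> k) = (\<Sum>j=1..N k. \<integral>b. dev y (b j) $ a \<partial>\<beta> k)"
    by (intro Bochner_Integration.integral_sum ij(1))
  also have "\<dots> = 0" by (intro sum.neutral ballI ij(2))
  finally show "(\<integral>b. Wf k y b $ a \<partial>\<beta> k) = 0"
    unfolding e integral_mult_right_zero by simp
qed

lemma good_cov:
  assumes "good y"
  shows "integrable (\<beta> k) (\<lambda>b. Wf k y b $ a * Wf k y b $ c)"
    "real (N k) * (\<integral>b. Wf k y b $ a * Wf k y b $ c \<partial>\<beta> k) = covm y a c"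
proof -
  interpret I: iid \<mu>0 "N k" by (rule iid_batch)
  have s: "integrable \<mu>0 (\<lambda>z. (dev y z $ a)\<^sup>2)" "integrable \<mu>0 (\<lambda>z. dev y z $ a)" for a
    using square_integrable_components assms by (simp_all add: good_def)
  have 0: "(\<integral>z. dev y z $ a \<partial>\<mu>0) = 0" using assms by (simp add: good_def)
  note C = I.covariance[OF dev_component dev_component s(1) s(1) s(2) s(2) 0, of c]
  have e: "Wf k y b $ a * Wf k y b $ c = (1 / (real (N k))\<^sup>2) * ((\<Sum>j=1..N k. dev y (b j) $ a) * (\<Sum>j=1..N k. dev y (b j) $ c))" for b
    by (simp add: Wf_dev sum_component power2_eq_square)
  show "integrable (\<beta> k) (\<lambda>b. Wf k y b $ a * Wf k y b $ c)"
    unfolding e using C(1) by (rule integrable_mult_right)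
  show "real (N k) * (\<integral>b. Wf k y b $ a * Wf k y b $ c \<partial>\<beta> k) = covm y a c"
    unfolding e integral_mult_right_zero C(2) covm_def using N_pos[of k] by (simp add: power2_eq_square)
qed

lemma sum_covm:
  assumes "good y"
  shows "(\<Sum>a\<in>UNIV. covm y a a) = (\<integral>z. (norm (dev y z))\<^sup>2 \<partial>\<mu>0)"
proof -
  have s: "integrable \<mu>0 (\<lambda>z. (dev y z $ a)\<^sup>2)" for a
    using square_integrable_components assms by (simp_all add: good_def)
  have "(\<integral>z. (norm (dev y z))\<^sup>2 \<partial>\<mu>0) = (\<integral>z. (\<Sum>a\<in>UNIV. (dev y z $ a)\<^sup>2) \<partial>\<mu>0)"
    by (simp only: norm_power2_eq_sum)
  also have "\<dots> = (\<Sum>a\<in>UNIV. covm y a a)"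
    using s by (simp add: Bochner_Integration.integral_sum covm_def power2_eq_square)
  finally show ?thesis ..
qed

lemma good_second:
  assumes "good y"
  shows "integrable (\<beta> k) (\<lambda>b. (norm (Wf k y b))\<^sup>2)" "(\<integral>b. (norm (Wf k y b))\<^sup>2 \<partial>\<beta> k) \<le> \<nu>\<^sup>2 / real (N k)"
proof -
  have e: "(norm (Wf k y b))\<^sup>2 = (\<Sum>a\<in>UNIV. Wf k y b $ a * Wf k y b $ a)" for b
    by (simp add: power2_norm_eq_inner inner_vec_def)
  show "integrable (\<beta> k) (\<lambda>b. (norm (Wf k y b))\<^sup>2)"
    unfolding e using good_cov(1)[OF assms] by simp
  have "real (N k) * (\<integral>b. (norm (Wf k y b))\<^sup>2 \<partial>\<beta> k) = (\<Sum>a\<in>UNIV. covm y a a)"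
    unfolding e using good_cov[OF assms]
    by (simp add: Bochner_Integration.integral_sum sum_distrib_left)
  also have "\<dots> \<le> \<nu>\<^sup>2" using sum_covm[OF assms] assms by (simp add: good_def)
  finally show "(\<integral>b. (norm (Wf k y b))\<^sup>2 \<partial>\<beta> k) \<le> \<nu>\<^sup>2 / real (N k)"
    using N_pos[of k] by (simp add: pos_le_divide_eq mult.commute)
qed

text \<open>The cross term between the deterministic step and the noise has mean 0; the former
  contracts by \<open>q\<close>, and averaging divides the variance of the latter by
  \<open>N k\<close>.\<close>

lemma good_step:
  assumes "good y"
  shows "(\<integral>\<^sup>+b. ennreal ((norm (y - \<alpha> *\<^sub>R (gf y + Wf k y b) - xs))\<^sup>2) \<partial>\<beta> k)
    \<le> ennreal (q * (norm (y - xs))\<^sup>2 + \<alpha>\<^sup>2 * \<nu>\<^sup>2 / real (N k))"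
proof -
  interpret B: prob_space "\<beta> k" by (rule prob_beta)
  define T where "T = y - xs - \<alpha> *\<^sub>R gf y"
  have e: "(norm (y - \<alpha> *\<^sub>R (gf y + Wf k y b) - xs))\<^sup>2
      = (norm T)\<^sup>2 - 2 * \<alpha> * (\<Sum>a\<in>UNIV. T $ a * Wf k y b $ a) + \<alpha>\<^sup>2 * (norm (Wf k y b))\<^sup>2" for b
  proof -
    have "y - \<alpha> *\<^sub>R (gf y + Wf k y b) - xs = T - \<alpha> *\<^sub>R Wf k y b" by (simp add: T_def scaleR_add_right)
    moreover have "(norm (T - \<alpha> *\<^sub>R Wf k y b))\<^sup>2 = (norm T)\<^sup>2 - 2 * \<alpha> * (T \<bullet> Wf k y b) + \<alpha>\<^sup>2 * (norm (Wf k y b))\<^sup>2"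
      by (simp only: power2_norm_eq_inner)
         (simp add: inner_diff_left inner_diff_right inner_commute algebra_simps power2_eq_square)
    ultimately show ?thesis by (simp add: inner_vec_def)
  qed
  have i1: "integrable (\<beta> k) (\<lambda>b. \<Sum>a\<in>UNIV. T $ a * Wf k y b $ a)" "(\<integral>b. (\<Sum>a\<in>UNIV. T $ a * Wf k y b $ a) \<partial>\<beta> k) = 0"
    using good_mean[OF assms] by (simp_all add: Bochner_Integration.integral_sum)
  note i2 = good_second[OF assms, of k]
  have i: "integrable (\<beta> k) (\<lambda>b. (norm (y - \<alpha> *\<^sub>R (gf y + Wf k y b) - xs))\<^sup>2)"
    unfolding e by (intro Bochner_Integration.integrable_add Bochner_Integration.integrable_diff
        integrable_mult_right i1(1) i2(1) B.integrable_const)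
  have "(\<integral>b. (norm (y - \<alpha> *\<^sub>R (gf y + Wf k y b) - xs))\<^sup>2 \<partial>\<beta> k) = (norm T)\<^sup>2 + \<alpha>\<^sup>2 * (\<integral>b. (norm (Wf k y b))\<^sup>2 \<partial>\<beta> k)"
    unfolding e using i1 i2 by (simp add: B.prob_space del: One_nat_def)
  also have "\<dots> \<le> q * (norm (y - xs))\<^sup>2 + \<alpha>\<^sup>2 * (\<nu>\<^sup>2 / real (N k))"
    unfolding T_def by (intro add_mono step mult_left_mono i2(2)) simp
  finally show ?thesis
    using i by (subst nn_integral_eq_integral) (auto intro!: ennreal_leI)
qed

lemma nn_batch:
  assumes k: "(\<lambda>p. f (fst p) (snd p)) \<in> borel_measurable (hist k \<Otimes>\<^sub>M E k)"
  shows "(\<integral>\<^sup>+\<omega>. f \<omega> (batch k \<omega>) \<partial>M) = (\<integral>\<^sup>+\<omega>. \<integral>\<^sup>+b. f \<omega> b \<partial>\<beta> k \<partial>M)"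
proof -
  interpret S: indep_sample M "hist k" "E k" "batch k" by (rule batch_indep)
  show ?thesis using S.nn_fubini(1)[OF k] unfolding batch_law by simp
qed

lemma xW_measurable: "(\<lambda>p. Wf k (x k (fst p)) (snd p)) \<in> borel_measurable (hist k \<Otimes>\<^sub>M E k)"
proof -
  have "(\<lambda>p. (x k (fst p), snd p)) \<in> measurable (hist k \<Otimes>\<^sub>M E k) (borel \<Otimes>\<^sub>M E k)"
    by (intro measurable_Pair measurable_compose[OF measurable_fst x_hist] measurable_snd)
  from measurable_compose[OF this Wf_measurable] show ?thesis by simp
qed

lemma x_fst: "(\<lambda>p. x k (fst p)) \<in> borel_measurable (hist k \<Otimes>\<^sub>M E k)"
  by (rule measurable_compose[OF measurable_fst x_hist])

lemma nn_second_w: "(\<integral>\<^sup>+\<omega>. ennreal ((norm (w k \<omega>))\<^sup>2) \<partial>M) \<le> ennreal (\<nu>\<^sup>2 / real (N k))"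
proof -
  have "(\<integral>\<^sup>+\<omega>. ennreal ((norm (w k \<omega>))\<^sup>2) \<partial>M) = (\<integral>\<^sup>+\<omega>. \<integral>\<^sup>+b. ennreal ((norm (Wf k (x k \<omega>) b))\<^sup>2) \<partial>\<beta> k \<partial>M)"
    unfolding w_batch by (rule nn_batch) (use xW_measurable in measurable)
  also have "\<dots> \<le> (\<integral>\<^sup>+\<omega>. ennreal (\<nu>\<^sup>2 / real (N k)) \<partial>M)"
  proof (rule nn_integral_mono_AE, rule eventually_mono[OF AE_good])
    fix \<omega> assume "good (x k \<omega>)"
    from good_second[OF this] show "(\<integral>\<^sup>+b. ennreal ((norm (Wf k (x k \<omega>) b))\<^sup>2) \<partial>\<beta> k) \<le> ennreal (\<nu>\<^sup>2 / real (N k))"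
      by (subst nn_integral_eq_integral) (auto intro!: ennreal_leI)
  qed
  finally show ?thesis by (simp add: emeasure_space_1)
qed

lemma nn_first_w: "(\<integral>\<^sup>+\<omega>. ennreal (norm (w k \<omega>)) \<partial>M) \<le> ennreal (\<nu> / sqrt (real (N k)))"
proof -
  let ?s = "sqrt (real (N k))"
  have s: "0 < ?s" "?s * ?s = real (N k)" using N_pos[of k] by simp_all
  \<comment> \<open>Expanding \<open>0 \<le> (?s * norm (w k \<omega>) - \<nu>)\<^sup>2\<close>;
    this replaces the Cauchy-Schwarz inequality for expectations.\<close>
  have le: "norm (w k \<omega>) \<le> (?s / (2 * \<nu>)) * (norm (w k \<omega>))\<^sup>2 + \<nu> / (2 * ?s)" for \<omega>
  proof -
    have "0 \<le> (?s * norm (w k \<omega>) - \<nu>)\<^sup>2" by simp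
    then show ?thesis using s \<nu> by (simp add: field_simps power2_eq_square)
  qed
  have "(\<integral>\<^sup>+\<omega>. ennreal (norm (w k \<omega>)) \<partial>M) \<le> (\<integral>\<^sup>+\<omega>. ennreal (?s / (2 * \<nu>)) * ennreal ((norm (w k \<omega>))\<^sup>2) + ennreal (\<nu> / (2 * ?s)) \<partial>M)"
    using s \<nu> le by (intro nn_integral_mono) (simp add: ennreal_mult'[symmetric] ennreal_plus[symmetric] del: ennreal_plus)
  also have "\<dots> = ennreal (?s / (2 * \<nu>)) * (\<integral>\<^sup>+\<omega>. ennreal ((norm (w k \<omega>))\<^sup>2) \<partial>M) + ennreal (\<nu> / (2 * ?s))"
    by (simp add: nn_integral_add nn_integral_cmult emeasure_space_1)
  also have "\<dots> \<le> ennreal (?s / (2 * \<nu>)) * ennreal (\<nu>\<^sup>2 / real (N k)) + ennreal (\<nu> / (2 * ?s))"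
    by (intro add_mono mult_left_mono nn_second_w) auto
  also have "\<dots> = ennreal (?s / (2 * \<nu>) * (\<nu>\<^sup>2 / real (N k)) + \<nu> / (2 * ?s))"
    using s \<nu> by (simp add: ennreal_mult'[symmetric] ennreal_plus[symmetric] del: ennreal_plus)
  also have "?s / (2 * \<nu>) * (\<nu>\<^sup>2 / real (N k)) + \<nu> / (2 * ?s) = \<nu> / ?s"
  proof -
    have "t / (2 * \<nu>) * (\<nu>\<^sup>2 / (t * t)) + \<nu> / (2 * t) = \<nu> / t" if "0 < t" for t
      using that \<nu> by (simp add: field_simps power2_eq_square)
    from this[OF s(1)] show ?thesis unfolding s(2) .
  qed
  finally show ?thesis .
qed

text \<open>The two entries are the thresholds for the base case and for the induction step of the
  mean square bound: the latter needs \<open>\<alpha>\<^sup>2 * \<nu>\<^sup>2 * \<rho> \<le> C2 *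
  (\<rho> - q)\<close>.\<close>

definition C2 :: real where
  "C2 = max ((norm (x0 - xs))\<^sup>2) (\<alpha>\<^sup>2 * \<nu>\<^sup>2 * \<rho> / (\<rho> - q))"

text \<open>Since \<open>1 / real (N k) \<le> \<rho> ^ (k + 1)\<close> and
  \<open>q < \<rho>\<close>, the noise and not the contraction dictates the rate.\<close>

lemma nn_second_x: "(\<integral>\<^sup>+\<omega>. ennreal ((norm (x k \<omega> - xs))\<^sup>2) \<partial>M) \<le> ennreal (C2 * \<rho> ^ k)"
proof (induction k)
  case 0
  show ?case by (simp add: x_0 emeasure_space_1 C2_def ennreal_leI)
next
  case (Suc k)
  have C2: "0 \<le> C2" "\<alpha>\<^sup>2 * \<nu>\<^sup>2 * \<rho> \<le> C2 * (\<rho> - q)"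
    using q by (auto simp: C2_def max_def pos_divide_le_eq not_le pos_le_divide_eq)
  have "(\<integral>\<^sup>+\<omega>. ennreal ((norm (x (Suc k) \<omega> - xs))\<^sup>2) \<partial>M)
      = (\<integral>\<^sup>+\<omega>. \<integral>\<^sup>+b. ennreal ((norm (x k \<omega> - \<alpha> *\<^sub>R (gf (x k \<omega>) + Wf k (x k \<omega>) b) - xs))\<^sup>2) \<partial>\<beta> k \<partial>M)"
    unfolding x_Suc w_batch
    by (rule nn_batch) (use xW_measurable[of k] x_fst[of k] measurable_compose[OF x_fst gf_m, of k] in measurable)
  also have "\<dots> \<le> (\<integral>\<^sup>+\<omega>. ennreal q * ennreal ((norm (x k \<omega> - xs))\<^sup>2) + ennreal (\<alpha>\<^sup>2 * \<nu>\<^sup>2 / real (N k)) \<partial>M)"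
  proof (rule nn_integral_mono_AE, rule eventually_mono[OF AE_good])
    fix \<omega> assume "good (x k \<omega>)"
    from good_step[OF this, of k]
    show "(\<integral>\<^sup>+b. ennreal ((norm (x k \<omega> - \<alpha> *\<^sub>R (gf (x k \<omega>) + Wf k (x k \<omega>) b) - xs))\<^sup>2) \<partial>\<beta> k)
        \<le> ennreal q * ennreal ((norm (x k \<omega> - xs))\<^sup>2) + ennreal (\<alpha>\<^sup>2 * \<nu>\<^sup>2 / real (N k))"
      using q by (simp add: ennreal_mult'[symmetric] ennreal_plus[symmetric] del: ennreal_plus)
  qed
  also have "\<dots> = ennreal q * (\<integral>\<^sup>+\<omega>. ennreal ((norm (x k \<omega> - xs))\<^sup>2) \<partial>M) + ennreal (\<alpha>\<^sup>2 * \<nu>\<^sup>2 / real (N k))"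
    by (simp add: nn_integral_add nn_integral_cmult emeasure_space_1)
  also have "\<dots> \<le> ennreal q * ennreal (C2 * \<rho> ^ k) + ennreal (\<alpha>\<^sup>2 * \<nu>\<^sup>2 / real (N k))"
    by (intro add_mono mult_left_mono Suc) auto
  also have "\<dots> = ennreal (q * (C2 * \<rho> ^ k) + \<alpha>\<^sup>2 * \<nu>\<^sup>2 / real (N k))"
    using q C2 rho_pos by (simp add: ennreal_mult'[symmetric] ennreal_plus[symmetric] del: ennreal_plus)
  also have "\<dots> \<le> ennreal (C2 * \<rho> ^ Suc k)"
  proof (rule ennreal_leI)
    have "1 / real (N k) \<le> \<rho> ^ (k + 1)"
      using N_ge[of k] rho_pos N_pos[of k] by (simp add: field_simps)
    then have "\<alpha>\<^sup>2 * \<nu>\<^sup>2 * (1 / real (N k)) \<le> \<alpha>\<^sup>2 * \<nu>\<^sup>2 * \<rho> ^ (k + 1)" by (intro mult_left_mono) auto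
    moreover have "(\<alpha>\<^sup>2 * \<nu>\<^sup>2 * \<rho>) * \<rho> ^ k \<le> C2 * (\<rho> - q) * \<rho> ^ k"
      using C2 rho_pos by (intro mult_right_mono) auto
    ultimately show "q * (C2 * \<rho> ^ k) + \<alpha>\<^sup>2 * \<nu>\<^sup>2 / real (N k) \<le> C2 * \<rho> ^ Suc k"
      by (simp add: algebra_simps)
  qed
  finally show ?case .
qed

end

lemma cmod_cis_diff: "cmod (cis a - cis b) \<le> \<bar>a - b\<bar>"
proof -
  have "cis a - cis b = cis b * (cis (a - b) - 1)" by (simp add: right_diff_distrib cis_mult)
  then have "cmod (cis a - cis b) = cmod (cis (a - b) - 1)" by (simp add: norm_mult)
  also have "\<dots> \<le> \<bar>a - b\<bar>" using iexp_approx1[of "a - b" 0] by (simp add: cis_conv_exp)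
  finally show ?thesis .
qed

text \<open>A rate \<open>s\<close> strictly above both \<open>r\<close> and \<open>p\<close> but
  below 1 absorbs the case \<open>r = p\<close>, in which terms of the form \<open>k * r ^ k\<close>
  would appear.\<close>

lemma ennreal_geometric_recursion:
  fixes d :: "nat \<Rightarrow> ennreal"
  assumes r: "0 \<le> r" "r < 1" and p: "0 \<le> p" "p < 1" and C: "0 \<le> C"
    and d0: "d 0 < \<infinity>" and d: "\<And>k. d (Suc k) \<le> ennreal r * d k + ennreal (C * p ^ k)"
  shows "d \<longlonglongrightarrow> 0"
proof -
  define s where "s = (1 + max r p) / 2"
  have s: "r < s" "p < s" "0 < s" "s < 1" using r p by (auto simp: s_def max_def)
  define B where "B = max (enn2real (d 0)) (C / (s - r))"
  have "C / (s - r) \<le> B" "enn2real (d 0) \<le> B" by (simp_all add: B_def)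
  then have B: "0 \<le> B" "C \<le> B * (s - r)"
    using s order_trans[OF enn2real_nonneg, of "d 0" B] by (simp_all add: pos_divide_le_eq)
  have "d k \<le> ennreal (B * s ^ k)" for k
  proof (induction k)
    case 0
    have "d 0 = ennreal (enn2real (d 0))" using d0 by simp
    also have "\<dots> \<le> ennreal (B * s ^ 0)" by (intro ennreal_leI) (simp add: B_def)
    finally show ?case .
  next
    case (Suc k)
    have "d (Suc k) \<le> ennreal r * ennreal (B * s ^ k) + ennreal (C * p ^ k)"
      by (rule order_trans[OF d]) (intro add_mono mult_left_mono Suc order_refl zero_le)
    also have "\<dots> = ennreal (r * (B * s ^ k) + C * p ^ k)"
      using r B s C p by (simp add: ennreal_mult'[symmetric] ennreal_plus[symmetric] del: ennreal_plus)
    also have "\<dots> \<le> ennreal (B * s ^ Suc k)"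
    proof (rule ennreal_leI)
      have "C * p ^ k \<le> B * (s - r) * s ^ k"
        using B C p s by (intro mult_mono power_mono) auto
      then show "r * (B * s ^ k) + C * p ^ k \<le> B * s ^ Suc k" by (simp add: algebra_simps)
    qed
    finally show ?case .
  qed
  moreover have "(\<lambda>k. ennreal (B * s ^ k)) \<longlonglongrightarrow> ennreal (B * 0)"
    using s by (intro tendsto_ennrealI tendsto_intros LIMSEQ_realpow_zero) auto
  ultimately show ?thesis
    by (intro tendsto_sandwich[of "\<lambda>_. 0" d sequentially "\<lambda>k. ennreal (B * s ^ k)"]) auto
qed

context sgd_chain
begin

section \<open>Conditional central limit theorem for one batch\<close>

definition qf :: "real^'m \<Rightarrow> real^'m \<Rightarrow> real" where
  "qf y u = (\<integral>z. (u \<bullet> dev y z)\<^sup>2 \<partial>\<mu>0)"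

definition qS :: "real^'m \<Rightarrow> real" where
  "qS u = u \<bullet> (S0 *v u)"

lemma qf_covm:
  assumes "good y"
  shows "qf y u = (\<Sum>a\<in>UNIV. \<Sum>c\<in>UNIV. u $ a * u $ c * covm y a c)"
    and "integrable \<mu>0 (\<lambda>z. (u \<bullet> dev y z)\<^sup>2)" "qf y u \<le> (norm u)\<^sup>2 * \<nu>\<^sup>2" "0 \<le> qf y u"
proof -
  interpret I: iid \<mu>0 "N 0" by (rule iid_batch)
  have s: "integrable \<mu>0 (\<lambda>z. (dev y z $ a)\<^sup>2)" for a
    using square_integrable_components assms by (simp_all add: good_def)
  have ii: "integrable \<mu>0 (\<lambda>z. dev y z $ a * dev y z $ c)" for a c
    by (rule I.square_integrable_imp_integrable_mult[OF dev_component dev_component s s])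
  have e: "(u \<bullet> dev y z)\<^sup>2 = (\<Sum>a\<in>UNIV. \<Sum>c\<in>UNIV. u $ a * u $ c * (dev y z $ a * dev y z $ c))" for z
    by (simp add: inner_vec_def power2_eq_square sum_product mult_ac)
  show "integrable \<mu>0 (\<lambda>z. (u \<bullet> dev y z)\<^sup>2)" unfolding e using ii by simp
  show "qf y u = (\<Sum>a\<in>UNIV. \<Sum>c\<in>UNIV. u $ a * u $ c * covm y a c)"
    unfolding qf_def e covm_def using ii by (simp add: Bochner_Integration.integral_sum)
  have "qf y u \<le> (\<integral>z. (norm u)\<^sup>2 * (norm (dev y z))\<^sup>2 \<partial>\<mu>0)"
    unfolding qf_def
  proof (rule integral_mono)
    show "integrable \<mu>0 (\<lambda>z. (u \<bullet> dev y z)\<^sup>2)" by fact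
    show "integrable \<mu>0 (\<lambda>z. (norm u)\<^sup>2 * (norm (dev y z))\<^sup>2)" using assms by (simp add: good_def)
    fix z
    have "\<bar>u \<bullet> dev y z\<bar>\<^sup>2 \<le> (norm u * norm (dev y z))\<^sup>2" by (intro power_mono Cauchy_Schwarz_ineq2) simp
    then show "(u \<bullet> dev y z)\<^sup>2 \<le> (norm u)\<^sup>2 * (norm (dev y z))\<^sup>2" by (simp add: power_mult_distrib)
  qed
  also have "\<dots> \<le> (norm u)\<^sup>2 * \<nu>\<^sup>2"
    using assms by (simp add: good_def mult_left_mono)
  finally show "qf y u \<le> (norm u)\<^sup>2 * \<nu>\<^sup>2" .
  show "0 \<le> qf y u" unfolding qf_def by (rule Bochner_Integration.integral_nonneg) simp
qed

text \<open>After freezing, \<open>N k\<close> times the conditional covariance of the average is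
  the covariance of one sample at \<open>x k\<close>. The hypothesis \<open>cov\<close> thus
  describes \<open>covm\<close> along almost every trajectory.\<close>

lemma AE_cov: "AE \<omega> in M. (\<lambda>k. qf (x k \<omega>) u) \<longlonglongrightarrow> qS u"
proof -
  have fr: "AE \<omega> in M. real_cond_exp M (hist k) (\<lambda>\<omega>'. w k \<omega>' $ a * w k \<omega>' $ c) \<omega>
      = (\<integral>b. Wf k (x k \<omega>) b $ a * Wf k (x k \<omega>) b $ c \<partial>\<beta> k)" for k a c
  proof -
    interpret S: indep_sample M "hist k" "E k" "batch k" by (rule batch_indep)
    have "AE \<omega> in M. integrable S.law (\<lambda>b. Wf k (x k \<omega>) b $ a * Wf k (x k \<omega>) b $ c)"
      unfolding batch_law by (rule eventually_mono[OF AE_good good_cov(1)])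
    moreover have "(\<lambda>p. Wf k (x k (fst p)) (snd p) $ a * Wf k (x k (fst p)) (snd p) $ c) \<in> borel_measurable (hist k \<Otimes>\<^sub>M E k)"
      by (intro borel_measurable_times measurable_compose[OF xW_measurable vec_nth_borel])
    ultimately show ?thesis
      using S.real_cond_exp_freeze[of "\<lambda>p. Wf k (x k (fst p)) (snd p) $ a * Wf k (x k (fst p)) (snd p) $ c"]
      unfolding batch_law by (simp only: fst_conv snd_conv w_batch)
  qed
  have "AE \<omega> in M. \<forall>k a c. real_cond_exp M (hist k) (\<lambda>\<omega>'. w k \<omega>' $ a * w k \<omega>' $ c) \<omega>
      = (\<integral>b. Wf k (x k \<omega>) b $ a * Wf k (x k \<omega>) b $ c \<partial>\<beta> k)"
    unfolding AE_all_countable by (intro allI fr)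
  moreover have "AE \<omega> in M. \<forall>k. good (x k \<omega>)" unfolding AE_all_countable by (intro allI AE_good)
  ultimately show ?thesis
    using cov
  proof eventually_elim
    case (elim \<omega>)
    have "(\<lambda>k. covm (x k \<omega>) a c) \<longlonglongrightarrow> S0 $ a $ c" for a c
    proof -
      have "(\<lambda>k. (real (N k) *\<^sub>R cond_exp_mat M (hist k) (\<lambda>\<omega>'. outer (w k \<omega>') (w k \<omega>')) \<omega>) $ a $ c) \<longlonglongrightarrow> S0 $ a $ c"
        using elim(3) by (intro tendsto_vec_nth)
      moreover have "(real (N k) *\<^sub>R cond_exp_mat M (hist k) (\<lambda>\<omega>'. outer (w k \<omega>') (w k \<omega>')) \<omega>) $ a $ c = covm (x k \<omega>) a c" for k
        using good_cov(2)[of "x k \<omega>" k a c] elim(1,2) by (simp add: cond_exp_mat_def outer_def del: One_nat_def)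
      ultimately show ?thesis by simp
    qed
    then have "(\<lambda>k. \<Sum>a\<in>UNIV. \<Sum>c\<in>UNIV. u $ a * u $ c * covm (x k \<omega>) a c) \<longlonglongrightarrow> (\<Sum>a\<in>UNIV. \<Sum>c\<in>UNIV. u $ a * u $ c * S0 $ a $ c)"
      by (intro tendsto_intros)
    also have "(\<Sum>a\<in>UNIV. \<Sum>c\<in>UNIV. u $ a * u $ c * S0 $ a $ c) = qS u"
      by (simp add: qS_def inner_vec_def matrix_vector_mult_def sum_distrib_left mult_ac)
    finally show ?case using elim(2) qf_covm(1) by simp
  qed
qed

definition tailm :: "nat \<Rightarrow> real \<Rightarrow> real^'m \<Rightarrow> ennreal" where
  "tailm k \<epsilon> y = (\<integral>\<^sup>+z. ennreal ((norm (dev y z))\<^sup>2) * indicator {z. norm (dev y z) > \<epsilon> * sqrt (real (N k))} z \<partial>\<mu>0)"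

lemma tail_measurable: "(\<lambda>p. ennreal ((norm (dev (fst p) (snd p)))\<^sup>2)
    * indicator {z. norm (dev (fst p) z) > c} (snd p)) \<in> borel_measurable (borel \<Otimes>\<^sub>M borel)"
proof -
  note dev_measurable[measurable]
  have "(\<lambda>p. ennreal ((norm (dev (fst p) (snd p)))\<^sup>2) * (if norm (dev (fst p) (snd p)) > c then 1 else 0))
     \<in> borel_measurable (borel \<Otimes>\<^sub>M borel)" by measurable
  then show ?thesis by (simp add: indicator_def)
qed

lemma sets_borel_mu0: "sets (borel \<Otimes>\<^sub>M \<mu>0) = sets (borel \<Otimes>\<^sub>M borel)"
  by (intro sets_pair_measure_cong refl sets_mu0)

lemma tailm_measurable [measurable]: "tailm k \<epsilon> \<in> borel_measurable borel"
proof -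
  interpret mu0: prob_space \<mu>0 by (rule prob_mu0)
  have "(\<lambda>y. \<integral>\<^sup>+z. ennreal ((norm (dev (fst (y, z)) (snd (y, z))))\<^sup>2)
    * indicator {z'. norm (dev (fst (y, z)) z') > \<epsilon> * sqrt (real (N k))} (snd (y, z)) \<partial>\<mu>0) \<in> borel_measurable borel"
    by (rule mu0.borel_measurable_nn_integral_fst) (simp only: measurable_cong_sets[OF sets_borel_mu0 refl] tail_measurable)
  then show ?thesis by (simp add: tailm_def[abs_def])
qed

text \<open>All \<open>N k\<close> summands of the Lindeberg hypothesis have the same value, so
  their average is the expected tail of one sample drawn at the current iterate.\<close>

lemma tail_tendsto:
  assumes "0 < \<epsilon>"
  shows "(\<lambda>k. \<integral>\<^sup>+\<omega>. tailm k \<epsilon> (x k \<omega>) \<partial>M) \<longlonglongrightarrow> 0"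
proof -
  have "(1 / ennreal (real (N k))) * (\<Sum>j=1..N k. \<integral>\<^sup>+\<omega>.
              ennreal ((norm (gF (x k \<omega>) (\<xi> k j \<omega>) - gf (x k \<omega>)))\<^sup>2) *
              indicator {\<omega>. norm (gF (x k \<omega>) (\<xi> k j \<omega>) - gf (x k \<omega>)) > \<epsilon> * sqrt (real (N k))} \<omega> \<partial>M)
      = (\<integral>\<^sup>+\<omega>. tailm k \<epsilon> (x k \<omega>) \<partial>M)" for k
  proof -
    interpret I: iid \<mu>0 "N k" by (rule iid_batch)
    define c where "c = \<epsilon> * sqrt (real (N k))"
    have "(\<integral>\<^sup>+\<omega>. ennreal ((norm (gF (x k \<omega>) (\<xi> k j \<omega>) - gf (x k \<omega>)))\<^sup>2) *
              indicator {\<omega>. norm (gF (x k \<omega>) (\<xi> k j \<omega>) - gf (x k \<omega>)) > c} \<omega> \<partial>M)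
       = (\<integral>\<^sup>+\<omega>. tailm k \<epsilon> (x k \<omega>) \<partial>M)" if j: "j \<in> {1..N k}" for j
    proof -
      let ?f = "\<lambda>\<omega> b. ennreal ((norm (dev (x k \<omega>) (b j)))\<^sup>2) * indicator {z. norm (dev (x k \<omega>) z) > c} (b j)"
      have pm: "(\<lambda>p. (x k (fst p), snd p j)) \<in> measurable (hist k \<Otimes>\<^sub>M E k) (borel \<Otimes>\<^sub>M borel)"
        by (intro measurable_Pair x_fst measurable_compose[OF measurable_snd measurable_component_singleton[OF j]])
      have "(\<integral>\<^sup>+\<omega>. ennreal ((norm (gF (x k \<omega>) (\<xi> k j \<omega>) - gf (x k \<omega>)))\<^sup>2) *
              indicator {\<omega>. norm (gF (x k \<omega>) (\<xi> k j \<omega>) - gf (x k \<omega>)) > c} \<omega> \<partial>M) = (\<integral>\<^sup>+\<omega>. ?f \<omega> (batch k \<omega>) \<partial>M)"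
        using j by (intro nn_integral_cong) (simp add: dev_def batch_def indicator_def)
      also have "\<dots> = (\<integral>\<^sup>+\<omega>. \<integral>\<^sup>+b. ?f \<omega> b \<partial>\<beta> k \<partial>M)"
        by (rule nn_batch) (use measurable_compose[OF pm tail_measurable] in simp)
      also have "\<dots> = (\<integral>\<^sup>+\<omega>. tailm k \<epsilon> (x k \<omega>) \<partial>M)"
      proof (rule nn_integral_cong)
        fix \<omega>
        have "(\<lambda>z. ennreal ((norm (dev (x k \<omega>) z))\<^sup>2) * indicator {z. norm (dev (x k \<omega>) z) > c} z) \<in> borel_measurable \<mu>0"
          using measurable_compose[OF measurable_Pair1' tail_measurable, of "x k \<omega>"]
          by (simp add: measurable_cong_sets[OF sets_mu0 refl])
        from I.component_nn_integral[OF j this]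
        show "(\<integral>\<^sup>+b. ?f \<omega> b \<partial>\<beta> k) = tailm k \<epsilon> (x k \<omega>)" by (simp only: tailm_def c_def)
      qed
      finally show ?thesis .
    qed
    then have "(1 / ennreal (real (N k))) * (\<Sum>j=1..N k. \<integral>\<^sup>+\<omega>.
              ennreal ((norm (gF (x k \<omega>) (\<xi> k j \<omega>) - gf (x k \<omega>)))\<^sup>2) *
              indicator {\<omega>. norm (gF (x k \<omega>) (\<xi> k j \<omega>) - gf (x k \<omega>)) > c} \<omega> \<partial>M)
       = (1 / ennreal (real (N k))) * (of_nat (N k) * (\<integral>\<^sup>+\<omega>. tailm k \<epsilon> (x k \<omega>) \<partial>M))"
      by (subst sum.cong[OF refl], assumption) simp
    also have "\<dots> = (1 / ennreal (real (N k)) * ennreal (real (N k))) * (\<integral>\<^sup>+\<omega>. tailm k \<epsilon> (x k \<omega>) \<partial>M)"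
      by (simp add: ennreal_of_nat_eq_real_of_nat mult.assoc)
    also have "1 / ennreal (real (N k)) * ennreal (real (N k)) = 1"
    proof -
      have "1 / ennreal (real (N k)) = ennreal (1 / real (N k))"
        using N_pos[of k] divide_ennreal[of 1 "real (N k)"] by simp
      then show ?thesis using N_pos[of k] by (simp add: ennreal_mult'[symmetric])
    qed
    finally show ?thesis by (simp add: c_def)
  qed
  then show ?thesis using lindeberg[OF assms] by simp
qed

text \<open>The conditional characteristic function of the scaled batch noise when the current
  iterate is \<open>y\<close>.\<close>

definition Phi :: "nat \<Rightarrow> real^'m \<Rightarrow> real^'m \<Rightarrow> complex" where
  "Phi k u y = (\<integral>b. cis (u \<bullet> (sqrt (real (N k)) *\<^sub>R Wf k y b)) \<partial>\<beta> k)"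

text \<open>This is \<open>lindeberg_bound\<close> for the scalar
  \<open>u \<bullet> dev y z\<close>, whose tail is dominated by that of
  \<open>norm (dev y z)\<close>. In the threshold \<open>\<epsilon> / (norm u + 1)\<close> the added
  1 covers \<open>u = 0\<close>.\<close>

lemma Phi_bound:
  assumes g: "good y" and \<epsilon>: "0 < \<epsilon>" and le: "(norm u)\<^sup>2 * \<nu>\<^sup>2 \<le> 4 * real (N k)"
  defines "K \<equiv> (norm u)\<^sup>2 * \<nu>\<^sup>2"
  shows "ennreal (cmod (Phi k u y - of_real (exp (- qf y u / 2))))
    \<le> ennreal (\<epsilon> * K + K\<^sup>2 / (8 * real (N k))) + ennreal ((norm u)\<^sup>2) * tailm k (\<epsilon> / (norm u + 1)) y"
proof -
  interpret I: iid \<mu>0 "N k" by (rule iid_batch)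
  let ?h = "\<lambda>z. u \<bullet> dev y z"
  let ?s = "sqrt (real (N k))"
  have s: "0 < ?s" "?s * ?s = real (N k)" using N_pos[of k] by simp_all
  note q = qf_covm[OF g, of u]
  have hm: "?h \<in> borel_measurable \<mu>0" by measurable
  have hi: "integrable \<mu>0 ?h" by (rule I.square_integrable_imp_integrable[OF hm q(2)])
  have h0: "(\<integral>z. ?h z \<partial>\<mu>0) = 0"
  proof -
    have "integrable \<mu>0 (\<lambda>z. dev y z $ a)" for a
      using g square_integrable_components by (simp add: good_def)
    then show ?thesis using g by (simp add: inner_vec_def good_def Bochner_Integration.integral_sum)
  qed
  have e: "u \<bullet> (?s *\<^sub>R Wf k y b) = (\<Sum>j=1..N k. (1 / ?s) * ?h (b j))" for b
  proof -
    have "t * (1 / (t * t)) = 1 / t" if "0 < t" for t :: real using that by simp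
    from this[OF s(1)] have "?s * (1 / real (N k)) = 1 / ?s" unfolding s(2) .
    then have "u \<bullet> (?s *\<^sub>R Wf k y b) = (1 / ?s) * (u \<bullet> (\<Sum>j=1..N k. dev y (b j)))"
      unfolding Wf_dev by (simp only: inner_scaleR_right mult.assoc[symmetric])
    then show ?thesis by (simp only: inner_sum_right sum_distrib_left)
  qed
  let ?I = "\<lambda>z. indicator {z. \<bar>?h z\<bar> > \<epsilon> * ?s} z :: real"
  have "cmod (Phi k u y - of_real (exp (- qf y u / 2)))
      \<le> \<epsilon> * qf y u + (\<integral>z. (?h z)\<^sup>2 * ?I z \<partial>\<mu>0) + (qf y u)\<^sup>2 / (8 * real (N k))"
    unfolding Phi_def e qf_def
    by (rule I.lindeberg_bound[OF hm hi h0 q(2) _ \<epsilon>]) (use q(3) le in \<open>simp add: qf_def\<close>)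
  also have "\<dots> \<le> \<epsilon> * K + (\<integral>z. (?h z)\<^sup>2 * ?I z \<partial>\<mu>0) + K\<^sup>2 / (8 * real (N k))"
    unfolding K_def using q(3,4) \<epsilon> by (intro add_mono mult_left_mono divide_right_mono power_mono) auto
  finally have "ennreal (cmod (Phi k u y - of_real (exp (- qf y u / 2))))
      \<le> ennreal ((\<epsilon> * K + K\<^sup>2 / (8 * real (N k))) + (\<integral>z. (?h z)\<^sup>2 * ?I z \<partial>\<mu>0))"
    by (intro ennreal_leI) (simp add: algebra_simps)
  also have "\<dots> = ennreal (\<epsilon> * K + K\<^sup>2 / (8 * real (N k))) + ennreal (\<integral>z. (?h z)\<^sup>2 * ?I z \<partial>\<mu>0)"
    using \<epsilon> by (intro ennreal_plus add_nonneg_nonneg Bochner_Integration.integral_nonneg) (auto simp: K_def)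
  also have "ennreal (\<integral>z. (?h z)\<^sup>2 * ?I z \<partial>\<mu>0) = (\<integral>\<^sup>+z. ennreal ((?h z)\<^sup>2 * ?I z) \<partial>\<mu>0)"
  proof (rule nn_integral_eq_integral[symmetric])
    have Im: "?I \<in> borel_measurable \<mu>0" by (rule borel_measurable_indicator') (use hm in measurable)
    show "integrable \<mu>0 (\<lambda>z. (?h z)\<^sup>2 * ?I z)"
      by (rule Bochner_Integration.integrable_bound[OF q(2)])
         (use hm Im in \<open>auto simp: indicator_def intro!: borel_measurable_times borel_measurable_power\<close>)
  qed simp
  also have "\<dots> \<le> (\<integral>\<^sup>+z. ennreal ((norm u)\<^sup>2) * (ennreal ((norm (dev y z))\<^sup>2)
      * indicator {z. norm (dev y z) > \<epsilon> / (norm u + 1) * ?s} z) \<partial>\<mu>0)"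
  proof (rule nn_integral_mono)
    fix z
    have cs: "\<bar>?h z\<bar> \<le> norm u * norm (dev y z)" by (rule Cauchy_Schwarz_ineq2)
    show "ennreal ((?h z)\<^sup>2 * ?I z) \<le> ennreal ((norm u)\<^sup>2) * (ennreal ((norm (dev y z))\<^sup>2)
      * indicator {z. norm (dev y z) > \<epsilon> / (norm u + 1) * ?s} z)"
    proof (cases "\<bar>?h z\<bar> > \<epsilon> * ?s")
      case True
      have "\<epsilon> * ?s < (norm u + 1) * norm (dev y z)" using True cs norm_ge_zero[of "dev y z"] by (simp only: distrib_right)
      then have t: "norm (dev y z) > \<epsilon> / (norm u + 1) * ?s"
        by (simp add: pos_divide_less_eq add_nonneg_pos mult.commute)
      have "\<bar>?h z\<bar>\<^sup>2 \<le> (norm u * norm (dev y z))\<^sup>2" by (intro power_mono cs) simp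
      then have "(?h z)\<^sup>2 \<le> (norm u)\<^sup>2 * (norm (dev y z))\<^sup>2" by (simp add: power_mult_distrib)
      then show ?thesis using t True by (simp add: ennreal_mult'[symmetric] ennreal_leI)
    qed simp
  qed
  also have "\<dots> = ennreal ((norm u)\<^sup>2) * tailm k (\<epsilon> / (norm u + 1)) y"
    unfolding tailm_def
  proof (rule nn_integral_cmult)
    show "(\<lambda>z. ennreal ((norm (dev y z))\<^sup>2) * indicator {z. norm (dev y z) > \<epsilon> / (norm u + 1) * ?s} z) \<in> borel_measurable \<mu>0"
      using measurable_compose[OF measurable_Pair1' tail_measurable, of y]
      by (simp add: measurable_cong_sets[OF sets_mu0 refl])
  qed
  finally show ?thesis by (simp add: add_left_mono)
qed

lemma Phi_measurable: "Phi k u \<in> borel_measurable borel"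
proof -
  interpret B: prob_space "\<beta> k" by (rule prob_beta)
  have s: "sets (borel \<Otimes>\<^sub>M \<beta> k) = sets (borel \<Otimes>\<^sub>M E k)"
    by (intro sets_pair_measure_cong refl sets_beta)
  have "(\<lambda>p. cis (u \<bullet> (sqrt (real (N k)) *\<^sub>R Wf k (fst p) (snd p)))) \<in> borel_measurable (borel \<Otimes>\<^sub>M \<beta> k)"
    unfolding measurable_cong_sets[OF s refl] using Wf_measurable by measurable
  from B.borel_measurable_lebesgue_integral[of "\<lambda>y b. cis (u \<bullet> (sqrt (real (N k)) *\<^sub>R Wf k y b))" borel] this
  show ?thesis by (simp add: Phi_def[abs_def] case_prod_beta')
qed

lemma qf_measurable [measurable]: "(\<lambda>y. qf y u) \<in> borel_measurable borel"
proof -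
  interpret mu0: prob_space \<mu>0 by (rule prob_mu0)
  have "(\<lambda>p. (u \<bullet> dev (fst p) (snd p))\<^sup>2) \<in> borel_measurable (borel \<Otimes>\<^sub>M \<mu>0)"
    unfolding measurable_cong_sets[OF sets_borel_mu0 refl] using dev_measurable by measurable
  from mu0.borel_measurable_lebesgue_integral[of "\<lambda>y z. (u \<bullet> dev y z)\<^sup>2" borel] this
  show ?thesis by (simp add: qf_def[abs_def] case_prod_beta')
qed

lemma N_at_top: "filterlim (\<lambda>k. real (N k)) at_top sequentially"
proof (rule filterlim_at_top_mono)
  have "filterlim (\<lambda>k. inverse (\<rho> ^ (k + 1))) at_top sequentially"
    using rho_pos \<rho> by (intro filterlim_inverse_at_top LIMSEQ_ignore_initial_segment LIMSEQ_realpow_zero) auto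
  then show "filterlim (\<lambda>k. 1 / \<rho> ^ (k + 1)) at_top sequentially" by (simp add: inverse_eq_divide)
qed (use N_ge in simp)

text \<open>Convergence is in mean over the iterates: the tails are controlled in expectation only,
  while the variances \<open>qf (x k \<omega>) u\<close> converge almost surely and enter through
  dominated convergence.\<close>

lemma clt_step:
  "(\<lambda>k. \<integral>\<^sup>+\<omega>. ennreal (cmod (Phi k u (x k \<omega>) - of_real (exp (- qS u / 2)))) \<partial>M) \<longlonglongrightarrow> 0"
proof -
  define K where "K = (norm u)\<^sup>2 * \<nu>\<^sup>2"
  have K: "0 \<le> K" by (simp add: K_def)
  note [measurable] = Phi_measurable
  let ?A = "\<lambda>k. \<integral>\<^sup>+\<omega>. ennreal (cmod (Phi k u (x k \<omega>) - of_real (exp (- qS u / 2)))) \<partial>M"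
  let ?c = "\<lambda>k. \<integral>\<^sup>+\<omega>. ennreal \<bar>exp (- qf (x k \<omega>) u / 2) - exp (- qS u / 2)\<bar> \<partial>M"
  have c0: "?c \<longlonglongrightarrow> 0"
  proof -
    have g: "AE \<omega> in M. \<forall>k. good (x k \<omega>)" unfolding AE_all_countable by (intro allI AE_good)
    have "?c \<longlonglongrightarrow> (\<integral>\<^sup>+\<omega>. 0 \<partial>M)"
    proof (rule nn_integral_dominated_convergence[where w="\<lambda>_. ennreal (1 + exp (- qS u / 2))"])
      show "AE \<omega> in M. (\<lambda>k. ennreal \<bar>exp (- qf (x k \<omega>) u / 2) - exp (- qS u / 2)\<bar>) \<longlonglongrightarrow> 0"
        using AE_cov[of u]
      proof eventually_elim
        case (elim \<omega>)
        have "(\<lambda>k. ennreal \<bar>exp (- qf (x k \<omega>) u / 2) - exp (- qS u / 2)\<bar>) \<longlonglongrightarrow> ennreal \<bar>exp (- qS u / 2) - exp (- qS u / 2)\<bar>"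
          by (intro tendsto_ennrealI tendsto_intros elim) simp
        then show ?case by simp
      qed
      show "AE \<omega> in M. ennreal \<bar>exp (- qf (x k \<omega>) u / 2) - exp (- qS u / 2)\<bar> \<le> ennreal (1 + exp (- qS u / 2))" for k
        using AE_good[of k]
      proof eventually_elim
        case (elim \<omega>)
        have "exp (- qf (x k \<omega>) u / 2) \<le> 1" using qf_covm(4)[OF elim] by simp
        then have "\<bar>exp (- qf (x k \<omega>) u / 2) - exp (- qS u / 2)\<bar> \<le> 1 + exp (- qS u / 2)"
          using exp_gt_zero[of "- qf (x k \<omega>) u / 2"] exp_gt_zero[of "- qS u / 2"] by linarith
        then show ?case by (rule ennreal_leI)
      qed
    qed (simp_all add: emeasure_space_1)
    then show ?thesis by simp
  qed
  show ?thesis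
  proof (rule order_tendstoI)
    fix a :: ennreal assume "a < 0" then show "\<forall>\<^sub>F k in sequentially. a < ?A k" by simp
  next
    fix a :: ennreal assume a: "0 < a"
    obtain d where d: "0 < d" "ennreal d < a"
    proof (cases a)
      case (real r)
      then show ?thesis using a that[of "r / 2"] by (auto simp: ennreal_less_iff)
    qed (use that[of 1] in auto)
    \<comment> \<open>Chosen so that the persistent error \<open>\<epsilon> * K\<close> is at most
      \<open>d\<close>.\<close>
    define \<epsilon> where "\<epsilon> = d / (K + 1)"
    have \<epsilon>: "0 < \<epsilon>" using d K by (simp add: \<epsilon>_def)
    have "\<epsilon> * K \<le> d" using d K by (simp add: \<epsilon>_def field_simps)
    define \<epsilon>' where "\<epsilon>' = \<epsilon> / (norm u + 1)"
    have \<epsilon>': "0 < \<epsilon>'" using \<epsilon> by (simp add: \<epsilon>'_def add_nonneg_pos)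
    let ?B = "\<lambda>k. ennreal (\<epsilon> * K + K\<^sup>2 / (8 * real (N k))) + ennreal ((norm u)\<^sup>2) * (\<integral>\<^sup>+\<omega>. tailm k \<epsilon>' (x k \<omega>) \<partial>M) + ?c k"
    have "?B \<longlonglongrightarrow> ennreal (\<epsilon> * K + 0) + ennreal ((norm u)\<^sup>2) * 0 + 0"
    proof (intro tendsto_add tendsto_ennrealI tendsto_const ennreal_tendsto_cmult tail_tendsto[OF \<epsilon>'] c0)
      have "filterlim (\<lambda>k. 8 * real (N k)) at_top sequentially"
        by (rule filterlim_tendsto_pos_mult_at_top[OF tendsto_const _ N_at_top]) simp
      then show "(\<lambda>k. K\<^sup>2 / (8 * real (N k))) \<longlonglongrightarrow> 0"
        by (rule real_tendsto_divide_at_top[OF tendsto_const])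
    qed simp
    then have "?B \<longlonglongrightarrow> ennreal (\<epsilon> * K)" by simp
    moreover have "ennreal (\<epsilon> * K) < a" using \<open>\<epsilon> * K \<le> d\<close> d by (meson ennreal_leI le_less_trans)
    ultimately have "\<forall>\<^sub>F k in sequentially. ?B k < a" by (rule order_tendstoD(2))
    \<comment> \<open>Secures the premise of \<open>Phi_bound\<close> on the size of the variance
      relative to the batch.\<close>
    moreover have "\<forall>\<^sub>F k in sequentially. K / 4 \<le> real (N k)"
      using N_at_top unfolding filterlim_at_top by blast
    ultimately show "\<forall>\<^sub>F k in sequentially. ?A k < a"
    proof eventually_elim
      case (elim k)
      have le: "(norm u)\<^sup>2 * \<nu>\<^sup>2 \<le> 4 * real (N k)" using elim(2) by (simp add: K_def)
      have "?A k \<le> (\<integral>\<^sup>+\<omega>. (ennreal (\<epsilon> * K + K\<^sup>2 / (8 * real (N k))) + ennreal ((norm u)\<^sup>2) * tailm k \<epsilon>' (x k \<omega>))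
          + ennreal \<bar>exp (- qf (x k \<omega>) u / 2) - exp (- qS u / 2)\<bar> \<partial>M)"
      proof (rule nn_integral_mono_AE, rule eventually_mono[OF AE_good[of k]])
        fix \<omega> assume g: "good (x k \<omega>)"
        have "cmod (Phi k u (x k \<omega>) - of_real (exp (- qS u / 2)))
          \<le> cmod (Phi k u (x k \<omega>) - of_real (exp (- qf (x k \<omega>) u / 2))) + \<bar>exp (- qf (x k \<omega>) u / 2) - exp (- qS u / 2)\<bar>"
          using norm_triangle_ineq[of "Phi k u (x k \<omega>) - of_real (exp (- qf (x k \<omega>) u / 2))" "of_real (exp (- qf (x k \<omega>) u / 2)) - of_real (exp (- qS u / 2))"]
            norm_of_real[of "exp (- qf (x k \<omega>) u / 2) - exp (- qS u / 2)", where 'a=complex]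
          by (simp only: of_real_diff) simp
        then have "ennreal (cmod (Phi k u (x k \<omega>) - of_real (exp (- qS u / 2))))
          \<le> ennreal (cmod (Phi k u (x k \<omega>) - of_real (exp (- qf (x k \<omega>) u / 2)))) + ennreal \<bar>exp (- qf (x k \<omega>) u / 2) - exp (- qS u / 2)\<bar>"
          by (drule_tac ennreal_leI) simp
        also have "\<dots> \<le> (ennreal (\<epsilon> * K + K\<^sup>2 / (8 * real (N k))) + ennreal ((norm u)\<^sup>2) * tailm k \<epsilon>' (x k \<omega>))
          + ennreal \<bar>exp (- qf (x k \<omega>) u / 2) - exp (- qS u / 2)\<bar>"
          unfolding K_def \<epsilon>'_def by (intro add_right_mono Phi_bound g \<epsilon> le)
        finally show "ennreal (cmod (Phi k u (x k \<omega>) - of_real (exp (- qS u / 2)))) \<le> (ennreal (\<epsilon> * K + K\<^sup>2 / (8 * real (N k))) + ennreal ((norm u)\<^sup>2) * tailm k \<epsilon>' (x k \<omega>))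
          + ennreal \<bar>exp (- qf (x k \<omega>) u / 2) - exp (- qS u / 2)\<bar>" .
      qed
      also have "\<dots> = ?B k"
        by (simp add: nn_integral_add nn_integral_cmult emeasure_space_1)
      finally show ?case using elim(1) by simp
    qed
  qed
qed

end

lemma ennreal_tendsto_0I:
  assumes "\<And>k. 0 \<le> a k" "\<And>k. ennreal (a k) \<le> b k" "b \<longlonglongrightarrow> 0"
  shows "a \<longlonglongrightarrow> 0"
proof -
  have "(\<lambda>k. ennreal (a k)) \<longlonglongrightarrow> 0"
    by (rule tendsto_sandwich[of "\<lambda>_. 0" "\<lambda>k. ennreal (a k)" sequentially b]) (use assms in auto)
  then show ?thesis using assms(1) by (simp add: ennreal_tendsto_0_iff)
qed

lemma matrix_vector_bounded:
  fixes A :: "real^'m^'n"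
  obtains B where "0 \<le> B" "\<And>v. norm (A *v v) \<le> B * norm v"
  using onorm_pos_le[of "\<lambda>v. A *v v"] onorm[of "\<lambda>v. A *v v"] matrix_vector_mul_bounded_linear[of A] that by blast

lemma mat_pow_commute: "mat_pow A t *v (A *v u) = A *v (mat_pow A t *v u)"
  by (induction t) (simp_all add: matrix_vector_mul_assoc[symmetric])

lemma powr_minus_half: "0 < r \<Longrightarrow> (r powr (- real k / 2))\<^sup>2 = 1 / r ^ k"
  by (simp add: power2_eq_square powr_add[symmetric] powr_minus powr_realpow inverse_eq_divide)

context sgd_chain
begin

section \<open>The linear recursion and its limit law\<close>

definition r0 :: real where "r0 = sqrt (q / \<rho>)"

lemma r0: "0 \<le> r0" "r0 < 1"
proof -
  show "0 \<le> r0" using q rho_pos by (simp add: r0_def)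
  have "q / \<rho> < 1" using q rho_pos by simp
  then have "sqrt (q / \<rho>) < sqrt 1" by (rule real_sqrt_less_mono)
  then show "r0 < 1" by (simp add: r0_def)
qed

lemma P_mult: "P *v h = (\<rho> powr (-1/2)) *\<^sub>R (h - \<alpha> *\<^sub>R (H *v h))"
  unfolding P by (simp add: scaleR_matrix_vector_assoc[symmetric] matrix_vector_mult_diff_rdistrib)

lemma symP: "u \<bullet> (P *v v) = (P *v u) \<bullet> v"
  unfolding P_mult using symH[of u v] by (simp add: inner_diff_left inner_diff_right inner_commute)

text \<open>The linearised step contracts norms by \<open>sqrt q\<close>, and normalising by the
  rate stretches them by \<open>\<rho> powr (-1/2)\<close>; together this is
  \<open>r0 < 1\<close>.\<close>

lemma norm_P: "norm (P *v h) \<le> r0 * norm h"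
proof (rule power2_le_imp_le)
  have "(norm (P *v h))\<^sup>2 = (1 / \<rho>) * (norm (h - \<alpha> *\<^sub>R (H *v h)))\<^sup>2"
    unfolding P_mult using powr_minus_half[OF rho_pos, of 1] by (simp add: power_mult_distrib)
  also have "\<dots> \<le> (1 / \<rho>) * (q * (norm h)\<^sup>2)" using rho_pos lin by (intro mult_left_mono) auto
  also have "\<dots> = (r0 * norm h)\<^sup>2" using q rho_pos by (simp add: r0_def power_mult_distrib)
  finally show "(norm (P *v h))\<^sup>2 \<le> (r0 * norm h)\<^sup>2" .
qed (use r0 in simp)

lemma norm_mat_pow: "norm (mat_pow P t *v u) \<le> r0 ^ t * norm u"
proof (induction t)
  case (Suc t)
  have "norm (mat_pow P (Suc t) *v u) \<le> r0 * norm (mat_pow P t *v u)"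
    using norm_P by (simp add: matrix_vector_mul_assoc[symmetric])
  also have "\<dots> \<le> r0 * (r0 ^ t * norm u)" using Suc r0 by (intro mult_left_mono)
  finally show ?case by (simp add: mult.assoc)
qed simp

text \<open>\<open>qS u\<close> is an almost sure limit of variances, and a statement free of
  \<open>\<omega>\<close> that holds almost surely on a probability space simply holds.\<close>

lemma qS_nonneg: "0 \<le> qS u"
proof -
  have "AE \<omega> in M. \<forall>k. good (x k \<omega>)" unfolding AE_all_countable by (intro allI AE_good)
  then have "AE \<omega> in M. 0 \<le> qS u"
    using AE_cov[of u]
  proof eventually_elim
    case (elim \<omega>)
    then show ?case using qf_covm(4) by (intro LIMSEQ_le_const[OF elim(2)]) auto
  qed
  then show ?thesis by simp
qed

lemma qS_uminus: "qS (- u) = qS u"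
  by (simp add: qS_def matrix_vector_mult_def inner_vec_def sum_negf)

lemma summable_qS: "summable (\<lambda>t. qS (mat_pow P t *v u))"
proof -
  obtain B where B: "0 \<le> B" "\<And>v. norm (S0 *v v) \<le> B * norm v" using matrix_vector_bounded by blast
  have "norm (qS (mat_pow P t *v u)) \<le> (B * (norm u)\<^sup>2) * (r0\<^sup>2) ^ t" for t
  proof -
    let ?v = "mat_pow P t *v u"
    have "\<bar>qS ?v\<bar> \<le> norm ?v * norm (S0 *v ?v)" unfolding qS_def by (rule Cauchy_Schwarz_ineq2)
    also have "\<dots> \<le> norm ?v * (B * norm ?v)" by (intro mult_left_mono B) simp
    also have "\<dots> = B * (norm ?v)\<^sup>2" by (simp add: power2_eq_square)
    also have "\<dots> \<le> B * (r0 ^ t * norm u)\<^sup>2" by (intro mult_left_mono power_mono norm_mat_pow B) simp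
    also have "\<dots> = (B * (norm u)\<^sup>2) * (r0\<^sup>2) ^ t" by (simp add: power_mult_distrib power_mult[symmetric] mult.commute)
    finally show ?thesis by simp
  qed
  moreover have "summable (\<lambda>t. (B * (norm u)\<^sup>2) * (r0\<^sup>2) ^ t)"
    using r0 by (intro summable_mult summable_geometric) (simp add: power_less_one_iff abs_square_less_1)
  ultimately show ?thesis by (rule summable_comparison_test'[rotated])
qed

text \<open>The linear surrogate of the normalised iterates. It starts at 0 and is driven by noise
  scaled with \<open>sqrt (real (N k))\<close> instead of
  \<open>\<rho> powr (- real (k + 1) / 2)\<close>, the scale of the central limit theorem.\<close>

primrec U :: "nat \<Rightarrow> 'a \<Rightarrow> real^'m" where
  "U 0 = (\<lambda>_. 0)"
| "U (Suc k) = (\<lambda>\<omega>. P *v U k \<omega> - sqrt (real (N k)) *\<^sub>R w k \<omega>)"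

lemma matrix_vector_borel: "(\<lambda>v. (A :: real^'m^'n) *v v) \<in> borel_measurable borel"
  by (intro borel_measurable_continuous_onI linear_continuous_on matrix_vector_mul_bounded_linear)

lemma U_hist: "U k \<in> measurable (hist k) borel"
proof (induction k)
  case (Suc k)
  have m: "U k \<in> measurable (hist (Suc k)) borel"
    by (rule measurable_from_subalg[OF hist_mono Suc]) simp
  show ?case
    unfolding U.simps
    by (intro borel_measurable_diff borel_measurable_scaleR borel_measurable_const w_hist
        measurable_compose[OF m matrix_vector_borel])
qed simp

lemma U_measurable [measurable]: "U k \<in> borel_measurable M"
  by (rule measurable_from_subalg[OF hist_sub U_hist])

definition cf :: "nat \<Rightarrow> real^'m \<Rightarrow> complex" where
  "cf k u = (\<integral>\<omega>. cis (u \<bullet> U k \<omega>) \<partial>M)"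

text \<open>Integrating out the batch first splits off \<open>Phi k (- u) (x k \<omega>)\<close>,
  which is close in mean to a constant; symmetry of \<open>P\<close> moves it onto \<open>u\<close>
  in the remaining factor.\<close>

lemma cf_step:
  "(\<lambda>k. cf (Suc k) u - of_real (exp (- qS u / 2)) * cf k (P *v u)) \<longlonglongrightarrow> 0"
proof (rule tendsto_norm_zero_cancel, rule ennreal_tendsto_0I)
  show "(\<lambda>k. \<integral>\<^sup>+\<omega>. ennreal (cmod (Phi k (- u) (x k \<omega>) - of_real (exp (- qS u / 2)))) \<partial>M) \<longlonglongrightarrow> 0"
    using clt_step[of "- u"] by (simp add: qS_uminus)
  fix k
  note [measurable] = Phi_measurable
  interpret B: prob_space "\<beta> k" by (rule prob_beta)
  interpret S: indep_sample M "hist k" "E k" "batch k" by (rule batch_indep)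
  let ?V = "\<lambda>\<omega>. cis ((P *v u) \<bullet> U k \<omega>)"
  let ?W = "\<lambda>y b. cis ((- u) \<bullet> (sqrt (real (N k)) *\<^sub>R Wf k y b))"
  have Phi_le: "cmod (Phi k (- u) y) \<le> 1" for y
  proof -
    have "cmod (Phi k (- u) y) \<le> (\<integral>b. cmod (?W y b) \<partial>\<beta> k)" unfolding Phi_def by (rule integral_norm_bound)
    also have "\<dots> = 1" using B.prob_space by (simp del: One_nat_def)
    finally show ?thesis .
  qed
  have iV: "integrable M ?V" by (intro integrable_const_bound[of _ 1]) auto
  have iVP: "integrable M (\<lambda>\<omega>. ?V \<omega> * Phi k (- u) (x k \<omega>))"
    by (intro integrable_const_bound[of _ 1]) (auto simp: norm_mult Phi_le)
  have "cf (Suc k) u = (\<integral>\<omega>. ?V \<omega> * ?W (x k \<omega>) (batch k \<omega>) \<partial>M)"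
    unfolding cf_def U.simps w_batch by (simp add: inner_diff_right symP cis_mult)
  also have "\<dots> = (\<integral>\<omega>. \<integral>b. ?V \<omega> * ?W (x k \<omega>) b \<partial>\<beta> k \<partial>M)"
  proof -
    have m1: "(\<lambda>p. ?V (fst p)) \<in> borel_measurable (hist k \<Otimes>\<^sub>M E k)"
      using measurable_compose[OF measurable_fst U_hist, of k "E k"] by measurable
    have m2: "(\<lambda>p. ?W (x k (fst p)) (snd p)) \<in> borel_measurable (hist k \<Otimes>\<^sub>M E k)"
      using xW_measurable[of k] by measurable
    have "integrable M (\<lambda>\<omega>. ?V \<omega> * ?W (x k \<omega>) (batch k \<omega>))"
      unfolding w_batch[symmetric] by (intro integrable_const_bound[of _ 1]) (auto simp: norm_mult)
    then show ?thesis
      using S.fubini[of "\<lambda>p. ?V (fst p) * ?W (x k (fst p)) (snd p)"] m1 m2 unfolding batch_law by simp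
  qed
  also have "\<dots> = (\<integral>\<omega>. ?V \<omega> * Phi k (- u) (x k \<omega>) \<partial>M)" by (simp add: Phi_def)
  finally have "cf (Suc k) u - of_real (exp (- qS u / 2)) * cf k (P *v u)
      = (\<integral>\<omega>. ?V \<omega> * (Phi k (- u) (x k \<omega>) - of_real (exp (- qS u / 2))) \<partial>M)"
    using iV iVP by (simp add: cf_def right_diff_distrib mult.commute[of _ "of_real _"])
  moreover have "ennreal (cmod (\<integral>\<omega>. ?V \<omega> * (Phi k (- u) (x k \<omega>) - of_real (exp (- qS u / 2))) \<partial>M))
      \<le> (\<integral>\<^sup>+\<omega>. ennreal (cmod (?V \<omega> * (Phi k (- u) (x k \<omega>) - of_real (exp (- qS u / 2))))) \<partial>M)"
    using iV iVP by (intro integral_norm_bound_ennreal) (simp add: right_diff_distrib)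
  ultimately show "ennreal (cmod (cf (Suc k) u - of_real (exp (- qS u / 2)) * cf k (P *v u)))
      \<le> (\<integral>\<^sup>+\<omega>. ennreal (cmod (Phi k (- u) (x k \<omega>) - of_real (exp (- qS u / 2)))) \<partial>M)"
    by (simp add: norm_mult)
qed simp

text \<open>For fixed \<open>r\<close> only finitely many errors accumulate. The induction varies
  \<open>u\<close> because the first step replaces it by \<open>P *v u\<close>.\<close>

lemma cf_iter:
  "(\<lambda>k. cf (k + r) u - of_real (exp (- (\<Sum>t<r. qS (mat_pow P t *v u)) / 2)) * cf k (mat_pow P r *v u)) \<longlonglongrightarrow> 0"
proof (induction r arbitrary: u)
  case 0
  show ?case by simp
next
  case (Suc r)
  let ?e = "of_real (exp (- qS u / 2)) :: complex"
  let ?E = "of_real (exp (- (\<Sum>t<r. qS (mat_pow P t *v (P *v u))) / 2)) :: complex"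
  have "(\<lambda>k. (cf (Suc (k + r)) u - ?e * cf (k + r) (P *v u)) + ?e * (cf (k + r) (P *v u) - ?E * cf k (mat_pow P r *v (P *v u)))) \<longlonglongrightarrow> 0 + ?e * 0"
    by (intro tendsto_add tendsto_mult tendsto_const Suc LIMSEQ_ignore_initial_segment[OF cf_step])
  moreover have "?e * ?E = of_real (exp (- (\<Sum>t<Suc r. qS (mat_pow P t *v u)) / 2))"
    unfolding sum.lessThan_Suc_shift of_real_mult[symmetric] exp_add[symmetric]
    by (simp add: mat_pow_commute matrix_vector_mul_assoc[symmetric] add_divide_distrib)
  ultimately show ?case
    by (simp add: mat_pow_commute matrix_vector_mul_assoc[symmetric] right_diff_distrib mult.assoc[symmetric])
qed

text \<open>The factor \<open>sqrt (real (N k))\<close> exactly compensates the decay of the noise,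
  so the bound \<open>b\<close> has to satisfy \<open>r0 * b + \<nu> \<le> b\<close>.\<close>

lemma nn_first_U: "(\<integral>\<^sup>+\<omega>. ennreal (norm (U k \<omega>)) \<partial>M) \<le> ennreal (\<nu> / (1 - r0))"
proof (induction k)
  case (Suc k)
  let ?s = "sqrt (real (N k))"
  have s: "0 < ?s" using N_pos[of k] by simp
  have "(\<integral>\<^sup>+\<omega>. ennreal (norm (U (Suc k) \<omega>)) \<partial>M) \<le> (\<integral>\<^sup>+\<omega>. ennreal r0 * ennreal (norm (U k \<omega>)) + ennreal ?s * ennreal (norm (w k \<omega>)) \<partial>M)"
  proof (rule nn_integral_mono)
    fix \<omega>
    have "norm (U (Suc k) \<omega>) \<le> norm (P *v U k \<omega>) + norm (?s *\<^sub>R w k \<omega>)" unfolding U.simps by (rule norm_triangle_ineq4)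
    also have "\<dots> \<le> r0 * norm (U k \<omega>) + ?s * norm (w k \<omega>)" using norm_P[of "U k \<omega>"] by simp
    finally show "ennreal (norm (U (Suc k) \<omega>)) \<le> ennreal r0 * ennreal (norm (U k \<omega>)) + ennreal ?s * ennreal (norm (w k \<omega>))"
      using r0 s by (simp add: ennreal_mult'[symmetric] ennreal_plus[symmetric] ennreal_leI del: ennreal_plus U.simps)
  qed
  also have "\<dots> = ennreal r0 * (\<integral>\<^sup>+\<omega>. ennreal (norm (U k \<omega>)) \<partial>M) + ennreal ?s * (\<integral>\<^sup>+\<omega>. ennreal (norm (w k \<omega>)) \<partial>M)"
    by (simp add: nn_integral_add nn_integral_cmult)
  also have "\<dots> \<le> ennreal r0 * ennreal (\<nu> / (1 - r0)) + ennreal ?s * ennreal (\<nu> / ?s)"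
    by (intro add_mono mult_left_mono Suc nn_first_w) auto
  also have "\<dots> = ennreal (r0 * (\<nu> / (1 - r0)) + ?s * (\<nu> / ?s))"
    using r0 s \<nu> by (simp add: ennreal_mult'[symmetric] ennreal_plus[symmetric] del: ennreal_plus)
  also have "r0 * (\<nu> / (1 - r0)) + ?s * (\<nu> / ?s) = \<nu> / (1 - r0)"
    using r0 s by (simp add: field_simps)
  finally show ?case .
qed simp

lemma cis_expectation_diff:
  fixes X Y :: "'a \<Rightarrow> real^'m"
  assumes [measurable]: "X \<in> borel_measurable M" "Y \<in> borel_measurable M"
  shows "ennreal (cmod ((\<integral>\<omega>. cis (u \<bullet> X \<omega>) \<partial>M) - (\<integral>\<omega>. cis (u \<bullet> Y \<omega>) \<partial>M)))
    \<le> ennreal (norm u) * (\<integral>\<^sup>+\<omega>. ennreal (norm (X \<omega> - Y \<omega>)) \<partial>M)"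
proof -
  have i: "integrable M (\<lambda>\<omega>. cis (u \<bullet> X \<omega>))" "integrable M (\<lambda>\<omega>. cis (u \<bullet> Y \<omega>))"
    by (auto intro!: integrable_const_bound[of _ 1])
  have "ennreal (cmod ((\<integral>\<omega>. cis (u \<bullet> X \<omega>) \<partial>M) - (\<integral>\<omega>. cis (u \<bullet> Y \<omega>) \<partial>M)))
      = ennreal (cmod (\<integral>\<omega>. cis (u \<bullet> X \<omega>) - cis (u \<bullet> Y \<omega>) \<partial>M))" using i by simp
  also have "\<dots> \<le> (\<integral>\<^sup>+\<omega>. ennreal (cmod (cis (u \<bullet> X \<omega>) - cis (u \<bullet> Y \<omega>))) \<partial>M)"
    using i by (intro integral_norm_bound_ennreal) simp
  also have "\<dots> \<le> (\<integral>\<^sup>+\<omega>. ennreal (norm u) * ennreal (norm (X \<omega> - Y \<omega>)) \<partial>M)"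
  proof (rule nn_integral_mono)
    fix \<omega>
    have "cmod (cis (u \<bullet> X \<omega>) - cis (u \<bullet> Y \<omega>)) \<le> \<bar>u \<bullet> (X \<omega> - Y \<omega>)\<bar>"
      unfolding inner_diff_right by (rule cmod_cis_diff)
    also have "\<dots> \<le> norm u * norm (X \<omega> - Y \<omega>)" by (rule Cauchy_Schwarz_ineq2)
    finally show "ennreal (cmod (cis (u \<bullet> X \<omega>) - cis (u \<bullet> Y \<omega>))) \<le> ennreal (norm u) * ennreal (norm (X \<omega> - Y \<omega>))"
      by (simp add: ennreal_mult'[symmetric] ennreal_leI)
  qed
  also have "\<dots> = ennreal (norm u) * (\<integral>\<^sup>+\<omega>. ennreal (norm (X \<omega> - Y \<omega>)) \<partial>M)"
    by (rule nn_integral_cmult) measurable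
  finally show ?thesis .
qed

lemma cf_near_1: "cmod (cf k v - 1) \<le> norm v * (\<nu> / (1 - r0))"
proof -
  have "ennreal (cmod (cf k v - 1)) \<le> ennreal (norm v) * (\<integral>\<^sup>+\<omega>. ennreal (norm (U k \<omega>)) \<partial>M)"
    using cis_expectation_diff[of "U k" "\<lambda>_. 0" v] by (simp add: cf_def prob_space)
  also have "\<dots> \<le> ennreal (norm v) * ennreal (\<nu> / (1 - r0))"
    by (intro mult_left_mono nn_first_U) simp
  also have "\<dots> = ennreal (norm v * (\<nu> / (1 - r0)))" by (rule ennreal_mult'[symmetric]) simp
  finally show ?thesis using r0 \<nu> by (simp add: ennreal_le_iff)
qed

text \<open>The order of choices matters: \<open>r\<close> first, making the tail of the series and
  \<open>mat_pow P r *v u\<close> small. By \<open>cf_near_1\<close> the factor at that argument is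
  then close to 1 for all \<open>k\<close> simultaneously, and only afterwards does \<open>k\<close>
  grow.\<close>

lemma cf_tendsto:
  "(\<lambda>k. cf k u) \<longlonglongrightarrow> of_real (exp (- (\<Sum>t. qS (mat_pow P t *v u)) / 2))"
proof (rule LIMSEQ_I)
  fix e :: real assume e: "0 < e"
  let ?V = "\<Sum>t. qS (mat_pow P t *v u)" and ?s = "\<lambda>r. \<Sum>t<r. qS (mat_pow P t *v u)"
  let ?C = "\<nu> / (1 - r0)"
  have "?s \<longlonglongrightarrow> ?V" by (rule summable_LIMSEQ[OF summable_qS])
  then have l1: "(\<lambda>r. \<bar>exp (- ?s r / 2) - exp (- ?V / 2)\<bar>) \<longlonglongrightarrow> \<bar>exp (- ?V / 2) - exp (- ?V / 2)\<bar>"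
    by (intro tendsto_intros) simp_all
  have l2: "(\<lambda>r. r0 ^ r * norm u * ?C) \<longlonglongrightarrow> 0 * norm u * ?C"
    using r0 by (intro tendsto_intros LIMSEQ_realpow_zero)
  have "\<forall>\<^sub>F r in sequentially. \<bar>exp (- ?s r / 2) - exp (- ?V / 2)\<bar> < e / 3 \<and> r0 ^ r * norm u * ?C < e / 3"
    using order_tendstoD(2)[OF l1, of "e / 3"] order_tendstoD(2)[OF l2, of "e / 3"] e
    by (auto intro: eventually_conj)
  then obtain r where r: "\<bar>exp (- ?s r / 2) - exp (- ?V / 2)\<bar> < e / 3" "r0 ^ r * norm u * ?C < e / 3"
    by (auto simp: eventually_sequentially)
  let ?v = "mat_pow P r *v u"
  let ?E = "of_real (exp (- ?s r / 2)) :: complex"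
  have v: "cmod (cf k ?v - 1) < e / 3" for k
  proof -
    have "cmod (cf k ?v - 1) \<le> norm ?v * ?C" by (rule cf_near_1)
    also have "\<dots> \<le> r0 ^ r * norm u * ?C" using r0 \<nu> by (intro mult_right_mono norm_mat_pow) auto
    finally show ?thesis using r(2) by linarith
  qed
  have E1: "cmod ?E \<le> 1" using qS_nonneg by (simp add: sum_nonneg)
  obtain K where K: "\<And>k. K \<le> k \<Longrightarrow> cmod (cf (k + r) u - ?E * cf k ?v) < e / 3"
    using LIMSEQ_D[OF cf_iter[of r u], of "e / 3"] e by auto
  have "cmod (cf k u - of_real (exp (- ?V / 2))) < e" if "K + r \<le> k" for k
  proof -
    define l where "l = k - r"
    have l: "k = l + r" "K \<le> l" using that by (auto simp: l_def)
    have a: "cmod (cf (l + r) u - ?E * cf l ?v) < e / 3" by (rule K[OF l(2)])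
    have "cmod (?E * (cf l ?v - 1)) \<le> 1 * cmod (cf l ?v - 1)" unfolding norm_mult by (intro mult_right_mono E1) simp
    then have b: "cmod (?E * (cf l ?v - 1)) < e / 3" using v[of l] by simp
    have c: "cmod (?E - of_real (exp (- ?V / 2))) < e / 3"
      using r(1) norm_of_real[of "exp (- ?s r / 2) - exp (- ?V / 2)", where 'a=complex] by (simp only: of_real_diff)
    have eq: "cf (l + r) u - of_real (exp (- ?V / 2))
        = (cf (l + r) u - ?E * cf l ?v) + (?E * (cf l ?v - 1) + (?E - of_real (exp (- ?V / 2))))"
      by (simp add: algebra_simps)
    have "cmod (cf (l + r) u - of_real (exp (- ?V / 2))) \<le> cmod (cf (l + r) u - ?E * cf l ?v) + (cmod (?E * (cf l ?v - 1)) + cmod (?E - of_real (exp (- ?V / 2))))"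
      unfolding eq by (rule order_trans[OF norm_triangle_ineq add_left_mono[OF norm_triangle_ineq]])
    also have "\<dots> < e"
    proof -
      have "p + (q' + r') < e" if "p < e / 3" "q' < e / 3" "r' < e / 3" for p q' r' :: real
        using that by linarith
      from this[OF a b c] show ?thesis .
    qed
    finally show ?thesis unfolding l(1) .
  qed
  then show "\<exists>no. \<forall>n\<ge>no. cmod (cf n u - of_real (exp (- ?V / 2))) < e" by blast
qed

section \<open>Comparison of the normalised iterates with the linear recursion\<close>

definition zs :: "nat \<Rightarrow> 'a \<Rightarrow> real^'m" where
  "zs k \<omega> = ((1 / \<alpha>) * \<rho> powr (- real k / 2)) *\<^sub>R (x k \<omega> - xs)"

lemma zs_measurable [measurable]: "zs k \<in> borel_measurable M"
  unfolding zs_def[abs_def] by measurable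

lemma zs_hist: "zs k \<in> measurable (hist k) borel"
  unfolding zs_def[abs_def] using x_hist[of k] by measurable

lemma zs_second: "(\<integral>\<^sup>+\<omega>. ennreal ((norm (zs k \<omega>))\<^sup>2) \<partial>M) \<le> ennreal (C2 / \<alpha>\<^sup>2)"
proof -
  have c: "((1 / \<alpha>) * \<rho> powr (- real k / 2))\<^sup>2 = 1 / (\<alpha>\<^sup>2 * \<rho> ^ k)"
    using powr_minus_half[OF rho_pos, of k] by (simp add: power_mult_distrib power_divide)
  have "ennreal ((norm (zs k \<omega>))\<^sup>2) = ennreal (1 / (\<alpha>\<^sup>2 * \<rho> ^ k)) * ennreal ((norm (x k \<omega> - xs))\<^sup>2)" for \<omega>
  proof -
    have "(norm (zs k \<omega>))\<^sup>2 = ((1 / \<alpha>) * \<rho> powr (- real k / 2))\<^sup>2 * (norm (x k \<omega> - xs))\<^sup>2"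
      unfolding zs_def norm_scaleR power_mult_distrib by (simp only: power2_abs power_mult_distrib)
    then have e: "(norm (zs k \<omega>))\<^sup>2 = 1 / (\<alpha>\<^sup>2 * \<rho> ^ k) * (norm (x k \<omega> - xs))\<^sup>2" unfolding c .
    show ?thesis unfolding e by (rule ennreal_mult') (use rho_pos in simp)
  qed
  then have "(\<integral>\<^sup>+\<omega>. ennreal ((norm (zs k \<omega>))\<^sup>2) \<partial>M) = ennreal (1 / (\<alpha>\<^sup>2 * \<rho> ^ k)) * (\<integral>\<^sup>+\<omega>. ennreal ((norm (x k \<omega> - xs))\<^sup>2) \<partial>M)"
    by (simp add: nn_integral_cmult)
  also have "\<dots> \<le> ennreal (1 / (\<alpha>\<^sup>2 * \<rho> ^ k)) * ennreal (C2 * \<rho> ^ k)"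
    by (intro mult_left_mono nn_second_x) simp
  also have "\<dots> = ennreal (C2 / \<alpha>\<^sup>2)"
    using rho_pos by (simp add: ennreal_mult'[symmetric])
  finally show ?thesis .
qed

text \<open>The difference contracts by \<open>r0\<close> and is disturbed by the quadratic
  remainder and by the rounding of \<open>N k\<close>. Both disturbances are of order
  \<open>sqrt \<rho> ^ k\<close> in mean, by the bounds on \<open>x k - xs\<close> and
  \<open>w k\<close>.\<close>

lemma zs_U_diff: "(\<lambda>k. \<integral>\<^sup>+\<omega>. ennreal (norm (zs k \<omega> - U k \<omega>)) \<partial>M) \<longlonglongrightarrow> 0"
proof (rule ennreal_geometric_recursion[OF r0])
  define a where "a = (\<lambda>k. \<rho> powr (- real k / 2))"
  have a: "0 < a k" "(a k)\<^sup>2 = 1 / \<rho> ^ k" for k using rho_pos powr_minus_half by (simp_all add: a_def)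
  have aS: "a (Suc k) = \<rho> powr (-1/2) * a k" for k
    unfolding a_def powr_add[symmetric] by (rule arg_cong[where f="\<lambda>t. \<rho> powr t"]) (simp add: field_simps)
  have C2: "0 \<le> C2" by (simp add: C2_def le_max_iff_disj)
  define p where "p = sqrt \<rho>"
  have p: "0 < p" "p < 1" "p * p = \<rho>" using rho_pos \<rho> by (simp_all add: p_def)
  show "0 \<le> p" "p < 1" using p by simp_all
  have ap: "a k = 1 / p ^ k" for k
  proof (rule power2_eq_imp_eq)
    show "(a k)\<^sup>2 = (1 / p ^ k)\<^sup>2" unfolding a(2) p(3)[symmetric]
      by (simp add: power2_eq_square power_mult_distrib)
  qed (use a p in \<open>simp_all add: less_imp_le\<close>)
  \<comment> \<open>The remainder contributes
    \<open>a (Suc k) * R * C2 * \<rho> ^ k = (R * C2 / p) * p ^ k\<close>, the rounding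
    \<open>\<nu> * p ^ k\<close>.\<close>
  define C where "C = R * C2 / p + \<nu>"
  show "0 \<le> C" using R C2 p \<nu> by (simp add: C_def)
  have "(\<integral>\<^sup>+\<omega>. ennreal (norm (zs 0 \<omega> - U 0 \<omega>)) \<partial>M) = ennreal (norm ((1 / \<alpha>) *\<^sub>R (x0 - xs)))"
    using rho_pos by (simp add: zs_def x_0 emeasure_space_1)
  then show "(\<integral>\<^sup>+\<omega>. ennreal (norm (zs 0 \<omega> - U 0 \<omega>)) \<partial>M) < \<infinity>" by simp
  fix k
  let ?s = "sqrt (real (N k))"
  have s: "0 < ?s" "?s * ?s = real (N k)" using N_pos[of k] by simp_all
  have as: "a (Suc k) \<le> ?s"
    using N_ge[of k] a(2)[of "Suc k"] by (intro real_le_rsqrt) simp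
  \<comment> \<open>Rounding up adds at most 1 to \<open>(a (Suc k))\<^sup>2\<close>, so the roots
    differ by at most \<open>1 / a (Suc k)\<close>. The extra factor \<open>?s\<close> is removed
    again by \<open>nn_first_w\<close>.\<close>
  have sa: "?s - a (Suc k) \<le> ?s * p ^ k"
  proof -
    have "?s * ?s \<le> a (Suc k) * a (Suc k) + 1"
      using N_le[of k] a(2)[of "Suc k"] s(2) by (simp add: power2_eq_square)
    then have "(?s - a (Suc k)) * (?s + a (Suc k)) \<le> 1" by (simp add: algebra_simps)
    moreover have "(?s - a (Suc k)) * a (Suc k) \<le> (?s - a (Suc k)) * (?s + a (Suc k))"
      using as s by (intro mult_left_mono) auto
    ultimately have "(?s - a (Suc k)) * a (Suc k) \<le> 1" by linarith
    then have "?s - a (Suc k) \<le> p ^ Suc k"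
      unfolding ap using p by (simp add: field_simps)
    also have "\<dots> \<le> 1 * p ^ k" using p by (simp add: mult_le_cancel_right1)
    also have "\<dots> \<le> ?s * p ^ k" using N_pos[of k] p by (intro mult_right_mono) auto
    finally show ?thesis .
  qed
  have zsa: "zs k \<omega> = (a k / \<alpha>) *\<^sub>R (x k \<omega> - xs)" for k \<omega> by (simp add: zs_def a_def)
  have rec: "norm (zs (Suc k) \<omega> - U (Suc k) \<omega>)
      \<le> r0 * norm (zs k \<omega> - U k \<omega>) + (a (Suc k) * R * (norm (x k \<omega> - xs))\<^sup>2 + ?s * p ^ k * norm (w k \<omega>))" for \<omega>
  proof -
    let ?e = "x k \<omega> - xs"
    have z1: "zs (Suc k) \<omega> = (a (Suc k) / \<alpha>) *\<^sub>R ?e - a (Suc k) *\<^sub>R gf (x k \<omega>) - a (Suc k) *\<^sub>R w k \<omega>"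
    proof -
      have e: "x (Suc k) \<omega> - xs = ?e - \<alpha> *\<^sub>R gf (x k \<omega>) - \<alpha> *\<^sub>R w k \<omega>" by (simp add: x_Suc algebra_simps)
      show ?thesis unfolding zsa e scaleR_diff_right using \<alpha> by simp
    qed
    have gen: "c *\<^sub>R ((b / \<alpha>) *\<^sub>R e - \<alpha> *\<^sub>R (H *v ((b / \<alpha>) *\<^sub>R e)))
        = (c * b / \<alpha>) *\<^sub>R e - (c * b) *\<^sub>R (H *v e)" for b c e
      using \<alpha> by (simp add: matrix_vector_mult_scaleR scaleR_diff_right)
    have z2: "P *v zs k \<omega> = (a (Suc k) / \<alpha>) *\<^sub>R ?e - a (Suc k) *\<^sub>R (H *v ?e)"
      unfolding zsa P_mult aS by (rule gen)
    have "zs (Suc k) \<omega> - U (Suc k) \<omega>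
        = P *v (zs k \<omega> - U k \<omega>) + (- (a (Suc k) *\<^sub>R (gf (x k \<omega>) - H *v ?e)) + (?s - a (Suc k)) *\<^sub>R w k \<omega>)"
      unfolding matrix_vector_mult_diff_distrib z1 z2 U.simps by (simp add: algebra_simps)
    then have "norm (zs (Suc k) \<omega> - U (Suc k) \<omega>)
        \<le> norm (P *v (zs k \<omega> - U k \<omega>)) + (norm (a (Suc k) *\<^sub>R (gf (x k \<omega>) - H *v ?e)) + norm ((?s - a (Suc k)) *\<^sub>R w k \<omega>))"
      by (metis (no_types) add_left_mono norm_minus_cancel norm_triangle_ineq order_trans)
    also have "\<dots> \<le> r0 * norm (zs k \<omega> - U k \<omega>) + (a (Suc k) * (R * (norm ?e)\<^sup>2) + ?s * p ^ k * norm (w k \<omega>))"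
    proof (intro add_mono norm_P)
      show "norm (a (Suc k) *\<^sub>R (gf (x k \<omega>) - H *v ?e)) \<le> a (Suc k) * (R * (norm ?e)\<^sup>2)"
        using a(1)[of "Suc k"] rem[of "x k \<omega>"] by (simp add: mult_left_mono)
      show "norm ((?s - a (Suc k)) *\<^sub>R w k \<omega>) \<le> ?s * p ^ k * norm (w k \<omega>)"
        using as sa by (simp add: mult_right_mono)
    qed
    finally show ?thesis by (simp add: mult.assoc)
  qed
  have "(\<integral>\<^sup>+\<omega>. ennreal (norm (zs (Suc k) \<omega> - U (Suc k) \<omega>)) \<partial>M)
      \<le> (\<integral>\<^sup>+\<omega>. ennreal r0 * ennreal (norm (zs k \<omega> - U k \<omega>)) + (ennreal (a (Suc k) * R) * ennreal ((norm (x k \<omega> - xs))\<^sup>2)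
          + ennreal (?s * p ^ k) * ennreal (norm (w k \<omega>))) \<partial>M)"
  proof (rule nn_integral_mono)
    fix \<omega>
    show "ennreal (norm (zs (Suc k) \<omega> - U (Suc k) \<omega>)) \<le> ennreal r0 * ennreal (norm (zs k \<omega> - U k \<omega>)) + (ennreal (a (Suc k) * R) * ennreal ((norm (x k \<omega> - xs))\<^sup>2)
          + ennreal (?s * p ^ k) * ennreal (norm (w k \<omega>)))"
      using ennreal_leI[OF rec[of \<omega>]] r0 a(1)[of "Suc k"] R s p
      by (simp add: ennreal_mult'' ennreal_mult' del: U.simps)
  qed
  also have "\<dots> = ennreal r0 * (\<integral>\<^sup>+\<omega>. ennreal (norm (zs k \<omega> - U k \<omega>)) \<partial>M) + (ennreal (a (Suc k) * R) * (\<integral>\<^sup>+\<omega>. ennreal ((norm (x k \<omega> - xs))\<^sup>2) \<partial>M)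
          + ennreal (?s * p ^ k) * (\<integral>\<^sup>+\<omega>. ennreal (norm (w k \<omega>)) \<partial>M))"
    by (simp add: nn_integral_add nn_integral_cmult)
  also have "\<dots> \<le> ennreal r0 * (\<integral>\<^sup>+\<omega>. ennreal (norm (zs k \<omega> - U k \<omega>)) \<partial>M) + (ennreal (a (Suc k) * R) * ennreal (C2 * \<rho> ^ k)
          + ennreal (?s * p ^ k) * ennreal (\<nu> / ?s))"
    by (intro add_mono mult_left_mono order_refl nn_second_x nn_first_w) auto
  also have "ennreal (a (Suc k) * R) * ennreal (C2 * \<rho> ^ k) + ennreal (?s * p ^ k) * ennreal (\<nu> / ?s) = ennreal (C * p ^ k)"
  proof -
    have "a (Suc k) * R * (C2 * \<rho> ^ k) + ?s * p ^ k * (\<nu> / ?s) = C * p ^ k"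
      unfolding ap p(3)[symmetric] C_def power_mult_distrib using p(1) s(1) by (simp add: field_simps)
    moreover have "0 \<le> a (Suc k) * R" "0 \<le> C2 * \<rho> ^ k" "0 \<le> ?s * p ^ k" "0 \<le> \<nu> / ?s"
      using a(1)[of "Suc k"] R C2 rho_pos s p \<nu> by simp_all
    ultimately show ?thesis by (simp only: ennreal_mult'[symmetric] ennreal_plus[symmetric] mult_nonneg_nonneg)
  qed
  finally show "(\<integral>\<^sup>+\<omega>. ennreal (norm (zs (Suc k) \<omega> - U (Suc k) \<omega>)) \<partial>M)
     \<le> ennreal r0 * (\<integral>\<^sup>+\<omega>. ennreal (norm (zs k \<omega> - U k \<omega>)) \<partial>M) + ennreal (C * p ^ k)" .
qed

theorem zs_charfun:
  "(\<lambda>k. \<integral>\<omega>. cis (u \<bullet> zs k \<omega>) \<partial>M) \<longlonglongrightarrow> of_real (exp (- (\<Sum>t. qS (mat_pow P t *v u)) / 2))"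
proof -
  have "(\<lambda>k. cmod ((\<integral>\<omega>. cis (u \<bullet> zs k \<omega>) \<partial>M) - cf k u)) \<longlonglongrightarrow> 0"
  proof (rule ennreal_tendsto_0I)
    show "(\<lambda>k. ennreal (norm u) * (\<integral>\<^sup>+\<omega>. ennreal (norm (zs k \<omega> - U k \<omega>)) \<partial>M)) \<longlonglongrightarrow> 0"
      using ennreal_tendsto_cmult[OF _ zs_U_diff, of "ennreal (norm u)"] by simp
    show "ennreal (cmod ((\<integral>\<omega>. cis (u \<bullet> zs k \<omega>) \<partial>M) - cf k u)) \<le> ennreal (norm u) * (\<integral>\<^sup>+\<omega>. ennreal (norm (zs k \<omega> - U k \<omega>)) \<partial>M)" for k
      unfolding cf_def by (rule cis_expectation_diff) measurable
  qed simp
  then have "(\<lambda>k. (\<integral>\<omega>. cis (u \<bullet> zs k \<omega>) \<partial>M) - cf k u) \<longlonglongrightarrow> 0" by (rule tendsto_norm_zero_cancel)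
  from tendsto_add[OF this cf_tendsto[of u]] show ?thesis by simp
qed

section \<open>The limiting covariance as a series\<close>

lemma S0_sym: "S0 $ a $ b = S0 $ b $ a"
proof -
  have "AE \<omega> in M. S0 $ a $ b = S0 $ b $ a"
    using cov
  proof eventually_elim
    case (elim \<omega>)
    let ?A = "\<lambda>k. real (N k) *\<^sub>R cond_exp_mat M (hist k) (\<lambda>\<omega>'. outer (w k \<omega>') (w k \<omega>')) \<omega>"
    have eq: "(\<lambda>k. ?A k $ a $ b) = (\<lambda>k. ?A k $ b $ a)"
      by (simp add: cond_exp_mat_def outer_def mult.commute)
    have lim: "(\<lambda>k. ?A k $ a $ b) \<longlonglongrightarrow> S0 $ a $ b" "(\<lambda>k. ?A k $ b $ a) \<longlonglongrightarrow> S0 $ b $ a"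
      using elim by (intro tendsto_vec_nth; assumption)+
    show ?case by (rule LIMSEQ_unique[OF lim(1)[unfolded eq] lim(2)])
  qed
  then show ?thesis by simp
qed

lemma mat_pow_sym: "u \<bullet> (mat_pow P t *v v) = (mat_pow P t *v u) \<bullet> v"
proof (induction t arbitrary: u v)
  case (Suc t)
  have "u \<bullet> (mat_pow P (Suc t) *v v) = (P *v u) \<bullet> (mat_pow P t *v v)"
    by (simp add: matrix_vector_mul_assoc[symmetric] symP)
  also have "\<dots> = (mat_pow P (Suc t) *v u) \<bullet> v"
    by (simp add: Suc mat_pow_commute matrix_vector_mul_assoc[symmetric])
  finally show ?case .
qed simp

lemma entry_eq: "(A :: real^'m^'m) $ a $ b = axis a 1 \<bullet> (A *v axis b 1)"
  by (simp add: inner_axis' matrix_vector_mult_basis column_def)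

lemma series_entry: "(mat_pow P t ** S0 ** mat_pow P t) $ a $ b
    = (mat_pow P t *v axis a 1) \<bullet> (S0 *v (mat_pow P t *v axis b 1))"
  unfolding entry_eq by (simp only: matrix_vector_mul_assoc[symmetric] mat_pow_sym)

text \<open>Each of the two powers of \<open>P\<close> contributes a factor
  \<open>r0 ^ t\<close>.\<close>

lemma summable_entry: "summable (\<lambda>t. (mat_pow P t ** S0 ** mat_pow P t) $ a $ b)"
proof -
  obtain B where B: "0 \<le> B" "\<And>v. norm (S0 *v v) \<le> B * norm v" using matrix_vector_bounded by blast
  have "norm ((mat_pow P t ** S0 ** mat_pow P t) $ a $ b) \<le> B * (r0\<^sup>2) ^ t" for t
  proof -
    let ?u = "mat_pow P t *v axis a 1" and ?v = "mat_pow P t *v axis b 1"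
    have le: "norm ?u \<le> r0 ^ t" "norm ?v \<le> r0 ^ t"
      using norm_mat_pow[of t "axis a 1"] norm_mat_pow[of t "axis b 1"] by (simp_all add: norm_axis_1)
    have "\<bar>?u \<bullet> (S0 *v ?v)\<bar> \<le> norm ?u * norm (S0 *v ?v)" by (rule Cauchy_Schwarz_ineq2)
    also have "\<dots> \<le> r0 ^ t * (B * r0 ^ t)"
      using le r0 B(1) by (intro mult_mono order_trans[OF B(2)] mult_left_mono) auto
    also have "\<dots> = B * (r0\<^sup>2) ^ t" by (simp add: power2_eq_square power_mult_distrib)
    finally show ?thesis by (simp add: series_entry)
  qed
  moreover have "summable (\<lambda>t. B * (r0\<^sup>2) ^ t)"
    using r0 by (intro summable_mult summable_geometric) (simp add: power_less_one_iff abs_square_less_1)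
  ultimately show ?thesis by (rule summable_comparison_test'[rotated])
qed

lemma series_sums: "(\<lambda>t. mat_pow P t ** S0 ** mat_pow P t) sums (\<chi> a b. \<Sum>t. (mat_pow P t ** S0 ** mat_pow P t) $ a $ b)"
  unfolding sums_def
proof (intro vec_tendstoI)
  fix a b
  show "(\<lambda>n. (\<Sum>t<n. mat_pow P t ** S0 ** mat_pow P t) $ a $ b)
      \<longlonglongrightarrow> (\<chi> a b. \<Sum>t. (mat_pow P t ** S0 ** mat_pow P t) $ a $ b) $ a $ b"
    using summable_LIMSEQ[OF summable_entry[of a b]] by (simp add: sum_component)
qed

lemma series_summable: "summable (\<lambda>t. mat_pow P t ** S0 ** mat_pow P t)"
  using series_sums by (rule sums_summable)

lemma series_quadratic_form:
  assumes "\<Sigma> = (\<Sum>t. mat_pow P t ** S0 ** mat_pow P t)"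
  shows "(\<Sum>t. qS (mat_pow P t *v u)) = u \<bullet> (\<Sigma> *v u)"
proof -
  have S: "\<Sigma> $ a $ b = (\<Sum>t. (mat_pow P t ** S0 ** mat_pow P t) $ a $ b)" for a b
  proof -
    have "\<Sigma> = (\<chi> a b. \<Sum>t. (mat_pow P t ** S0 ** mat_pow P t) $ a $ b)"
      unfolding assms by (rule sums_unique[OF series_sums, symmetric])
    then show ?thesis by (simp only: vec_lambda_beta)
  qed
  have q: "qS (mat_pow P t *v u) = (\<Sum>a\<in>UNIV. \<Sum>b\<in>UNIV. u $ a * u $ b * (mat_pow P t ** S0 ** mat_pow P t) $ a $ b)" for t
  proof -
    have "qS (mat_pow P t *v u) = u \<bullet> ((mat_pow P t ** S0 ** mat_pow P t) *v u)"
      unfolding qS_def by (simp only: matrix_vector_mul_assoc[symmetric] mat_pow_sym)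
    then show ?thesis by (simp add: inner_vec_def matrix_vector_mult_def sum_distrib_left mult_ac)
  qed
  have "(\<lambda>t. qS (mat_pow P t *v u)) sums (\<Sum>a\<in>UNIV. \<Sum>b\<in>UNIV. u $ a * u $ b * \<Sigma> $ a $ b)"
    unfolding q S by (intro sums_sum sums_mult summable_sums summable_entry)
  then show ?thesis
    by (simp add: sums_iff inner_vec_def matrix_vector_mult_def sum_distrib_left mult_ac)
qed

lemma series_sym:
  assumes "\<Sigma> = (\<Sum>t. mat_pow P t ** S0 ** mat_pow P t)"
  shows "\<Sigma> $ a $ b = \<Sigma> $ b $ a"
proof -
  have S: "\<Sigma> $ a $ b = (\<Sum>t. (mat_pow P t ** S0 ** mat_pow P t) $ a $ b)" for a b
  proof -
    have "\<Sigma> = (\<chi> a b. \<Sum>t. (mat_pow P t ** S0 ** mat_pow P t) $ a $ b)"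
      unfolding assms by (rule sums_unique[OF series_sums, symmetric])
    then show ?thesis by (simp only: vec_lambda_beta)
  qed
  have "u \<bullet> (S0 *v v) = v \<bullet> (S0 *v u)" for u v
  proof -
    have "u \<bullet> (S0 *v v) = (\<Sum>a\<in>UNIV. \<Sum>b\<in>UNIV. u $ a * v $ b * S0 $ a $ b)"
      by (simp add: inner_vec_def matrix_vector_mult_def sum_distrib_left mult_ac)
    also have "\<dots> = (\<Sum>b\<in>UNIV. \<Sum>a\<in>UNIV. v $ b * u $ a * S0 $ b $ a)"
      by (subst sum.swap, intro sum.cong refl) (metis S0_sym mult.commute)
    also have "\<dots> = v \<bullet> (S0 *v u)"
      by (simp add: inner_vec_def matrix_vector_mult_def sum_distrib_left mult_ac)
    finally show ?thesis .
  qed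
  then show ?thesis unfolding S series_entry by simp
qed

lemma series_psd:
  assumes "\<Sigma> = (\<Sum>t. mat_pow P t ** S0 ** mat_pow P t)"
  shows "0 \<le> u \<bullet> (\<Sigma> *v u)"
  unfolding series_quadratic_form[OF assms, symmetric]
  by (intro suminf_nonneg summable_qS qS_nonneg)

end

subsection \<open>Independent replications\<close>

lemma hotW_cong:
  assumes "\<And>i a. i \<in> K \<Longrightarrow> z (i, a) = z' (i, a)"
  shows "hotW K z c = hotW K z' c"
proof -
  have "ip K c (colv z a) = ip K c (colv z' a)" "ip K (colv z a) (colv z b) = ip K (colv z' a) (colv z' b)" for a b
    using assms by (auto intro!: ip_cong simp: colv_def)
  then show ?thesis by (simp add: hotW_def)
qed

lemma borel_measurable_matrix_inv_form:
  fixes S :: "'x \<Rightarrow> real^'m^'m"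
  assumes S [measurable]: "\<And>a b. (\<lambda>x. S x $ a $ b) \<in> borel_measurable M"
    and b [measurable]: "\<And>a. (\<lambda>x. b x $ a) \<in> borel_measurable M"
  shows "(\<lambda>x. b x \<bullet> (matrix_inv (S x) *v b x)) \<in> borel_measurable M"
proof -
  let ?G = "\<lambda>x. \<Sum>k\<in>UNIV. b x $ k * (det (\<chi> i j. if j = k then b x $ i else S x $ i $ j) / det (S x))"
  \<comment> \<open>For a singular matrix the predicate behind \<open>matrix_inv\<close> is
    unsatisfiable, so the choice operator returns this one matrix whatever the argument. On the
    singular part the expression is thus a polynomial in \<open>b x\<close>.\<close>
  let ?J = "(SOME A' :: real^'m^'m. False)"
  have d[measurable]: "(\<lambda>x. det (S x)) \<in> borel_measurable M" by (rule borel_measurable_det[OF S])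
  have c[measurable]: "(\<lambda>x. det (\<chi> i j. if j = k then b x $ i else S x $ i $ j)) \<in> borel_measurable M" for k
  proof (rule borel_measurable_det)
    fix i j show "(\<lambda>x. (\<chi> i j. if j = k then b x $ i else S x $ i $ j) $ i $ j) \<in> borel_measurable M"
      by (cases "j = k") (simp_all add: S b)
  qed
  have eq: "b x \<bullet> (matrix_inv (S x) *v b x)
      = (if det (S x) = 0 then (\<Sum>i\<in>UNIV. b x $ i * (\<Sum>j\<in>UNIV. ?J $ i $ j * b x $ j)) else ?G x)" for x
  proof (cases "det (S x) = 0")
    case True
    then have "(S x ** A' = mat 1 \<and> A' ** S x = mat 1) = False" for A'
      using invertible_det_nz[of "S x"] by (auto simp: invertible_def)
    then have "matrix_inv (S x) = ?J" unfolding matrix_inv_def by (simp only:)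
    then show ?thesis using True by (simp add: inner_vec_def matrix_vector_mult_def)
  qed (simp add: matrix_inv_cramer inner_vec_def)
  show ?thesis unfolding eq by measurable
qed

lemma (in prob_space) expectation_cis_sum:
  fixes Z :: "'i \<Rightarrow> 'a \<Rightarrow> real^'m"
  assumes ind: "indep_vars (\<lambda>_. borel) Z I" and I: "finite I"
  shows "(\<integral>\<omega>. cis (\<Sum>i\<in>I. u i \<bullet> Z i \<omega>) \<partial>M) = (\<Prod>i\<in>I. \<integral>\<omega>. cis (u i \<bullet> Z i \<omega>) \<partial>M)"
proof -
  have m: "(\<lambda>v. cis (u i \<bullet> v)) \<in> borel_measurable borel" for i
    by (intro borel_measurable_continuous_onI continuous_intros)
  have ind': "indep_vars (\<lambda>_. borel) (\<lambda>i \<omega>. cis (u i \<bullet> Z i \<omega>)) I"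
    by (rule indep_vars_compose2[OF ind m])
  have "integrable M (\<lambda>\<omega>. cis (u i \<bullet> Z i \<omega>))" if "i \<in> I" for i
    using ind' that unfolding indep_vars_def by (intro integrable_const_bound[where B=1]) auto
  then show ?thesis
    unfolding cis_sum[OF I] by (rule indep_vars_lebesgue_integral[OF I ind'])
qed

lemma inner_mult_transpose: "u \<bullet> ((A ** transpose A) *v u) = (norm (transpose A *v u))\<^sup>2" for A :: "real^'m^'m"
  by (simp only: power2_norm_eq_inner inner_transpose_mult matrix_vector_mul_assoc)

text \<open>Independent sequences whose marginal characteristic functions converge to that of
  \<open>A\<close> applied to a standard normal vector; the constant \<open>C\<close> bounds all
  their second moments at once.\<close>

locale replications = prob_space M for M :: "'a measure" +
  fixes Z :: "nat \<Rightarrow> nat \<Rightarrow> 'a \<Rightarrow> real^'m" and n :: nat and A :: "real^'m^'m" and C :: real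
  assumes n: "0 < n"
    and Zm: "\<And>i k. i \<in> {1..n} \<Longrightarrow> Z i k \<in> borel_measurable M"
    and ind: "\<And>k. indep_vars (\<lambda>_. borel) (\<lambda>i. Z i k) {1..n}"
    and bound: "\<And>i k. i \<in> {1..n} \<Longrightarrow> (\<integral>\<^sup>+\<omega>. ennreal ((norm (Z i k \<omega>))\<^sup>2) \<partial>M) \<le> ennreal C"
    and charfun: "\<And>i u. i \<in> {1..n} \<Longrightarrow> (\<lambda>k. \<integral>\<omega>. cis (u \<bullet> Z i k \<omega>) \<partial>M)
        \<longlonglongrightarrow> of_real (exp (- (norm (transpose A *v u))\<^sup>2 / 2))"
begin

lemma joint_charfun:
  "(\<lambda>k. \<integral>\<omega>. cis (\<Sum>i\<in>{1..n}. u i \<bullet> Z i k \<omega>) \<partial>M)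
     \<longlonglongrightarrow> of_real (exp (- (\<Sum>i\<in>{1..n}. (norm (transpose A *v u i))\<^sup>2) / 2))"
proof -
  have "(\<lambda>k. \<Prod>i\<in>{1..n}. \<integral>\<omega>. cis (u i \<bullet> Z i k \<omega>) \<partial>M)
      \<longlonglongrightarrow> (\<Prod>i\<in>{1..n}. of_real (exp (- (norm (transpose A *v u i))\<^sup>2 / 2)))"
    by (intro tendsto_prod charfun)
  moreover have "(\<Prod>i\<in>{1..n}. of_real (exp (- (norm (transpose A *v u i))\<^sup>2 / 2)))
      = (of_real (exp (- (\<Sum>i\<in>{1..n}. (norm (transpose A *v u i))\<^sup>2) / 2)) :: complex)"
    unfolding of_real_prod[symmetric]
    by (simp add: exp_sum[symmetric] sum_negf sum_divide_distrib del: One_nat_def)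
  ultimately show ?thesis by (simp only: expectation_cis_sum[OF ind finite_atLeastAtMost])
qed

text \<open>Each of the \<open>n\<close> independent limits enters with weight
  \<open>1 / sqrt n\<close>, so their exponents average to that of a single one. The limit is
  written with \<open>0 +\<close> to match \<open>multivariate_normal\<close> with mean 0.\<close>

lemma sample_mean_limit:
  "weak_conv_vec (\<lambda>k. distr M borel (\<lambda>\<omega>. (1 / sqrt (real n)) *\<^sub>R (\<Sum>i=1..n. Z i k \<omega>)))
     (distr std_normal_vec borel (\<lambda>z. 0 + A *v z))"
proof (rule weak_conv_vecI[where C="real n * C"])
  interpret S: prob_space "std_normal_vec :: (real^'m) measure" by (rule std_normal_vec_prob)
  have Am: "(\<lambda>z. 0 + A *v z) \<in> measurable std_normal_vec borel"
    unfolding measurable_cong_sets[OF sets_std_normal_vec refl]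
    by (intro borel_measurable_continuous_onI continuous_intros)
  show "prob_space (distr std_normal_vec borel (\<lambda>z. 0 + A *v z))" by (rule S.prob_space_distr[OF Am])
  show "sets (distr std_normal_vec borel (\<lambda>z. 0 + A *v z)) = sets borel" by simp
  show "(\<lambda>\<omega>. (1 / sqrt (real n)) *\<^sub>R (\<Sum>i=1..n. Z i k \<omega>)) \<in> borel_measurable M" for k
    using Zm by (intro borel_measurable_scaleR borel_measurable_sum borel_measurable_const) auto
  show "(\<integral>\<^sup>+\<omega>. ennreal ((norm ((1 / sqrt (real n)) *\<^sub>R (\<Sum>i=1..n. Z i k \<omega>)))\<^sup>2) \<partial>M) \<le> ennreal (real n * C)" for k
  proof -
    have "(norm ((1 / sqrt (real n)) *\<^sub>R (\<Sum>i=1..n. Z i k \<omega>)))\<^sup>2 \<le> (\<Sum>i=1..n. (norm (Z i k \<omega>))\<^sup>2)" for \<omega>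
    proof -
      have "(norm (\<Sum>i=1..n. Z i k \<omega>))\<^sup>2 \<le> (\<Sum>i=1..n. norm (Z i k \<omega>))\<^sup>2"
        by (intro power_mono norm_sum) simp
      also have "\<dots> \<le> real n * (\<Sum>i=1..n. (norm (Z i k \<omega>))\<^sup>2)"
        using sum_squared_le_sum_of_squares[of "\<lambda>i. norm (Z i k \<omega>)" "{1..n}"] by (simp add: mult.commute)
      finally show ?thesis using n by (simp add: power_divide divide_le_eq mult.commute)
    qed
    then have "(\<integral>\<^sup>+\<omega>. ennreal ((norm ((1 / sqrt (real n)) *\<^sub>R (\<Sum>i=1..n. Z i k \<omega>)))\<^sup>2) \<partial>M)
        \<le> (\<integral>\<^sup>+\<omega>. (\<Sum>i=1..n. ennreal ((norm (Z i k \<omega>))\<^sup>2)) \<partial>M)"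
      by (intro nn_integral_mono) (simp add: sum_ennreal ennreal_leI del: norm_scaleR)
    also have "\<dots> = (\<Sum>i=1..n. \<integral>\<^sup>+\<omega>. ennreal ((norm (Z i k \<omega>))\<^sup>2) \<partial>M)"
      using Zm by (intro nn_integral_sum) (simp del: One_nat_def)
    also have "\<dots> \<le> (\<Sum>i=1..n. ennreal C)" by (intro sum_mono bound)
    also have "\<dots> = ennreal (real n * C)" by (simp add: ennreal_mult' ennreal_of_nat_eq_real_of_nat)
    finally show ?thesis .
  qed
  fix u :: "real^'m"
  have s: "u \<bullet> ((1 / sqrt (real n)) *\<^sub>R (\<Sum>i=1..n. Z i k \<omega>)) = (\<Sum>i\<in>{1..n}. ((1 / sqrt (real n)) *\<^sub>R u) \<bullet> Z i k \<omega>)" for k \<omega>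
    by (simp add: inner_sum_right sum_divide_distrib)
  have "(\<Sum>i\<in>{1..n}. (norm (transpose A *v ((1 / sqrt (real n)) *\<^sub>R u)))\<^sup>2) = (norm (transpose A *v u))\<^sup>2"
    using n by (simp add: matrix_vector_mult_scaleR power_divide)
  then have "(\<lambda>k. \<integral>\<omega>. cis (u \<bullet> ((1 / sqrt (real n)) *\<^sub>R (\<Sum>i=1..n. Z i k \<omega>))) \<partial>M)
      \<longlonglongrightarrow> of_real (exp (- (norm (transpose A *v u))\<^sup>2 / 2))"
    using joint_charfun[of "\<lambda>_. (1 / sqrt (real n)) *\<^sub>R u"] by (simp only: s)
  moreover have "(\<integral>x. cis (u \<bullet> x) \<partial>distr std_normal_vec borel (\<lambda>z. 0 + A *v z)) = of_real (exp (- (norm (transpose A *v u))\<^sup>2 / 2))"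
  proof -
    have "(\<integral>x. cis (u \<bullet> x) \<partial>distr std_normal_vec borel (\<lambda>z. 0 + A *v z)) = (\<integral>z. cis (u \<bullet> (0 + A *v z)) \<partial>std_normal_vec)"
      by (rule integral_distr[OF Am]) (intro borel_measurable_continuous_onI continuous_intros)
    then show ?thesis by (simp add: inner_transpose_mult[symmetric] std_normal_vec_cis)
  qed
  ultimately show "(\<lambda>k. \<integral>\<omega>. cis (u \<bullet> ((1 / sqrt (real n)) *\<^sub>R (\<Sum>i=1..n. Z i k \<omega>))) \<partial>M)
      \<longlonglongrightarrow> (\<integral>x. cis (u \<bullet> x) \<partial>distr std_normal_vec borel (\<lambda>z. 0 + A *v z))" by simp
qed

text \<open>Extension by 0 to all of \<open>nat\<close> places the sample in a function space over a
  fixed countable type, independent of \<open>n\<close>.\<close>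

definition padded :: "(nat \<Rightarrow> real^'m) \<Rightarrow> nat \<times> 'm \<Rightarrow> real" where
  "padded V = (\<lambda>(i, a). if i \<in> {1..n} then V i $ a else 0)"

lemma padded_sum:
  assumes J: "finite J"
  shows "(\<Sum>p\<in>J. t p * padded V p) = (\<Sum>i\<in>{1..n}. (\<chi> a. if (i, a) \<in> J then t (i, a) else 0) \<bullet> V i)"
proof -
  have "(\<Sum>p\<in>J. t p * padded V p) = (\<Sum>(i, a)\<in>{1..n} \<times> UNIV. (if (i, a) \<in> J then t (i, a) else 0) * V i $ a)"
    by (rule sum.mono_neutral_cong) (auto simp: J padded_def split: if_splits)
  then show ?thesis by (simp add: sum.cartesian_product[symmetric] inner_vec_def del: One_nat_def)
qed

definition rows :: "(nat \<times> 'm \<Rightarrow> real) \<Rightarrow> nat \<Rightarrow> real^'m" where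
  "rows z i = A *v (\<chi> b. z (i, b))"

lemma rows_gauss_cis:
  "(\<integral>z. cis (\<Sum>i\<in>{1..n}. u i \<bullet> rows z i) \<partial>gauss)
     = of_real (exp (- (\<Sum>i\<in>{1..n}. (norm (transpose A *v u i))\<^sup>2) / 2))"
proof -
  let ?s = "\<lambda>(i, b). (transpose A *v u i) $ b"
  have "(\<Sum>i\<in>{1..n}. u i \<bullet> rows z i) = (\<Sum>p\<in>{1..n} \<times> UNIV. ?s p * z p)" for z
  proof -
    have "u i \<bullet> rows z i = (\<Sum>b\<in>UNIV. ?s (i, b) * z (i, b))" for i
      unfolding rows_def inner_transpose_mult[symmetric] by (simp add: inner_vec_def)
    then show ?thesis by (simp add: sum.cartesian_product case_prod_beta' del: One_nat_def)
  qed
  moreover have "(\<Sum>p\<in>{1..n} \<times> UNIV. (?s p)\<^sup>2) = (\<Sum>i\<in>{1..n}. (norm (transpose A *v u i))\<^sup>2)"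
    unfolding power2_norm_eq_inner inner_vec_def inner_real_def power2_eq_square[symmetric]
    by (simp add: sum.cartesian_product case_prod_beta' del: One_nat_def)
  ultimately show ?thesis using gauss_cis[of "{1..n} \<times> (UNIV :: 'm set)" ?s] by simp
qed

lemma padded_rows_measurable: "(\<lambda>z. padded (rows z)) \<in> borel_measurable gauss"
proof (rule measurable_coordinatewise_then_product)
  fix p :: "nat \<times> 'm"
  show "(\<lambda>z. padded (rows z) p) \<in> borel_measurable gauss"
  proof (cases p)
    case (Pair i a)
    show ?thesis
    proof (cases "i \<in> {1..n}")
      case True
      then show ?thesis
        by (simp add: Pair padded_def rows_def matrix_vector_mult_def measurable_cong_sets[OF sets_gauss refl])
    next
      case False
      then have "padded (rows z) p = 0" for z by (auto simp: Pair padded_def)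
      then show ?thesis by simp
    qed
  qed
qed

lemma padded_measurable: "(\<lambda>\<omega>. padded (\<lambda>i. Z i k \<omega>)) \<in> borel_measurable M"
proof (rule measurable_coordinatewise_then_product)
  fix p :: "nat \<times> 'm"
  show "(\<lambda>\<omega>. padded (\<lambda>i. Z i k \<omega>) p) \<in> borel_measurable M"
  proof (cases p)
    case (Pair i a)
    show ?thesis
    proof (cases "i \<in> {1..n}")
      case True
      have "(\<lambda>\<omega>. Z i k \<omega> $ a) \<in> borel_measurable M"
        by (rule measurable_compose[OF Zm[OF True]]) (intro borel_measurable_continuous_onI continuous_intros)
      then show ?thesis using True by (simp add: Pair padded_def)
    next
      case False
      then have "padded (\<lambda>i. Z i k \<omega>) p = 0" for \<omega> by (auto simp: Pair padded_def)
      then show ?thesis by simp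
    qed
  qed
qed

lemma padded_limit:
  fixes h :: "(nat \<times> 'm \<Rightarrow> real) \<Rightarrow> real"
  assumes h: "continuous_on UNIV h" "\<And>y. \<bar>h y\<bar> \<le> B"
  shows "(\<lambda>k. \<integral>\<omega>. h (padded (\<lambda>i. Z i k \<omega>)) \<partial>M) \<longlonglongrightarrow> (\<integral>y. h y \<partial>distr gauss borel (\<lambda>z. padded (rows z)))"
proof (rule family_weak_conv[OF _ _ _ _ _ h])
  show "(\<lambda>\<omega>. padded (\<lambda>i. Z i k \<omega>) p) \<in> borel_measurable M" for k p
    by (rule measurable_compose[OF padded_measurable])
       (intro borel_measurable_continuous_onI continuous_on_product_coordinates)
  show "prob_space (distr gauss borel (\<lambda>z. padded (rows z)))"
    by (rule gauss.prob_space_distr[OF padded_rows_measurable])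
  show "(\<integral>\<^sup>+\<omega>. ennreal ((padded (\<lambda>i. Z i k \<omega>) p)\<^sup>2) \<partial>M) \<le> ennreal C" for k p
  proof (cases p)
    case (Pair i a)
    show ?thesis
    proof (cases "i \<in> {1..n}")
      case True
      have "(Z i k \<omega> $ a)\<^sup>2 \<le> (norm (Z i k \<omega>))\<^sup>2" for \<omega>
        unfolding abs_le_square_iff[symmetric] using component_le_norm_cart[of "Z i k \<omega>" a] by simp
      then have "(\<integral>\<^sup>+\<omega>. ennreal ((padded (\<lambda>i. Z i k \<omega>) p)\<^sup>2) \<partial>M) \<le> (\<integral>\<^sup>+\<omega>. ennreal ((norm (Z i k \<omega>))\<^sup>2) \<partial>M)"
        using True by (intro nn_integral_mono ennreal_leI) (simp add: Pair padded_def)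
      then show ?thesis using bound[OF True, of k] by (rule order_trans)
    next
      case False
      then have "padded (\<lambda>i. Z i k \<omega>) p = 0" for \<omega> by (auto simp: Pair padded_def)
      then show ?thesis by simp
    qed
  qed
  fix J :: "(nat \<times> 'm) set" and t :: "nat \<times> 'm \<Rightarrow> real" assume J: "finite J"
  let ?u = "\<lambda>i. \<chi> a. if (i, a) \<in> J then t (i, a) else 0"
  have "(\<integral>y. cis (\<Sum>p\<in>J. t p * y p) \<partial>distr gauss borel (\<lambda>z. padded (rows z)))
      = (\<integral>z. cis (\<Sum>p\<in>J. t p * padded (rows z) p) \<partial>gauss)"
    by (rule integral_distr[OF padded_rows_measurable])
       (intro borel_measurable_continuous_onI continuous_intros continuous_on_product_coordinates)
  then show "(\<lambda>k. \<integral>\<omega>. cis (\<Sum>p\<in>J. t p * padded (\<lambda>i. Z i k \<omega>) p) \<partial>M)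
      \<longlonglongrightarrow> (\<integral>y. cis (\<Sum>p\<in>J. t p * y p) \<partial>distr gauss borel (\<lambda>z. padded (rows z)))"
    using joint_charfun[of ?u] by (simp only: padded_sum[OF J] rows_gauss_cis)
qed simp

text \<open>The determinant of \<open>hotW\<close> serves as the function whose zeros are avoided,
  almost surely nonzero in the limit. There \<open>hotelling_lin\<close> removes \<open>A\<close>,
  which leaves the statistic of standard normal data.\<close>

lemma hotelling_limit:
  assumes A: "det A \<noteq> 0" and size: "CARD('m) + 1 \<le> n"
    and Tm: "\<And>k. T k \<in> borel_measurable M"
    and T: "\<And>k \<omega> y. y = (\<lambda>(i, a). Z i k \<omega> $ a) \<Longrightarrow> det (hotW {1..n} y (\<lambda>_. 1)) \<noteq> 0 \<Longrightarrow>
      T k \<omega> = (real n - 1) * hotelling {1..n} y (\<lambda>_. 1)"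
  shows "weak_conv_m (\<lambda>k. distr M borel (T k))
     (distr (F_distribution CARD('m) (n - CARD('m))) borel
        (\<lambda>y. real CARD('m) * (real n - 1) / (real n - real CARD('m)) * y))"
proof -
  obtain J0 :: "'m \<Rightarrow> nat" where J0: "bij_betw J0 UNIV {0..<CARD('m)}"
    using ex_bij_betw_finite_nat[OF finite[of "UNIV :: 'm set"]] by blast
  \<comment> \<open>The shift is due to samples being numbered from 1. The first
    \<open>CARD('m)\<close> samples serve as pivots, and sample \<open>CARD('m) + 1\<close> is left
    for the denominator.\<close>
  define J where "J = (\<lambda>a. Suc (J0 a))"
  have J: "inj J" "range J \<subseteq> {1..n}" "{1..n} - range J \<noteq> {}"
  proof -
    show "inj J" using J0 unfolding J_def bij_betw_def inj_on_def by auto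
    have lt: "J0 a < CARD('m)" for a using bij_betwE[OF J0] by auto
    show "range J \<subseteq> {1..n}"
    proof
      fix i assume "i \<in> range J"
      then obtain a where "i = Suc (J0 a)" by (auto simp: J_def)
      then show "i \<in> {1..n}" using lt[of a] size by auto
    qed
    have "CARD('m) + 1 \<notin> range J"
    proof
      assume "CARD('m) + 1 \<in> range J"
      then obtain a where "CARD('m) = J0 a" by (auto simp: J_def)
      then show False using lt[of a] by simp
    qed
    then show "{1..n} - range J \<noteq> {}" using size by (metis DiffI atLeastAtMost_iff empty_iff le_add2)
  qed
  let ?\<nu> = "distr gauss borel (\<lambda>z. padded (rows z))"
  let ?D = "\<lambda>y :: nat \<times> 'm \<Rightarrow> real. det (hotW {1..n} y (\<lambda>_. 1))"
  let ?Q = "\<lambda>y :: nat \<times> 'm \<Rightarrow> real. (real n - 1) * hotelling {1..n} y (\<lambda>_. 1)"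
  have pl: "padded (rows z) (i, a) = lin A z (i, a)" if "i \<in> {1..n}" for z i a
    using that by (simp add: padded_def rows_def lin_def matrix_vector_mult_def)
  have hl: "hotelling {1..n} (padded (rows z)) (\<lambda>_. 1) = hotelling {1..n} z (\<lambda>_. 1)"
    "?D (padded (rows z)) = 0 \<longleftrightarrow> ?D z = 0" for z
    using hotelling_lin[OF A, of "{1..n}" z "\<lambda>_. 1"]
      hotelling_cong[of "{1..n}" "\<lambda>_. 1" "\<lambda>_. 1" "padded (rows z)" "lin A z"] hotW_cong[of "{1..n}" "padded (rows z)" "lin A z" "\<lambda>_. 1"]
    by (simp_all add: pl del: One_nat_def)
  have D: "continuous_on UNIV ?D" by (rule continuous_on_det[OF continuous_on_hotW])
  have Qm: "?Q \<in> borel_measurable borel"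
    by (intro borel_measurable_times borel_measurable_const hotelling_measurable) simp_all
  have pc: "padded (\<lambda>i. Z i k \<omega>) (i, a) = (\<lambda>(i, a). Z i k \<omega> $ a) (i, a)" if "i \<in> {1..n}" for k \<omega> i a
    using that by (simp add: padded_def)
  have "weak_conv_m (\<lambda>k. distr M borel (T k)) (distr ?\<nu> borel ?Q)"
  proof (rule weak_conv_m_off_null_set[where X="\<lambda>k \<omega>. padded (\<lambda>i. Z i k \<omega>)" and D="?D"])
    show "(\<lambda>\<omega>. padded (\<lambda>i. Z i k \<omega>)) \<in> borel_measurable M" for k by (rule padded_measurable)
    show "prob_space ?\<nu>" by (rule gauss.prob_space_distr[OF padded_rows_measurable])
    show "continuous_on {y. ?D y \<noteq> 0} ?Q" by (intro continuous_intros continuous_on_hotelling)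
    show "AE y in ?\<nu>. ?D y \<noteq> 0"
    proof (subst AE_distr_iff[OF padded_rows_measurable])
      show "{y \<in> space borel. ?D y \<noteq> 0} \<in> sets borel"
        using borel_measurable_continuous_onI[OF D] by measurable
      show "AE z in gauss. ?D (padded (rows z)) \<noteq> 0"
        unfolding hl by (rule AE_gauss_hotW[OF _ J]) simp
    qed
    fix k \<omega> assume nz: "?D (padded (\<lambda>i. Z i k \<omega>)) \<noteq> 0"
    have w: "hotW {1..n} (padded (\<lambda>i. Z i k \<omega>)) (\<lambda>_. 1) = hotW {1..n} (\<lambda>(i, a). Z i k \<omega> $ a) (\<lambda>_. 1)"
      by (rule hotW_cong) (rule pc)
    have h: "hotelling {1..n} (padded (\<lambda>i. Z i k \<omega>)) (\<lambda>_. 1) = hotelling {1..n} (\<lambda>(i, a). Z i k \<omega> $ a) (\<lambda>_. 1)"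
      by (rule hotelling_cong[OF refl]) (rule pc)
    show "T k \<omega> = ?Q (padded (\<lambda>i. Z i k \<omega>))"
      unfolding h by (rule T[OF refl]) (use nz w in simp)
  next
    fix h :: "(nat \<times> 'm \<Rightarrow> real) \<Rightarrow> real" and B
    assume "continuous_on UNIV h" "\<And>y. \<bar>h y\<bar> \<le> B"
    then show "(\<lambda>k. \<integral>\<omega>. h (padded (\<lambda>i. Z i k \<omega>)) \<partial>M) \<longlonglongrightarrow> (\<integral>y. h y \<partial>?\<nu>)" by (rule padded_limit)
  qed (rule D Qm Tm sets_distr)+
  also have "distr ?\<nu> borel ?Q = distr gauss borel (\<lambda>z. ?Q (padded (rows z)))"
    using distr_distr[OF Qm padded_rows_measurable] by (simp add: comp_def)
  also have "\<dots> = distr (F_distribution CARD('m) (n - CARD('m))) borel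
        (\<lambda>y. real CARD('m) * (real n - 1) / (real n - real CARD('m)) * y)"
    unfolding hl using hotelling_F_law[OF _ J] by (simp del: One_nat_def)
  finally show ?thesis .
qed

end

section \<open>Independence within and across replications\<close>

lemma (in prob_space) indep_vars_replication:
  fixes \<xi> :: "'i \<Rightarrow> nat \<Rightarrow> nat \<Rightarrow> 'a \<Rightarrow> real^'d"
  assumes ind: "indep_vars (\<lambda>_. borel) (\<lambda>(i, k, j). \<xi> i k j) {(i, k, j). i \<in> I \<and> j \<in> {1..N k}}"
    and i: "i \<in> I"
  shows "indep_vars (\<lambda>_. borel) (\<lambda>(k, j). \<xi> i k j) {(k, j). j \<in> {1..N k}}"
proof -
  have m: "\<xi> i k j \<in> borel_measurable M" if "j \<in> {1..N k}" for k j
    using ind i that unfolding indep_vars_def by auto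
  have s: "indep_sets (\<lambda>(i, k, j). {\<xi> i k j -` B \<inter> space M | B. B \<in> sets borel}) {(i, k, j). i \<in> I \<and> j \<in> {1..N k}}"
    using ind unfolding indep_vars_def2 by (simp add: case_prod_beta')
  have "indep_sets (\<lambda>(k, j). {\<xi> i k j -` B \<inter> space M | B. B \<in> sets borel}) {(k, j). j \<in> {1..N k}}"
  proof (rule indep_setsI)
    fix A J assume J: "J \<noteq> {}" "J \<subseteq> {(k, j). j \<in> {1..N k}}" "finite J"
      and A: "\<forall>p\<in>J. A p \<in> (case p of (k, j) \<Rightarrow> {\<xi> i k j -` B \<inter> space M | B. B \<in> sets borel})"
    have "prob (\<Inter>p\<in>Pair i ` J. A (snd p)) = (\<Prod>p\<in>Pair i ` J. prob (A (snd p)))"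
      by (rule indep_setsD[OF s]) (use J A i in auto)
    then show "prob (\<Inter>p\<in>J. A p) = (\<Prod>p\<in>J. prob (A p))"
      by (simp add: image_image prod.reindex inj_on_def)
  qed (auto intro!: measurable_sets[OF m])
  then show ?thesis
    unfolding indep_vars_def2 using m by (simp add: case_prod_beta')
qed

text \<open>Each variable is measurable with respect to the history of its own replication, and
  these histories are generated by disjoint blocks of independent samples.\<close>

lemma (in prob_space) indep_vars_history:
  fixes \<xi> :: "'i \<Rightarrow> nat \<Rightarrow> nat \<Rightarrow> 'a \<Rightarrow> real^'d" and Z :: "'i \<Rightarrow> 'a \<Rightarrow> 'c::topological_space"
  assumes ind: "indep_vars (\<lambda>_. borel) (\<lambda>(i, k, j). \<xi> i k j) {(i, k, j). i \<in> I \<and> j \<in> {1..N k}}"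
    and Z: "\<And>i. i \<in> I \<Longrightarrow> Z i \<in> borel_measurable (history M N (\<xi> i) k)"
  shows "indep_vars (\<lambda>_. borel) Z I"
proof -
  let ?F = "\<lambda>(i :: 'i, t, j). {\<xi> i t j -` B \<inter> space M | B. B \<in> sets borel}"
  let ?I = "\<lambda>i :: 'i. {(i', t, j). i' = i \<and> t < k \<and> j \<in> {1..N t}}"
  have "indep_sets ?F {(i, k, j). i \<in> I \<and> j \<in> {1..N k}}"
    using ind unfolding indep_vars_def2 by (simp add: case_prod_beta')
  then have "indep_sets ?F (\<Union>i\<in>I. ?I i)" by (rule indep_sets_mono_index[rotated]) auto
  then have "indep_sets (\<lambda>i. sigma_sets (space M) (\<Union>p\<in>?I i. ?F p)) I"
  proof (rule indep_sets_collect_sigma)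
    fix p i assume "p \<in> ?I i"
    obtain i' t j where p: "p = (i', t, j)" by (cases p)
    show "Int_stable (?F p)" unfolding p
    proof (safe intro!: Int_stableI, simp)
      fix B B' :: "(real^'d) set" assume "B \<in> sets borel" "B' \<in> sets borel"
      then show "\<exists>B''. \<xi> i' t j -` B \<inter> space M \<inter> (\<xi> i' t j -` B' \<inter> space M) = \<xi> i' t j -` B'' \<inter> space M \<and> B'' \<in> sets borel"
        by (intro exI[of _ "B \<inter> B'"]) auto
    qed
  qed (auto simp: disjoint_family_on_def)
  moreover have "sigma_sets (space M) (\<Union>p\<in>?I i. ?F p) = sets (history M N (\<xi> i) k)" for i
    unfolding sets_history by (rule arg_cong2[where f=sigma_sets]) auto
  ultimately have s: "indep_sets (\<lambda>i. sets (history M N (\<xi> i) k)) I" by simp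
  have pre: "Z i -` A \<inter> space M \<in> sets (history M N (\<xi> i) k)" if "i \<in> I" "A \<in> sets borel" for i A
    using measurable_sets[OF Z[OF that(1)] that(2)] by simp
  have "Z i \<in> borel_measurable M" if i: "i \<in> I" for i
  proof (rule measurableI)
    fix A :: "'c set" assume A: "A \<in> sets borel"
    show "Z i -` A \<inter> space M \<in> sets M"
      using s pre[OF i A] i unfolding indep_sets_def by blast
  qed simp
  moreover have "indep_sets (\<lambda>i. {Z i -` A \<inter> space M | A. A \<in> sets borel}) I"
    by (rule indep_sets_mono_sets[OF s]) (use pre in blast)
  ultimately show ?thesis unfolding indep_vars_def2 by simp
qed

theorem proposition9:
  fixes M :: "'a measure"
    and \<xi>0 :: "'a \<Rightarrow> real^'d"
    and F :: "real^'m \<Rightarrow> real^'d \<Rightarrow> real"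
    and gF :: "real^'m \<Rightarrow> real^'d \<Rightarrow> real^'m"
    and f :: "real^'m \<Rightarrow> real"
    and gf :: "real^'m \<Rightarrow> real^'m"
    and \<xi> :: "nat \<Rightarrow> nat \<Rightarrow> nat \<Rightarrow> 'a \<Rightarrow> real^'d"
    and x w :: "nat \<Rightarrow> nat \<Rightarrow> 'a \<Rightarrow> real^'m"
    and x0 xs :: "real^'m"
    and H S0 P \<Sigma> :: "real^'m^'m"
    and L \<eta> \<alpha> \<rho> q :: real
    and N :: "nat \<Rightarrow> nat"
    and n :: nat
    and xbar :: "nat \<Rightarrow> 'a \<Rightarrow> real^'m"
    and S :: "nat \<Rightarrow> 'a \<Rightarrow> real^'m^'m"
  \<comment> \<open>the problem\<close>
  assumes "prob_space M"
    and "\<xi>0 \<in> borel_measurable M"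
    and "(\<lambda>(y, z). F y z) \<in> borel_measurable borel"
    and "\<forall>y. integrable M (\<lambda>\<omega>. F y (\<xi>0 \<omega>))"
    and "\<forall>y. f y = (\<integral>\<omega>. F y (\<xi>0 \<omega>) \<partial>M)"
    and "\<forall>y z. GDERIV (\<lambda>y'. F y' z) y :> gF y z"
  \<comment> \<open>\<open>n\<close> independent replications of the algorithm, indexed by \<open>i\<close>\<close>
    and "n \<ge> CARD('m) + 1"
    and "prob_space.indep_vars M (\<lambda>_. borel) (\<lambda>(i, k, j). \<xi> i k j)
           {(i, k, j). i \<in> {1..n} \<and> j \<in> {1..N k}}"
    and "\<forall>i\<in>{1..n}. \<forall>k. \<forall>j\<in>{1..N k}. distr M borel (\<xi> i k j) = distr M borel \<xi>0"
    and "\<forall>i \<omega>. x i 0 \<omega> = x0"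
    and "\<forall>i k \<omega>. w i k \<omega> =
           (1 / real (N k)) *\<^sub>R (\<Sum>j=1..N k. gF (x i k \<omega>) (\<xi> i k j \<omega>)) - gf (x i k \<omega>)"
    and "\<forall>i k \<omega>. x i (Suc k) \<omega> = x i k \<omega> - \<alpha> *\<^sub>R (gf (x i k \<omega>) + w i k \<omega>)"
  \<comment> \<open>parameters\<close>
    and "0 < \<alpha>" and "\<alpha> \<le> 2 / (\<eta> + L)"
    and "q = 1 - 2 * \<alpha> * \<eta> * L / (\<eta> + L)"
    and "q < \<rho>" and "\<rho> < 1"
    and "\<forall>k. N k = nat \<lceil>1 / \<rho> ^ (k + 1)\<rceil>"
  \<comment> \<open>assumption (A)\<close>
    and "\<forall>y. GDERIV f y :> gf y" and "continuous_on UNIV gf"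
    and "L > 0" and "\<forall>y y'. norm (gf y - gf y') \<le> L * norm (y - y')"
    and "\<eta> > 0" and "\<forall>y y'. (gf y - gf y') \<bullet> (y - y') \<ge> \<eta> * (norm (y - y'))\<^sup>2"
    and "\<forall>i\<in>{1..n}. \<exists>\<nu>>0. \<forall>k. \<forall>j\<in>{1..N k}.
           (AE \<omega> in M. cond_exp_vec M (history M N (\<xi> i) k)
              (\<lambda>\<omega>'. gF (x i k \<omega>') (\<xi> i k j \<omega>')) \<omega> = gf (x i k \<omega>)) \<and>
           (AE \<omega> in M. nn_cond_exp M (history M N (\<xi> i) k)
              (\<lambda>\<omega>'. ennreal ((norm (gF (x i k \<omega>') (\<xi> i k j \<omega>') - gf (x i k \<omega>')))\<^sup>2)) \<omega>
              \<le> ennreal (\<nu>\<^sup>2))"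
    and "is_arg_min f (\<lambda>_. True) xs"
  \<comment> \<open>assumption (B)\<close>
    and "(gf has_derivative (\<lambda>h. H *v h)) (at xs)"
    and "\<exists>D :: real^'m \<Rightarrow> real^'m^'m. \<exists>R>0. \<forall>y.
           gf y = H *v (y - xs) + D y *v (y - xs) \<and>
           onorm (\<lambda>h. D y *v h) \<le> R * norm (y - xs)"
    and "\<forall>i\<in>{1..n}. AE \<omega> in M.
           (\<lambda>k. real (N k) *\<^sub>R cond_exp_mat M (history M N (\<xi> i) k)
              (\<lambda>\<omega>'. outer (w i k \<omega>') (w i k \<omega>')) \<omega>) \<longlonglongrightarrow> S0"
    and "\<forall>i\<in>{1..n}. (\<lambda>k. real (N k) *\<^sub>R (\<integral>\<omega>. outer (w i k \<omega>) (w i k \<omega>) \<partial>M)) \<longlonglongrightarrow> S0"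
    and "\<forall>i\<in>{1..n}.
           ((\<lambda>r::real. SUP k. \<integral>\<^sup>+\<omega>. ennreal ((norm (sqrt (real (N k)) *\<^sub>R w i k \<omega>))\<^sup>2) *
              indicator {\<omega>. norm (sqrt (real (N k)) *\<^sub>R w i k \<omega>) > r} \<omega> \<partial>M) \<longlongrightarrow> 0) at_top"
  \<comment> \<open>Lindeberg condition for the batch averages; without it (i) can fail, since (B) constrains
    the averaged errors \<open>w\<close> but not the individual sampling errors\<close>
    and "\<forall>i\<in>{1..n}. \<forall>\<epsilon>>0.
           (\<lambda>k. (1 / ennreal (real (N k))) * (\<Sum>j=1..N k. \<integral>\<^sup>+\<omega>.
              ennreal ((norm (gF (x i k \<omega>) (\<xi> i k j \<omega>) - gf (x i k \<omega>)))\<^sup>2) *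
              indicator {\<omega>. norm (gF (x i k \<omega>) (\<xi> i k j \<omega>) - gf (x i k \<omega>))
                              > \<epsilon> * sqrt (real (N k))} \<omega> \<partial>M)) \<longlonglongrightarrow> 0"
  \<comment> \<open>quantities in the conclusion\<close>
    and "P = (\<rho> powr (-1/2)) *\<^sub>R (mat 1 - \<alpha> *\<^sub>R H)"
    and "\<Sigma> = (\<Sum>t. mat_pow P t ** S0 ** mat_pow P t)"
    and "\<forall>k \<omega>. xbar k \<omega> = (1 / real n) *\<^sub>R (\<Sum>i=1..n. x i k \<omega>)"
    and "\<forall>k \<omega>. S k \<omega> =
           (1 / (real n - 1)) *\<^sub>R (\<Sum>i=1..n. outer (x i k \<omega> - xbar k \<omega>) (x i k \<omega> - xbar k \<omega>))"
  \<comment> \<open>The premise \<open>invertible \<Sigma>\<close> of the last part excludes e.g. noiseless gradients, for which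
    \<open>S k = 0\<close> has no inverse.\<close>
  shows "summable (\<lambda>t. mat_pow P t ** S0 ** mat_pow P t) \<and>
    (\<exists>\<nu>. multivariate_normal \<nu> 0 \<Sigma> \<and>
       weak_conv_vec (\<lambda>k. distr M borel
         (\<lambda>\<omega>. (sqrt (real n) * (1 / \<alpha>) * \<rho> powr (- real k / 2)) *\<^sub>R (xbar k \<omega> - xs))) \<nu>) \<and>
    (invertible \<Sigma> \<longrightarrow>
       weak_conv_m (\<lambda>k. distr M borel
         (\<lambda>\<omega>. real n * ((xbar k \<omega> - xs) \<bullet> (matrix_inv (S k \<omega>) *v (xbar k \<omega> - xs)))))
         (distr (F_distribution CARD('m) (n - CARD('m))) borel
           (\<lambda>y. real CARD('m) * (real n - 1) / (real n - real CARD('m)) * y)))"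
proof -
  interpret prob_space M by (rule assms(1))
  have d: "GDERIV f y :> gf y" for y using assms(19) by blast
  have lip: "norm (gf y - gf y') \<le> L * norm (y - y')" for y y' using assms(22) by blast
  have sc: "\<eta> * (norm (y - y'))\<^sup>2 \<le> (gf y - gf y') \<bullet> (y - y')" for y y' using assms(24) by blast
  have contr: "(norm ((y - y') - \<alpha> *\<^sub>R (gf y - gf y')))\<^sup>2 \<le> q * (norm (y - y'))\<^sup>2" for y y'
    unfolding assms(15)
    by (rule gradient_step_contraction[OF d lip sc assms(23) strong_convexity_le_Lipschitz[OF lip sc] assms(13,14)])
  obtain D R where R: "0 < R" and D: "\<And>y. gf y = H *v (y - xs) + D y *v (y - xs)"
    "\<And>y. onorm (\<lambda>h. D y *v h) \<le> R * norm (y - xs)"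
    using assms(28) by blast
  \<comment> \<open>Evaluating the expansion of the gradient at \<open>xs\<close> itself gives
    stationarity.\<close>
  have gf0: "gf xs = 0" using D(1)[of xs] by simp
  \<comment> \<open>A square is bounded by \<open>q\<close> times the squared length of a unit
    vector.\<close>
  have q0: "0 \<le> q"
    using order_trans[OF zero_le_power2 contr[of "axis undefined 1" 0]] by (simp add: norm_axis_1)
  have \<rho>0: "0 < \<rho>" using q0 assms(16) by simp
  have n2: "2 \<le> n" "0 < n" using assms(7) zero_less_card_finite[where 'a='m] by linarith+
  define c where "c = (\<lambda>k::nat. (1 / \<alpha>) * \<rho> powr (- real k / 2))"
  have c: "c k \<noteq> 0" for k using assms(13) \<rho>0 by (simp add: c_def)
  define Z where "Z = (\<lambda>i k \<omega>. c k *\<^sub>R (x i k \<omega> - xs))"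
  \<comment> \<open>The bound \<open>\<nu>\<close> may differ between replications, whereas
    \<open>R\<close> is common to all of them.\<close>
  have chain: "\<exists>\<nu>. sgd_chain M (distr M borel \<xi>0) gF gf (\<xi> i) (x i) (w i) x0 xs H S0 P \<alpha> \<rho> q R \<nu> N"
    if i: "i \<in> {1..n}" for i
  proof -
    obtain \<nu> where \<nu>: "0 < \<nu>" and A: "\<And>k j. j \<in> {1..N k} \<Longrightarrow>
           (AE \<omega> in M. cond_exp_vec M (history M N (\<xi> i) k)
              (\<lambda>\<omega>'. gF (x i k \<omega>') (\<xi> i k j \<omega>')) \<omega> = gf (x i k \<omega>)) \<and>
           (AE \<omega> in M. nn_cond_exp M (history M N (\<xi> i) k)
              (\<lambda>\<omega>'. ennreal ((norm (gF (x i k \<omega>') (\<xi> i k j \<omega>') - gf (x i k \<omega>')))\<^sup>2)) \<omega>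
              \<le> ennreal (\<nu>\<^sup>2))"
      using assms(25)[rule_format, OF i] by blast
    have "sgd_chain M (distr M borel \<xi>0) gF gf (\<xi> i) (x i) (w i) x0 xs H S0 P \<alpha> \<rho> q R \<nu> N"
    proof (intro sgd_chain.intro sgd_chain_axioms.intro)
      show "prob_space M" by (rule assms(1))
      show "(\<lambda>p. gF (fst p) (snd p)) \<in> borel_measurable (borel \<Otimes>\<^sub>M borel)"
        using assms(3,6) by (intro gradient_measurable) auto
      show "gf \<in> borel_measurable borel" by (rule borel_measurable_continuous_onI[OF assms(20)])
      show "indep_vars (\<lambda>_. borel) (\<lambda>(k, j). \<xi> i k j) {(k, j). j \<in> {1..N k}}"
        by (rule indep_vars_replication[OF assms(8) i])
      show "(norm (y - xs - \<alpha> *\<^sub>R gf y))\<^sup>2 \<le> q * (norm (y - xs))\<^sup>2" for y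
        using contr[of y xs] by (simp add: gf0)
      show "(norm (h - \<alpha> *\<^sub>R (H *v h)))\<^sup>2 \<le> q * (norm h)\<^sup>2" for h
        by (rule linearised_step_contraction[OF contr assms(27)])
      show "u \<bullet> (H *v v) = v \<bullet> (H *v u)" for u v
        by (rule derivative_of_gradient_symmetric[OF d assms(27)])
      show "norm (gf y - H *v (y - xs)) \<le> R * (norm (y - xs))\<^sup>2" for y
        using quadratic_remainder[OF D(2)[of y]] unfolding D(1)[of y] by simp
      show "distr M borel (\<xi> i k j) = distr M borel \<xi>0" if "j \<in> {1..N k}" for k j
        using assms(9) i that by blast
      show "AE \<omega> in M. (\<lambda>k. real (N k) *\<^sub>R cond_exp_mat M (history M N (\<xi> i) k)
              (\<lambda>\<omega>'. outer (w i k \<omega>') (w i k \<omega>')) \<omega>) \<longlonglongrightarrow> S0"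
        using assms(29) i by blast
    qed (use assms(10-12,13,16-18,32,33) i \<nu> A q0 R in blast)+
    then show ?thesis by blast
  qed
  have rep: "\<exists>C. (\<forall>k. Z i k \<in> borel_measurable (history M N (\<xi> i) k) \<and> x i k \<in> borel_measurable M \<and>
      (\<integral>\<^sup>+\<omega>. ennreal ((norm (Z i k \<omega>))\<^sup>2) \<partial>M) \<le> ennreal C) \<and>
      (\<forall>u. (\<lambda>k. \<integral>\<omega>. cis (u \<bullet> Z i k \<omega>) \<partial>M) \<longlonglongrightarrow> of_real (exp (- (u \<bullet> (\<Sigma> *v u)) / 2)))"
    if i: "i \<in> {1..n}" for i
  proof -
    from chain[OF i] obtain \<nu>
      where "sgd_chain M (distr M borel \<xi>0) gF gf (\<xi> i) (x i) (w i) x0 xs H S0 P \<alpha> \<rho> q R \<nu> N" by blast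
    then interpret ch: sgd_chain M "distr M borel \<xi>0" gF gf "\<xi> i" "x i" "w i" x0 xs H S0 P \<alpha> \<rho> q R \<nu> N .
    have Z: "Z i k = ch.zs k" for k by (simp add: fun_eq_iff Z_def c_def ch.zs_def)
    show ?thesis
      unfolding Z using ch.zs_hist ch.x_measurable ch.zs_second ch.zs_charfun[unfolded ch.series_quadratic_form[OF assms(34)]]
      by blast
  qed
  \<comment> \<open>Symmetry and positivity of \<open>\<Sigma>\<close> follow from any one
    replication; the first is taken.\<close>
  have "1 \<in> {1..n}" using n2 by simp
  from chain[OF this] obtain \<nu>
    where "sgd_chain M (distr M borel \<xi>0) gF gf (\<xi> 1) (x 1) (w 1) x0 xs H S0 P \<alpha> \<rho> q R \<nu> N" by blast
  then interpret ch: sgd_chain M "distr M borel \<xi>0" gF gf "\<xi> 1" "x 1" "w 1" x0 xs H S0 P \<alpha> \<rho> q R \<nu> N .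
  obtain A :: "real^'m^'m" where A: "A ** transpose A = \<Sigma>"
    using psd_square_root[OF ch.series_sym[OF assms(34)] ch.series_psd[OF assms(34)]] by blast
  obtain C where C: "\<And>i k. i \<in> {1..n} \<Longrightarrow> (\<integral>\<^sup>+\<omega>. ennreal ((norm (Z i k \<omega>))\<^sup>2) \<partial>M) \<le> ennreal (C i)"
    using rep by metis
  \<comment> \<open>The sum of absolute values is a common second moment bound for the finitely many
    replications.\<close>
  interpret replications M Z n A "\<Sum>i=1..n. \<bar>C i\<bar>"
  proof
    show "0 < n" by (rule n2)
    fix i k assume i: "i \<in> {1..n}"
    show "Z i k \<in> borel_measurable M"
      using rep[OF i] unfolding Z_def
      by (intro borel_measurable_scaleR borel_measurable_diff borel_measurable_const) blast
    show "(\<integral>\<^sup>+\<omega>. ennreal ((norm (Z i k \<omega>))\<^sup>2) \<partial>M) \<le> ennreal (\<Sum>i=1..n. \<bar>C i\<bar>)"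
    proof (rule order_trans[OF C[OF i] ennreal_leI])
      have "\<bar>C i\<bar> \<le> (\<Sum>i=1..n. \<bar>C i\<bar>)" using i by (intro member_le_sum) auto
      then show "C i \<le> (\<Sum>i=1..n. \<bar>C i\<bar>)" by simp
    qed
  next
    show "indep_vars (\<lambda>_. borel) (\<lambda>i. Z i k) {1..n}" for k
      using rep by (intro indep_vars_history[OF assms(8)]) blast
    fix i u assume "i \<in> {1..n}"
    then show "(\<lambda>k. \<integral>\<omega>. cis (u \<bullet> Z i k \<omega>) \<partial>M) \<longlonglongrightarrow> of_real (exp (- (norm (transpose A *v u))\<^sup>2 / 2))"
      using rep[of i] unfolding A[symmetric] inner_mult_transpose by blast
  qed
  have mean: "(sqrt (real n) * (1 / \<alpha>) * \<rho> powr (- real k / 2)) *\<^sub>R (xbar k \<omega> - xs)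
      = (1 / sqrt (real n)) *\<^sub>R (\<Sum>i=1..n. Z i k \<omega>)" for k \<omega>
  proof -
    have "(\<Sum>i=1..n. Z i k \<omega>) = c k *\<^sub>R ((\<Sum>i=1..n. x i k \<omega>) - real n *\<^sub>R xs)"
      unfolding Z_def scaleR_sum_right[symmetric] sum_subtractf by (simp add: sum_constant_scaleR del: sum_constant)
    also have "\<dots> = (c k * real n) *\<^sub>R (xbar k \<omega> - xs)"
      unfolding assms(35)[rule_format] using n2 by (simp add: algebra_simps)
    also have "(1 / sqrt (real n)) *\<^sub>R \<dots> = (sqrt (real n) * (1 / \<alpha>) * \<rho> powr (- real k / 2)) *\<^sub>R (xbar k \<omega> - xs)"
    proof -
      have "(1 / sqrt (real n)) * (c k * real n) = (real n / sqrt (real n)) * c k" by simp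
      also have "\<dots> = sqrt (real n) * (1 / \<alpha>) * \<rho> powr (- real k / 2)"
        using real_div_sqrt[of "real n"] by (simp add: c_def)
      finally show ?thesis by (simp only: scaleR_scaleR)
    qed
    finally show ?thesis by simp
  qed
  have part1: "multivariate_normal (distr std_normal_vec borel (\<lambda>z. 0 + A *v z)) 0 \<Sigma>"
    unfolding multivariate_normal_def using A by blast
  have part2: "weak_conv_m (\<lambda>k. distr M borel
         (\<lambda>\<omega>. real n * ((xbar k \<omega> - xs) \<bullet> (matrix_inv (S k \<omega>) *v (xbar k \<omega> - xs)))))
         (distr (F_distribution CARD('m) (n - CARD('m))) borel
           (\<lambda>y. real CARD('m) * (real n - 1) / (real n - real CARD('m)) * y))" if inv: "invertible \<Sigma>"
  proof (rule hotelling_limit)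
    have "det \<Sigma> \<noteq> 0" using inv by (simp add: invertible_det_nz)
    then show "det A \<noteq> 0" unfolding A[symmetric] det_mul by auto
    show "CARD('m) + 1 \<le> n" by (rule assms(7))
    show "(\<lambda>\<omega>. real n * ((xbar k \<omega> - xs) \<bullet> (matrix_inv (S k \<omega>) *v (xbar k \<omega> - xs)))) \<in> borel_measurable M" for k
    proof (intro borel_measurable_times borel_measurable_const borel_measurable_matrix_inv_form)
      have xm: "(\<lambda>\<omega>. x i k \<omega> $ a) \<in> borel_measurable M" if "i \<in> {1..n}" for i a
        using rep[OF that] by (intro measurable_compose[of "x i k" M borel "\<lambda>v. v $ a"]
            borel_measurable_continuous_onI continuous_intros) auto
      have xbm: "(\<lambda>\<omega>. xbar k \<omega> $ a) \<in> borel_measurable M" for a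
        unfolding assms(35)[rule_format] vector_scaleR_component sum_component
        by (intro borel_measurable_scaleR borel_measurable_const borel_measurable_sum xm)
      show "(\<lambda>\<omega>. (xbar k \<omega> - xs) $ a) \<in> borel_measurable M" for a
        unfolding vector_minus_component by (intro borel_measurable_diff xbm borel_measurable_const)
      show "(\<lambda>\<omega>. S k \<omega> $ a $ b) \<in> borel_measurable M" for a b
        unfolding assms(36)[rule_format] vector_scaleR_component sum_component outer_def vec_lambda_beta vector_minus_component
        by (intro borel_measurable_scaleR borel_measurable_const borel_measurable_sum borel_measurable_times
            borel_measurable_diff xm xbm)
    qed
    fix k \<omega> y assume y: "y = (\<lambda>(i, a). Z i k \<omega> $ a)" and nz: "det (hotW {1..n} y (\<lambda>_. 1)) \<noteq> 0"
    define y' where "y' = (\<lambda>(i, a). (x i k \<omega> - xs) $ a)"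
    \<comment> \<open>Scaling by \<open>c k\<close> is a regular linear map, hence invisible to the
      statistic; this is why no normalisation appears in the second limit.\<close>
    let ?c = "matrix ((*\<^sub>R) (c k)) :: real^'m^'m"
    have dc: "det ?c \<noteq> 0" using c by (simp add: det_matrix_scaleR)
    have cab: "?c $ a $ b = (if a = b then c k else 0)" for a b by (simp add: matrix_def axis_def)
    have "y = lin ?c y'"
    proof (intro ext)
      fix p show "y p = lin ?c y' p"
        by (cases p) (simp add: y y'_def lin_def Z_def cab mult_delta_left)
    qed
    then have "hotelling {1..n} y (\<lambda>_. 1) = hotelling {1..n} y' (\<lambda>_. 1)" "det (hotW {1..n} y' (\<lambda>_. 1)) \<noteq> 0"
      using hotelling_lin[OF dc, of "{1..n}" y' "\<lambda>_. 1"] nz by simp_all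
    then show "real n * ((xbar k \<omega> - xs) \<bullet> (matrix_inv (S k \<omega>) *v (xbar k \<omega> - xs)))
        = (real n - 1) * hotelling {1..n} y (\<lambda>_. 1)"
      using hotelling_T2[OF n2(1) assms(35)[rule_format, of k \<omega>] assms(36)[rule_format, of k \<omega>] y'_def] by simp
  qed
  show ?thesis
  proof (intro conjI impI exI)
    show "summable (\<lambda>t. mat_pow P t ** S0 ** mat_pow P t)" by (rule ch.series_summable)
    show "multivariate_normal (distr std_normal_vec borel (\<lambda>z. 0 + A *v z)) 0 \<Sigma>" by (rule part1)
    show "weak_conv_vec (\<lambda>k. distr M borel
         (\<lambda>\<omega>. (sqrt (real n) * (1 / \<alpha>) * \<rho> powr (- real k / 2)) *\<^sub>R (xbar k \<omega> - xs)))
         (distr std_normal_vec borel (\<lambda>z. 0 + A *v z))"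
      unfolding mean by (rule sample_mean_limit)
  qed (rule part2)
qed

end
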